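(* For $\kappa=-1,0,$ or $1$, let $\gamma:(-\infty,\infty)\to M$ be a unit speed geodesic in a complete Riemannian $n$-manifold $M$ with $\mathrm{Ric}_k(\dot\gamma,\cdot)\geq k\cdot\kappa$. Let $\Lambda$ be a Lagrangian subspace of normal Jacobi fields along $\gamma$ with Riccati operator $S$, let $t_0<t_{\max}$, let $\tilde\lambda_\kappa$ be a solution on $[t_0,t_{\max})$ of $\tilde\lambda_\kappa'+\tilde\lambda_\kappa^2+\kappa=0$, and let $W_{t_0}\perp\gamma'(t_0)$ be some $k$-dimensional subspace such that $S_{t_0}$ is defined on $W_{t_0}$ and $$\mathrm{Trace}\,(S_{t_0})|_{W_{t_0}}\leq k\cdot\tilde\lambda_\kappa(t_0).$$ Denote by $\mathcal V$ the subspace of $\Lambda$ formed by those Jacobi fields that are orthogonal to $W_{t_0}$ at $t_0$, and by $H(t)$ the subspace of $\gamma'(t)^\perp$ that is orthogonal to $\mathcal V(t)$. Assume that $\mathcal V$ is of full index in the interval $[t_0,t_{\max})$. Then: (1) For all $t\in[t_0,t_{\max})$, $\ \mathrm{Trace}\,S_t|_{H(t)}\leq k\cdot\tilde\lambda_\kappa(t)$. (2) If for some $t_1\in[t_0,t_{\max})$, $\mathrm{Trace}\,S_{t_1}|_{H(t_1)}=k\cdot\tilde\lambda_\kappa(t_1)$, then the Jacobi equation splits orthogonally along $\gamma$ in the interval $[t_0,t_1]$ as $\Lambda=\mathcal V\oplus\mathcal H$, where every nonzero Jacobi field $J\in\mathcal H$ is equal (on $[t_0,t_1]$) to $J=\tilde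 f\cdot E$, where $E$ is a unit parallel field with $E(t_0)\in H(t_0)$, and $\tilde f$ is the solution of $\tilde f''+\kappa\tilde f=0$ with logarithmic derivative $\tilde f'/\tilde f=\tilde\lambda_\kappa$ that satisfies $\tilde f(t_0)=|J(t_0)|$.
   Context: $\mathrm{Ric}_k(\dot\gamma,\cdot)\geq k\kappa$ means $\sum_{i=1}^k\mathrm{sec}(\dot\gamma,E_i)\geq k\kappa$ for any orthonormal set $\{\dot\gamma(t),E_1,\ldots,E_k\}$ at any point of $\gamma$. An $(n-1)$-dimensional subspace $\Lambda$ of the normal Jacobi fields along $\gamma$ is Lagrangian if $\langle J_1,J_2'\rangle=\langle J_1',J_2\rangle$ for all $J_1,J_2\in\Lambda$. Its Riccati operator is $S_t:J(t)\mapsto J'(t)$, $J\in\Lambda$. For a subspace $W\subset\gamma'(t)^\perp$ each of whose vectors is $J(t)$ for some $J\in\Lambda$, $\mathrm{Trace}\,S_t|_W$ denotes the trace of $W\ni J(t)\mapsto P_W(J'(t))\in W$, with $P_W$ the orthogonal projection onto $W$ (this does not depend on the choice of $J\in\Lambda$, since $\Lambda$ is Lagrangian). For a subspace $\mathcal W\subset\Lambda$, $\mathcal W(t)=\{J(t): J\in\mathcal W\}\oplus\{J'(t): J\in\mathcal W,\ J(t)=0\}$. A subspace $\mathcal V\subset\Lambda$ has full index at $t$ if every $J\in\Lambda$ with $J(t)=0$ belongs to $\mathcal V$, and has full index on an interval if it does so at every point of the interval. (If $\mathcal V$ has full index at $t$, then each vector of $H(t)=\mathcal V(t)^\perp\cap\gamma'(t)^\perp$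 is of the form $J(t)$ with $J\in\Lambda$, so $\mathrm{Trace}\,S_t|_{H(t)}$ is defined.) "The Jacobi equation splits orthogonally as $\Lambda=\mathcal V\oplus\mathcal H$ on an interval" means that $\mathcal H\subset\Lambda$ is a subspace complementary to $\mathcal V$ such that on that interval $\mathcal V(t)$ and $\mathcal H(t)=H(t)$ are orthogonal parallel distributions along $\gamma$. *)

theory Defs
  imports "HOL-Analysis.Analysis" "HOL-Library.Function_Algebras"
begin

section \<open>Smooth maps\<close>

text \<open>
  \<open>Ck_on k S f\<close> is meant for open \<open>S\<close>: there, a map between finite-dimensional spaces is of
  class \<open>C\<^sup>k\<close> iff it is differentiable with all directional derivatives of class \<open>C\<^sup>k\<^sup>-\<^sup>1\<close>.
\<close>

primrec Ck_on :: "nat \<Rightarrow> 'a::real_normed_vector set \<Rightarrow> ('a \<Rightarrow> 'b::real_normed_vector) \<Rightarrow> bool" where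
  "Ck_on 0 S f \<longleftrightarrow> continuous_on S f"
| "Ck_on (Suc k) S f \<longleftrightarrow>
     f differentiable_on S \<and> (\<forall>v. Ck_on k S (\<lambda>x. frechet_derivative f (at x) v))"

definition smooth_on :: "'a::real_normed_vector set \<Rightarrow> ('a \<Rightarrow> 'b::real_normed_vector) \<Rightarrow> bool" where
  "smooth_on S f \<longleftrightarrow> (\<forall>k. Ck_on k S f)"


section \<open>Riemannian manifolds\<close>

text \<open>
  A manifold is carried by a Hausdorff second countable type \<open>'m\<close> and modelled on a Euclidean space
  \<open>'a\<close>, so its dimension is \<open>DIM('a)\<close>. A chart is a pair of its domain and its coordinate map.

  The tangent space at \<open>p\<close> is the vector space \<open>'a\<close>, a vector being given by its components in the
  chart \<open>chart_at M p\<close>, which is a fixed choice of a chart around \<open>p\<close>. Hence a vector field along a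
  curve \<open>\<gamma>\<close> is a function \<open>real \<Rightarrow> 'a\<close>, whose value at \<open>t\<close> lies in the tangent space at \<open>\<gamma> t\<close>. Note that
  the chart used for the components depends on \<open>t\<close>: such a function is in general discontinuous,
  and smoothness and derivatives of fields refer to components in one chart
  (\<open>coord_change\<close> converts between charts). The only structure on \<open>'a\<close> with an invariant meaning
  as structure of the tangent space is that of a vector space; inner products are those of
  \<open>rmetric M p\<close>.
\<close>

type_synonym ('m, 'a) chart = "'m set \<times> ('m \<Rightarrow> 'a)"

abbreviation chart_dom :: "('m, 'a) chart \<Rightarrow> 'm set" where
  "chart_dom c \<equiv> fst c"

abbreviation chart_map :: "('m, 'a) chart \<Rightarrow> 'm \<Rightarrow> 'a" where
  "chart_map c \<equiv> snd c"

definition chart_inv :: "('m, 'a) chart \<Rightarrow> 'a \<Rightarrow> 'm" where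
  "chart_inv c = inv_into (chart_dom c) (chart_map c)"

record ('m, 'a) metric_atlas =
  atlas :: "('m, 'a) chart set"
  rmetric :: "'m \<Rightarrow> 'a \<Rightarrow> 'a \<Rightarrow> real"

definition chart_at :: "('m, 'a, 'z) metric_atlas_scheme \<Rightarrow> 'm \<Rightarrow> ('m, 'a) chart" where
  "chart_at M p = (SOME c. c \<in> atlas M \<and> p \<in> chart_dom c)"

definition smooth_atlas ::
    "('m::{t2_space, second_countable_topology}, 'a::euclidean_space) chart set \<Rightarrow> bool" where
  "smooth_atlas A \<longleftrightarrow>
     (\<Union>c\<in>A. chart_dom c) = UNIV \<and>
     (\<forall>c\<in>A. open (chart_dom c) \<and> open (chart_map c ` chart_dom c) \<and>
        homeomorphism (chart_dom c) (chart_map c ` chart_dom c) (chart_map c) (chart_inv c)) \<and>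
     (\<forall>c\<in>A. \<forall>d\<in>A. smooth_on (chart_map c ` (chart_dom c \<inter> chart_dom d)) (chart_map d \<circ> chart_inv c))"

text \<open>Transforms the components in \<open>c\<close> of a tangent vector at \<open>p\<close> into its components in \<open>d\<close>.\<close>

definition coord_change ::
    "('m, 'a::euclidean_space) chart \<Rightarrow> ('m, 'a) chart \<Rightarrow> 'm \<Rightarrow> 'a \<Rightarrow> 'a" where
  "coord_change c d p = frechet_derivative (chart_map d \<circ> chart_inv c) (at (chart_map c p))"

text \<open>The metric in a chart: the functions \<open>g\<^sub>i\<^sub>j\<close> are the \<open>\<lambda>x. chart_metric M c x e\<^sub>i e\<^sub>j\<close>.\<close>

definition chart_metric ::
    "('m, 'a::euclidean_space, 'z) metric_atlas_scheme \<Rightarrow> ('m, 'a) chart \<Rightarrow> 'a \<Rightarrow> 'a \<Rightarrow> 'a \<Rightarrow> real" where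
  "chart_metric M c x u v =
     (let p = chart_inv c x; d = chart_at M p
      in rmetric M p (coord_change c d p u) (coord_change c d p v))"

definition riemannian_manifold ::
    "('m::{t2_space, second_countable_topology}, 'a::euclidean_space, 'z) metric_atlas_scheme \<Rightarrow> bool" where
  "riemannian_manifold M \<longleftrightarrow>
     smooth_atlas (atlas M) \<and>
     (\<forall>p. bilinear (rmetric M p) \<and> (\<forall>u v. rmetric M p u v = rmetric M p v u) \<and>
        (\<forall>v. v \<noteq> 0 \<longrightarrow> rmetric M p v v > 0)) \<and>
     (\<forall>c\<in>atlas M. \<forall>u v. smooth_on (chart_map c ` chart_dom c) (\<lambda>x. chart_metric M c x u v))"

text \<open>
  Levi-Civita connection and curvature in a chart. The Christoffel symbol is the bilinear map
  \<open>\<Gamma>\<^sub>x(u, v) = u\<^sup>i v\<^sup>j \<Gamma>\<^sup>k\<^sub>i\<^sub>j e\<^sub>k\<close>, determined by Koszul's formula for constant coordinate fields.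
\<close>

definition christoffel ::
    "('m, 'a::euclidean_space, 'z) metric_atlas_scheme \<Rightarrow> ('m, 'a) chart \<Rightarrow> 'a \<Rightarrow> 'a \<Rightarrow> 'a \<Rightarrow> 'a" where
  "christoffel M c x u v =
     (THE w. \<forall>z. chart_metric M c x w z =
        (frechet_derivative (\<lambda>y. chart_metric M c y v z) (at x) u
       + frechet_derivative (\<lambda>y. chart_metric M c y u z) (at x) v
       - frechet_derivative (\<lambda>y. chart_metric M c y u v) (at x) z) / 2)"

definition nabla ::
    "('m, 'a::euclidean_space, 'z) metric_atlas_scheme \<Rightarrow> ('m, 'a) chart \<Rightarrow>
     ('a \<Rightarrow> 'a) \<Rightarrow> ('a \<Rightarrow> 'a) \<Rightarrow> 'a \<Rightarrow> 'a" where
  "nabla M c X Y x = frechet_derivative Y (at x) (X x) + christoffel M c x (X x) (Y x)"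

text \<open>
  \<open>R(u, v)w = \<nabla>\<^sub>u\<nabla>\<^sub>v w - \<nabla>\<^sub>v\<nabla>\<^sub>u w\<close> for the constant coordinate fields extending the three vectors;
  the term with their Lie bracket vanishes.
\<close>

definition curvature ::
    "('m, 'a::euclidean_space, 'z) metric_atlas_scheme \<Rightarrow> 'm \<Rightarrow> 'a \<Rightarrow> 'a \<Rightarrow> 'a \<Rightarrow> 'a" where
  "curvature M p u v w =
     (let c = chart_at M p; U = (\<lambda>_. u); V = (\<lambda>_. v); W = (\<lambda>_. w); x = chart_map c p
      in nabla M c U (nabla M c V W) x - nabla M c V (nabla M c U W) x)"

definition sec_curvature ::
    "('m, 'a::euclidean_space, 'z) metric_atlas_scheme \<Rightarrow> 'm \<Rightarrow> 'a \<Rightarrow> 'a \<Rightarrow> real" where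
  "sec_curvature M p u v =
     rmetric M p (curvature M p u v v) u /
       (rmetric M p u u * rmetric M p v v - (rmetric M p u v)\<^sup>2)"

definition orthonormal_at ::
    "('m, 'a::euclidean_space, 'z) metric_atlas_scheme \<Rightarrow> 'm \<Rightarrow> nat set \<Rightarrow> (nat \<Rightarrow> 'a) \<Rightarrow> bool" where
  "orthonormal_at M p I e \<longleftrightarrow>
     (\<forall>i\<in>I. \<forall>j\<in>I. rmetric M p (e i) (e j) = (if i = j then 1 else 0))"


section \<open>Curves and vector fields along them\<close>

definition smooth_curve ::
    "('m::topological_space, 'a::euclidean_space, 'z) metric_atlas_scheme \<Rightarrow> (real \<Rightarrow> 'm) \<Rightarrow> bool" where
  "smooth_curve M \<gamma> \<longleftrightarrow>
     continuous_on UNIV \<gamma> \<and>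
     (\<forall>c\<in>atlas M. smooth_on {t. \<gamma> t \<in> chart_dom c} (\<lambda>t. chart_map c (\<gamma> t)))"

definition velocity ::
    "('m, 'a::euclidean_space, 'z) metric_atlas_scheme \<Rightarrow> (real \<Rightarrow> 'm) \<Rightarrow> real \<Rightarrow> 'a" where
  "velocity M \<gamma> t = vector_derivative (\<lambda>s. chart_map (chart_at M (\<gamma> t)) (\<gamma> s)) (at t)"

definition field_in_chart ::
    "('m, 'a::euclidean_space, 'z) metric_atlas_scheme \<Rightarrow> (real \<Rightarrow> 'm) \<Rightarrow> (real \<Rightarrow> 'a) \<Rightarrow>
     ('m, 'a) chart \<Rightarrow> real \<Rightarrow> 'a" where
  "field_in_chart M \<gamma> X c t = coord_change (chart_at M (\<gamma> t)) c (\<gamma> t) (X t)"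

definition smooth_field_along ::
    "('m, 'a::euclidean_space, 'z) metric_atlas_scheme \<Rightarrow> (real \<Rightarrow> 'm) \<Rightarrow> (real \<Rightarrow> 'a) \<Rightarrow> bool" where
  "smooth_field_along M \<gamma> X \<longleftrightarrow>
     (\<forall>c\<in>atlas M. smooth_on {t. \<gamma> t \<in> chart_dom c} (field_in_chart M \<gamma> X c))"

text \<open>The covariant derivative \<open>X'\<close> along \<open>\<gamma>\<close>; at \<open>t\<close> it is computed in the chart chosen at \<open>\<gamma> t\<close>.\<close>

definition covariant_deriv ::
    "('m, 'a::euclidean_space, 'z) metric_atlas_scheme \<Rightarrow> (real \<Rightarrow> 'm) \<Rightarrow> (real \<Rightarrow> 'a) \<Rightarrow> real \<Rightarrow> 'a" where
  "covariant_deriv M \<gamma> X t =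
     (let c = chart_at M (\<gamma> t)
      in vector_derivative (field_in_chart M \<gamma> X c) (at t)
         + christoffel M c (chart_map c (\<gamma> t)) (velocity M \<gamma> t) (X t))"

definition parallel_field ::
    "('m, 'a::euclidean_space, 'z) metric_atlas_scheme \<Rightarrow> (real \<Rightarrow> 'm) \<Rightarrow> (real \<Rightarrow> 'a) \<Rightarrow> bool" where
  "parallel_field M \<gamma> X \<longleftrightarrow> smooth_field_along M \<gamma> X \<and> (\<forall>t. covariant_deriv M \<gamma> X t = 0)"

definition geodesic ::
    "('m::topological_space, 'a::euclidean_space, 'z) metric_atlas_scheme \<Rightarrow> (real \<Rightarrow> 'm) \<Rightarrow> bool" where
  "geodesic M \<gamma> \<longleftrightarrow> smooth_curve M \<gamma> \<and> (\<forall>t. covariant_deriv M \<gamma> (velocity M \<gamma>) t = 0)"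

definition unit_speed_geodesic ::
    "('m::topological_space, 'a::euclidean_space, 'z) metric_atlas_scheme \<Rightarrow> (real \<Rightarrow> 'm) \<Rightarrow> bool" where
  "unit_speed_geodesic M \<gamma> \<longleftrightarrow>
     geodesic M \<gamma> \<and> (\<forall>t. rmetric M (\<gamma> t) (velocity M \<gamma> t) (velocity M \<gamma> t) = 1)"

text \<open>Geodesic completeness: every tangent vector is the initial velocity of a geodesic on \<open>\<real>\<close>.\<close>

definition complete_manifold ::
    "('m::{t2_space, second_countable_topology}, 'a::euclidean_space, 'z) metric_atlas_scheme \<Rightarrow> bool" where
  "complete_manifold M \<longleftrightarrow> (\<forall>p v. \<exists>\<gamma>. geodesic M \<gamma> \<and> \<gamma> 0 = p \<and> velocity M \<gamma> 0 = v)"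

definition Ric_along_ge ::
    "('m, 'a::euclidean_space, 'z) metric_atlas_scheme \<Rightarrow> nat \<Rightarrow> (real \<Rightarrow> 'm) \<Rightarrow> real \<Rightarrow> bool" where
  "Ric_along_ge M k \<gamma> b \<longleftrightarrow>
     (\<forall>t E. orthonormal_at M (\<gamma> t) {0..k} E \<and> E 0 = velocity M \<gamma> t \<longrightarrow>
        (\<Sum>i = 1..k. sec_curvature M (\<gamma> t) (velocity M \<gamma> t) (E i)) \<ge> b)"

text \<open>
  Fields along a curve form a vector space with pointwise operations; \<open>fields.subspace\<close> and
  \<open>fields.dim\<close> are the library's notions for it.
\<close>

interpretation fields: vector_space
  "\<lambda>(c::real) (X::real \<Rightarrow> 'a::euclidean_space) t. c *\<^sub>R X t"
  by unfold_locales (auto simp: fun_eq_iff algebra_simps)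

definition normal_jacobi_field ::
    "('m, 'a::euclidean_space, 'z) metric_atlas_scheme \<Rightarrow> (real \<Rightarrow> 'm) \<Rightarrow> (real \<Rightarrow> 'a) \<Rightarrow> bool" where
  "normal_jacobi_field M \<gamma> J \<longleftrightarrow>
     smooth_field_along M \<gamma> J \<and>
     (\<forall>t. covariant_deriv M \<gamma> (covariant_deriv M \<gamma> J) t
          + curvature M (\<gamma> t) (J t) (velocity M \<gamma> t) (velocity M \<gamma> t) = 0) \<and>
     (\<forall>t. rmetric M (\<gamma> t) (J t) (velocity M \<gamma> t) = 0)"

definition lagrangian ::
    "('m, 'a::euclidean_space, 'z) metric_atlas_scheme \<Rightarrow> (real \<Rightarrow> 'm) \<Rightarrow> (real \<Rightarrow> 'a) set \<Rightarrow> bool" where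
  "lagrangian M \<gamma> \<Lambda> \<longleftrightarrow>
     fields.subspace \<Lambda> \<and> fields.dim \<Lambda> = DIM('a) - 1 \<and>
     (\<forall>J\<in>\<Lambda>. normal_jacobi_field M \<gamma> J) \<and>
     (\<forall>J\<in>\<Lambda>. \<forall>K\<in>\<Lambda>. \<forall>t. rmetric M (\<gamma> t) (J t) (covariant_deriv M \<gamma> K t)
                     = rmetric M (\<gamma> t) (covariant_deriv M \<gamma> J t) (K t))"


section \<open>Riccati operator and its traces\<close>

definition velocity_perp ::
    "('m, 'a::euclidean_space, 'z) metric_atlas_scheme \<Rightarrow> (real \<Rightarrow> 'm) \<Rightarrow> real \<Rightarrow> 'a set" where
  "velocity_perp M \<gamma> t = {v. rmetric M (\<gamma> t) v (velocity M \<gamma> t) = 0}"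

definition trace_on :: "'a::euclidean_space set \<Rightarrow> ('a \<Rightarrow> 'a) \<Rightarrow> real" where
  "trace_on W f =
     (let B = (SOME B. B \<subseteq> W \<and> independent B \<and> W \<subseteq> span B)
      in \<Sum>b\<in>B. representation B (f b) b)"

definition metric_proj ::
    "('m, 'a::euclidean_space, 'z) metric_atlas_scheme \<Rightarrow> 'm \<Rightarrow> 'a set \<Rightarrow> 'a \<Rightarrow> 'a" where
  "metric_proj M p W v = (THE w. w \<in> W \<and> (\<forall>z\<in>W. rmetric M p (v - w) z = 0))"

definition riccati_defined_on :: "(real \<Rightarrow> 'a) set \<Rightarrow> real \<Rightarrow> 'a set \<Rightarrow> bool" where
  "riccati_defined_on \<Lambda> t W \<longleftrightarrow> (\<forall>w\<in>W. \<exists>J\<in>\<Lambda>. J t = w)"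

text \<open>
  \<open>J(t) \<mapsto> J'(t)\<close>. If several \<open>J \<in> \<Lambda>\<close> have the value \<open>w\<close> at \<open>t\<close>, one is chosen; the projection of
  the result to a subspace on which the operator is defined does not depend on the choice.
\<close>

definition riccati ::
    "('m, 'a::euclidean_space, 'z) metric_atlas_scheme \<Rightarrow> (real \<Rightarrow> 'm) \<Rightarrow> (real \<Rightarrow> 'a) set \<Rightarrow>
     real \<Rightarrow> 'a \<Rightarrow> 'a" where
  "riccati M \<gamma> \<Lambda> t w = covariant_deriv M \<gamma> (SOME J. J \<in> \<Lambda> \<and> J t = w) t"

definition riccati_trace ::
    "('m, 'a::euclidean_space, 'z) metric_atlas_scheme \<Rightarrow> (real \<Rightarrow> 'm) \<Rightarrow> (real \<Rightarrow> 'a) set \<Rightarrow>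
     real \<Rightarrow> 'a set \<Rightarrow> real" where
  "riccati_trace M \<gamma> \<Lambda> t W = trace_on W (\<lambda>w. metric_proj M (\<gamma> t) W (riccati M \<gamma> \<Lambda> t w))"

text \<open>The distribution \<open>\<W>(t) = {J(t) : J \<in> \<W>} \<oplus> {J'(t) : J \<in> \<W>, J(t) = 0}\<close>.\<close>

definition distribution_of ::
    "('m, 'a::euclidean_space, 'z) metric_atlas_scheme \<Rightarrow> (real \<Rightarrow> 'm) \<Rightarrow> (real \<Rightarrow> 'a) set \<Rightarrow>
     real \<Rightarrow> 'a set" where
  "distribution_of M \<gamma> \<W> t =
     {J t + covariant_deriv M \<gamma> K t | J K. J \<in> \<W> \<and> K \<in> \<W> \<and> K t = 0}"

definition horizontal_space ::
    "('m, 'a::euclidean_space, 'z) metric_atlas_scheme \<Rightarrow> (real \<Rightarrow> 'm) \<Rightarrow> (real \<Rightarrow> 'a) set \<Rightarrow>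
     real \<Rightarrow> 'a set" where
  "horizontal_space M \<gamma> \<V> t =
     {v \<in> velocity_perp M \<gamma> t. \<forall>w\<in>distribution_of M \<gamma> \<V> t. rmetric M (\<gamma> t) v w = 0}"

definition full_index_at :: "(real \<Rightarrow> 'a::zero) set \<Rightarrow> (real \<Rightarrow> 'a) set \<Rightarrow> real \<Rightarrow> bool" where
  "full_index_at \<Lambda> \<V> t \<longleftrightarrow> (\<forall>J\<in>\<Lambda>. J t = 0 \<longrightarrow> J \<in> \<V>)"

text \<open>Invariance under parallel transport between the points of \<open>I\<close>.\<close>

definition parallel_distribution ::
    "('m, 'a::euclidean_space, 'z) metric_atlas_scheme \<Rightarrow> (real \<Rightarrow> 'm) \<Rightarrow> real set \<Rightarrow>
     (real \<Rightarrow> 'a set) \<Rightarrow> bool" where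
  "parallel_distribution M \<gamma> I D \<longleftrightarrow>
     (\<forall>s\<in>I. \<forall>v\<in>D s. \<exists>E. parallel_field M \<gamma> E \<and> E s = v \<and> (\<forall>t\<in>I. E t \<in> D t))"

definition splits_orthogonally ::
    "('m, 'a::euclidean_space, 'z) metric_atlas_scheme \<Rightarrow> (real \<Rightarrow> 'm) \<Rightarrow> (real \<Rightarrow> 'a) set \<Rightarrow>
     (real \<Rightarrow> 'a) set \<Rightarrow> (real \<Rightarrow> 'a) set \<Rightarrow> real set \<Rightarrow> bool" where
  "splits_orthogonally M \<gamma> \<Lambda> \<V> \<H> I \<longleftrightarrow>
     fields.subspace \<H> \<and> \<H> \<subseteq> \<Lambda> \<and>
     \<V> \<inter> \<H> = {0} \<and> {J + K | J K. J \<in> \<V> \<and> K \<in> \<H>} = \<Lambda> \<and>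
     (\<forall>t\<in>I. distribution_of M \<gamma> \<H> t = horizontal_space M \<gamma> \<V> t) \<and>
     (\<forall>t\<in>I. \<forall>v\<in>distribution_of M \<gamma> \<V> t. \<forall>h\<in>distribution_of M \<gamma> \<H> t. rmetric M (\<gamma> t) v h = 0) \<and>
     parallel_distribution M \<gamma> I (distribution_of M \<gamma> \<V>) \<and>
     parallel_distribution M \<gamma> I (distribution_of M \<gamma> \<H>)"

end

theory Submission
  imports Defs
begin

text \<open>
  The proof follows Wilking's transverse Jacobi equation. The fields in \<open>\<V>\<close> are divided out: their values, together
  with the derivatives of those that vanish, span a distribution of constant dimension along \<open>\<gamma>\<close>, whose complement
  \<open>H(t)\<close> is \<open>k\<close>-dimensional and equals \<open>W\<close> at the initial time (\<open>horizontal_eq\<close>). Where \<open>\<V>\<close> has full index, all poles of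
  the Riccati operator \<open>S\<close> are vertical, and the trace of \<open>S\<close> on \<open>H(t)\<close> is a continuous function (\<open>tr_continuous\<close>).

  At times at which no field of \<open>\<Lambda>\<close> vanishes, the trace can be differentiated. The Riccati equation
  \<open>S' + S\<^sup>2 + R = 0\<close>, the Cauchy--Schwarz inequality for the trace and the curvature bound for \<open>k\<close> orthonormal vectors give
  \<open>\<sigma>' \<le> - \<sigma>\<^sup>2 - \<kappa>\<close> for \<open>\<sigma> = Trace S / k\<close>; the rotation of \<open>H(t)\<close> contributes a further term with the favourable sign
  (\<open>tr_deriv\<close>, \<open>tr_inequality\<close>). The excluded times are isolated (\<open>nonsing_punctured\<close>), so that by continuity the
  inequality can be integrated across them. Comparison with the solution \<open>lam\<close> of the Riccati equation
  (\<open>riccati_comparison\<close>) proves the first claim.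

  If equality holds at \<open>t\<^sub>1\<close>, then it holds on all of \<open>[t\<^sub>0, t\<^sub>1]\<close>, hence in each of the inequalities above. So \<open>S\<close> is
  \<open>lam\<close> times the identity on \<open>H(t)\<close> and \<open>H(t)\<close> does not rotate: \<open>H\<close> and its complement are parallel (\<open>PH_const\<close>). The
  curvature operator therefore respects the decomposition (\<open>R_commutes\<close>), and the solutions that start horizontally with
  suitable derivative remain horizontal and are multiples \<open>f E\<close> of parallel fields (\<open>flow_Z\<close>).

  All of this happens in a Euclidean space once tangent vectors are written in a parallel orthonormal frame. The
  preparations establish what this translation requires: the Levi-Civita connection and the curvature in charts with
  their symmetries and their independence of the chart, and parallel transport along \<open>\<gamma>\<close>.
\<close>

section \<open>Calculus of smooth maps\<close>

abbreviation fd :: "('a::real_normed_vector \<Rightarrow> 'b::real_normed_vector) \<Rightarrow> 'a \<Rightarrow> 'a \<Rightarrow> 'b" where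
  "fd f x \<equiv> frechet_derivative f (at x)"

lemma linear_basis_expand:
  fixes L :: "'a::euclidean_space \<Rightarrow> 'b::real_normed_vector"
  assumes "linear L"
  shows "L v = (\<Sum>b\<in>Basis. (v \<bullet> b) *\<^sub>R L b)"
  using assms by (metis (no_types, lifting) euclidean_representation linear_scale linear_sum sum.cong)

lemma fd_eqI: "(f has_derivative f') (at x) \<Longrightarrow> fd f x = f'"
  using frechet_derivative_at by metis

lemma Ck_on_SucD:
  assumes "open S" "Ck_on (Suc k) S f"
  shows "x \<in> S \<Longrightarrow> (f has_derivative fd f x) (at x)" "Ck_on k S (\<lambda>x. fd f x v)"
  using assms by (auto simp: differentiable_on_eq_differentiable_at frechet_derivative_works)

lemma Ck_on_continuous: "Ck_on k S f \<Longrightarrow> continuous_on S f"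
  by (cases k) (auto intro: differentiable_imp_continuous_on)

lemma Ck_on_cong:
  assumes "open S" "\<And>x. x \<in> S \<Longrightarrow> f x = g x" "Ck_on k S f"
  shows "Ck_on k S g"
  using assms(2,3)
proof (induction k arbitrary: f g)
  case 0 then show ?case by (metis Ck_on.simps(1) continuous_on_cong)
next
  case (Suc k)
  have d: "(g has_derivative fd f x) (at x)" if "x \<in> S" for x
    using has_derivative_transform_within_open[OF Ck_on_SucD(1)[OF assms(1) Suc.prems(2) that] assms(1) that] Suc.prems(1)
    by auto
  have "Ck_on k S (\<lambda>x. fd g x v)" for v
    by (rule Suc.IH[OF _ Ck_on_SucD(2)[OF assms(1) Suc.prems(2), of v]]) (simp add: fd_eqI[OF d])
  then show ?case
    using d assms(1) by (auto simp: differentiable_on_eq_differentiable_at differentiable_def)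
qed

lemma Ck_on_SucI:
  assumes "open S" "\<And>x. x \<in> S \<Longrightarrow> (f has_derivative f' x) (at x)" "\<And>v. Ck_on k S (\<lambda>x. f' x v)"
  shows "Ck_on (Suc k) S f"
proof -
  have "Ck_on k S (\<lambda>x. fd f x v)" for v
    by (rule Ck_on_cong[OF assms(1) _ assms(3)[of v]]) (simp add: fd_eqI[OF assms(2)])
  then show ?thesis
    using assms by (auto simp: differentiable_on_eq_differentiable_at differentiable_def)
qed

lemma Ck_on_lower: "open S \<Longrightarrow> Ck_on (Suc k) S f \<Longrightarrow> Ck_on k S f"
proof (induction k arbitrary: f)
  case 0 then show ?case using Ck_on_continuous[of "Suc 0"] by simp
next
  case (Suc k)
  show ?case
    by (rule Ck_on_SucI[OF Suc.prems(1) Ck_on_SucD(1)[OF Suc.prems]])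
       (auto intro!: Suc.IH[OF Suc.prems(1)] Ck_on_SucD(2)[OF Suc.prems])
qed

lemma Ck_on_subset: "open S \<Longrightarrow> open T \<Longrightarrow> T \<subseteq> S \<Longrightarrow> Ck_on k S f \<Longrightarrow> Ck_on k T f"
proof (induction k arbitrary: f)
  case 0 then show ?case by (auto intro: continuous_on_subset)
next
  case (Suc k)
  show ?case
    by (rule Ck_on_SucI[OF Suc.prems(2) Ck_on_SucD(1)[OF Suc.prems(1,4)]])
       (use Suc.prems in \<open>auto intro!: Suc.IH Ck_on_SucD(2)[OF Suc.prems(1,4)]\<close>)
qed

lemma Ck_on_const: "open S \<Longrightarrow> Ck_on k S (\<lambda>x. c)"
proof (induction k arbitrary: c)
  case (Suc k) then show ?case by (intro Ck_on_SucI[where f'="\<lambda>_ _. 0"]) auto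
qed auto

lemma Ck_on_add:
  "open S \<Longrightarrow> Ck_on k S f \<Longrightarrow> Ck_on k S g \<Longrightarrow> Ck_on k S (\<lambda>x. f x + g x)"
proof (induction k arbitrary: f g)
  case (Suc k)
  show ?case
    by (rule Ck_on_SucI[OF Suc.prems(1) has_derivative_add[OF Ck_on_SucD(1)[OF Suc.prems(1,2)] Ck_on_SucD(1)[OF Suc.prems(1,3)]]])
       (auto intro!: Suc.IH[OF Suc.prems(1)] Ck_on_SucD(2)[OF Suc.prems(1,2)] Ck_on_SucD(2)[OF Suc.prems(1,3)])
qed (auto intro: continuous_on_add)

lemma Ck_on_bilinear:
  assumes "bounded_bilinear m"
  shows "open S \<Longrightarrow> Ck_on k S f \<Longrightarrow> Ck_on k S g \<Longrightarrow> Ck_on k S (\<lambda>x. m (f x) (g x))"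
proof (induction k arbitrary: f g)
  case 0 then show ?case using bounded_bilinear.continuous_on[OF assms] by auto
next
  case (Suc k)
  show ?case
    by (rule Ck_on_SucI[OF Suc.prems(1) bounded_bilinear.FDERIV[OF assms Ck_on_SucD(1)[OF Suc.prems(1,2)] Ck_on_SucD(1)[OF Suc.prems(1,3)]]])
       (use Suc.prems in \<open>auto intro!: Ck_on_add Suc.IH[OF Suc.prems(1)] intro: Ck_on_lower
          Ck_on_SucD(2)[OF Suc.prems(1,2)] Ck_on_SucD(2)[OF Suc.prems(1,3)]\<close>)
qed

lemma Ck_on_scaleR:
  "open S \<Longrightarrow> Ck_on k S f \<Longrightarrow> Ck_on k S g \<Longrightarrow> Ck_on k S (\<lambda>x. f x *\<^sub>R g x)"
  by (rule Ck_on_bilinear[OF bounded_bilinear_scaleR])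

lemma Ck_on_inner_const: "open S \<Longrightarrow> Ck_on k S f \<Longrightarrow> Ck_on k S (\<lambda>x. f x \<bullet> c)"
  by (rule Ck_on_bilinear[OF bounded_bilinear_inner _ _ Ck_on_const])

lemma Ck_on_sum:
  "open S \<Longrightarrow> (\<And>i. i \<in> B \<Longrightarrow> Ck_on k S (f i)) \<Longrightarrow> Ck_on k S (\<lambda>x. \<Sum>i\<in>B. f i x)"
  by (induction B rule: infinite_finite_induct) (auto intro: Ck_on_const Ck_on_add)

lemma Ck_on_compose:
  fixes f :: "'a::real_normed_vector \<Rightarrow> 'b::euclidean_space" and g :: "'b \<Rightarrow> 'c::real_normed_vector"
  assumes "open S" "open T" "\<And>x. x \<in> S \<Longrightarrow> f x \<in> T"
  shows "Ck_on k S f \<Longrightarrow> Ck_on k T g \<Longrightarrow> Ck_on k S (\<lambda>x. g (f x))"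
proof (induction k arbitrary: g)
  case 0 then show ?case using assms(3) continuous_on_compose2[of T g S f] by (simp add: image_subset_iff)
next
  case (Suc k)
  have l: "linear (fd g y)" if "y \<in> T" for y
    by (rule has_derivative_linear[OF Ck_on_SucD(1)[OF assms(2) Suc.prems(2) that]])
  show ?case
  proof (rule Ck_on_SucI[OF assms(1)])
    fix x assume x: "x \<in> S"
    show "((\<lambda>x. g (f x)) has_derivative (\<lambda>v. \<Sum>b\<in>Basis. (fd f x v \<bullet> b) *\<^sub>R fd g (f x) b)) (at x)"
      using diff_chain_at[OF Ck_on_SucD(1)[OF assms(1) Suc.prems(1) x] Ck_on_SucD(1)[OF assms(2) Suc.prems(2) assms(3)[OF x]]]
      unfolding o_def by (subst (asm) linear_basis_expand[OF l[OF assms(3)[OF x]]])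
  next
    fix v
    show "Ck_on k S (\<lambda>x. \<Sum>b\<in>Basis. (fd f x v \<bullet> b) *\<^sub>R fd g (f x) b)"
      by (intro Ck_on_sum Ck_on_scaleR Ck_on_inner_const assms Suc.IH Ck_on_SucD(2)[OF assms(1) Suc.prems(1)]
         Ck_on_SucD(2)[OF assms(2) Suc.prems(2)] Ck_on_lower[OF assms(1) Suc.prems(1)])
  qed
qed

text \<open>
  By induction on the order, since the derivative of \<open>1 / f\<close> is \<open>- f' / f\<^sup>2\<close>.
\<close>

lemma Ck_on_inverse:
  fixes f :: "'a::real_normed_vector \<Rightarrow> real"
  assumes "open S" "\<And>x. x \<in> S \<Longrightarrow> f x \<noteq> 0"
  shows "Ck_on k S f \<Longrightarrow> Ck_on k S (\<lambda>x. inverse (f x))"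
proof (induction k)
  case 0 then show ?case using assms by (auto intro!: continuous_on_inverse)
next
  case (Suc k)
  have k: "Ck_on k S (\<lambda>x. inverse (f x))" using Suc.IH Ck_on_lower[OF assms(1) Suc.prems] by blast
  show ?case
  proof (rule Ck_on_SucI[OF assms(1)])
    fix x assume x: "x \<in> S"
    show "((\<lambda>x. inverse (f x)) has_derivative (\<lambda>h. (-1) *\<^sub>R (inverse (f x) *\<^sub>R (fd f x h *\<^sub>R inverse (f x))))) (at x)"
      using Deriv.has_derivative_inverse[OF assms(2)[OF x] Ck_on_SucD(1)[OF assms(1) Suc.prems x]] by (simp add: mult.assoc)
  qed (intro Ck_on_scaleR Ck_on_const k assms Ck_on_SucD(2)[OF assms(1) Suc.prems])
qed

lemma Ck_on_local:
  assumes "open S" "\<And>x. x \<in> S \<Longrightarrow> \<exists>U. open U \<and> x \<in> U \<and> Ck_on k U f"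
  shows "Ck_on k S f"
  using assms(2)
proof (induction k arbitrary: f)
  case 0
  then show ?case
    by (metis Ck_on.simps(1) assms(1) continuous_at_imp_continuous_on continuous_on_eq_continuous_at)
next
  case (Suc k)
  show ?case
  proof (rule Ck_on_SucI[OF assms(1), where f'="\<lambda>x. fd f x"])
    show "(f has_derivative fd f x) (at x)" if x: "x \<in> S" for x
    proof -
      obtain U where "open U" "x \<in> U" "Ck_on (Suc k) U f" using Suc.prems[OF x] by auto
      then show ?thesis using Ck_on_SucD(1) by metis
    qed
    show "Ck_on k S (\<lambda>x. fd f x v)" for v
    proof (rule Suc.IH)
      fix x assume "x \<in> S"
      then obtain U where "open U" "x \<in> U" "Ck_on (Suc k) U f" using Suc.prems by auto
      then show "\<exists>U. open U \<and> x \<in> U \<and> Ck_on k U (\<lambda>x. fd f x v)" using Ck_on_SucD(2) by metis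
    qed
  qed
qed

text \<open>
  Expanding the argument in a basis reduces a family of linear maps applied to a moving vector to finitely many
  products, so it suffices to know how the family behaves on fixed vectors.
\<close>

lemma Ck_on_family_apply:
  fixes w :: "'a::real_normed_vector \<Rightarrow> 'b::euclidean_space" and B :: "'a \<Rightarrow> 'b \<Rightarrow> 'c::real_normed_vector"
  assumes "open S" "\<And>x. x \<in> S \<Longrightarrow> linear (B x)" "\<And>b. b \<in> Basis \<Longrightarrow> Ck_on k S (\<lambda>x. B x b)" "Ck_on k S w"
  shows "Ck_on k S (\<lambda>x. B x (w x))"
  by (rule Ck_on_cong[OF assms(1), of "\<lambda>x. \<Sum>b\<in>Basis. (w x \<bullet> b) *\<^sub>R B x b"])
     (use assms in \<open>auto intro!: Ck_on_sum Ck_on_scaleR Ck_on_inner_const simp: linear_basis_expand[symmetric]\<close>)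

lemma has_derivative_family_apply:
  fixes w :: "'a::real_normed_vector \<Rightarrow> 'b::euclidean_space" and B :: "'a \<Rightarrow> 'b \<Rightarrow> 'c::real_normed_vector"
  assumes "open U" "x \<in> U" "\<And>y. y \<in> U \<Longrightarrow> linear (B y)"
    and B': "\<And>b. ((\<lambda>y. B y b) has_derivative (\<lambda>u. B' u b)) (at x within S)"
    and w: "(w has_derivative w') (at x within S)"
    and lin: "\<And>u. linear (B' u)"
  shows "((\<lambda>y. B y (w y)) has_derivative (\<lambda>u. B' u (w x) + B x (w' u))) (at x within S)"
proof -
  have "((\<lambda>y. \<Sum>b\<in>Basis. (w y \<bullet> b) *\<^sub>R B y b) has_derivative
      (\<lambda>u. \<Sum>b\<in>Basis. (w x \<bullet> b) *\<^sub>R B' u b + (w' u \<bullet> b) *\<^sub>R B x b)) (at x within S)"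
    by (intro has_derivative_sum has_derivative_scaleR B' has_derivative_inner_left w)
  moreover have "(\<Sum>b\<in>Basis. (w x \<bullet> b) *\<^sub>R B' u b + (w' u \<bullet> b) *\<^sub>R B x b) = B' u (w x) + B x (w' u)" for u
    unfolding sum.distrib linear_basis_expand[OF lin, of u "w x"] linear_basis_expand[OF assms(3)[OF assms(2)], of "w' u"] ..
  ultimately have "((\<lambda>y. \<Sum>b\<in>Basis. (w y \<bullet> b) *\<^sub>R B y b) has_derivative
      (\<lambda>u. B' u (w x) + B x (w' u))) (at x within S)" by simp
  then show ?thesis
    by (rule has_derivative_transform_within_open[OF _ assms(1,2)])
      (rule linear_basis_expand[OF assms(3), symmetric])
qed

lemma smooth_on_Ck: "smooth_on S f \<Longrightarrow> Ck_on k S f"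
  by (simp add: smooth_on_def)

lemma smooth_on_deriv:
  assumes "open S" "smooth_on S f"
  shows "x \<in> S \<Longrightarrow> (f has_derivative fd f x) (at x)" "smooth_on S (\<lambda>x. fd f x v)"
proof -
  show "x \<in> S \<Longrightarrow> (f has_derivative fd f x) (at x)"
    by (rule Ck_on_SucD(1)[OF assms(1) smooth_on_Ck[OF assms(2), of "Suc 0"]])
  show "smooth_on S (\<lambda>x. fd f x v)"
    unfolding smooth_on_def by (rule allI, rule Ck_on_SucD(2)[OF assms(1) smooth_on_Ck[OF assms(2)]])
qed

lemma smooth_on_const: "open S \<Longrightarrow> smooth_on S (\<lambda>x. c)"
  unfolding smooth_on_def by (rule allI, erule Ck_on_const)

lemma smooth_on_add: "open S \<Longrightarrow> smooth_on S f \<Longrightarrow> smooth_on S g \<Longrightarrow> smooth_on S (\<lambda>x. f x + g x)"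
  unfolding smooth_on_def by (rule allI, rule Ck_on_add, assumption, (erule spec)+)

lemma smooth_on_scaleR: "open S \<Longrightarrow> smooth_on S r \<Longrightarrow> smooth_on S g \<Longrightarrow> smooth_on S (\<lambda>x. r x *\<^sub>R g x)"
  unfolding smooth_on_def by (rule allI, rule Ck_on_scaleR, assumption, (erule spec)+)

lemma smooth_on_inner_const: "open S \<Longrightarrow> smooth_on S h \<Longrightarrow> smooth_on S (\<lambda>x. h x \<bullet> d)"
  unfolding smooth_on_def by (rule allI, rule Ck_on_inner_const, assumption, (erule spec)+)

lemma smooth_on_sum: "open S \<Longrightarrow> (\<And>i. i \<in> B \<Longrightarrow> smooth_on S (f i)) \<Longrightarrow> smooth_on S (\<lambda>x. \<Sum>i\<in>B. f i x)"
  unfolding smooth_on_def by (rule allI, rule Ck_on_sum) auto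

lemma smooth_on_cong: "open S \<Longrightarrow> (\<And>x. x \<in> S \<Longrightarrow> f x = g x) \<Longrightarrow> smooth_on S f \<Longrightarrow> smooth_on S g"
  unfolding smooth_on_def by (rule allI, rule Ck_on_cong[of S f g]) auto

lemma smooth_on_subset: "open S \<Longrightarrow> open T \<Longrightarrow> T \<subseteq> S \<Longrightarrow> smooth_on S f \<Longrightarrow> smooth_on T f"
  unfolding smooth_on_def by (rule allI, rule Ck_on_subset[of S T]) auto

lemma smooth_on_compose:
  fixes f :: "'a::real_normed_vector \<Rightarrow> 'b::euclidean_space"
  assumes "open S" "open T" "\<And>x. x \<in> S \<Longrightarrow> f x \<in> T" "smooth_on S f" "smooth_on T g"
  shows "smooth_on S (\<lambda>x. g (f x))"
  using Ck_on_compose[OF assms(1-3) smooth_on_Ck[OF assms(4)] smooth_on_Ck[OF assms(5)]]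
  unfolding smooth_on_def by (rule allI)

lemma smooth_on_family_apply:
  fixes w :: "'a::real_normed_vector \<Rightarrow> 'b::euclidean_space"
  assumes "open S" "\<And>x. x \<in> S \<Longrightarrow> linear (B x)" "\<And>b. b \<in> Basis \<Longrightarrow> smooth_on S (\<lambda>x. B x b)" "smooth_on S w"
  shows "smooth_on S (\<lambda>x. B x (w x))"
  using Ck_on_family_apply[OF assms(1,2) smooth_on_Ck[OF assms(3)] smooth_on_Ck[OF assms(4)]]
  unfolding smooth_on_def by (rule allI)

lemma smooth_on_continuous: "smooth_on S f \<Longrightarrow> continuous_on S f"
  by (rule Ck_on_continuous[OF smooth_on_Ck[of _ _ 0]])

lemma Ck_on_curveI:
  assumes "open S" "\<And>t. t \<in> S \<Longrightarrow> (f has_vector_derivative f' t) (at t)" "Ck_on k S f'"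
  shows "Ck_on (Suc k) S f"
  by (rule Ck_on_SucI[OF assms(1) assms(2)[unfolded has_vector_derivative_def]])
     (auto intro!: Ck_on_scaleR Ck_on_const assms)

lemma smooth_on_curve_deriv:
  fixes f :: "real \<Rightarrow> 'b::real_normed_vector"
  assumes "open S" "smooth_on S f"
  shows "t \<in> S \<Longrightarrow> (f has_vector_derivative vector_derivative f (at t)) (at t)"
    "smooth_on S (\<lambda>t. vector_derivative f (at t))"
proof -
  show d: "(f has_vector_derivative vector_derivative f (at t)) (at t)" if "t \<in> S" for t
    using differentiableI[OF smooth_on_deriv(1)[OF assms that]] by (simp add: vector_derivative_works)
  show "smooth_on S (\<lambda>t. vector_derivative f (at t))"
    by (rule smooth_on_cong[OF assms(1) _ smooth_on_deriv(2)[OF assms, of 1]])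
      (simp add: fd_eqI[OF d[unfolded has_vector_derivative_def]])
qed


subsection \<open>Symmetry of the second derivative\<close>

text \<open>
  Two applications of the mean value theorem, first along \<open>u\<close>, then along \<open>v\<close>, express the symmetric second
  difference through one mixed derivative at an intermediate point. Its left-hand side is symmetric in the two
  directions, which is what forces mixed derivatives to agree.
\<close>

lemma second_difference:
  fixes F :: "'a::real_normed_vector \<Rightarrow> real"
  assumes S: "open S" and F: "Ck_on (Suc (Suc 0)) S F" and h: "0 < h"
    and cb: "\<And>s r. 0 \<le> s \<Longrightarrow> s \<le> h \<Longrightarrow> 0 \<le> r \<Longrightarrow> r \<le> h \<Longrightarrow> x + s *\<^sub>R u + r *\<^sub>R v \<in> S"
  shows "\<exists>s r. 0 \<le> s \<and> s \<le> h \<and> 0 \<le> r \<and> r \<le> h \<and>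
    F (x + h *\<^sub>R u + h *\<^sub>R v) - F (x + h *\<^sub>R u) - F (x + h *\<^sub>R v) + F x
      = h * h * fd (\<lambda>y. fd F y u) (x + s *\<^sub>R u + r *\<^sub>R v) v"
proof -
  have d1: "((\<lambda>s. F (x + s *\<^sub>R u + r *\<^sub>R v)) has_real_derivative fd F (x + s *\<^sub>R u + r *\<^sub>R v) u) (at s)"
    if "0 \<le> s" "s \<le> h" "0 \<le> r" "r \<le> h" for s r
  proof -
    have "((\<lambda>s. x + s *\<^sub>R u + r *\<^sub>R v) has_vector_derivative u) (at s)"
      by (auto intro!: derivative_eq_intros)
    from vector_derivative_diff_chain_within[OF this, of F]
    show ?thesis
      using Ck_on_SucD(1)[OF S F cb[OF that]] has_derivative_at_withinI
      by (fastforce simp: o_def has_real_derivative_iff_has_vector_derivative)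
  qed
  have d2: "((\<lambda>r. fd F (x + s *\<^sub>R u + r *\<^sub>R v) u) has_real_derivative fd (\<lambda>y. fd F y u) (x + s *\<^sub>R u + r *\<^sub>R v) v) (at r)"
    if "0 \<le> s" "s \<le> h" "0 \<le> r" "r \<le> h" for s r
  proof -
    have "((\<lambda>r. x + s *\<^sub>R u + r *\<^sub>R v) has_vector_derivative v) (at r)"
      by (auto intro!: derivative_eq_intros)
    from vector_derivative_diff_chain_within[OF this, of "\<lambda>y. fd F y u"]
    show ?thesis
      using Ck_on_SucD(1)[OF S Ck_on_SucD(2)[OF S F, of u] cb[OF that]] has_derivative_at_withinI
      by (fastforce simp: o_def has_real_derivative_iff_has_vector_derivative)
  qed
  let ?\<phi> = "\<lambda>s. F (x + s *\<^sub>R u + h *\<^sub>R v) - F (x + s *\<^sub>R u + 0 *\<^sub>R v)"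
  have d3: "(?\<phi> has_real_derivative fd F (x + s *\<^sub>R u + h *\<^sub>R v) u - fd F (x + s *\<^sub>R u + 0 *\<^sub>R v) u) (at s)"
    if "0 \<le> s" "s \<le> h" for s
    by (intro DERIV_diff d1) (use that h in auto)
  have "\<exists>s>0. s < h \<and> ?\<phi> h - ?\<phi> 0 = (h - 0) * (fd F (x + s *\<^sub>R u + h *\<^sub>R v) u - fd F (x + s *\<^sub>R u + 0 *\<^sub>R v) u)"
    by (rule MVT2[OF h d3])
  then obtain s where s: "0 < s" "s < h"
    and es: "?\<phi> h - ?\<phi> 0 = h * (fd F (x + s *\<^sub>R u + h *\<^sub>R v) u - fd F (x + s *\<^sub>R u + 0 *\<^sub>R v) u)" by auto
  have "\<exists>r>0. r < h \<and> fd F (x + s *\<^sub>R u + h *\<^sub>R v) u - fd F (x + s *\<^sub>R u + 0 *\<^sub>R v) u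
      = (h - 0) * fd (\<lambda>y. fd F y u) (x + s *\<^sub>R u + r *\<^sub>R v) v"
    by (rule MVT2[OF h d2]) (use s in auto)
  then obtain r where r: "0 < r" "r < h"
    and er: "fd F (x + s *\<^sub>R u + h *\<^sub>R v) u - fd F (x + s *\<^sub>R u + 0 *\<^sub>R v) u = h * fd (\<lambda>y. fd F y u) (x + s *\<^sub>R u + r *\<^sub>R v) v"
    by auto
  show ?thesis
    by (rule exI[of _ s], rule exI[of _ r]) (use s r es er in \<open>auto simp: algebra_simps\<close>)
qed

lemma second_derivative_symmetric_real:
  fixes F :: "'a::real_normed_vector \<Rightarrow> real"
  assumes S: "open S" and F: "Ck_on (Suc (Suc 0)) S F" and x: "x \<in> S"
  shows "fd (\<lambda>y. fd F y u) x v = fd (\<lambda>y. fd F y v) x u"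
proof (rule ccontr)
  let ?A = "\<lambda>y. fd (\<lambda>y. fd F y u) y v" and ?B = "\<lambda>y. fd (\<lambda>y. fd F y v) y u"
  assume "?A x \<noteq> ?B x"
  then have e: "0 < \<bar>?A x - ?B x\<bar> / 2" by simp
  have cont: "continuous_on S ?A" "continuous_on S ?B"
    using Ck_on_SucD(2)[OF S Ck_on_SucD(2)[OF S F]] by auto
  obtain d1 where d1: "0 < d1" "\<forall>y\<in>S. dist y x < d1 \<longrightarrow> dist (?A y) (?A x) < \<bar>?A x - ?B x\<bar> / 2"
    using bspec[OF cont(1)[unfolded continuous_on_iff] x] e by metis
  obtain d2 where d2: "0 < d2" "\<forall>y\<in>S. dist y x < d2 \<longrightarrow> dist (?B y) (?B x) < \<bar>?A x - ?B x\<bar> / 2"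
    using bspec[OF cont(2)[unfolded continuous_on_iff] x] e by metis
  have d: "0 < d1" "0 < d2"
    "\<And>y. y \<in> S \<Longrightarrow> dist y x < d1 \<Longrightarrow> dist (?A y) (?A x) < \<bar>?A x - ?B x\<bar> / 2"
    "\<And>y. y \<in> S \<Longrightarrow> dist y x < d2 \<Longrightarrow> dist (?B y) (?B x) < \<bar>?A x - ?B x\<bar> / 2"
    using d1 d2 by auto
  obtain d3 where d3: "0 < d3" "ball x d3 \<subseteq> S" using S x openE by blast
  define dd where "dd = min d1 (min d2 d3)"
  \<comment> \<open>The parallelogram with sides \<open>h u\<close>, \<open>h v\<close> has to fit into a small ball around \<open>x\<close>; adding \<open>1\<close> keeps \<open>N\<close> positive.\<close>
  define N where "N = norm u + norm v + 1"
  define h where "h = dd / 2 / N"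
  have dd: "0 < dd" using d d3 by (auto simp: dd_def)
  have n: "0 < N" by (simp add: N_def add_nonneg_pos)
  have h: "0 < h" using dd n by (simp add: h_def)
  have near: "norm (s *\<^sub>R u + r *\<^sub>R v) < dd" if "0 \<le> s" "s \<le> h" "0 \<le> r" "r \<le> h" for s r u' v'
  proof -
    have "norm (s *\<^sub>R u + r *\<^sub>R v) \<le> h * norm u + h * norm v"
      by (rule norm_triangle_le) (use that in \<open>auto intro!: add_mono mult_right_mono\<close>)
    also have "\<dots> \<le> h * N" using h by (simp add: N_def algebra_simps)
    also have "\<dots> < dd" using dd n by (simp add: h_def)
    finally show ?thesis .
  qed
  have in1: "x + s *\<^sub>R u + r *\<^sub>R v \<in> S \<and> dist (x + s *\<^sub>R u + r *\<^sub>R v) x < dd"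
    if "0 \<le> s" "s \<le> h" "0 \<le> r" "r \<le> h" for s r
  proof -
    have "dist (x + s *\<^sub>R u + r *\<^sub>R v) x < dd" using near[OF that] by (simp add: dist_norm add.assoc)
    then show ?thesis using d3 by (auto simp: dd_def dist_commute subset_iff)
  qed
  obtain s r where 1: "0 \<le> s" "s \<le> h" "0 \<le> r" "r \<le> h"
    "F (x + h *\<^sub>R u + h *\<^sub>R v) - F (x + h *\<^sub>R u) - F (x + h *\<^sub>R v) + F x = h * h * ?A (x + s *\<^sub>R u + r *\<^sub>R v)"
    using second_difference[OF S F h, of x u v] in1 by blast
  have in2: "x + s *\<^sub>R v + r *\<^sub>R u \<in> S \<and> dist (x + s *\<^sub>R v + r *\<^sub>R u) x < dd"
    if "0 \<le> s" "s \<le> h" "0 \<le> r" "r \<le> h" for s r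
    using in1[OF that(3,4,1,2)] by (simp add: algebra_simps)
  obtain s' r' where 2: "0 \<le> s'" "s' \<le> h" "0 \<le> r'" "r' \<le> h"
    "F (x + h *\<^sub>R v + h *\<^sub>R u) - F (x + h *\<^sub>R v) - F (x + h *\<^sub>R u) + F x = h * h * ?B (x + s' *\<^sub>R v + r' *\<^sub>R u)"
    using second_difference[OF S F h, of x v u] in2 by blast
  have "h * h * ?A (x + s *\<^sub>R u + r *\<^sub>R v) = h * h * ?B (x + s' *\<^sub>R v + r' *\<^sub>R u)"
    using 1(5) 2(5) by (simp add: algebra_simps)
  then have "?A (x + s *\<^sub>R u + r *\<^sub>R v) = ?B (x + s' *\<^sub>R v + r' *\<^sub>R u)" using h by simp
  moreover have "dist (?A (x + s *\<^sub>R u + r *\<^sub>R v)) (?A x) < \<bar>?A x - ?B x\<bar> / 2"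
    using in1[OF 1(1-4)] d(3) by (auto simp: dd_def)
  moreover have "dist (?B (x + s' *\<^sub>R v + r' *\<^sub>R u)) (?B x) < \<bar>?A x - ?B x\<bar> / 2"
    using in2[OF 2(1-4)] d(4) by (auto simp: dd_def)
  moreover have "False" if "a = b" "dist a a' < \<bar>a' - b'\<bar> / 2" "dist b b' < \<bar>a' - b'\<bar> / 2" for a b a' b' :: real
    using that unfolding dist_real_def by (auto simp: abs_if split: if_splits)
  ultimately show False by iprover
qed

lemma second_derivative_symmetric:
  fixes F :: "'a::real_normed_vector \<Rightarrow> 'b::euclidean_space"
  assumes S: "open S" and F: "smooth_on S F" and x: "x \<in> S"
  shows "fd (\<lambda>y. fd F y u) x v = fd (\<lambda>y. fd F y v) x u"
proof (rule euclidean_eqI)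
  fix b :: 'b assume "b \<in> Basis"
  have 1: "fd (\<lambda>y. F y \<bullet> b) y w = fd F y w \<bullet> b" if "y \<in> S" for y w
    using fd_eqI[OF has_derivative_inner_left[OF smooth_on_deriv(1)[OF S F that], of b]] by simp
  have 2: "fd (\<lambda>y. fd F y w \<bullet> b) x z = fd (\<lambda>y. fd F y w) x z \<bullet> b" for w z
    using fd_eqI[OF has_derivative_inner_left[OF smooth_on_deriv(1)[OF S smooth_on_deriv(2)[OF S F, of w] x], of b]] by simp
  have sm: "smooth_on S (\<lambda>y. F y \<bullet> b)" by (rule smooth_on_inner_const[OF S F])
  have 3: "fd (\<lambda>y. fd (\<lambda>y. F y \<bullet> b) y w) x z = fd (\<lambda>y. fd F y w \<bullet> b) x z" for w z
    by (rule fun_cong[OF frechet_derivative_transform_within_open[OF _ S x]])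
      (use differentiableI[OF smooth_on_deriv(1)[OF S smooth_on_deriv(2)[OF S sm] x]] 1 in auto)
  show "fd (\<lambda>y. fd F y u) x v \<bullet> b = fd (\<lambda>y. fd F y v) x u \<bullet> b"
    using second_derivative_symmetric_real[OF S smooth_on_Ck[OF sm] x, of u v] 2 3 by metis
qed


section \<open>Solving linear systems within a class of functions\<close>

text \<open>
  Gaussian elimination only uses the ring operations and the inversion of functions that do not vanish at the base
  point. Abstracting from the class of functions gives the same result for smooth functions on a manifold (used for
  the Christoffel symbols) and for functions of time with continuous derivative (used for frames along a geodesic).
\<close>

locale germ_ring =
  fixes A :: "('x::topological_space \<Rightarrow> real) \<Rightarrow> bool" and x0 :: 'x
  assumes A_const: "A (\<lambda>_. c)"
    and A_add: "A f \<Longrightarrow> A g \<Longrightarrow> A (\<lambda>x. f x + g x)"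
    and A_mult: "A f \<Longrightarrow> A g \<Longrightarrow> A (\<lambda>x. f x * g x)"
    and A_inverse: "A f \<Longrightarrow> f x0 \<noteq> 0 \<Longrightarrow> A (\<lambda>x. inverse (f x))"
    and A_nonzero: "A f \<Longrightarrow> f x0 \<noteq> 0 \<Longrightarrow> eventually (\<lambda>x. f x \<noteq> 0) (nhds x0)"
begin

lemma A_sum: "(\<And>i. i \<in> B \<Longrightarrow> A (f i)) \<Longrightarrow> A (\<lambda>x. \<Sum>i\<in>B. f i x)"
  by (induction B rule: infinite_finite_induct) (auto intro: A_const A_add)

lemma A_diff: "A f \<Longrightarrow> A g \<Longrightarrow> A (\<lambda>x. f x - g x)"
  using A_add[OF _ A_mult[OF A_const[of "-1"]], of f g] by simp

text \<open>
  Induction on the size of the system: solve the smaller system for \<open>y\<close> and for the column of the new index, then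
  determine the new unknown by dividing by the Schur complement. The latter is positive at the base point because it
  is the value of the quadratic form \<open>G\<close> at a vector whose component at the new index is \<open>1\<close>.
\<close>

lemma local_solve:
  assumes "finite B"
    and "\<And>i j. i \<in> B \<Longrightarrow> j \<in> B \<Longrightarrow> A (G i j)"
    and "\<And>i j x. G i j x = G j i x"
    and "\<And>c. (\<exists>i\<in>B. c i \<noteq> 0) \<Longrightarrow> (\<Sum>i\<in>B. \<Sum>j\<in>B. c i * G i j x0 * c j) > 0"
    and "\<And>i. i \<in> B \<Longrightarrow> A (y i)"
  shows "\<exists>c. (\<forall>i\<in>B. A (c i)) \<and> eventually (\<lambda>x. \<forall>i\<in>B. (\<Sum>j\<in>B. G i j x * c j x) = y i x) (nhds x0)"
  using assms(1,2,4,5)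
proof (induction B arbitrary: y rule: finite_induct)
  case empty then show ?case by simp
next
  case (insert v B)
  have sub: "\<And>c. (\<exists>i\<in>B. c i \<noteq> 0) \<Longrightarrow> (\<Sum>i\<in>B. \<Sum>j\<in>B. c i * G i j x0 * c j) > 0"
  proof -
    fix c :: "'a \<Rightarrow> real" assume c: "\<exists>i\<in>B. c i \<noteq> 0"
    let ?c = "c(v := 0)"
    have "(\<Sum>i\<in>insert v B. \<Sum>j\<in>insert v B. ?c i * G i j x0 * ?c j) > 0"
      by (rule insert.prems(2)) (use c insert.hyps in auto)
    moreover have "(\<Sum>i\<in>insert v B. \<Sum>j\<in>insert v B. ?c i * G i j x0 * ?c j) = (\<Sum>i\<in>B. \<Sum>j\<in>B. ?c i * G i j x0 * ?c j)"
      using insert.hyps by simp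
    moreover have "\<dots> = (\<Sum>i\<in>B. \<Sum>j\<in>B. c i * G i j x0 * c j)"
      by (intro sum.cong) (use insert.hyps in auto)
    ultimately show "(\<Sum>i\<in>B. \<Sum>j\<in>B. c i * G i j x0 * c j) > 0" by simp
  qed
  have G: "\<And>i j. i \<in> B \<Longrightarrow> j \<in> B \<Longrightarrow> A (G i j)" using insert.prems(1) by simp
  obtain p where p: "\<forall>i\<in>B. A (p i)"
    "eventually (\<lambda>x. \<forall>i\<in>B. (\<Sum>j\<in>B. G i j x * p j x) = G i v x) (nhds x0)"
    using insert.IH[OF G sub, of "\<lambda>i. G i v"] insert.prems(1) by auto
  obtain q where q: "\<forall>i\<in>B. A (q i)"
    "eventually (\<lambda>x. \<forall>i\<in>B. (\<Sum>j\<in>B. G i j x * q j x) = y i x) (nhds x0)"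
    using insert.IH[OF G sub, of y] insert.prems(3) by auto
  define n where "n = (\<lambda>x. G v v x - (\<Sum>j\<in>B. G v j x * p j x))"
  have Gv: "A (G v v)" "\<And>j. j \<in> B \<Longrightarrow> A (G v j)" by (simp_all add: insert.prems(1))
  have Ap: "\<And>j. j \<in> B \<Longrightarrow> A (p j)" and Aq: "\<And>j. j \<in> B \<Longrightarrow> A (q j)"
    using p(1) q(1) by simp_all
  have An: "A n" unfolding n_def by (rule A_diff, rule Gv(1), rule A_sum, rule A_mult, erule Gv(2), erule Ap)
  have p0: "\<forall>i\<in>B. (\<Sum>j\<in>B. G i j x0 * p j x0) = G i v x0"
    by (rule eventually_nhds_x_imp_x[OF p(2)])
  have n0: "n x0 > 0"
  proof -
    let ?c = "\<lambda>i. if i = v then 1 else - p i x0"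
    have "(\<Sum>i\<in>insert v B. \<Sum>j\<in>insert v B. ?c i * G i j x0 * ?c j) > 0"
      by (rule insert.prems(2)) auto
    moreover have "(\<Sum>j\<in>insert v B. ?c i * G i j x0 * ?c j) = ?c i * (G i v x0 - (\<Sum>j\<in>B. G i j x0 * p j x0))" for i
    proof -
      have "(\<Sum>j\<in>B. ?c i * G i j x0 * ?c j) = (\<Sum>j\<in>B. ?c i * (- (G i j x0 * p j x0)))"
        by (rule sum.cong) (use insert.hyps in auto)
      also have "\<dots> = ?c i * (- (\<Sum>j\<in>B. G i j x0 * p j x0))"
        by (simp only: sum_distrib_left[symmetric] sum_negf)
      finally have "(\<Sum>j\<in>insert v B. ?c i * G i j x0 * ?c j) = ?c i * G i v x0 * ?c v + ?c i * (- (\<Sum>j\<in>B. G i j x0 * p j x0))"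
        by (simp only: sum.insert[OF insert.hyps(1,2)])
      then show ?thesis by (simp only: right_diff_distrib) simp
    qed
    ultimately have "(\<Sum>i\<in>insert v B. ?c i * (G i v x0 - (\<Sum>j\<in>B. G i j x0 * p j x0))) > 0" by simp
    moreover have "(\<Sum>i\<in>insert v B. ?c i * (G i v x0 - (\<Sum>j\<in>B. G i j x0 * p j x0))) = n x0"
      using insert.hyps p0 by (simp add: n_def)
    ultimately show ?thesis by simp
  qed
  define cv where "cv = (\<lambda>x. (y v x - (\<Sum>j\<in>B. p j x * y j x)) * inverse (n x))"
  have Ay: "A (y j)" if "j \<in> insert v B" for j using insert.prems(3) that by simp
  have "A (\<lambda>x. y v x - (\<Sum>j\<in>B. p j x * y j x))"
    by (rule A_diff, rule Ay, simp, rule A_sum, rule A_mult, erule Ap, rule Ay, simp)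
  moreover have "A (\<lambda>x. inverse (n x))" using A_inverse[OF An] n0 by simp
  ultimately have Acv: "A cv" unfolding cv_def by (rule A_mult)
  define c where "c = (\<lambda>i x. if i = v then cv x else q i x - cv x * p i x)"
  have Ac: "\<forall>i\<in>insert v B. A (c i)"
  proof
    fix i assume i: "i \<in> insert v B"
    show "A (c i)"
    proof (cases "i = v")
      case True then show ?thesis using Acv by (simp add: c_def)
    next
      case False
      then have "i \<in> B" using i by simp
      then have "A (\<lambda>x. q i x - cv x * p i x)" by (intro A_diff[OF Aq] A_mult[OF Acv] Ap)
      then show ?thesis using False by (simp add: c_def)
    qed
  qed
  have "eventually (\<lambda>x. n x \<noteq> 0) (nhds x0)" using A_nonzero[OF An] n0 by simp
  with p(2) q(2) have "eventually (\<lambda>x. \<forall>i\<in>insert v B. (\<Sum>j\<in>insert v B. G i j x * c j x) = y i x) (nhds x0)"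
  proof eventually_elim
    case (elim x)
    have e: "(\<Sum>j\<in>insert v B. G i j x * c j x) = G i v x * cv x + (\<Sum>j\<in>B. G i j x * q j x) - cv x * (\<Sum>j\<in>B. G i j x * p j x)" for i
    proof -
      have "(\<Sum>j\<in>B. G i j x * c j x) = (\<Sum>j\<in>B. G i j x * q j x - cv x * (G i j x * p j x))"
        by (rule sum.cong) (use insert.hyps in \<open>auto simp: c_def algebra_simps\<close>)
      then show ?thesis using insert.hyps by (simp add: sum_subtractf sum_distrib_left c_def)
    qed
    have "(\<Sum>j\<in>B. G v j x * q j x) = (\<Sum>j\<in>B. (\<Sum>i\<in>B. G j i x * p i x) * q j x)"
      by (rule sum.cong) (use elim(1) assms(3)[of v _ x] in auto)
    also have "\<dots> = (\<Sum>i\<in>B. p i x * (\<Sum>j\<in>B. G i j x * q j x))"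
      unfolding sum_distrib_left sum_distrib_right
      by (subst sum.swap) (intro sum.cong refl, simp add: assms(3)[of _ _ x] mult_ac)
    also have "\<dots> = (\<Sum>i\<in>B. p i x * y i x)" using elim(2) by simp
    finally have vq: "(\<Sum>j\<in>B. G v j x * q j x) = (\<Sum>i\<in>B. p i x * y i x)" .
    show ?case
    proof (intro ballI)
      fix i assume i: "i \<in> insert v B"
      show "(\<Sum>j\<in>insert v B. G i j x * c j x) = y i x"
      proof (cases "i = v")
        case True
        have "G v v x * cv x + (\<Sum>j\<in>B. G v j x * q j x) - cv x * (\<Sum>j\<in>B. G v j x * p j x)
          = cv x * n x + (\<Sum>i\<in>B. p i x * y i x)" unfolding vq n_def by (simp add: algebra_simps)
        also have "cv x * n x = y v x - (\<Sum>j\<in>B. p j x * y j x)" using elim(3) by (simp add: cv_def)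
        finally show ?thesis unfolding e True by simp
      next
        case False
        then have "i \<in> B" using i by simp
        then show ?thesis unfolding e using elim(1,2) by (simp add: mult.commute)
      qed
    qed
  qed
  with Ac show ?case by blast
qed

text \<open>The coefficients of the dual frame with respect to the frame itself solve a linear system whose matrix is the
  Gram matrix, and this is positive definite where the frame is independent.\<close>

lemma local_dual_frame:
  fixes q :: "'i \<Rightarrow> 'x \<Rightarrow> 'b::euclidean_space"
  assumes B: "finite B" and Aq: "\<And>i e. i \<in> B \<Longrightarrow> e \<in> Basis \<Longrightarrow> A (\<lambda>x. q i x \<bullet> e)"
    and ind: "\<And>c i. (\<Sum>i\<in>B. c i *\<^sub>R q i x0) = 0 \<Longrightarrow> i \<in> B \<Longrightarrow> c i = 0"
  obtains d where "\<And>i e. i \<in> B \<Longrightarrow> e \<in> Basis \<Longrightarrow> A (\<lambda>x. d i x \<bullet> e)"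
    "eventually (\<lambda>x. \<forall>i\<in>B. \<forall>j\<in>B. q i x \<bullet> d j x = (if i = j then 1 else 0)) (nhds x0)"
    "\<And>i x. i \<in> B \<Longrightarrow> d i x \<in> span ((\<lambda>j. q j x) ` B)"
proof -
  let ?G = "\<lambda>i j x. q i x \<bullet> q j x"
  have AG: "A (?G i j)" if "i \<in> B" "j \<in> B" for i j
    unfolding euclidean_inner[of "q i _" "q j _"] using that Aq by (intro A_sum A_mult) auto
  have pos: "(\<Sum>i\<in>B. \<Sum>j\<in>B. c i * ?G i j x0 * c j) > 0" if "\<exists>i\<in>B. c i \<noteq> 0" for c
  proof -
    have "(\<Sum>i\<in>B. \<Sum>j\<in>B. c i * ?G i j x0 * c j) = (\<Sum>i\<in>B. c i *\<^sub>R q i x0) \<bullet> (\<Sum>i\<in>B. c i *\<^sub>R q i x0)"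
      by (simp add: inner_sum_left inner_sum_right mult_ac) (simp add: sum_distrib_left mult_ac inner_commute)
    moreover have "(\<Sum>i\<in>B. c i *\<^sub>R q i x0) \<noteq> 0" using ind that by blast
    ultimately show ?thesis by simp
  qed
  have "\<forall>k. \<exists>c. (\<forall>i\<in>B. A (c i)) \<and>
      eventually (\<lambda>x. \<forall>i\<in>B. (\<Sum>j\<in>B. ?G i j x * c j x) = (if i = k then 1 else 0)) (nhds x0)"
  proof
    fix k
    show "\<exists>c. (\<forall>i\<in>B. A (c i)) \<and>
      eventually (\<lambda>x. \<forall>i\<in>B. (\<Sum>j\<in>B. ?G i j x * c j x) = (if i = k then 1 else 0)) (nhds x0)"
      by (rule local_solve[OF B AG inner_commute pos A_const])
  qed
  from choice[OF this] obtain c where c0: "\<forall>k. (\<forall>i\<in>B. A (c k i)) \<and>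
      eventually (\<lambda>x. \<forall>i\<in>B. (\<Sum>j\<in>B. ?G i j x * c k j x) = (if i = k then 1 else 0)) (nhds x0)"
    by (rule exE)
  have c: "A (c k i)" if "i \<in> B" for k i using c0[rule_format, of k] that by simp
  have c': "eventually (\<lambda>x. \<forall>i\<in>B. (\<Sum>j\<in>B. ?G i j x * c k j x) = (if i = k then 1 else 0)) (nhds x0)" for k
    using c0[rule_format, of k] by simp
  show thesis
  proof (rule that[of "\<lambda>k x. \<Sum>j\<in>B. c k j x *\<^sub>R q j x"])
    show "A (\<lambda>x. (\<Sum>j\<in>B. c k j x *\<^sub>R q j x) \<bullet> e)" if "e \<in> Basis" for k e
      unfolding inner_sum_left inner_scaleR_left by (intro A_sum A_mult c Aq that)
    have "eventually (\<lambda>x. \<forall>k\<in>B. \<forall>i\<in>B. (\<Sum>j\<in>B. ?G i j x * c k j x) = (if i = k then 1 else 0)) (nhds x0)"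
      by (rule eventually_ball_finite[OF B]) (simp add: c')
    then show "eventually (\<lambda>x. \<forall>i\<in>B. \<forall>k\<in>B. q i x \<bullet> (\<Sum>j\<in>B. c k j x *\<^sub>R q j x) = (if i = k then 1 else 0)) (nhds x0)"
      by eventually_elim (simp add: inner_sum_right mult.commute)
    show "(\<Sum>j\<in>B. c k j x *\<^sub>R q j x) \<in> span ((\<lambda>j. q j x) ` B)" for k x
      by (intro span_sum span_scale span_base) auto
  qed
qed

end

lemma germ_ring_smooth:
  fixes x0 :: "'a::real_normed_vector"
  shows "germ_ring (\<lambda>f. \<exists>U. open U \<and> x0 \<in> U \<and> smooth_on U f) x0"
proof (unfold_locales, goal_cases)
  case (1 c)
  show ?case using smooth_on_const[OF open_UNIV, of c] by (intro exI[of _ UNIV]) simp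
next
  case (2 f g)
  obtain U where U: "open U" "x0 \<in> U" "smooth_on U f" using 2(1) by (elim exE conjE)
  obtain V where V: "open V" "x0 \<in> V" "smooth_on V g" using 2(2) by (elim exE conjE)
  have W: "open (U \<inter> V)" "x0 \<in> U \<inter> V" using U V by auto
  have "smooth_on (U \<inter> V) (\<lambda>x. f x + g x)"
    by (rule smooth_on_add[OF W(1) smooth_on_subset[OF U(1) W(1) _ U(3)] smooth_on_subset[OF V(1) W(1) _ V(3)]]) simp_all
  with W show ?case by (intro exI[of _ "U \<inter> V"] conjI)
next
  case (3 f g)
  obtain U where U: "open U" "x0 \<in> U" "smooth_on U f" using 3(1) by (elim exE conjE)
  obtain V where V: "open V" "x0 \<in> V" "smooth_on V g" using 3(2) by (elim exE conjE)
  have W: "open (U \<inter> V)" "x0 \<in> U \<inter> V" using U V by auto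
  have "smooth_on (U \<inter> V) (\<lambda>x. f x *\<^sub>R g x)"
    by (rule smooth_on_scaleR[OF W(1) smooth_on_subset[OF U(1) W(1) _ U(3)] smooth_on_subset[OF V(1) W(1) _ V(3)]]) simp_all
  then have "smooth_on (U \<inter> V) (\<lambda>x. f x * g x)" by (simp only: real_scaleR_def)
  with W show ?case by (intro exI[of _ "U \<inter> V"] conjI)
next
  case (4 f)
  obtain U where U: "open U" "x0 \<in> U" "smooth_on U f" using 4(1) by (elim exE conjE)
  have o: "open {x \<in> U. f x \<noteq> 0}"
    using continuous_open_preimage[OF smooth_on_continuous[OF U(3)] U(1) open_Compl[OF closed_singleton[of 0]]]
    by (simp add: vimage_def Int_def)
  have "smooth_on {x \<in> U. f x \<noteq> 0} f" by (rule smooth_on_subset[OF U(1) o _ U(3)]) auto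
  then have "smooth_on {x \<in> U. f x \<noteq> 0} (\<lambda>x. inverse (f x))"
    unfolding smooth_on_def using Ck_on_inverse[OF o, of f] by simp
  with o U(2) 4(2) show ?case by (intro exI[of _ "{x \<in> U. f x \<noteq> 0}"] conjI) simp_all
next
  case (5 f)
  obtain U where U: "open U" "x0 \<in> U" "smooth_on U f" using 5(1) by (elim exE conjE)
  have o: "open {x \<in> U. f x \<noteq> 0}"
    using continuous_open_preimage[OF smooth_on_continuous[OF U(3)] U(1) open_Compl[OF closed_singleton[of 0]]]
    by (simp add: vimage_def Int_def)
  then show ?case unfolding eventually_nhds using 5(2) U(2) by (intro exI[of _ "{x \<in> U. f x \<noteq> 0}"]) auto
qed

lemma smooth_on_local:
  assumes "open S" "\<And>x. x \<in> S \<Longrightarrow> \<exists>U. open U \<and> x \<in> U \<and> smooth_on U f"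
  shows "smooth_on S f"
  unfolding smooth_on_def
proof
  fix k show "Ck_on k S f"
  proof (rule Ck_on_local[OF assms(1)])
    fix x assume "x \<in> S"
    from assms(2)[OF this] obtain U where "open U" "x \<in> U" "smooth_on U f" by (elim exE conjE)
    then show "\<exists>U. open U \<and> x \<in> U \<and> Ck_on k U f" by (intro exI[of _ U] conjI smooth_on_Ck)
  qed
qed

lemma smooth_near_common:
  assumes "finite B" "\<And>i. i \<in> B \<Longrightarrow> \<exists>U. open U \<and> x \<in> U \<and> smooth_on U (f i)"
  shows "\<exists>U. open U \<and> x \<in> U \<and> (\<forall>i\<in>B. smooth_on U (f i))"
  using assms
proof (induction B rule: finite_induct)
  case empty then show ?case by (intro exI[of _ UNIV]) simp
next
  case (insert i B)
  obtain U where U: "open U" "x \<in> U" "\<forall>i\<in>B. smooth_on U (f i)" using insert by auto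
  obtain V where V: "open V" "x \<in> V" "smooth_on V (f i)" using insert.prems[of i] by auto
  have "smooth_on (U \<inter> V) (f j)" if "j \<in> insert i B" for j
  proof (cases "j = i")
    case True
    show ?thesis unfolding True by (rule smooth_on_subset[OF V(1) _ _ V(3)]) (use U V in auto)
  next
    case False
    then have "smooth_on U (f j)" using that U(3) by simp
    then show ?thesis by (rule smooth_on_subset[OF U(1), rotated 2]) (use U V in auto)
  qed
  then show ?case using U V by (intro exI[of _ "U \<inter> V"]) auto
qed

lemma linear_fd_family:
  assumes V: "open V" "x \<in> V" and lin: "\<And>y. y \<in> V \<Longrightarrow> linear (B y)"
    and d: "\<And>v. (\<lambda>y. B y v) differentiable at x"
  shows "linear (\<lambda>v. fd (\<lambda>y. B y v) x u)"
proof (rule linearI)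
  have d': "((\<lambda>y. B y v) has_derivative fd (\<lambda>y. B y v) x) (at x)" for v
    using d by (simp add: frechet_derivative_works[symmetric])
  fix v w
  have "((\<lambda>y. B y (v + w)) has_derivative (\<lambda>h. fd (\<lambda>y. B y v) x h + fd (\<lambda>y. B y w) x h)) (at x)"
    by (rule has_derivative_transform_within_open[OF has_derivative_add[OF d'[of v] d'[of w]] V])
      (simp add: linear_add[OF lin])
  from fd_eqI[OF this] show "fd (\<lambda>y. B y (v + w)) x u = fd (\<lambda>y. B y v) x u + fd (\<lambda>y. B y w) x u" by simp
next
  have d': "((\<lambda>y. B y v) has_derivative fd (\<lambda>y. B y v) x) (at x)" for v
    using d by (simp add: frechet_derivative_works[symmetric])
  fix r v
  have "((\<lambda>y. B y (r *\<^sub>R v)) has_derivative (\<lambda>h. r *\<^sub>R fd (\<lambda>y. B y v) x h)) (at x)"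
    by (rule has_derivative_transform_within_open[OF has_derivative_scaleR_right[OF d'[of v]] V])
      (simp add: linear_scale[OF lin])
  from fd_eqI[OF this] show "fd (\<lambda>y. B y (r *\<^sub>R v)) x u = r *\<^sub>R fd (\<lambda>y. B y v) x u" by simp
qed

text \<open>Product and chain rule for a bilinear map depending on a point.\<close>

lemma has_derivative_bifamily:
  fixes B :: "'y::real_normed_vector \<Rightarrow> 'a::euclidean_space \<Rightarrow> 'b::euclidean_space \<Rightarrow> 'c::real_normed_vector"
    and f :: "'z::real_normed_vector \<Rightarrow> 'y"
  assumes V: "open V" and l1: "\<And>y w. y \<in> V \<Longrightarrow> linear (\<lambda>v. B y v w)" and l2: "\<And>y v. y \<in> V \<Longrightarrow> linear (B y v)"
    and dB: "\<And>y v w. y \<in> V \<Longrightarrow> ((\<lambda>y. B y v w) has_derivative fd (\<lambda>y. B y v w) y) (at y)"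
    and U: "open U" "x \<in> U" "\<And>z. z \<in> U \<Longrightarrow> f z \<in> V"
    and f: "(f has_derivative f') (at x within S)"
    and a: "(a has_derivative a') (at x within S)" and b: "(b has_derivative b') (at x within S)"
  shows "((\<lambda>z. B (f z) (a z) (b z)) has_derivative
     (\<lambda>u. fd (\<lambda>y. B y (a x) (b x)) (f x) (f' u) + B (f x) (a' u) (b x) + B (f x) (a x) (b' u))) (at x within S)"
proof -
  have fx: "f x \<in> V" using U by simp
  have df: "(\<lambda>y. B y v w) differentiable at (f x)" for v w using dB[OF fx] by (rule differentiableI)
  have c: "((\<lambda>z. B (f z) v w) has_derivative (\<lambda>u. fd (\<lambda>y. B y v w) (f x) (f' u))) (at x within S)" for v w
    using has_derivative_compose[OF f dB[OF fx]] .
  have 1: "((\<lambda>z. B (f z) (a z) w) has_derivative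
     (\<lambda>u. fd (\<lambda>y. B y (a x) w) (f x) (f' u) + B (f x) (a' u) w)) (at x within S)" for w
    by (rule has_derivative_family_apply[where B="\<lambda>z v. B (f z) v w" and B'="\<lambda>u v. fd (\<lambda>y. B y v w) (f x) (f' u)", OF U(1,2) _ c a])
      (auto intro: l1 U(3) linear_fd_family[where B="\<lambda>y v. B y v w", OF V fx l1 df])
  have "((\<lambda>z. B (f z) (a z) (b z)) has_derivative
     (\<lambda>u. (fd (\<lambda>y. B y (a x) (b x)) (f x) (f' u) + B (f x) (a' u) (b x)) + B (f x) (a x) (b' u))) (at x within S)"
    by (rule has_derivative_family_apply[where B="\<lambda>z w. B (f z) (a z) w" and
          B'="\<lambda>u w. fd (\<lambda>y. B y (a x) w) (f x) (f' u) + B (f x) (a' u) w", OF U(1,2) _ 1 b])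
      (auto intro!: linear_compose_add l2 U(3) fx linear_fd_family[where B="\<lambda>y w. B y (a x) w", OF V fx l2 df])
  then show ?thesis .
qed


section \<open>Charts of a Riemannian manifold\<close>

locale riemannian =
  fixes M :: "('m::{t2_space, second_countable_topology}, 'a::euclidean_space) metric_atlas"
  assumes riem: "riemannian_manifold M"
begin

abbreviation "cim c \<equiv> chart_map c ` chart_dom c"
abbreviation "ovl c d \<equiv> chart_map c ` (chart_dom c \<inter> chart_dom d)"
abbreviation "trans_map c d \<equiv> chart_map d \<circ> chart_inv c"

lemma atlas_smooth: "smooth_atlas (atlas M)"
  using riem by (simp add: riemannian_manifold_def)

lemma chart_open: assumes "c \<in> atlas M"
  shows "open (chart_dom c)" "open (cim c)"
    and chart_homeo: "homeomorphism (chart_dom c) (cim c) (chart_map c) (chart_inv c)"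
  using atlas_smooth assms by (auto simp: smooth_atlas_def)

lemma chart_at: "chart_at M p \<in> atlas M" "p \<in> chart_dom (chart_at M p)"
proof -
  have "p \<in> (\<Union>c\<in>atlas M. chart_dom c)" using atlas_smooth by (simp add: smooth_atlas_def)
  then have "\<exists>c. c \<in> atlas M \<and> p \<in> chart_dom c" by auto
  from someI_ex[OF this] show "chart_at M p \<in> atlas M" "p \<in> chart_dom (chart_at M p)"
    by (simp_all add: chart_at_def)
qed

lemma chart_inv_map: "c \<in> atlas M \<Longrightarrow> p \<in> chart_dom c \<Longrightarrow> chart_inv c (chart_map c p) = p"
  using chart_homeo[of c] by (simp add: homeomorphism_def)

lemma open_chart_image:
  assumes c: "c \<in> atlas M" and "open T"
  shows "open (chart_map c ` (chart_dom c \<inter> T))"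
  using homeomorphism_imp_open_map[OF chart_homeo[OF c], of "chart_dom c \<inter> T"] chart_open[OF c] assms(2)
  by (simp add: openin_open_eq open_Int)

lemma open_ovl: "c \<in> atlas M \<Longrightarrow> d \<in> atlas M \<Longrightarrow> open (ovl c d)"
  by (rule open_chart_image) (auto intro: chart_open)

lemma trans_smooth: "c \<in> atlas M \<Longrightarrow> d \<in> atlas M \<Longrightarrow> smooth_on (ovl c d) (trans_map c d)"
  using atlas_smooth by (simp add: smooth_atlas_def)

lemma trans_deriv:
  assumes "c \<in> atlas M" "d \<in> atlas M" "p \<in> chart_dom c" "p \<in> chart_dom d"
  shows "(trans_map c d has_derivative coord_change c d p) (at (chart_map c p))"
  unfolding coord_change_def
  by (rule smooth_on_deriv(1)[OF open_ovl trans_smooth]) (use assms in auto)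

lemma cc_linear:
  assumes "c \<in> atlas M" "d \<in> atlas M" "p \<in> chart_dom c" "p \<in> chart_dom d"
  shows "linear (coord_change c d p)"
  using trans_deriv[OF assms] by (rule has_derivative_linear)

text \<open>
  The chain rule, applied to the composition of two coordinate transitions.
\<close>

lemma cc_cocycle:
  assumes c: "c \<in> atlas M" "p \<in> chart_dom c" and d: "d \<in> atlas M" "p \<in> chart_dom d" and e: "e \<in> atlas M" "p \<in> chart_dom e"
  shows "coord_change d e p (coord_change c d p v) = coord_change c e p v"
proof -
  have p: "trans_map c d (chart_map c p) = chart_map d p" using chart_inv_map c by simp
  have "(trans_map d e \<circ> trans_map c d has_derivative coord_change d e p \<circ> coord_change c d p) (at (chart_map c p))"
    by (rule diff_chain_at[OF trans_deriv[OF c(1) d(1) c(2) d(2)]]) (simp only: p trans_deriv[OF d(1) e(1) d(2) e(2)])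
  then have "(trans_map c e has_derivative coord_change d e p \<circ> coord_change c d p) (at (chart_map c p))"
  proof (rule has_derivative_transform_within_open)
    show "open (chart_map c ` (chart_dom c \<inter> (chart_dom d \<inter> chart_dom e)))"
      using open_chart_image[OF c(1)] chart_open d e by (simp add: open_Int)
    show "chart_map c p \<in> chart_map c ` (chart_dom c \<inter> (chart_dom d \<inter> chart_dom e))" using c d e by auto
  next
    fix x assume "x \<in> chart_map c ` (chart_dom c \<inter> (chart_dom d \<inter> chart_dom e))"
    then obtain q where q: "x = chart_map c q" "q \<in> chart_dom c" "q \<in> chart_dom d" by auto
    show "(trans_map d e \<circ> trans_map c d) x = trans_map c e x"
      by (simp add: q(1) chart_inv_map[OF c(1) q(2)] chart_inv_map[OF d(1) q(3)])
  qed
  from has_derivative_unique[OF this trans_deriv[OF c(1) e(1) c(2) e(2)]] show ?thesis by (metis comp_apply)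
qed

lemma cc_id:
  assumes c: "c \<in> atlas M" "p \<in> chart_dom c"
  shows "coord_change c c p v = v"
proof -
  have "x = trans_map c c x" if "x \<in> cim c" for x using that chart_inv_map[OF c(1)] by auto
  then have "(trans_map c c has_derivative (\<lambda>x. x)) (at (chart_map c p))"
    by (rule has_derivative_transform_within_open[OF has_derivative_ident chart_open(2)[OF c(1)], rotated])
      (use c in auto)
  from has_derivative_unique[OF this trans_deriv[OF c(1) c(1) c(2) c(2)]] show ?thesis by metis
qed

lemma cc_inverse:
  assumes "c \<in> atlas M" "p \<in> chart_dom c" and "d \<in> atlas M" "p \<in> chart_dom d"
  shows "coord_change d c p (coord_change c d p v) = v"
  using cc_cocycle[OF assms assms(1,2)] cc_id assms by simp


subsection \<open>The metric in a chart\<close>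

lemma rm: "bilinear (rmetric M p)" "rmetric M p u v = rmetric M p v u" "v \<noteq> 0 \<Longrightarrow> rmetric M p v v > 0"
  using riem by (auto simp: riemannian_manifold_def)

lemma rm_linear: "linear (rmetric M p u)" "linear (\<lambda>v. rmetric M p v u)"
  using rm(1)[of p] by (auto simp: bilinear_def)

lemmas rm_simps = linear_add[OF rm_linear(1)] linear_add[OF rm_linear(2)] linear_scale[OF rm_linear(1)] linear_scale[OF rm_linear(2)]
   linear_0[OF rm_linear(1)] linear_0[OF rm_linear(2)] linear_diff[OF rm_linear(1)] linear_diff[OF rm_linear(2)]
   linear_neg[OF rm_linear(1)] linear_neg[OF rm_linear(2)]

abbreviation "cm \<equiv> chart_metric M"

lemma cm_at:
  assumes "c \<in> atlas M" "p \<in> chart_dom c"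
  shows "cm c (chart_map c p) u v = rmetric M p (coord_change c (chart_at M p) p u) (coord_change c (chart_at M p) p v)"
  using chart_inv_map[OF assms] by (simp add: chart_metric_def Let_def)

lemma cm_change:
  assumes c: "c \<in> atlas M" "p \<in> chart_dom c" and d: "d \<in> atlas M" "p \<in> chart_dom d"
  shows "cm c (chart_map c p) u v = cm d (chart_map d p) (coord_change c d p u) (coord_change c d p v)"
  by (simp only: cm_at[OF c] cm_at[OF d] cc_cocycle[OF c d chart_at])

lemma rm_chart:
  assumes c: "c \<in> atlas M" "p \<in> chart_dom c"
  shows "rmetric M p u v = cm c (chart_map c p) (coord_change (chart_at M p) c p u) (coord_change (chart_at M p) c p v)"
  by (simp only: cm_at[OF c] cc_inverse[OF chart_at c])

lemma cm_sym: "cm c x u v = cm c x v u"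
  by (simp add: chart_metric_def Let_def rm(2))

lemma cm_linear:
  assumes c: "c \<in> atlas M" and x: "x \<in> cim c"
  shows "linear (cm c x u)" "linear (\<lambda>v. cm c x v u)"
proof -
  obtain p where p: "p \<in> chart_dom c" "x = chart_map c p" using x by auto
  have "linear (rmetric M p (coord_change c (chart_at M p) p u) \<circ> coord_change c (chart_at M p) p)"
    by (intro linear_compose rm_linear cc_linear c chart_at p)
  then show *: "linear (cm c x u)" unfolding p(2) cm_at[OF c p(1)] o_def .
  then show "linear (\<lambda>v. cm c x v u)" by (simp add: cm_sym[of c x _ u])
qed

lemma cm_pos:
  assumes c: "c \<in> atlas M" and x: "x \<in> cim c" and "v \<noteq> 0"
  shows "cm c x v v > 0"
proof -
  obtain p where p: "p \<in> chart_dom c" "x = chart_map c p" using x by auto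
  have "coord_change c (chart_at M p) p v \<noteq> 0"
    using cc_inverse[OF c p(1) chart_at, of v] linear_0[OF cc_linear[OF chart_at(1) c chart_at(2) p(1)]] assms(3) by metis
  then show ?thesis unfolding p(2) cm_at[OF c p(1)] by (rule rm(3))
qed

lemma cm_eqI:
  assumes c: "c \<in> atlas M" and x: "x \<in> cim c" and "\<And>z. cm c x v z = cm c x w z"
  shows "v = w"
proof (rule ccontr)
  assume "v \<noteq> w"
  then have "cm c x (v - w) (v - w) > 0" by (intro cm_pos[OF c x]) simp
  then show False using assms(3)[of "v - w"] by (simp add: linear_diff[OF cm_linear(2)[OF c x]])
qed

lemma cm_smooth: "c \<in> atlas M \<Longrightarrow> smooth_on (cim c) (\<lambda>x. cm c x u v)"
  using riem by (simp add: riemannian_manifold_def)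

text \<open>
  The derivative of the metric coefficients, with the direction of differentiation as first vector.
\<close>

definition Dm :: "('m, 'a) chart \<Rightarrow> 'a \<Rightarrow> 'a \<Rightarrow> 'a \<Rightarrow> 'a \<Rightarrow> real" where
  "Dm c x u v w = fd (\<lambda>y. cm c y v w) x u"

lemma cm_deriv: "c \<in> atlas M \<Longrightarrow> x \<in> cim c \<Longrightarrow> ((\<lambda>y. cm c y v w) has_derivative (\<lambda>u. Dm c x u v w)) (at x)"
  unfolding Dm_def by (rule smooth_on_deriv(1)[OF chart_open(2) cm_smooth])

lemma Dm_sym: fixes c x u v w shows "Dm c x u v w = Dm c x u w v"
proof -
  have "(\<lambda>y. cm c y v w) = (\<lambda>y. cm c y w v)" by (rule ext) (rule cm_sym)
  then show ?thesis unfolding Dm_def by (rule arg_cong)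
qed

lemma Dm_linear:
  assumes "c \<in> atlas M" "x \<in> cim c"
  shows "linear (\<lambda>u. Dm c x u v w)" "linear (\<lambda>v. Dm c x u v w)" "linear (Dm c x u v)"
proof -
  show "linear (\<lambda>u. Dm c x u v w)" by (rule has_derivative_linear[OF cm_deriv[OF assms]])
  show "linear (\<lambda>v. Dm c x u v w)"
    unfolding Dm_def by (rule linear_fd_family[OF chart_open(2)[OF assms(1)] assms(2) cm_linear(2)[OF assms(1)] differentiableI[OF cm_deriv[OF assms]]])
  have "linear (\<lambda>w. Dm c x u v w)"
    unfolding Dm_def by (rule linear_fd_family[OF chart_open(2)[OF assms(1)] assms(2) cm_linear(1)[OF assms(1)] differentiableI[OF cm_deriv[OF assms]]])
  then show "linear (Dm c x u v)" .
qed

lemma cm_bideriv: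
  assumes c: "c \<in> atlas M" and U: "open U" "x \<in> U" "\<And>z. z \<in> U \<Longrightarrow> f z \<in> cim c"
    and f: "(f has_derivative f') (at x within S)"
    and a: "(a has_derivative a') (at x within S)" and b: "(b has_derivative b') (at x within S)"
  shows "((\<lambda>z. cm c (f z) (a z) (b z)) has_derivative
     (\<lambda>u. Dm c (f x) (f' u) (a x) (b x) + cm c (f x) (a' u) (b x) + cm c (f x) (a x) (b' u))) (at x within S)"
  unfolding Dm_def
  by (rule has_derivative_bifamily[where B="cm c", OF chart_open(2)[OF c] cm_linear(2)[OF c] cm_linear(1)[OF c] cm_deriv[OF c, unfolded Dm_def] U f a b])


subsection \<open>The Christoffel symbols\<close>

definition "koszul c x u v z = (Dm c x u v z + Dm c x v u z - Dm c x z u v) / 2"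
abbreviation "\<Gamma> \<equiv> christoffel M"

lemma koszul_linear:
  assumes "c \<in> atlas M" "x \<in> cim c"
  shows "linear (koszul c x u v)"
proof (rule linearI)
  fix z w
  show "koszul c x u v (z + w) = koszul c x u v z + koszul c x u v w"
    unfolding koszul_def linear_add[OF Dm_linear(1)[OF assms]] linear_add[OF Dm_linear(3)[OF assms]] by (simp add: field_simps)
  fix r
  show "koszul c x u v (r *\<^sub>R z) = r *\<^sub>R koszul c x u v z"
    unfolding koszul_def linear_scale[OF Dm_linear(1)[OF assms]] linear_scale[OF Dm_linear(3)[OF assms]] by (simp add: field_simps)
qed

lemma koszul_smooth:
  fixes u v z
  assumes c: "c \<in> atlas M"
  shows "smooth_on (cim c) (\<lambda>x. koszul c x u v z)"
proof -
  note o = chart_open(2)[OF c]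
  have D: "smooth_on (cim c) (\<lambda>x. Dm c x u v w)" for u v w unfolding Dm_def by (rule smooth_on_deriv(2)[OF o cm_smooth[OF c]])
  have "smooth_on (cim c) (\<lambda>x. (1/2) *\<^sub>R ((Dm c x u v z + Dm c x v u z) + (-1) *\<^sub>R Dm c x z u v))"
    by (intro smooth_on_scaleR[OF o] smooth_on_add[OF o] smooth_on_const[OF o] D)
  then show ?thesis by (simp add: koszul_def)
qed

text \<open>
  The metric is positive definite, so that the linear system for the coefficients of the vector dual to Koszul's
  formula can be solved with smooth dependence on the point.
\<close>

lemma christoffel_local:
  assumes c: "c \<in> atlas M" and x0: "x0 \<in> cim c"
  shows "\<exists>U w. open U \<and> x0 \<in> U \<and> U \<subseteq> cim c \<and> smooth_on U w \<and> (\<forall>y\<in>U. \<forall>z. cm c y (w y) z = koszul c y u v z)"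
proof -
  interpret germ_ring "\<lambda>f. \<exists>U. open U \<and> x0 \<in> U \<and> smooth_on U f" x0 by (rule germ_ring_smooth)
  have near: "\<exists>U. open U \<and> x0 \<in> U \<and> smooth_on U f" if "smooth_on (cim c) f" for f :: "'a \<Rightarrow> real"
    using that x0 chart_open(2)[OF c] by (intro exI[of _ "cim c"]) simp
  have pos: "(\<Sum>i\<in>Basis. \<Sum>j\<in>Basis. a i * cm c x0 i j * a j) > 0" if "\<exists>i\<in>Basis. a i \<noteq> 0" for a :: "'a \<Rightarrow> real"
  proof -
    let ?v = "\<Sum>i\<in>Basis. a i *\<^sub>R i"
    have "(\<Sum>i\<in>Basis. \<Sum>j\<in>Basis. a i * cm c x0 i j * a j) = cm c x0 ?v ?v"
      unfolding linear_sum[OF cm_linear(1)[OF c x0]] linear_sum[OF cm_linear(2)[OF c x0]]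
        linear_scale[OF cm_linear(1)[OF c x0]] linear_scale[OF cm_linear(2)[OF c x0]]
      by (subst sum.swap) (simp add: sum_distrib_left mult_ac)
    moreover have "?v \<noteq> 0"
    proof
      assume "?v = 0"
      then have "?v \<bullet> i = 0" for i by simp
      then have "a i = 0" if "i \<in> Basis" for i using that by (metis inner_sum_left_Basis)
      then show False using that by auto
    qed
    ultimately show ?thesis using cm_pos[OF c x0] by simp
  qed
  obtain a where a: "\<forall>i\<in>Basis. \<exists>U. open U \<and> x0 \<in> U \<and> smooth_on U (a i)"
    and ev: "eventually (\<lambda>x. \<forall>i\<in>Basis. (\<Sum>j\<in>Basis. cm c x i j * a j x) = koszul c x u v i) (nhds x0)"
  proof -
    have "\<exists>a. (\<forall>i\<in>Basis. \<exists>U. open U \<and> x0 \<in> U \<and> smooth_on U (a i)) \<and>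
       eventually (\<lambda>x. \<forall>i\<in>Basis. (\<Sum>j\<in>Basis. cm c x i j * a j x) = koszul c x u v i) (nhds x0)"
    proof (rule local_solve[OF finite_Basis])
      show "\<exists>U. open U \<and> x0 \<in> U \<and> smooth_on U (\<lambda>x. cm c x i j)" for i j by (rule near[OF cm_smooth[OF c]])
      show "\<exists>U. open U \<and> x0 \<in> U \<and> smooth_on U (\<lambda>x. koszul c x u v i)" for i by (rule near[OF koszul_smooth[OF c]])
      show "cm c x i j = cm c x j i" for i j x by (rule cm_sym)
      show "0 < (\<Sum>i\<in>Basis. \<Sum>j\<in>Basis. a i * cm c x0 i j * a j)" if "\<exists>i\<in>Basis. a i \<noteq> 0" for a :: "'a \<Rightarrow> real"
        by (rule pos[OF that])
    qed
    then show thesis using that by (elim exE conjE)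
  qed
  obtain U where U: "open U" "x0 \<in> U" "\<forall>i\<in>Basis. smooth_on U (a i)"
  proof -
    have "\<exists>U. open U \<and> x0 \<in> U \<and> (\<forall>i\<in>Basis. smooth_on U (a i))"
      by (rule smooth_near_common[OF finite_Basis]) (rule a[rule_format])
    then show thesis using that by (elim exE conjE)
  qed
  obtain T where T: "open T" "x0 \<in> T" "\<forall>x\<in>T. \<forall>i\<in>Basis. (\<Sum>j\<in>Basis. cm c x i j * a j x) = koszul c x u v i"
    using ev unfolding eventually_nhds by (elim exE conjE)
  let ?U = "U \<inter> T \<inter> cim c"
  let ?w = "\<lambda>x. \<Sum>b\<in>Basis. a b x *\<^sub>R b"
  have o: "open ?U" using U T chart_open(2)[OF c] by auto
  have "smooth_on ?U (\<lambda>x. a b x *\<^sub>R b)" if "b \<in> Basis" for b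
    by (rule smooth_on_scaleR[OF o smooth_on_subset[OF U(1) o _ U(3)[rule_format, OF that]] smooth_on_const[OF o]]) auto
  then have sm: "smooth_on ?U ?w" by (rule smooth_on_sum[OF o])
  have "cm c y (?w y) z = koszul c y u v z" if y: "y \<in> ?U" for y z
  proof -
    have yc: "y \<in> cim c" and yT: "y \<in> T" using y by auto
    have *: "cm c y (?w y) i = koszul c y u v i" if "i \<in> Basis" for i
      using T(3)[rule_format, OF yT that]
      by (simp add: linear_sum[OF cm_linear(2)[OF c yc]] linear_scale[OF cm_linear(2)[OF c yc]] cm_sym[of c y i] mult.commute)
    have "cm c y (?w y) z = (\<Sum>i\<in>Basis. (z \<bullet> i) *\<^sub>R cm c y (?w y) i)"
      by (rule linear_basis_expand[OF cm_linear(1)[OF c yc]])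
    also have "\<dots> = (\<Sum>i\<in>Basis. (z \<bullet> i) *\<^sub>R koszul c y u v i)" by (intro sum.cong refl) (simp only: *)
    also have "\<dots> = koszul c y u v z" by (rule linear_basis_expand[OF koszul_linear[OF c yc], symmetric])
    finally show ?thesis .
  qed
  then have eq: "\<forall>y\<in>?U. \<forall>z. cm c y (?w y) z = koszul c y u v z" by (intro ballI allI)
  have "x0 \<in> ?U" "?U \<subseteq> cim c" using U(2) T(2) x0 by auto
  then show ?thesis by (intro exI[of _ ?U] exI[of _ ?w] conjI o sm eq)
qed

lemma christoffel_eqI:
  assumes c: "c \<in> atlas M" and x: "x \<in> cim c" and w: "\<And>z. cm c x w z = koszul c x u v z"
  shows "\<Gamma> c x u v = w"
  unfolding christoffel_def Dm_def[symmetric] koszul_def[symmetric]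
proof (rule the_equality)
  show "\<forall>z. cm c x w z = koszul c x u v z" using w by simp
  fix w' assume "\<forall>z. cm c x w' z = koszul c x u v z"
  then show "w' = w" by (intro cm_eqI[OF c x]) (simp only: w)
qed

lemma christoffel_koszul:
  assumes c: "c \<in> atlas M" and x: "x \<in> cim c"
  shows "cm c x (\<Gamma> c x u v) z = koszul c x u v z"
proof -
  obtain U w where "x \<in> U" and w: "\<forall>y\<in>U. \<forall>z. cm c y (w y) z = koszul c y u v z"
    using christoffel_local[OF assms, where u=u and v=v] by (elim exE conjE)
  then have k: "cm c x (w x) z = koszul c x u v z" for z by simp
  have "\<Gamma> c x u v = w x" by (rule christoffel_eqI[OF c x]) (rule k)
  then show ?thesis using k[of z] by (rule back_subst[of "\<lambda>w. cm c x w z = koszul c x u v z", rotated, OF sym])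
qed

lemma christoffel_smooth:
  assumes c: "c \<in> atlas M"
  shows "smooth_on (cim c) (\<lambda>x. \<Gamma> c x u v)"
proof (rule smooth_on_local[OF chart_open(2)[OF c]])
  fix x assume x: "x \<in> cim c"
  obtain U w where U: "open U" "x \<in> U" "U \<subseteq> cim c" "smooth_on U w"
    and w: "\<forall>y\<in>U. \<forall>z. cm c y (w y) z = koszul c y u v z"
    using christoffel_local[OF c x, where u=u and v=v] by (elim exE conjE)
  have "w y = \<Gamma> c y u v" if "y \<in> U" for y
    by (rule christoffel_eqI[symmetric, OF c]) (use that U(3) w in auto)
  from smooth_on_cong[OF U(1) this U(4)] show "\<exists>U. open U \<and> x \<in> U \<and> smooth_on U (\<lambda>x. \<Gamma> c x u v)"
    using U(1,2) by (intro exI[of _ U] conjI)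
qed

lemma christoffel_sym: "\<Gamma> c x u v = \<Gamma> c x v u"
  unfolding christoffel_def unfolding Dm_def[symmetric] by (simp only: Dm_sym[of c x _ u v] add.commute[of "Dm c x u v _"])

lemma christoffel_linear:
  assumes c: "c \<in> atlas M" and x: "x \<in> cim c"
  shows "linear (\<Gamma> c x u)" "linear (\<lambda>v. \<Gamma> c x v u)"
proof -
  note k = christoffel_koszul[OF assms]
  have id: "(a + b - d) / 2 + (a' + b' - d') / 2 = (a + a' + (b + b') - (d + d')) / 2" for a b d a' b' d' :: real
    by (simp add: field_simps)
  have id2: "r * ((a + b - d) / 2) = (r * a + r * b - r * d) / 2" for r a b d :: real
    by (simp add: field_simps)
  show *: "linear (\<Gamma> c x u)"
  proof (rule linearI)
    fix v w
    show "\<Gamma> c x u (v + w) = \<Gamma> c x u v + \<Gamma> c x u w"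
      by (rule christoffel_eqI[OF assms])
        (unfold koszul_def linear_add[OF cm_linear(2)[OF assms]] linear_add[OF Dm_linear(1)[OF assms]]
          linear_add[OF Dm_linear(2)[OF assms]] linear_add[OF Dm_linear(3)[OF assms]] k[unfolded koszul_def], rule id)
    fix r
    show "\<Gamma> c x u (r *\<^sub>R v) = r *\<^sub>R \<Gamma> c x u v"
      by (rule christoffel_eqI[OF assms])
        (unfold koszul_def linear_scale[OF cm_linear(2)[OF assms]] linear_scale[OF Dm_linear(1)[OF assms]]
          linear_scale[OF Dm_linear(2)[OF assms]] linear_scale[OF Dm_linear(3)[OF assms]] k[unfolded koszul_def]
          real_scaleR_def, rule id2)
  qed
  have "(\<lambda>v. \<Gamma> c x v u) = \<Gamma> c x u" by (rule ext) (rule christoffel_sym)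
  with * show "linear (\<lambda>v. \<Gamma> c x v u)" by (simp only:)
qed

text \<open>
  Adding the Koszul formulas for \<open>\<Gamma>(u, v)\<close> against \<open>w\<close> and \<open>\<Gamma>(u, w)\<close> against \<open>v\<close> cancels the other derivatives.
\<close>

lemma metric_compatible:
  assumes c: "c \<in> atlas M" and x: "x \<in> cim c"
  shows "Dm c x u v w = cm c x (\<Gamma> c x u v) w + cm c x v (\<Gamma> c x u w)"
proof -
  have id: "a' = a \<Longrightarrow> a = (a + b - d) / 2 + (a' + d - b) / 2" for a a' b d :: real by (simp add: field_simps)
  show ?thesis
    unfolding cm_sym[of c x v "\<Gamma> c x u w"] christoffel_koszul[OF assms] koszul_def by (rule id[OF Dm_sym])
qed

end

context riemannian
begin

subsection \<open>Change of charts\<close>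

text \<open>
  The second derivative of a coordinate transition: the inhomogeneous term in the transformation of the
  Christoffel symbols.
\<close>

definition hess :: "('m, 'a) chart \<Rightarrow> ('m, 'a) chart \<Rightarrow> 'a \<Rightarrow> 'a \<Rightarrow> 'a \<Rightarrow> 'a" where
  "hess c d x u v = fd (\<lambda>y. fd (trans_map c d) y v) x u"

lemma fd_trans_deriv:
  assumes "c \<in> atlas M" "d \<in> atlas M" "x \<in> ovl c d"
  shows "((\<lambda>y. fd (trans_map c d) y v) has_derivative (\<lambda>u. hess c d x u v)) (at x)"
  unfolding hess_def
  by (rule smooth_on_deriv(1)[OF open_ovl[OF assms(1,2)] smooth_on_deriv(2)[OF open_ovl[OF assms(1,2)] trans_smooth[OF assms(1,2)]] assms(3)])

lemma fd_trans_linear: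
  assumes "c \<in> atlas M" "d \<in> atlas M" "x \<in> ovl c d"
  shows "linear (fd (trans_map c d) x)"
  by (rule has_derivative_linear[OF smooth_on_deriv(1)[OF open_ovl[OF assms(1,2)] trans_smooth[OF assms(1,2)] assms(3)]])

lemma hess_sym:
  assumes "c \<in> atlas M" "d \<in> atlas M" "x \<in> ovl c d"
  shows "hess c d x u v = hess c d x v u"
  unfolding hess_def by (rule second_derivative_symmetric[OF open_ovl[OF assms(1,2)] trans_smooth[OF assms(1,2)] assms(3)])

lemma hess_linear:
  assumes "c \<in> atlas M" "d \<in> atlas M" "x \<in> ovl c d"
  shows "linear (\<lambda>u. hess c d x u v)" "linear (hess c d x u)"
proof -
  show 1: "linear (\<lambda>u. hess c d x u v)" for v by (rule has_derivative_linear[OF fd_trans_deriv[OF assms]])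
  have "hess c d x u = (\<lambda>v. hess c d x v u)" by (rule ext) (rule hess_sym[OF assms])
  then show "linear (hess c d x u)" using 1 by simp
qed

lemma coord_change_fd: "coord_change c d p = fd (trans_map c d) (chart_map c p)"
  by (simp add: coord_change_def)

lemma ovl_trans:
  assumes "c \<in> atlas M" "y \<in> ovl c d"
  shows "trans_map c d y \<in> cim d" "y \<in> cim c"
  using assms chart_inv_map[OF assms(1)] by auto

lemma cm_change': 
  assumes c: "c \<in> atlas M" and d: "d \<in> atlas M" and y: "y \<in> ovl c d"
  shows "cm c y u v = cm d (trans_map c d y) (fd (trans_map c d) y u) (fd (trans_map c d) y v)"
proof -
  obtain p where p: "p \<in> chart_dom c" "p \<in> chart_dom d" "y = chart_map c p" using y by auto
  show ?thesis using cm_change[OF c p(1) d p(2)] by (simp add: p(3) coord_change_fd chart_inv_map[OF c p(1)])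
qed

lemma Dm_change:
  assumes c: "c \<in> atlas M" and d: "d \<in> atlas M" and x: "x \<in> ovl c d"
  defines "\<phi> \<equiv> fd (trans_map c d) x"
  shows "Dm c x u v z = Dm d (trans_map c d x) (\<phi> u) (\<phi> v) (\<phi> z)
    + cm d (trans_map c d x) (hess c d x u v) (\<phi> z) + cm d (trans_map c d x) (\<phi> v) (hess c d x u z)"
proof -
  let ?f = "trans_map c d"
  have "((\<lambda>y. cm d (?f y) (fd ?f y v) (fd ?f y z)) has_derivative
      (\<lambda>u. Dm d (?f x) (\<phi> u) (fd ?f x v) (fd ?f x z) + cm d (?f x) (hess c d x u v) (fd ?f x z) + cm d (?f x) (fd ?f x v) (hess c d x u z))) (at x)"
    by (rule cm_bideriv[OF d open_ovl[OF c d] x ovl_trans(1)[OF c]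
          smooth_on_deriv(1)[OF open_ovl[OF c d] trans_smooth[OF c d] x, folded \<phi>_def]
           fd_trans_deriv[OF c d x] fd_trans_deriv[OF c d x]])
  then have "((\<lambda>y. cm c y v z) has_derivative
      (\<lambda>u. Dm d (?f x) (\<phi> u) (fd ?f x v) (fd ?f x z) + cm d (?f x) (hess c d x u v) (fd ?f x z) + cm d (?f x) (fd ?f x v) (hess c d x u z))) (at x)"
    by (rule has_derivative_transform_within_open[OF _ open_ovl[OF c d] x]) (rule cm_change'[OF c d, symmetric])
  from fun_cong[OF has_derivative_unique[OF this cm_deriv[OF c ovl_trans(2)[OF c x]]], of u]
  show ?thesis by (simp add: \<phi>_def)
qed

text \<open>
  The transformed vector satisfies Koszul's formula in the other chart, because the derivative of the pulled back
  metric produces the second derivatives of the transition, and those are symmetric.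
\<close>

lemma christoffel_change:
  assumes c: "c \<in> atlas M" and d: "d \<in> atlas M" and x: "x \<in> ovl c d"
  defines "\<phi> \<equiv> fd (trans_map c d) x"
  shows "\<phi> (\<Gamma> c x u v) = \<Gamma> d (trans_map c d x) (\<phi> u) (\<phi> v) + hess c d x u v"
proof -
  let ?y = "trans_map c d x"
  obtain p where p: "p \<in> chart_dom c" "p \<in> chart_dom d" "x = chart_map c p" using x by auto
  have xc: "x \<in> cim c" and yd: "?y \<in> cim d" using ovl_trans[OF c x] by auto
  have \<phi>: "\<phi> = coord_change c d p" by (simp add: \<phi>_def coord_change_fd p(3))
  have inv: "\<phi> (coord_change d c p w) = w" for w unfolding \<phi> by (rule cc_inverse[OF d p(2) c p(1)])
  define r where "r = \<Gamma> d ?y (\<phi> u) (\<phi> v) + hess c d x u v"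
  have "\<Gamma> c x u v = coord_change d c p r"
  proof (rule christoffel_eqI[OF c xc])
    fix z
    have "cm c x (coord_change d c p r) z = cm d ?y r (\<phi> z)"
      using cm_change'[OF c d x, of "coord_change d c p r" z] by (simp only: \<phi>_def[symmetric] inv)
    also have "\<dots> = koszul d ?y (\<phi> u) (\<phi> v) (\<phi> z) + cm d ?y (hess c d x u v) (\<phi> z)"
      by (simp only: r_def linear_add[OF cm_linear(2)[OF d yd]] christoffel_koszul[OF d yd])
    also have "\<dots> = koszul c x u v z"
      unfolding koszul_def Dm_change[OF c d x, folded \<phi>_def]
        hess_sym[OF c d x, of z v] hess_sym[OF c d x, of z u] hess_sym[OF c d x, of v u]
        cm_sym[of d ?y "\<phi> u" "hess c d x v z"] cm_sym[of d ?y "\<phi> v" "hess c d x u z"]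
      by (simp add: field_simps cm_sym)
    finally show "cm c x (coord_change d c p r) z = koszul c x u v z" .
  qed
  then show ?thesis by (simp only: inv r_def)
qed


subsection \<open>Curvature\<close>

definition D\<Gamma> :: "('m, 'a) chart \<Rightarrow> 'a \<Rightarrow> 'a \<Rightarrow> 'a \<Rightarrow> 'a \<Rightarrow> 'a" where
  "D\<Gamma> c x u v w = fd (\<lambda>y. \<Gamma> c y v w) x u"

text \<open>
  The curvature in a chart, expanded into derivatives and products of Christoffel symbols.
\<close>

definition Rc :: "('m, 'a) chart \<Rightarrow> 'a \<Rightarrow> 'a \<Rightarrow> 'a \<Rightarrow> 'a \<Rightarrow> 'a" where
  "Rc c x u v w = D\<Gamma> c x u v w - D\<Gamma> c x v u w + \<Gamma> c x u (\<Gamma> c x v w) - \<Gamma> c x v (\<Gamma> c x u w)"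

lemma curvature_Rc: "curvature M p u v w = Rc (chart_at M p) (chart_map (chart_at M p) p) u v w"
proof -
  have "nabla M c (\<lambda>_. v) (\<lambda>_. w) = (\<lambda>y. \<Gamma> c y v w)" for c v w
    by (rule ext) (simp add: nabla_def)
  then show ?thesis by (simp add: curvature_def Let_def Rc_def D\<Gamma>_def) (simp add: nabla_def)
qed

lemma \<Gamma>_deriv: "c \<in> atlas M \<Longrightarrow> x \<in> cim c \<Longrightarrow> ((\<lambda>y. \<Gamma> c y v w) has_derivative (\<lambda>u. D\<Gamma> c x u v w)) (at x)"
  unfolding D\<Gamma>_def by (rule smooth_on_deriv(1)[OF chart_open(2) christoffel_smooth])

lemma \<Gamma>_bideriv:
  assumes c: "c \<in> atlas M" and U: "open U" "x \<in> U" "\<And>z. z \<in> U \<Longrightarrow> f z \<in> cim c"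
    and f: "(f has_derivative f') (at x within S)"
    and a: "(a has_derivative a') (at x within S)" and b: "(b has_derivative b') (at x within S)"
  shows "((\<lambda>z. \<Gamma> c (f z) (a z) (b z)) has_derivative
     (\<lambda>u. D\<Gamma> c (f x) (f' u) (a x) (b x) + \<Gamma> c (f x) (a' u) (b x) + \<Gamma> c (f x) (a x) (b' u))) (at x within S)"
  unfolding D\<Gamma>_def
  by (rule has_derivative_bifamily[where B="\<Gamma> c", OF chart_open(2)[OF c] christoffel_linear(2)[OF c] christoffel_linear(1)[OF c] \<Gamma>_deriv[OF c, unfolded D\<Gamma>_def] U f a b])

lemma D\<Gamma>_linear:
  assumes "c \<in> atlas M" "x \<in> cim c"
  shows "linear (\<lambda>u. D\<Gamma> c x u v w)" "linear (\<lambda>v. D\<Gamma> c x u v w)" "linear (\<lambda>w. D\<Gamma> c x u v w)"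
proof -
  show "linear (\<lambda>u. D\<Gamma> c x u v w)" by (rule has_derivative_linear[OF \<Gamma>_deriv[OF assms]])
  show "linear (\<lambda>v. D\<Gamma> c x u v w)" unfolding D\<Gamma>_def
    by (rule linear_fd_family[OF chart_open(2)[OF assms(1)] assms(2) christoffel_linear(2)[OF assms(1)] differentiableI[OF \<Gamma>_deriv[OF assms]]])
  show "linear (\<lambda>w. D\<Gamma> c x u v w)" unfolding D\<Gamma>_def
    by (rule linear_fd_family[OF chart_open(2)[OF assms(1)] assms(2) christoffel_linear(1)[OF assms(1)] differentiableI[OF \<Gamma>_deriv[OF assms]]])
qed

lemma Rc_linear:
  assumes "c \<in> atlas M" "x \<in> cim c"
  shows "linear (\<lambda>u. Rc c x u v w)" "linear (\<lambda>v. Rc c x u v w)" "linear (\<lambda>w. Rc c x u v w)"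
proof -
  note a = linear_add[OF D\<Gamma>_linear(1)[OF assms]] linear_add[OF D\<Gamma>_linear(2)[OF assms]] linear_add[OF D\<Gamma>_linear(3)[OF assms]]
    linear_add[OF christoffel_linear(1)[OF assms]] linear_add[OF christoffel_linear(2)[OF assms]]
  note s = linear_scale[OF D\<Gamma>_linear(1)[OF assms]] linear_scale[OF D\<Gamma>_linear(2)[OF assms]] linear_scale[OF D\<Gamma>_linear(3)[OF assms]]
    linear_scale[OF christoffel_linear(1)[OF assms]] linear_scale[OF christoffel_linear(2)[OF assms]]
  show "linear (\<lambda>u. Rc c x u v w)"  "linear (\<lambda>v. Rc c x u v w)" "linear (\<lambda>w. Rc c x u v w)"
    by (rule linearI; simp add: Rc_def a s algebra_simps)+
qed

lemma Rc_antisym: "Rc c x u v w = - Rc c x v u w"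
  by (simp add: Rc_def)

lemma Rc_smooth:
  assumes c: "c \<in> atlas M"
  shows "smooth_on (cim c) (\<lambda>x. Rc c x u v w)"
proof -
  note o = chart_open(2)[OF c]
  have D: "smooth_on (cim c) (\<lambda>x. D\<Gamma> c x u v w)" for u v w
    unfolding D\<Gamma>_def by (rule smooth_on_deriv(2)[OF o christoffel_smooth[OF c]])
  have G: "smooth_on (cim c) (\<lambda>x. \<Gamma> c x u (\<Gamma> c x v w))" for u v w
    by (rule smooth_on_family_apply[OF o christoffel_linear(1)[OF c] christoffel_smooth[OF c] christoffel_smooth[OF c]])
  have "smooth_on (cim c) (\<lambda>x. (D\<Gamma> c x u v w + (-1) *\<^sub>R D\<Gamma> c x v u w) + (\<Gamma> c x u (\<Gamma> c x v w) + (-1) *\<^sub>R \<Gamma> c x v (\<Gamma> c x u w)))"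
    by (intro smooth_on_scaleR[OF o] smooth_on_add[OF o] smooth_on_const[OF o] D G)
  then show ?thesis by (simp add: Rc_def algebra_simps)
qed

lemma Dm_deriv2:
  assumes c: "c \<in> atlas M" and x: "x \<in> cim c"
  shows "fd (\<lambda>y. Dm c y v w z) x u =
    cm c x (\<Gamma> c x u (\<Gamma> c x v w)) z + cm c x (\<Gamma> c x v w) (\<Gamma> c x u z) + cm c x (D\<Gamma> c x u v w) z
  + (cm c x (\<Gamma> c x u w) (\<Gamma> c x v z) + cm c x w (\<Gamma> c x u (\<Gamma> c x v z)) + cm c x w (D\<Gamma> c x u v z))"
proof -
  note o = chart_open(2)[OF c]
  have 1: "((\<lambda>y. cm c y (\<Gamma> c y v w) z) has_derivative
      (\<lambda>u. Dm c x u (\<Gamma> c x v w) z + cm c x (D\<Gamma> c x u v w) z + cm c x (\<Gamma> c x v w) 0)) (at x)" for w z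
    by (rule cm_bideriv[OF c o x _ has_derivative_ident \<Gamma>_deriv[OF c x] has_derivative_const])
  have "((\<lambda>y. cm c y (\<Gamma> c y v w) z + cm c y (\<Gamma> c y v z) w) has_derivative
      (\<lambda>u. (Dm c x u (\<Gamma> c x v w) z + cm c x (D\<Gamma> c x u v w) z + cm c x (\<Gamma> c x v w) 0) +
       (Dm c x u (\<Gamma> c x v z) w + cm c x (D\<Gamma> c x u v z) w + cm c x (\<Gamma> c x v z) 0))) (at x)"
    by (rule has_derivative_add[OF 1 1])
  then have "((\<lambda>y. Dm c y v w z) has_derivative
      (\<lambda>u. (Dm c x u (\<Gamma> c x v w) z + cm c x (D\<Gamma> c x u v w) z + cm c x (\<Gamma> c x v w) 0) +
       (Dm c x u (\<Gamma> c x v z) w + cm c x (D\<Gamma> c x u v z) w + cm c x (\<Gamma> c x v z) 0))) (at x)"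
    by (rule has_derivative_transform_within_open[OF _ o x]) (simp only: metric_compatible[OF c] cm_sym[of c _ w])
  from fun_cong[OF fd_eqI[OF this], of u] show ?thesis
    by (simp add: metric_compatible[OF c x] linear_0[OF cm_linear(1)[OF c x]] linear_0[OF cm_linear(2)[OF c x]] cm_sym)
qed

text \<open>
  Differentiating metric compatibility once more expresses the second derivatives of the metric through the
  Christoffel symbols; their symmetry in the two directions of differentiation is the assertion.
\<close>

lemma Rc_skew:
  assumes c: "c \<in> atlas M" and x: "x \<in> cim c"
  shows "cm c x (Rc c x u v w) z = - cm c x w (Rc c x u v z)"
proof -
  note o = chart_open(2)[OF c]
  have "fd (\<lambda>y. Dm c y v w z) x u = fd (\<lambda>y. Dm c y u w z) x v"
    unfolding Dm_def by (rule second_derivative_symmetric[OF o cm_smooth[OF c] x])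
  note * = this[unfolded Dm_deriv2[OF c x]]
  show ?thesis
    unfolding Rc_def linear_add[OF cm_linear(1)[OF c x]] linear_add[OF cm_linear(2)[OF c x]]
      linear_diff[OF cm_linear(1)[OF c x]] linear_diff[OF cm_linear(2)[OF c x]]
    using * by (simp add: algebra_simps)
qed

text \<open>
  Differentiate the transformation law of the Christoffel symbols and antisymmetrise: the third derivatives of the
  transition cancel. The curvature is used along curves that leave any single chart, so that its continuity depends
  on this invariance.
\<close>

lemma Rc_change:
  assumes c: "c \<in> atlas M" and d: "d \<in> atlas M" and x: "x \<in> ovl c d"
  defines "\<phi> \<equiv> fd (trans_map c d) x"
  shows "\<phi> (Rc c x u v w) = Rc d (trans_map c d x) (\<phi> u) (\<phi> v) (\<phi> w)"
proof -
  let ?f = "trans_map c d"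
  let ?y = "?f x"
  note o = open_ovl[OF c d]
  have xc: "x \<in> cim c" and yd: "?y \<in> cim d" using ovl_trans[OF c x] by auto
  note df = smooth_on_deriv(1)[OF o trans_smooth[OF c d] x, folded \<phi>_def]
  define F3 where "F3 = (\<lambda>u v w. fd (\<lambda>y. hess c d y v w) x u)"
  have F3sym: "F3 u v w = F3 v u w" for u v w
    unfolding F3_def hess_def
    by (rule second_derivative_symmetric[OF o smooth_on_deriv(2)[OF o trans_smooth[OF c d]] x])
  have dh: "((\<lambda>y. hess c d y v w) has_derivative (\<lambda>u. F3 u v w)) (at x)" for v w
    unfolding F3_def hess_def
    by (rule smooth_on_deriv(1)[OF o smooth_on_deriv(2)[OF o smooth_on_deriv(2)[OF o trans_smooth[OF c d]]] x])
  have eq: "hess c d x u (\<Gamma> c x v w) + \<phi> (D\<Gamma> c x u v w)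
     = D\<Gamma> d ?y (\<phi> u) (\<phi> v) (\<phi> w) + \<Gamma> d ?y (hess c d x u v) (\<phi> w) + \<Gamma> d ?y (\<phi> v) (hess c d x u w) + F3 u v w" for u v w
  proof -
    have l: "((\<lambda>y. fd ?f y (\<Gamma> c y v w)) has_derivative (\<lambda>u. hess c d x u (\<Gamma> c x v w) + fd ?f x (D\<Gamma> c x u v w))) (at x)"
      by (rule has_derivative_family_apply[where B="fd ?f" and B'="hess c d x", OF o x fd_trans_linear[OF c d] fd_trans_deriv[OF c d x] \<Gamma>_deriv[OF c xc] hess_linear(2)[OF c d x]])
    have r: "((\<lambda>y. \<Gamma> d (?f y) (fd ?f y v) (fd ?f y w)) has_derivative
      (\<lambda>u. D\<Gamma> d ?y (\<phi> u) (fd ?f x v) (fd ?f x w) + \<Gamma> d ?y (hess c d x u v) (fd ?f x w) + \<Gamma> d ?y (fd ?f x v) (hess c d x u w))) (at x)"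
      by (rule \<Gamma>_bideriv[OF d o x ovl_trans(1)[OF c] df fd_trans_deriv[OF c d x] fd_trans_deriv[OF c d x]])
    have "((\<lambda>y. fd ?f y (\<Gamma> c y v w)) has_derivative
      (\<lambda>u. (D\<Gamma> d ?y (\<phi> u) (fd ?f x v) (fd ?f x w) + \<Gamma> d ?y (hess c d x u v) (fd ?f x w) + \<Gamma> d ?y (fd ?f x v) (hess c d x u w)) + F3 u v w)) (at x)"
      by (rule has_derivative_transform_within_open[OF has_derivative_add[OF r dh] o x])
        (simp only: christoffel_change[OF c d])
    from fun_cong[OF has_derivative_unique[OF l this], of u] show ?thesis by (simp only: \<phi>_def)
  qed
  have lin: "linear \<phi>" unfolding \<phi>_def by (rule fd_trans_linear[OF c d x])
  have GG: "\<phi> (\<Gamma> c x u (\<Gamma> c x v w)) = \<Gamma> d ?y (\<phi> u) (\<Gamma> d ?y (\<phi> v) (\<phi> w)) + \<Gamma> d ?y (\<phi> u) (hess c d x v w) + hess c d x u (\<Gamma> c x v w)" for u v w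
    by (simp only: christoffel_change[OF c d x, folded \<phi>_def] linear_add[OF christoffel_linear(1)[OF d yd]])
  have D: "\<phi> (D\<Gamma> c x u v w) = D\<Gamma> d ?y (\<phi> u) (\<phi> v) (\<phi> w) + \<Gamma> d ?y (hess c d x u v) (\<phi> w) + \<Gamma> d ?y (\<phi> v) (hess c d x u w) + F3 u v w
     - hess c d x u (\<Gamma> c x v w)" for u v w
    using eq[of u v w] by (metis add_diff_cancel_left')
  have "\<phi> (Rc c x u v w) = \<phi> (D\<Gamma> c x u v w) - \<phi> (D\<Gamma> c x v u w) + \<phi> (\<Gamma> c x u (\<Gamma> c x v w)) - \<phi> (\<Gamma> c x v (\<Gamma> c x u w))"
    by (simp only: Rc_def linear_add[OF lin] linear_diff[OF lin])
  also have "\<dots> = Rc d ?y (\<phi> u) (\<phi> v) (\<phi> w)"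
    unfolding D GG Rc_def F3sym[of v u w] hess_sym[OF c d x, of v u] by (simp add: algebra_simps)
  finally show ?thesis .
qed

lemma curvature_chart:
  assumes c: "c \<in> atlas M" "p \<in> chart_dom c"
  defines "\<phi> \<equiv> coord_change (chart_at M p) c p"
  shows "\<phi> (curvature M p u v w) = Rc c (chart_map c p) (\<phi> u) (\<phi> v) (\<phi> w)"
proof -
  let ?d = "chart_at M p"
  have "chart_map ?d p \<in> ovl ?d c" using chart_at c by auto
  from Rc_change[OF chart_at(1) c(1) this, folded coord_change_fd] show ?thesis
    unfolding curvature_Rc \<phi>_def by (simp add: chart_inv_map[OF chart_at])
qed

lemma curvature_linear:
  "linear (\<lambda>u. curvature M p u v w)" "linear (\<lambda>v. curvature M p u v w)" "linear (\<lambda>w. curvature M p u v w)"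
  unfolding curvature_Rc by (rule Rc_linear; use chart_at in auto)+

lemma curvature_antisym: "curvature M p u v w = - curvature M p v u w"
  unfolding curvature_Rc by (rule Rc_antisym)

lemma curvature_skew: "rmetric M p (curvature M p u v w) z = - rmetric M p w (curvature M p u v z)"
proof -
  let ?d = "chart_at M p"
  have x: "chart_map ?d p \<in> cim ?d" using chart_at(2) by auto
  show ?thesis
    using Rc_skew[OF chart_at(1) x] by (simp add: rm_chart[OF chart_at] curvature_Rc cc_id[OF chart_at])
qed

end

section \<open>Linear differential equations on short intervals\<close>

lemma continuous_on_family_apply:
  fixes y :: "'t::topological_space \<Rightarrow> 'a::euclidean_space" and A :: "'t \<Rightarrow> 'a \<Rightarrow> 'b::real_normed_vector"
  assumes "\<And>t. t \<in> S \<Longrightarrow> linear (A t)" "\<And>v. continuous_on S (\<lambda>t. A t v)" "continuous_on S y"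
  shows "continuous_on S (\<lambda>t. A t (y t))"
proof -
  have "continuous_on S (\<lambda>t. \<Sum>b\<in>Basis. (y t \<bullet> b) *\<^sub>R A t b)"
    by (intro continuous_on_sum continuous_on_scaleR continuous_on_inner assms continuous_on_const)
  moreover have "A t (y t) = (\<Sum>b\<in>Basis. (y t \<bullet> b) *\<^sub>R A t b)" if "t \<in> S" for t
    by (rule linear_basis_expand[OF assms(1)[OF that]])
  ultimately show ?thesis by (simp cong: continuous_on_cong)
qed

text \<open>
  Compactness bounds the values on each basis vector, and linearity does the rest.
\<close>

lemma linear_family_bound:
  fixes A :: "'t::topological_space \<Rightarrow> 'a::euclidean_space \<Rightarrow> 'b::real_normed_vector"
  assumes "compact S" "\<And>t. t \<in> S \<Longrightarrow> linear (A t)" "\<And>v. continuous_on S (\<lambda>t. A t v)"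
  obtains K where "0 < K" "\<And>t v. t \<in> S \<Longrightarrow> norm (A t v) \<le> K * norm v"
proof -
  have "\<exists>k. \<forall>t\<in>S. norm (A t b) \<le> k" for b
    using compact_imp_bounded[OF compact_continuous_image[OF assms(3) assms(1), of b]] by (auto simp: bounded_iff)
  then obtain k where k: "\<forall>b. \<forall>t\<in>S. norm (A t b) \<le> k b" by metis
  let ?K = "1 + (\<Sum>b\<in>Basis. \<bar>k b\<bar>)"
  show thesis
  proof (rule that[of ?K])
    show "0 < ?K" by (simp add: add_pos_nonneg sum_nonneg)
    fix t v assume t: "t \<in> S"
    have "norm (A t v) = norm (\<Sum>b\<in>Basis. (v \<bullet> b) *\<^sub>R A t b)"
      by (rule arg_cong[OF linear_basis_expand[OF assms(2)[OF t]]])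
    also have "\<dots> \<le> (\<Sum>b\<in>Basis. norm v * \<bar>k b\<bar>)"
    proof (rule sum_norm_le)
      fix b :: 'a assume b: "b \<in> Basis"
      have "norm (A t b) \<le> k b" using k t by simp
      then have nb: "norm (A t b) \<le> \<bar>k b\<bar>" by linarith
      have "\<bar>v \<bullet> b\<bar> * norm (A t b) \<le> norm v * \<bar>k b\<bar>"
        by (rule mult_mono[OF Basis_le_norm[OF b] nb]) auto
      then show "norm ((v \<bullet> b) *\<^sub>R A t b) \<le> norm v * \<bar>k b\<bar>" by simp
    qed
    also have "\<dots> \<le> ?K * norm v" by (simp add: sum_distrib_left[symmetric] algebra_simps)
    finally show "norm (A t v) \<le> ?K * norm v" .
  qed
qed

text \<open>The Picard map is a contraction of the bounded continuous functions; they are made constant outside the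
  interval to be defined on the whole line.\<close>

lemma linear_ode_short:
  fixes A :: "real \<Rightarrow> 'a::euclidean_space \<Rightarrow> 'a"
  assumes ab: "a \<le> b" and s: "s \<in> {a..b}" and lin: "\<And>t. t \<in> {a..b} \<Longrightarrow> linear (A t)"
    and cont: "\<And>v. continuous_on {a..b} (\<lambda>t. A t v)"
    and K: "\<And>t v. t \<in> {a..b} \<Longrightarrow> norm (A t v) \<le> K * norm v" and short: "2 * K * (b - a) < 1" and "0 < K"
  shows "\<exists>y. y s = v \<and> (\<forall>t\<in>{a..b}. (y has_vector_derivative A t (y t)) (at t within {a..b}))"
proof -
  define cl where "cl = (\<lambda>t. max a (min b t))"
  have cl: "cl t \<in> {a..b}" for t using ab by (auto simp: cl_def)
  have cl_id: "cl t = t" if "t \<in> {a..b}" for t using that by (auto simp: cl_def)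
  have ccl: "continuous_on UNIV cl" unfolding cl_def by (intro continuous_intros)
  define g where "g = (\<lambda>(y :: real \<Rightarrow>\<^sub>C 'a) u. A u (apply_bcontfun y u))"
  have cg: "continuous_on {a..b} (g y)" for y
    unfolding g_def by (rule continuous_on_family_apply[where A=A, OF lin cont continuous_on_apply_bcontfun])
  define F where "F = (\<lambda>y t. v + integral {a..cl t} (g y) - integral {a..s} (g y))"
  have dI: "((\<lambda>u. integral {a..u} (g y)) has_vector_derivative g y t) (at t within {a..b})" if "t \<in> {a..b}" for y t
    by (rule integral_has_vector_derivative[OF cg that])
  have cI: "continuous_on {a..b} (\<lambda>u. integral {a..u} (g y))" for y
    by (rule indefinite_integral_continuous_1[OF integrable_continuous_real[OF cg]])
  have cF: "continuous_on UNIV (F y)" for y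
  proof -
    have "continuous_on UNIV (\<lambda>t. integral {a..cl t} (g y))"
      by (rule continuous_on_compose2[OF cI ccl]) (use cl in auto)
    then show ?thesis unfolding F_def by (intro continuous_on_diff continuous_on_add continuous_on_const)
  qed
  have Fb: "F y \<in> bcontfun" for y
  proof -
    have "F y ` UNIV \<subseteq> F y ` {a..b}"
    proof
      fix z assume "z \<in> F y ` UNIV"
      then obtain t where "z = F y t" by auto
      then have "z = F y (cl t)" using cl_id[OF cl[of t]] by (simp add: F_def)
      then show "z \<in> F y ` {a..b}" using cl by blast
    qed
    moreover have "bounded (F y ` {a..b})"
      by (rule compact_imp_bounded[OF compact_continuous_image[OF continuous_on_subset[OF cF]]]) auto
    ultimately have "bounded (F y ` UNIV)" by (rule bounded_subset[rotated])
    then show ?thesis using cF by (simp add: bcontfun_def)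
  qed
  define P where "P y = Bcontfun (F y)" for y
  have P: "apply_bcontfun (P y) = F y" for y unfolding P_def by (rule Bcontfun_inverse[OF Fb])
  have "dist (P y) (P z) \<le> (2 * K * (b - a)) * dist y z" for y z
  proof (rule dist_bound)
    fix t
    have gd: "norm (g y u - g z u) \<le> K * dist y z" if u: "u \<in> {a..b}" for u
    proof -
      have "g y u - g z u = A u (apply_bcontfun y u - apply_bcontfun z u)"
        unfolding g_def by (simp add: linear_diff[OF lin[OF u]])
      also have "norm \<dots> \<le> K * norm (apply_bcontfun y u - apply_bcontfun z u)" by (rule K[OF u])
      also have "\<dots> \<le> K * dist y z"
        using dist_bounded[of y u z] \<open>0 < K\<close> by (simp add: dist_norm mult_left_mono)
      finally show ?thesis .
    qed
    have bd: "norm (integral {a..w} (g y) - integral {a..w} (g z)) \<le> K * dist y z * (b - a)" if w: "w \<in> {a..b}" for w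
    proof -
      have sub: "{a..w} \<subseteq> {a..b}" using w by auto
      note c = continuous_on_subset[OF cg sub]
      have "integral {a..w} (g y) - integral {a..w} (g z) = integral {a..w} (\<lambda>u. g y u - g z u)"
        by (rule integral_diff[symmetric]) (intro integrable_continuous_real c)+
      also have "norm \<dots> \<le> K * dist y z * (w - a)"
        by (rule integral_bound) (use w gd sub in \<open>auto intro!: continuous_on_diff c\<close>)
      also have "\<dots> \<le> K * dist y z * (b - a)"
        by (rule mult_left_mono) (use w \<open>0 < K\<close> in auto)
      finally show ?thesis .
    qed
    have "dist (apply_bcontfun (P y) t) (apply_bcontfun (P z) t)
      = norm ((integral {a..cl t} (g y) - integral {a..cl t} (g z)) - (integral {a..s} (g y) - integral {a..s} (g z)))"
      unfolding P F_def dist_norm by (rule arg_cong[where f=norm]) (simp add: algebra_simps)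
    also have "\<dots> \<le> K * dist y z * (b - a) + K * dist y z * (b - a)"
      by (rule norm_triangle_le_diff[OF add_mono[OF bd[OF cl] bd[OF s]]])
    also have "\<dots> = (2 * K * (b - a)) * dist y z" by (simp add: algebra_simps)
    finally show "dist (apply_bcontfun (P y) t) (apply_bcontfun (P z) t) \<le> (2 * K * (b - a)) * dist y z" .
  qed
  then have "\<exists>!y. P y = y"
    by (intro banach_fix_type[of "2 * K * (b - a)"]) (use short ab \<open>0 < K\<close> in auto)
  then obtain y where y: "P y = y" by auto
  have yF: "apply_bcontfun y = F y" using P[of y] y by simp
  have "(apply_bcontfun y has_vector_derivative A t (apply_bcontfun y t)) (at t within {a..b})" if t: "t \<in> {a..b}" for t
  proof (rule has_vector_derivative_transform[OF t])
    show "((\<lambda>u. v + integral {a..u} (g y) - integral {a..s} (g y)) has_vector_derivative A t (apply_bcontfun y t)) (at t within {a..b})"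
      using has_vector_derivative_diff[OF has_vector_derivative_add[OF has_vector_derivative_const dI[OF t]] has_vector_derivative_const, of v y "integral {a..s} (g y)"]
      by (simp add: g_def)
    show "apply_bcontfun y u = v + integral {a..u} (g y) - integral {a..s} (g y)" if "u \<in> {a..b}" for u
      unfolding yF F_def cl_id[OF that] ..
  qed
  moreover have "apply_bcontfun y s = v" unfolding yF F_def cl_id[OF s] by simp
  ultimately show ?thesis by (intro exI[of _ "apply_bcontfun y"]) simp
qed

lemma has_vector_derivative_Un:
  "(f has_vector_derivative f') (at x within S) \<Longrightarrow> (f has_vector_derivative f') (at x within T)
    \<Longrightarrow> (f has_vector_derivative f') (at x within (S \<union> T))"
  unfolding has_vector_derivative_def has_derivative_within by (simp add: Lim_within_Un)

lemma has_vector_derivative_outside: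
  assumes "closed S" "x \<notin> S" shows "(f has_vector_derivative f') (at x within S)"
proof -
  have "at x within S = bot" using assms by (simp add: at_within_eq_bot_iff)
  then show ?thesis by (simp add: has_vector_derivative_def has_derivative_def bounded_linear_scaleR_left)
qed


section \<open>Covariant derivatives along a geodesic\<close>

locale geodesic_curve = riemannian M
  for M :: "('m::{t2_space, second_countable_topology}, 'a::euclidean_space) metric_atlas" +
  fixes \<gamma> :: "real \<Rightarrow> 'm"
  assumes us: "unit_speed_geodesic M \<gamma>"
begin

abbreviation "xc c t \<equiv> chart_map c (\<gamma> t)"
abbreviation "vel \<equiv> velocity M \<gamma>"
abbreviation "fic \<equiv> field_in_chart M \<gamma>"
abbreviation "at_chart t \<equiv> chart_at M (\<gamma> t)"
abbreviation "cov \<equiv> covariant_deriv M \<gamma>"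

definition T :: "('m, 'a) chart \<Rightarrow> real set" where "T c = {t. \<gamma> t \<in> chart_dom c}"
definition vc :: "('m, 'a) chart \<Rightarrow> real \<Rightarrow> 'a" where "vc c t = vector_derivative (\<lambda>s. xc c s) (at t)"

lemma curve_smooth: "smooth_curve M \<gamma>"
  using us by (simp add: unit_speed_geodesic_def geodesic_def)

lemma T_open: assumes "c \<in> atlas M" shows "open (T c)"
proof -
  have "continuous_on UNIV \<gamma>" using curve_smooth by (simp add: smooth_curve_def)
  from open_vimage[OF chart_open(1)[OF assms] this] show ?thesis by (simp add: T_def vimage_def)
qed

lemma T_at: "t \<in> T (at_chart t)" by (simp add: T_def chart_at)

lemma xc_smooth: "c \<in> atlas M \<Longrightarrow> smooth_on (T c) (\<lambda>t. xc c t)"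
  using curve_smooth by (simp add: smooth_curve_def T_def)

lemma xc_cim: "t \<in> T c \<Longrightarrow> xc c t \<in> cim c" by (auto simp: T_def)

lemma xc_ovl: "t \<in> T c \<Longrightarrow> t \<in> T d \<Longrightarrow> xc c t \<in> ovl c d" by (auto simp: T_def)

lemma vc_deriv: "c \<in> atlas M \<Longrightarrow> t \<in> T c \<Longrightarrow> ((\<lambda>t. xc c t) has_vector_derivative vc c t) (at t)"
  unfolding vc_def by (rule smooth_on_curve_deriv(1)[OF T_open xc_smooth])

lemma vc_smooth: assumes "c \<in> atlas M" shows "smooth_on (T c) (vc c)"
proof -
  have "vc c = (\<lambda>t. vector_derivative (\<lambda>s. xc c s) (at t))" by (rule ext) (simp add: vc_def)
  with smooth_on_curve_deriv(2)[OF T_open[OF assms] xc_smooth[OF assms]] show ?thesis by simp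
qed

lemma xc_trans: "c \<in> atlas M \<Longrightarrow> t \<in> T c \<Longrightarrow> trans_map c d (xc c t) = xc d t"
  by (simp add: chart_inv_map T_def)

lemma vel_vc: "vel t = vc (at_chart t) t"
  by (simp add: velocity_def vc_def)

lemma ccl: assumes "c \<in> atlas M" "d \<in> atlas M" "t \<in> T c" "t \<in> T d"
  shows "linear (coord_change c d (\<gamma> t))"
  using cc_linear[OF assms(1,2)] assms(3,4) by (simp add: T_def)

lemma fic_change:
  assumes "c \<in> atlas M" "d \<in> atlas M" "t \<in> T c" "t \<in> T d"
  shows "coord_change c d (\<gamma> t) (fic X c t) = fic X d t"
  unfolding field_in_chart_def by (rule cc_cocycle) (use assms chart_at in \<open>auto simp: T_def\<close>)

lemma vc_change:
  assumes c: "c \<in> atlas M" and d: "d \<in> atlas M" and t: "t \<in> T c" "t \<in> T d"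
  shows "coord_change c d (\<gamma> t) (vc c t) = vc d t"
proof -
  have dt: "(trans_map c d has_derivative coord_change c d (\<gamma> t)) (at (xc c t))"
    using trans_deriv[OF c d] t by (simp add: T_def)
  have "((\<lambda>s. trans_map c d (xc c s)) has_derivative (\<lambda>h. coord_change c d (\<gamma> t) (h *\<^sub>R vc c t))) (at t)"
    by (rule has_derivative_compose[OF vc_deriv[OF c t(1), unfolded has_vector_derivative_def] dt])
  then have "((\<lambda>s. xc d s) has_derivative (\<lambda>h. coord_change c d (\<gamma> t) (h *\<^sub>R vc c t))) (at t)"
    by (rule has_derivative_transform_within_open[OF _ T_open[OF c] t(1)]) (rule xc_trans[OF c])
  from fun_cong[OF has_derivative_unique[OF this vc_deriv[OF d t(2), unfolded has_vector_derivative_def]], of 1]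
  show ?thesis by simp
qed

lemma fic_vel: assumes "c \<in> atlas M" "t \<in> T c" shows "fic vel c t = vc c t"
  unfolding field_in_chart_def vel_vc by (rule vc_change[OF chart_at(1) assms(1) T_at assms(2)])

lemma fic_at: "fic X (at_chart t) t = X t"
  by (simp add: field_in_chart_def cc_id chart_at)

lemma rm_fic:
  assumes "c \<in> atlas M" "t \<in> T c"
  shows "rmetric M (\<gamma> t) (X t) (Y t) = cm c (xc c t) (fic X c t) (fic Y c t)"
  unfolding field_in_chart_def by (rule rm_chart) (use assms in \<open>auto simp: T_def\<close>)

text \<open>\<open>w\<close> is the covariant derivative of \<open>X\<close> at \<open>t\<close>, relative to parameters in \<open>S\<close>; one-sided derivatives
  are needed to join parallel fields on adjacent intervals.\<close>

definition has_cov :: "(real \<Rightarrow> 'a) \<Rightarrow> 'a \<Rightarrow> real \<Rightarrow> real set \<Rightarrow> bool" where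
  "has_cov X w t S \<longleftrightarrow> (\<forall>c\<in>atlas M. t \<in> T c \<longrightarrow>
     (fic X c has_vector_derivative (coord_change (at_chart t) c (\<gamma> t) w - \<Gamma> c (xc c t) (vc c t) (fic X c t))) (at t within S))"

lemma has_covD:
  "has_cov X w t S \<Longrightarrow> c \<in> atlas M \<Longrightarrow> t \<in> T c \<Longrightarrow>
    (fic X c has_vector_derivative (coord_change (at_chart t) c (\<gamma> t) w - \<Gamma> c (xc c t) (vc c t) (fic X c t))) (at t within S)"
  by (simp add: has_cov_def)

text \<open>
  The transformation law of the Christoffel symbols makes the condition independent of the chart, so that one
  chart suffices.
\<close>

lemma has_covI:
  assumes c: "c \<in> atlas M" and t: "t \<in> T c"
    and der: "(fic X c has_vector_derivative (coord_change (at_chart t) c (\<gamma> t) w - \<Gamma> c (xc c t) (vc c t) (fic X c t))) (at t within S)"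
  shows "has_cov X w t S"
  unfolding has_cov_def
proof (intro ballI impI)
  fix d assume d: "d \<in> atlas M" and td: "t \<in> T d"
  let ?x = "xc c t" and ?\<phi> = "coord_change c d (\<gamma> t)" and ?w = "coord_change (at_chart t) c (\<gamma> t) w"
  let ?f = "trans_map c d"
  have U: "open (T c \<inter> T d)" "t \<in> T c \<inter> T d" using T_open[OF c] T_open[OF d] t td by auto
  have x: "?x \<in> ovl c d" by (rule xc_ovl[OF t td])
  have \<phi>: "fd ?f ?x = ?\<phi>" by (simp add: coord_change_fd)
  have lin: "linear ?\<phi>" by (rule ccl[OF c d t td])
  have fx: "((\<lambda>s. fd ?f (xc c s) b) has_derivative (\<lambda>h. hess c d ?x (h *\<^sub>R vc c t) b)) (at t within S)" for b
    by (rule has_derivative_compose[OF has_derivative_at_withinI[OF vc_deriv[OF c t, unfolded has_vector_derivative_def]] fd_trans_deriv[OF c d x]])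
  have "((\<lambda>s. fd ?f (xc c s) (fic X c s)) has_derivative
     (\<lambda>h. hess c d ?x (h *\<^sub>R vc c t) (fic X c t) + fd ?f ?x (h *\<^sub>R (?w - \<Gamma> c ?x (vc c t) (fic X c t))))) (at t within S)"
    by (rule has_derivative_family_apply[where B="\<lambda>s. fd ?f (xc c s)", OF U fd_trans_linear[OF c d xc_ovl] fx der[unfolded has_vector_derivative_def] hess_linear(2)[OF c d x]])
       auto
  then have "(fic X d has_derivative
     (\<lambda>h. hess c d ?x (h *\<^sub>R vc c t) (fic X c t) + fd ?f ?x (h *\<^sub>R (?w - \<Gamma> c ?x (vc c t) (fic X c t))))) (at t within S)"
    by (rule has_derivative_transform_within_open[OF _ U])
      (simp add: coord_change_fd[symmetric] fic_change[OF c d])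
  moreover have "hess c d ?x (h *\<^sub>R vc c t) (fic X c t) + fd ?f ?x (h *\<^sub>R (?w - \<Gamma> c ?x (vc c t) (fic X c t)))
      = h *\<^sub>R (coord_change (at_chart t) d (\<gamma> t) w - \<Gamma> d (xc d t) (vc d t) (fic X d t))" for h
  proof -
    have G: "?\<phi> (\<Gamma> c ?x (vc c t) (fic X c t)) = \<Gamma> d (xc d t) (vc d t) (fic X d t) + hess c d ?x (vc c t) (fic X c t)"
      using christoffel_change[OF c d x, of "vc c t" "fic X c t"]
      by (simp only: \<phi> xc_trans[OF c t] vc_change[OF c d t td] fic_change[OF c d t td])
    have W: "?\<phi> ?w = coord_change (at_chart t) d (\<gamma> t) w"
      by (rule cc_cocycle) (use c d t td chart_at in \<open>auto simp: T_def\<close>)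
    show ?thesis
      unfolding \<phi> linear_scale[OF hess_linear(1)[OF c d x]] linear_scale[OF lin] linear_diff[OF lin] G W
      by (simp add: algebra_simps)
  qed
  ultimately show "(fic X d has_vector_derivative (coord_change (at_chart t) d (\<gamma> t) w - \<Gamma> d (xc d t) (vc d t) (fic X d t))) (at t within S)"
    unfolding has_vector_derivative_def by simp
qed

lemma cov_eqI:
  assumes "has_cov X w t UNIV"
  shows "cov X t = w"
proof -
  have "vector_derivative (fic X (at_chart t)) (at t) = w - \<Gamma> (at_chart t) (xc (at_chart t) t) (vc (at_chart t) t) (X t)"
    using vector_derivative_at[OF has_covD[OF assms chart_at(1) T_at]] by (simp add: fic_at cc_id chart_at)
  then show ?thesis by (simp add: covariant_deriv_def Let_def vel_vc)
qed

lemma fic_smooth: "smooth_field_along M \<gamma> X \<Longrightarrow> c \<in> atlas M \<Longrightarrow> smooth_on (T c) (fic X c)"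
  by (simp add: smooth_field_along_def T_def)

lemma smooth_has_cov:
  assumes "smooth_field_along M \<gamma> X"
  shows "has_cov X (cov X t) t UNIV"
proof (rule has_covI[OF chart_at(1) T_at])
  show "(fic X (at_chart t) has_vector_derivative coord_change (at_chart t) (at_chart t) (\<gamma> t) (cov X t) -
      \<Gamma> (at_chart t) (xc (at_chart t) t) (vc (at_chart t) t) (fic X (at_chart t) t)) (at t)"
    using smooth_on_curve_deriv(1)[OF T_open fic_smooth[OF assms] T_at, OF chart_at(1) chart_at(1)]
    by (simp add: fic_at cc_id chart_at covariant_deriv_def Let_def vel_vc)
qed

lemma fic_linear_comb:
  assumes "c \<in> atlas M" "t \<in> T c"
  shows "fic (\<lambda>s. X s + Y s) c t = fic X c t + fic Y c t" "fic (\<lambda>s. r *\<^sub>R X s) c t = r *\<^sub>R fic X c t"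
  using ccl[OF chart_at(1) assms(1) T_at assms(2)] by (simp_all add: field_in_chart_def linear_add linear_scale)

lemma has_cov_add:
  assumes "has_cov X w t S" "has_cov Y z t S" shows "has_cov (\<lambda>s. X s + Y s) (w + z) t S"
proof (rule has_covI[OF chart_at(1) T_at])
  let ?c = "at_chart t"
  note lg = linear_add[OF christoffel_linear(1)[OF chart_at(1) xc_cim[OF T_at]]] linear_add[OF ccl[OF chart_at(1) chart_at(1) T_at T_at]]
  have "((\<lambda>s. fic X ?c s + fic Y ?c s) has_vector_derivative coord_change ?c ?c (\<gamma> t) (w + z) - \<Gamma> ?c (xc ?c t) (vc ?c t) (fic (\<lambda>s. X s + Y s) ?c t)) (at t within S)"
    using has_vector_derivative_add[OF has_covD[OF assms(1) chart_at(1) T_at] has_covD[OF assms(2) chart_at(1) T_at]]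
    by (simp add: fic_linear_comb[OF chart_at(1) T_at] lg algebra_simps)
  then show "(fic (\<lambda>s. X s + Y s) ?c has_vector_derivative coord_change ?c ?c (\<gamma> t) (w + z) - \<Gamma> ?c (xc ?c t) (vc ?c t) (fic (\<lambda>s. X s + Y s) ?c t)) (at t within S)"
    unfolding has_vector_derivative_def
    by (rule has_derivative_transform_within_open[OF _ T_open[OF chart_at(1)] T_at]) (simp add: fic_linear_comb[OF chart_at(1)])
qed

lemma has_cov_scale:
  assumes "has_cov X w t S" shows "has_cov (\<lambda>s. r *\<^sub>R X s) (r *\<^sub>R w) t S"
proof (rule has_covI[OF chart_at(1) T_at])
  let ?c = "at_chart t"
  note lg = linear_scale[OF christoffel_linear(1)[OF chart_at(1) xc_cim[OF T_at]]] linear_scale[OF ccl[OF chart_at(1) chart_at(1) T_at T_at]]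
  have "((\<lambda>s. r *\<^sub>R fic X ?c s) has_vector_derivative coord_change ?c ?c (\<gamma> t) (r *\<^sub>R w) - \<Gamma> ?c (xc ?c t) (vc ?c t) (fic (\<lambda>s. r *\<^sub>R X s) ?c t)) (at t within S)"
    using bounded_linear.has_vector_derivative[OF bounded_linear_scaleR_right has_covD[OF assms(1) chart_at(1) T_at], of r]
    by (simp add: fic_linear_comb[OF chart_at(1) T_at] lg algebra_simps)
  then show "(fic (\<lambda>s. r *\<^sub>R X s) ?c has_vector_derivative coord_change ?c ?c (\<gamma> t) (r *\<^sub>R w) - \<Gamma> ?c (xc ?c t) (vc ?c t) (fic (\<lambda>s. r *\<^sub>R X s) ?c t)) (at t within S)"
    unfolding has_vector_derivative_def
    by (rule has_derivative_transform_within_open[OF _ T_open[OF chart_at(1)] T_at]) (simp add: fic_linear_comb[OF chart_at(1)])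
qed

lemma has_cov_sum:
  assumes "finite B" "\<And>i. i \<in> B \<Longrightarrow> has_cov (X i) (w i) t S"
  shows "has_cov (\<lambda>s. \<Sum>i\<in>B. X i s) (\<Sum>i\<in>B. w i) t S"
  using assms
proof (induction B rule: finite_induct)
  case empty
  have z: "has_cov (\<lambda>s. 0) 0 t S"
  proof (rule has_covI[OF chart_at(1) T_at])
    let ?c = "at_chart t"
    have z: "fic (\<lambda>s. 0) ?c s = 0" if "s \<in> T ?c" for s
      using linear_0[OF ccl[OF chart_at(1) chart_at(1) T_at that]] by (simp add: field_in_chart_def)
    have "((\<lambda>s. 0) has_vector_derivative 0) (at t within S)" by (rule has_vector_derivative_const)
    then have "(fic (\<lambda>s. 0) ?c has_vector_derivative 0) (at t within S)"
      unfolding has_vector_derivative_def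
      by (rule has_derivative_transform_within_open[OF _ T_open[OF chart_at(1)] T_at]) (simp add: z)
    then show "(fic (\<lambda>s. 0) ?c has_vector_derivative coord_change ?c ?c (\<gamma> t) 0 - \<Gamma> ?c (xc ?c t) (vc ?c t) (fic (\<lambda>s. 0) ?c t)) (at t within S)"
      by (simp add: z[OF T_at] linear_0[OF christoffel_linear(1)[OF chart_at(1) xc_cim[OF T_at]]] cc_id chart_at)
  qed
  then show ?case by simp
next
  case (insert i B)
  have "has_cov (\<lambda>s. X i s + (\<Sum>i\<in>B. X i s)) (w i + (\<Sum>i\<in>B. w i)) t S"
    by (rule has_cov_add) (use insert in auto)
  then show ?case using insert.hyps by simp
qed

text \<open>
  Metric compatibility of the connection along the curve, computed in one chart.
\<close>

lemma product_rule:
  assumes "has_cov X w t S" "has_cov Y z t S"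
  shows "((\<lambda>s. rmetric M (\<gamma> s) (X s) (Y s)) has_real_derivative (rmetric M (\<gamma> t) w (Y t) + rmetric M (\<gamma> t) (X t) z)) (at t within S)"
proof -
  let ?c = "at_chart t"
  let ?x = "xc ?c t" and ?v = "vc ?c t"
  note c = chart_at(1)[of "\<gamma> t"]
  note xi = xc_cim[OF T_at]
  have dX: "(fic X ?c has_derivative (\<lambda>h. h *\<^sub>R (w - \<Gamma> ?c ?x ?v (X t)))) (at t within S)"
    using has_covD[OF assms(1) c T_at] by (simp add: has_vector_derivative_def fic_at cc_id chart_at)
  have dY: "(fic Y ?c has_derivative (\<lambda>h. h *\<^sub>R (z - \<Gamma> ?c ?x ?v (Y t)))) (at t within S)"
    using has_covD[OF assms(2) c T_at] by (simp add: has_vector_derivative_def fic_at cc_id chart_at)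
  have "((\<lambda>s. cm ?c (xc ?c s) (fic X ?c s) (fic Y ?c s)) has_derivative
     (\<lambda>h. Dm ?c ?x (h *\<^sub>R ?v) (fic X ?c t) (fic Y ?c t) + cm ?c ?x (h *\<^sub>R (w - \<Gamma> ?c ?x ?v (X t))) (fic Y ?c t)
        + cm ?c ?x (fic X ?c t) (h *\<^sub>R (z - \<Gamma> ?c ?x ?v (Y t))))) (at t within S)"
    by (rule cm_bideriv[OF c T_open[OF c] T_at xc_cim has_derivative_at_withinI[OF vc_deriv[OF c T_at, unfolded has_vector_derivative_def]] dX dY])
  then have "((\<lambda>s. rmetric M (\<gamma> s) (X s) (Y s)) has_derivative
     (\<lambda>h. Dm ?c ?x (h *\<^sub>R ?v) (X t) (Y t) + cm ?c ?x (h *\<^sub>R (w - \<Gamma> ?c ?x ?v (X t))) (Y t)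
        + cm ?c ?x (X t) (h *\<^sub>R (z - \<Gamma> ?c ?x ?v (Y t))))) (at t within S)"
    unfolding fic_at by (rule has_derivative_transform_within_open[OF _ T_open[OF c] T_at]) (rule rm_fic[OF c, symmetric])
  moreover have "Dm ?c ?x (h *\<^sub>R ?v) (X t) (Y t) + cm ?c ?x (h *\<^sub>R (w - \<Gamma> ?c ?x ?v (X t))) (Y t)
        + cm ?c ?x (X t) (h *\<^sub>R (z - \<Gamma> ?c ?x ?v (Y t)))
      = (rmetric M (\<gamma> t) w (Y t) + rmetric M (\<gamma> t) (X t) z) * h" for h
    unfolding linear_scale[OF Dm_linear(1)[OF c xi]] linear_scale[OF cm_linear(1)[OF c xi]] linear_scale[OF cm_linear(2)[OF c xi]]
      linear_diff[OF cm_linear(1)[OF c xi]] linear_diff[OF cm_linear(2)[OF c xi]] metric_compatible[OF c xi]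
      rm_chart[OF c chart_at(2)] cc_id[OF c chart_at(2)]
    by (simp add: linear_scale[OF christoffel_linear(2)[OF c xi]] linear_scale[OF cm_linear(1)[OF c xi]]
      linear_scale[OF cm_linear(2)[OF c xi]] algebra_simps)
  ultimately show ?thesis by (simp add: has_field_derivative_def)
qed

lemma \<Gamma>_curve_Ck:
  assumes c: "c \<in> atlas M" and y: "Ck_on k (T c) y"
  shows "Ck_on k (T c) (\<lambda>t. \<Gamma> c (xc c t) (vc c t) (y t))"
proof -
  note o = T_open[OF c]
  have 1: "Ck_on k (T c) (\<lambda>t. \<Gamma> c (xc c t) e b)" for e b
    by (rule Ck_on_compose[OF o chart_open(2)[OF c] xc_cim smooth_on_Ck[OF xc_smooth[OF c]] smooth_on_Ck[OF christoffel_smooth[OF c]]])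
  have 2: "Ck_on k (T c) (\<lambda>t. \<Gamma> c (xc c t) (vc c t) b)" for b
    by (rule Ck_on_family_apply[where B="\<lambda>t e. \<Gamma> c (xc c t) e b", OF o christoffel_linear(2)[OF c xc_cim] 1 smooth_on_Ck[OF vc_smooth[OF c]]])
  show ?thesis
    by (rule Ck_on_family_apply[where B="\<lambda>t. \<Gamma> c (xc c t) (vc c t)", OF o christoffel_linear(1)[OF c xc_cim] 2 y])
qed

lemma cov_smooth:
  assumes X: "smooth_field_along M \<gamma> X"
  shows "smooth_field_along M \<gamma> (cov X)"
  unfolding smooth_field_along_def
proof
  fix c assume c: "c \<in> atlas M"
  note o = T_open[OF c]
  have "smooth_on (T c) (\<lambda>t. vector_derivative (fic X c) (at t) + \<Gamma> c (xc c t) (vc c t) (fic X c t))"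
    by (rule smooth_on_add[OF o smooth_on_curve_deriv(2)[OF o fic_smooth[OF X c]]])
      (simp add: smooth_on_def \<Gamma>_curve_Ck[OF c smooth_on_Ck[OF fic_smooth[OF X c]]])
  then have "smooth_on (T c) (fic (cov X) c)"
  proof (rule smooth_on_cong[OF o, rotated])
    fix t assume t: "t \<in> T c"
    show "vector_derivative (fic X c) (at t) + \<Gamma> c (xc c t) (vc c t) (fic X c t) = fic (cov X) c t"
      using vector_derivative_at[OF has_covD[OF smooth_has_cov[OF X] c t]] by (simp add: field_in_chart_def)
  qed
  then show "smooth_on {t. \<gamma> t \<in> chart_dom c} (fic (cov X) c)" by (simp add: T_def)
qed

lemma vel_smooth: "smooth_field_along M \<gamma> vel"
  unfolding smooth_field_along_def
proof
  fix c assume c: "c \<in> atlas M"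
  have "smooth_on (T c) (fic vel c)"
    by (rule smooth_on_cong[OF T_open[OF c] fic_vel[OF c, symmetric] vc_smooth[OF c]])
  then show "smooth_on {t. \<gamma> t \<in> chart_dom c} (fic vel c)" by (simp add: T_def)
qed

lemma vel_parallel: "parallel_field M \<gamma> vel"
  using us vel_smooth by (simp add: parallel_field_def unit_speed_geodesic_def geodesic_def)

text \<open>
  Smoothness is automatic: in a chart a parallel field solves a first-order linear equation with smooth
  coefficients, and each derivative of the solution gains one order.
\<close>

lemma parallelI:
  assumes X: "\<And>t. has_cov X 0 t UNIV"
  shows "parallel_field M \<gamma> X"
proof -
  have "smooth_on (T c) (fic X c)" if c: "c \<in> atlas M" for c
    unfolding smooth_on_def
  proof
    fix k
    have d: "(fic X c has_vector_derivative (-1) *\<^sub>R \<Gamma> c (xc c t) (vc c t) (fic X c t)) (at t)" if "t \<in> T c" for t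
      using has_covD[OF X c that] by (simp add: linear_0[OF ccl[OF chart_at(1) c T_at that]])
    show "Ck_on k (T c) (fic X c)"
    proof (induction k)
      case 0
      show ?case unfolding Ck_on.simps
        by (intro continuous_at_imp_continuous_on ballI) (erule has_vector_derivative_continuous[OF d])
    next
      case (Suc k)
      show ?case
        by (rule Ck_on_curveI[OF T_open[OF c]], erule d)
          (intro Ck_on_scaleR[OF T_open[OF c]] Ck_on_const[OF T_open[OF c]] \<Gamma>_curve_Ck[OF c Suc])
    qed
  qed
  then have "smooth_field_along M \<gamma> X" by (simp add: smooth_field_along_def T_def)
  moreover have "cov X t = 0" for t by (rule cov_eqI[OF X])
  ultimately show ?thesis by (simp add: parallel_field_def)
qed

lemma parallelD: "parallel_field M \<gamma> X \<Longrightarrow> has_cov X 0 t UNIV"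
  using smooth_has_cov[of X t] by (simp add: parallel_field_def)

end

context geodesic_curve
begin

subsection \<open>Parallel transport\<close>

text \<open>
  Derivatives are taken within \<open>S\<close>, so that fields on compact intervals can be glued at common end points.
\<close>

definition parallel_on :: "(real \<Rightarrow> 'a) \<Rightarrow> real set \<Rightarrow> bool" where
  "parallel_on X S \<longleftrightarrow> (\<forall>t\<in>S. has_cov X 0 t S)"

lemma has_cov_transform:
  assumes "has_cov X w t S" "t \<in> S" "\<And>s. s \<in> S \<Longrightarrow> X s = Y s"
  shows "has_cov Y w t S"
proof (rule has_covI[OF chart_at(1) T_at])
  have e: "fic Y c s = fic X c s" if "s \<in> S" for c s by (simp add: field_in_chart_def assms(3)[OF that])
  show "(fic Y (at_chart t) has_vector_derivative coord_change (at_chart t) (at_chart t) (\<gamma> t) w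
     - \<Gamma> (at_chart t) (xc (at_chart t) t) (vc (at_chart t) t) (fic Y (at_chart t) t)) (at t within S)"
    unfolding e[OF assms(2)]
    by (rule has_vector_derivative_transform[OF assms(2) e has_covD[OF assms(1) chart_at(1) T_at]])
qed

lemma has_cov_Un: "has_cov X w t S \<Longrightarrow> has_cov X w t S' \<Longrightarrow> has_cov X w t (S \<union> S')"
  unfolding has_cov_def by (intro ballI impI has_vector_derivative_Un) auto

lemma has_cov_outside: "closed S \<Longrightarrow> t \<notin> S \<Longrightarrow> has_cov X w t S"
  unfolding has_cov_def by (intro ballI impI has_vector_derivative_outside) auto

lemma parallel_local_in_chart:
  assumes c: "c \<in> atlas M" and sub: "{a..b} \<subseteq> T c" and ab: "a \<le> b" and s: "s \<in> {a..b}"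
    and K: "\<And>t v. t \<in> {a..b} \<Longrightarrow> norm ((-1) *\<^sub>R \<Gamma> c (xc c t) (vc c t) v) \<le> K * norm v"
    and "2 * K * (b - a) < 1" "0 < K"
  shows "\<exists>X. X s = v \<and> parallel_on X {a..b}"
proof -
  note o = T_open[OF c]
  have sT: "s \<in> T c" using s sub by auto
  define A where "A = (\<lambda>t v. (-1) *\<^sub>R \<Gamma> c (xc c t) (vc c t) v)"
  have lin: "linear (A t)" if "t \<in> {a..b}" for t
    unfolding A_def using that sub by (intro linear_compose_scale_right christoffel_linear(1)[OF c xc_cim]) auto
  have cont: "continuous_on {a..b} (\<lambda>t. A t v)" for v
  proof -
    have "continuous_on (T c) (\<lambda>t. \<Gamma> c (xc c t) (vc c t) v)"
      using \<Gamma>_curve_Ck[OF c, of 0 "\<lambda>_. v"] by simp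
    from continuous_on_subset[OF this sub] show ?thesis unfolding A_def by (intro continuous_on_scaleR continuous_on_const)
  qed
  obtain y where y: "y s = coord_change (at_chart s) c (\<gamma> s) v" "\<forall>t\<in>{a..b}. (y has_vector_derivative A t (y t)) (at t within {a..b})"
  proof -
    have Ki: "norm (A t w) \<le> K * norm w" if "t \<in> {a..b}" for t w unfolding A_def by (rule K[OF that])
    have "\<exists>y. y s = coord_change (at_chart s) c (\<gamma> s) v \<and> (\<forall>t\<in>{a..b}. (y has_vector_derivative A t (y t)) (at t within {a..b}))"
      by (rule linear_ode_short[OF ab s lin cont Ki assms(6,7)])
    then show thesis using that by (elim exE conjE)
  qed
  define X where "X = (\<lambda>t. coord_change c (at_chart t) (\<gamma> t) (y t))"
  have fX: "fic X c t = y t" if "t \<in> T c" for t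
    unfolding field_in_chart_def X_def by (rule cc_inverse) (use c that chart_at in \<open>auto simp: T_def\<close>)
  have "X s = v" unfolding X_def y(1) by (rule cc_inverse) (use c sT chart_at in \<open>auto simp: T_def\<close>)
  moreover have "has_cov X 0 t {a..b}" if t: "t \<in> {a..b}" for t
  proof -
    have tT: "t \<in> T c" using t sub by auto
    have "(fic X c has_vector_derivative A t (y t)) (at t within {a..b})"
      using y(2)[rule_format, OF t] unfolding has_vector_derivative_def
      by (rule has_derivative_transform_within_open[OF _ o tT]) (rule fX[symmetric])
    then show ?thesis
      by (intro has_covI[OF c tT]) (simp add: linear_0[OF ccl[OF chart_at(1) c T_at tT]] fX[OF tT] A_def)
  qed
  ultimately show ?thesis unfolding parallel_on_def by auto
qed

text \<open>
  Uniformly in the subinterval around \<open>t\<close>: this is the local hypothesis for extending parallel fields by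
  bisection.
\<close>

lemma parallel_local:
  "\<exists>d>0. \<forall>a b. a \<le> t \<and> t \<le> b \<and> b - a < d \<longrightarrow> (\<forall>s\<in>{a..b}. \<forall>v. \<exists>X. X s = v \<and> parallel_on X {a..b})"
proof -
  let ?c = "at_chart t"
  note c = chart_at(1)[of "\<gamma> t"]
  obtain e where e: "0 < e" "cball t e \<subseteq> T ?c" using T_open[OF c] T_at[of t] open_contains_cball by blast
  let ?A = "\<lambda>t v. (-1) *\<^sub>R \<Gamma> ?c (xc ?c t) (vc ?c t) v"
  have ll: "linear (?A s)" if "s \<in> cball t e" for s
    using that e by (intro linear_compose_scale_right christoffel_linear(1)[OF c xc_cim]) auto
  have cc: "continuous_on (cball t e) (\<lambda>t. ?A t v)" for v
  proof -
    have "continuous_on (T ?c) (\<lambda>t. \<Gamma> ?c (xc ?c t) (vc ?c t) v)"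
      using \<Gamma>_curve_Ck[OF c, of 0 "\<lambda>_. v"] by simp
    from continuous_on_subset[OF this e(2)] show ?thesis by (intro continuous_on_scaleR continuous_on_const)
  qed
  obtain K where K: "0 < K" "\<And>s v. s \<in> cball t e \<Longrightarrow> norm (?A s v) \<le> K * norm v"
    using linear_family_bound[where A="?A", OF compact_cball ll cc] by auto
  show ?thesis
  proof (intro exI[of _ "min e (1 / (2 * K))"] conjI allI impI ballI)
    show "0 < min e (1 / (2 * K))" using e K by simp
    fix a b s v assume ab: "a \<le> t \<and> t \<le> b \<and> b - a < min e (1 / (2 * K))" and s: "s \<in> {a..b}"
    have sub: "{a..b} \<subseteq> cball t e"
    proof
      fix x assume "x \<in> {a..b}"
      then show "x \<in> cball t e" using ab by (auto simp: dist_real_def)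
    qed
    have "2 * K * (b - a) < 1" using ab K(1) by (simp add: field_simps)
    moreover have "a \<le> b" using ab by simp
    ultimately show "\<exists>X. X s = v \<and> parallel_on X {a..b}"
      by (intro parallel_local_in_chart[OF c subset_trans[OF sub e(2)] _ s K(2)] K(1)) (use sub in auto)
  qed
qed

text \<open>
  Bisection: parallel fields exist on short intervals, and two of them that agree at a common end point join.
\<close>

lemma parallel_on_interval:
  assumes "a \<le> b" "s \<in> {a..b}"
  shows "\<exists>X. X s = v \<and> parallel_on X {a..b}"
proof -
  have "\<forall>s\<in>{a..b}. \<forall>v. \<exists>X. X s = v \<and> parallel_on X {a..b}"
    using assms(1)
  proof (induction rule: Bolzano)
    case (trans a b c)
    show ?case
    proof (intro ballI allI)
      fix s v assume s: "s \<in> {a..c}"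
      have "\<exists>X Y. parallel_on X {a..b} \<and> parallel_on Y {b..c} \<and> X b = Y b \<and> (if s \<le> b then X s = v else Y s = v)"
      proof (cases "s \<le> b")
        case True
        then have "s \<in> {a..b}" using s by auto
        then obtain X where X: "X s = v" "parallel_on X {a..b}" using trans(1) by blast
        have "b \<in> {b..c}" using trans by auto
        then obtain Y where Y: "Y b = X b" "parallel_on Y {b..c}" using trans(2) by blast
        show ?thesis using X Y True by (intro exI[of _ X] exI[of _ Y]) auto
      next
        case False
        then have "s \<in> {b..c}" using s by auto
        then obtain Y where Y: "Y s = v" "parallel_on Y {b..c}" using trans(2) by blast
        have "b \<in> {a..b}" using trans by auto
        then obtain X where X: "X b = Y b" "parallel_on X {a..b}" using trans(1) by blast
        show ?thesis using X Y False by (intro exI[of _ X] exI[of _ Y]) auto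
      qed
      then obtain X Y where XY: "parallel_on X {a..b}" "parallel_on Y {b..c}" "X b = Y b" "if s \<le> b then X s = v else Y s = v"
        by blast
      define Z where "Z = (\<lambda>t. if t \<le> b then X t else Y t)"
      have Z1: "has_cov Z 0 t {a..b}" for t
      proof (cases "t \<in> {a..b}")
        case True
        then have "has_cov X 0 t {a..b}" using XY(1) by (auto simp: parallel_on_def)
        then show ?thesis by (rule has_cov_transform[OF _ True]) (auto simp: Z_def)
      qed (rule has_cov_outside, auto)
      have Z2: "has_cov Z 0 t {b..c}" for t
      proof (cases "t \<in> {b..c}")
        case True
        then have "has_cov Y 0 t {b..c}" using XY(2) by (auto simp: parallel_on_def)
        then show ?thesis by (rule has_cov_transform[OF _ True]) (use XY(3) in \<open>auto simp: Z_def\<close>)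
      qed (rule has_cov_outside, auto)
      have "{a..b} \<union> {b..c} = {a..c}" using trans by auto
      then have "parallel_on Z {a..c}" using has_cov_Un[OF Z1 Z2] unfolding parallel_on_def by simp
      moreover have "Z s = v" using XY(4) by (auto simp: Z_def split: if_splits)
      ultimately show "\<exists>X. X s = v \<and> parallel_on X {a..c}" by blast
    qed
  next
    case (local x)
    show ?case using parallel_local[of x] .
  qed
  then show ?thesis using assms(2) by blast
qed

lemma parallel_on_inner_const:
  assumes X: "parallel_on X S" and Y: "parallel_on Y S" and S: "convex S" "s \<in> S" "t \<in> S"
  shows "rmetric M (\<gamma> t) (X t) (Y t) = rmetric M (\<gamma> s) (X s) (Y s)"
proof -
  have "((\<lambda>t. rmetric M (\<gamma> t) (X t) (Y t)) has_real_derivative 0) (at t within S)" if "t \<in> S" for t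
    using product_rule[of X 0 t S Y 0] X Y that by (simp add: parallel_on_def rm_simps)
  from has_field_derivative_zero_constant[OF S(1) this] obtain k where "\<And>t. t \<in> S \<Longrightarrow> rmetric M (\<gamma> t) (X t) (Y t) = k" by blast
  then show ?thesis using S by simp
qed

text \<open>
  The difference of two parallel fields has constant length.
\<close>

lemma parallel_on_unique:
  assumes X: "parallel_on X S" and Y: "parallel_on Y S" and S: "convex S" "s \<in> S" "t \<in> S" and "X s = Y s"
  shows "X t = Y t"
proof (rule ccontr)
  assume ne: "X t \<noteq> Y t"
  have "parallel_on (\<lambda>t. X t + (-1) *\<^sub>R Y t) S"
    using X Y has_cov_add[OF _ has_cov_scale[of Y 0 _ S "-1"], of X 0] by (simp add: parallel_on_def)
  from parallel_on_inner_const[OF this this S]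
  have "rmetric M (\<gamma> t) (X t - Y t) (X t - Y t) = 0" using assms(6) by (simp add: rm_simps)
  moreover have "rmetric M (\<gamma> t) (X t - Y t) (X t - Y t) > 0" by (rule rm(3)) (use ne in simp)
  ultimately show False by simp
qed

lemma parallel_on_subset:
  assumes "parallel_on X S" "S' \<subseteq> S" shows "parallel_on X S'"
proof -
  have "has_cov X 0 t S'" if "t \<in> S'" for t
  proof -
    have "has_cov X 0 t S" using assms that by (auto simp: parallel_on_def)
    then show ?thesis unfolding has_cov_def by (intro ballI impI has_vector_derivative_within_subset[OF _ assms(2)]) simp
  qed
  then show ?thesis by (simp add: parallel_on_def)
qed

text \<open>
  The solutions on the growing intervals \<open>[s - n, s + n]\<close> agree where they overlap, by uniqueness, and together
  define a field on the whole line.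
\<close>

lemma parallel_transport: "\<exists>X. X s = v \<and> parallel_field M \<gamma> X"
proof -
  define J where "J = (\<lambda>n::nat. {s - real n .. s + real n})"
  have sJ: "s \<in> J n" for n by (simp add: J_def)
  have "\<exists>X. X s = v \<and> parallel_on X (J n)" for n
    unfolding J_def by (rule parallel_on_interval) auto
  then obtain X where X: "\<And>n. X n s = v" "\<And>n. parallel_on (X n) (J n)" by metis
  have Jm: "J m \<subseteq> J n" if "m \<le> n" for m n using that by (auto simp: J_def)
  have eq: "X m t = X n t" if "t \<in> J m" "m \<le> n" for m n t
    by (rule parallel_on_unique[OF X(2) parallel_on_subset[OF X(2) Jm[OF that(2)]] _ sJ that(1)]) (simp_all add: X J_def)
  define N where "N = (\<lambda>t. nat \<lceil>\<bar>t - s\<bar>\<rceil>)"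
  have N: "t \<in> J (N t)" for t
  proof -
    have "\<bar>t - s\<bar> \<le> real (N t)" unfolding N_def by linarith
    then show ?thesis by (auto simp: J_def)
  qed
  define Y where "Y = (\<lambda>t. X (N t) t)"
  have Y: "Y t = X n t" if "t \<in> J n" for n t
  proof (cases "N t \<le> n")
    case True then show ?thesis unfolding Y_def by (intro eq N)
  next
    case False then show ?thesis unfolding Y_def by (intro eq[symmetric] that) simp
  qed
  have "has_cov Y 0 t UNIV" for t
  proof -
    let ?n = "Suc (N t)"
    have t: "t \<in> interior (J ?n)" using N[of t] by (auto simp: J_def interior_atLeastAtMost_real)
    then have tJ: "t \<in> J ?n" using interior_subset by blast
    then have "has_cov (X ?n) 0 t (J ?n)" using X(2) by (simp add: parallel_on_def)
    then have "has_cov Y 0 t (J ?n)" by (rule has_cov_transform[OF _ tJ]) (rule Y[symmetric])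
    then show ?thesis unfolding has_cov_def at_within_interior[OF t] by simp
  qed
  then have "parallel_field M \<gamma> Y" by (rule parallelI)
  moreover have "Y s = v" using Y[OF sJ[of 0]] X(1) by simp
  ultimately show ?thesis by blast
qed

lemma parallel_field_on: "parallel_field M \<gamma> X \<Longrightarrow> parallel_on X UNIV"
  by (simp add: parallel_on_def parallelD)

text \<open>
  Gram--Schmidt, one basis vector at a time.
\<close>

lemma orthonormal_exists:
  "\<exists>e :: 'a \<Rightarrow> 'a. \<forall>i\<in>Basis. \<forall>j\<in>Basis. rmetric M p (e i) (e j) = (if i = j then 1 else 0)"
proof -
  have "\<exists>e :: 'a \<Rightarrow> 'a. \<forall>i\<in>F. \<forall>j\<in>F. rmetric M p (e i) (e j) = (if i = j then 1 else 0)"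
    if "finite F" "F \<subseteq> Basis" for F :: "'a set"
    using that
  proof (induction F rule: finite_induct)
    case empty then show ?case by simp
  next
    case (insert v F)
    then obtain e :: "'a \<Rightarrow> 'a" where e: "\<forall>i\<in>F. \<forall>j\<in>F. rmetric M p (e i) (e j) = (if i = j then 1 else 0)" by auto
    have "dim (span (e ` F)) \<le> card F" using insert.hyps by (simp add: dim_le_card' card_image_le order_trans[OF dim_le_card'])
    also have "card F < card (insert v F)" using insert.hyps by simp
    also have "\<dots> \<le> DIM('a)" by (rule card_mono) (use insert in auto)
    finally have "span (e ` F) \<noteq> UNIV" by (metis dim_UNIV less_irrefl)
    then obtain x where x: "x \<notin> span (e ` F)" by blast
    define n where "n = x - (\<Sum>i\<in>F. rmetric M p x (e i) *\<^sub>R e i)"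
    have "(\<Sum>i\<in>F. rmetric M p x (e i) *\<^sub>R e i) \<in> span (e ` F)" by (intro span_sum span_scale span_base) auto
    then have "n \<noteq> 0" using x by (auto simp: n_def)
    then have np: "rmetric M p n n > 0" by (rule rm(3))
    have no: "rmetric M p n (e j) = 0" if j: "j \<in> F" for j
    proof -
      have "rmetric M p (\<Sum>i\<in>F. rmetric M p x (e i) *\<^sub>R e i) (e j) = (\<Sum>i\<in>F. rmetric M p x (e i) * rmetric M p (e i) (e j))"
        by (simp add: linear_sum[OF rm_linear(2)] rm_simps)
      also have "\<dots> = (\<Sum>i\<in>F. if i = j then rmetric M p x (e i) else 0)"
        by (rule sum.cong) (use e j in auto)
      also have "\<dots> = rmetric M p x (e j)" using j insert.hyps by simp
      finally show ?thesis by (simp add: n_def rm_simps)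
    qed
    define m where "m = (1 / sqrt (rmetric M p n n)) *\<^sub>R n"
    have mm: "rmetric M p m m = 1" using np by (simp add: m_def rm_simps field_simps)
    have mo: "rmetric M p m (e j) = 0" "rmetric M p (e j) m = 0" if "j \<in> F" for j
      using no[OF that] rm(2)[of p "e j" m] by (simp_all add: m_def rm_simps)
    show ?case
      by (rule exI[of _ "e(v := m)"]) (use e mm mo insert.hyps in auto)
  qed
  from this[OF finite_Basis subset_refl] show ?thesis .
qed

lemma parallel_frame_exists:
  "\<exists>E :: 'a \<Rightarrow> real \<Rightarrow> 'a. \<forall>i\<in>Basis. parallel_field M \<gamma> (E i) \<and> (\<forall>j\<in>Basis. \<forall>t. rmetric M (\<gamma> t) (E i t) (E j t) = (if i = j then 1 else 0))"
proof -
  obtain e :: "'a \<Rightarrow> 'a" where e: "\<forall>i\<in>Basis. \<forall>j\<in>Basis. rmetric M (\<gamma> 0) (e i) (e j) = (if i = j then 1 else 0)"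
    using orthonormal_exists by blast
  have "\<forall>i. \<exists>X. X 0 = e i \<and> parallel_field M \<gamma> X" using parallel_transport by blast
  then obtain E where E: "\<And>i. E i 0 = e i" "\<And>i. parallel_field M \<gamma> (E i)" by metis
  have "rmetric M (\<gamma> t) (E i t) (E j t) = (if i = j then 1 else 0)" if "i \<in> Basis" "j \<in> Basis" for i j t
    using parallel_on_inner_const[OF parallel_field_on[OF E(2)] parallel_field_on[OF E(2)] convex_UNIV, of 0 t i j] e that E(1) by simp
  note on = this
  show ?thesis
  proof (intro exI[of _ E] ballI conjI allI)
    show "parallel_field M \<gamma> (E i)" for i by (rule E(2))
    show "rmetric M (\<gamma> t) (E i t) (E j t) = (if i = j then 1 else 0)" if "i \<in> Basis" "j \<in> Basis" for i j t
      by (rule on[OF that])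
  qed
qed

end


subsection \<open>Parallel frames\<close>

text \<open>
  A parallel orthonormal frame identifies all tangent spaces along the geodesic with one Euclidean space. Under this
  identification covariant derivatives become ordinary derivatives, parallel fields become constants, and the Jacobi
  equation becomes a linear second-order equation \<open>y'' = - R y\<close>.
\<close>

locale parallel_frame = geodesic_curve M \<gamma>
  for M :: "('m::{t2_space, second_countable_topology}, 'a::euclidean_space) metric_atlas" and \<gamma> +
  fixes E :: "'a \<Rightarrow> real \<Rightarrow> 'a"
  assumes E_parallel: "i \<in> Basis \<Longrightarrow> parallel_field M \<gamma> (E i)"
    and E_orthonormal: "i \<in> Basis \<Longrightarrow> j \<in> Basis \<Longrightarrow> rmetric M (\<gamma> t) (E i t) (E j t) = (if i = j then 1 else 0)"
begin

definition \<Phi> :: "real \<Rightarrow> 'a \<Rightarrow> 'a" where "\<Phi> t v = (\<Sum>b\<in>Basis. rmetric M (\<gamma> t) v (E b t) *\<^sub>R b)"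
definition \<Psi> :: "real \<Rightarrow> 'a \<Rightarrow> 'a" where "\<Psi> t y = (\<Sum>b\<in>Basis. (y \<bullet> b) *\<^sub>R E b t)"

lemma \<Phi>_inner: "b \<in> Basis \<Longrightarrow> \<Phi> t v \<bullet> b = rmetric M (\<gamma> t) v (E b t)"
  by (simp add: \<Phi>_def inner_sum_left_Basis)

lemma \<Phi>_linear: "linear (\<Phi> t)"
  by (rule linearI) (simp_all add: \<Phi>_def rm_simps scaleR_add_left sum.distrib scaleR_sum_right)

lemma \<Psi>_linear: "linear (\<Psi> t)"
  by (rule linearI) (simp_all add: \<Psi>_def inner_simps scaleR_add_left sum.distrib scaleR_sum_right)

lemma \<Phi>_\<Psi>: "\<Phi> t (\<Psi> t y) = y"
proof (rule euclidean_eqI)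
  fix b :: 'a assume b: "b \<in> Basis"
  have "\<Phi> t (\<Psi> t y) \<bullet> b = (\<Sum>i\<in>Basis. (y \<bullet> i) * rmetric M (\<gamma> t) (E i t) (E b t))"
    by (simp add: \<Phi>_inner[OF b] \<Psi>_def linear_sum[OF rm_linear(2)] rm_simps)
  also have "\<dots> = (\<Sum>i\<in>Basis. if i = b then y \<bullet> i else 0)"
    by (rule sum.cong) (use E_orthonormal b in auto)
  also have "\<dots> = y \<bullet> b" using b by simp
  finally show "\<Phi> t (\<Psi> t y) \<bullet> b = y \<bullet> b" .
qed

lemma \<Psi>_\<Phi>: "\<Psi> t (\<Phi> t v) = v"
proof -
  have "inj (\<Psi> t)" by (rule inj_on_inverseI[of _ "\<Phi> t"]) (rule \<Phi>_\<Psi>)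
  then have "surj (\<Psi> t)" using linear_injective_imp_surjective[OF \<Psi>_linear] by blast
  then obtain y where "v = \<Psi> t y" by (metis surjD)
  then show ?thesis by (simp add: \<Phi>_\<Psi>)
qed

lemma \<Phi>_isometry: "\<Phi> t u \<bullet> \<Phi> t v = rmetric M (\<gamma> t) u v"
proof -
  have "rmetric M (\<gamma> t) u (\<Psi> t (\<Phi> t v)) = (\<Sum>b\<in>Basis. (\<Phi> t v \<bullet> b) * (\<Phi> t u \<bullet> b))"
    by (simp add: \<Psi>_def[of t "\<Phi> t v"] linear_sum[OF rm_linear(1)] rm_simps \<Phi>_inner)
  also have "\<dots> = \<Phi> t u \<bullet> \<Phi> t v" by (subst euclidean_inner[of "\<Phi> t u"]) (simp only: mult.commute)
  finally show ?thesis by (simp only: \<Psi>_\<Phi>)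
qed

lemma \<Psi>_isometry: "rmetric M (\<gamma> t) (\<Psi> t u) (\<Psi> t v) = u \<bullet> v"
  using \<Phi>_isometry[of t "\<Psi> t u" "\<Psi> t v"] by (simp add: \<Phi>_\<Psi>)

lemma \<Phi>_deriv:
  assumes "has_cov X w t S"
  shows "((\<lambda>s. \<Phi> s (X s)) has_vector_derivative \<Phi> t w) (at t within S)"
proof -
  have "((\<lambda>s. rmetric M (\<gamma> s) (X s) (E b s)) has_vector_derivative rmetric M (\<gamma> t) w (E b t)) (at t within S)" if "b \<in> Basis" for b
  proof -
    have "has_cov (E b) 0 t S"
      unfolding has_cov_def
      by (intro ballI impI, rule has_vector_derivative_at_within, rule has_covD[OF parallelD[OF E_parallel[OF that]]])
    from product_rule[OF assms this] show ?thesis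
      unfolding has_real_derivative_iff_has_vector_derivative linear_0[OF rm_linear(1)] add_0_right .
  qed
  note 1 = this
  have "((\<lambda>s. rmetric M (\<gamma> s) (X s) (E b s) *\<^sub>R b) has_vector_derivative rmetric M (\<gamma> t) w (E b t) *\<^sub>R b) (at t within S)" if "b \<in> Basis" for b
    by (rule bounded_linear.has_vector_derivative[OF bounded_linear_scaleR_left 1[OF that]])
  then show ?thesis unfolding \<Phi>_def by (intro has_vector_derivative_sum)
qed

lemma \<Psi>_parallel: "parallel_field M \<gamma> (\<lambda>t. \<Psi> t y)"
proof (rule parallelI)
  fix t
  have "has_cov (\<lambda>t. \<Sum>b\<in>Basis. (y \<bullet> b) *\<^sub>R E b t) (\<Sum>b\<in>Basis. (y \<bullet> b) *\<^sub>R 0) t UNIV"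
    by (rule has_cov_sum[OF finite_Basis]) (rule has_cov_scale[OF parallelD[OF E_parallel]])
  then show "has_cov (\<lambda>t. \<Psi> t y) 0 t UNIV" unfolding \<Psi>_def scaleR_zero_right sum.neutral_const .
qed

definition Rf :: "real \<Rightarrow> 'a \<Rightarrow> 'a" where
  "Rf t y = \<Phi> t (curvature M (\<gamma> t) (\<Psi> t y) (vel t) (vel t))"

lemma Rf_linear: "linear (Rf t)"
proof -
  have "linear (\<Phi> t \<circ> ((\<lambda>u. curvature M (\<gamma> t) u (vel t) (vel t)) \<circ> \<Psi> t))"
    by (intro linear_compose \<Phi>_linear \<Psi>_linear curvature_linear)
  then show ?thesis by (simp add: Rf_def[abs_def] o_def)
qed

lemma curvature_curve_smooth:
  assumes c: "c \<in> atlas M" and u: "smooth_on (T c) u" and v: "smooth_on (T c) v" and w: "smooth_on (T c) w"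
  shows "smooth_on (T c) (\<lambda>t. Rc c (xc c t) (u t) (v t) (w t))"
proof -
  note o = T_open[OF c]
  have 0: "smooth_on (T c) (\<lambda>t. Rc c (xc c t) a b d)" for a b d
    by (rule smooth_on_compose[OF o chart_open(2)[OF c] xc_cim xc_smooth[OF c] Rc_smooth[OF c]])
  have 1: "smooth_on (T c) (\<lambda>t. Rc c (xc c t) (u t) b d)" for b d
    by (rule smooth_on_family_apply[where B="\<lambda>t a. Rc c (xc c t) a b d", OF o Rc_linear(1)[OF c xc_cim] 0 u])
  have 2: "smooth_on (T c) (\<lambda>t. Rc c (xc c t) (u t) (v t) d)" for d
    by (rule smooth_on_family_apply[where B="\<lambda>t b. Rc c (xc c t) (u t) b d", OF o Rc_linear(2)[OF c xc_cim] 1 v])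
  show ?thesis
    by (rule smooth_on_family_apply[where B="\<lambda>t d. Rc c (xc c t) (u t) (v t) d", OF o Rc_linear(3)[OF c xc_cim] 2 w])
qed

lemma metric_curve_smooth:
  assumes c: "c \<in> atlas M" and u: "smooth_on (T c) u" and v: "smooth_on (T c) v"
  shows "smooth_on (T c) (\<lambda>t. cm c (xc c t) (u t) (v t))"
proof -
  note o = T_open[OF c]
  have 0: "smooth_on (T c) (\<lambda>t. cm c (xc c t) a b)" for a b
    by (rule smooth_on_compose[OF o chart_open(2)[OF c] xc_cim xc_smooth[OF c] cm_smooth[OF c]])
  have 1: "smooth_on (T c) (\<lambda>t. cm c (xc c t) (u t) b)" for b
    by (rule smooth_on_family_apply[where B="\<lambda>t a. cm c (xc c t) a b", OF o cm_linear(2)[OF c xc_cim] 0 u])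
  show ?thesis
    by (rule smooth_on_family_apply[where B="\<lambda>t b. cm c (xc c t) (u t) b", OF o cm_linear(1)[OF c xc_cim] 1 v])
qed

text \<open>
  In a chart around the given time all ingredients are smooth, and the curvature does not depend on the chart.
\<close>

lemma Rf_continuous: "continuous_on UNIV (\<lambda>t. Rf t y)"
proof -
  have ct: "isCont (\<lambda>t. Rf t y) t0" for t0
  proof -
    let ?c = "at_chart t0"
    note c = chart_at(1)[of "\<gamma> t0"]
    have eq: "Rf t y \<bullet> b = cm ?c (xc ?c t) (Rc ?c (xc ?c t) (fic (\<lambda>t. \<Psi> t y) ?c t) (vc ?c t) (vc ?c t)) (fic (E b) ?c t)"
      if "b \<in> Basis" "t \<in> T ?c" for b t
    proof -
      have g: "\<gamma> t \<in> chart_dom ?c" using that by (simp add: T_def)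
      have "Rf t y \<bullet> b = cm ?c (xc ?c t) (fic (\<lambda>t. curvature M (\<gamma> t) (\<Psi> t y) (vel t) (vel t)) ?c t) (fic (E b) ?c t)"
        unfolding Rf_def \<Phi>_inner[OF that(1)] by (rule rm_fic[OF c that(2)])
      also have "fic (\<lambda>t. curvature M (\<gamma> t) (\<Psi> t y) (vel t) (vel t)) ?c t = Rc ?c (xc ?c t) (fic (\<lambda>t. \<Psi> t y) ?c t) (fic vel ?c t) (fic vel ?c t)"
        unfolding field_in_chart_def by (rule curvature_chart[OF c g])
      finally show ?thesis by (simp only: fic_vel[OF c that(2)])
    qed
    have "continuous_on (T ?c) (\<lambda>t. Rf t y \<bullet> b)" if b: "b \<in> Basis" for b
    proof -
      have s: "smooth_field_along M \<gamma> (\<lambda>t. \<Psi> t y)" "smooth_field_along M \<gamma> (E b)"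
        using \<Psi>_parallel E_parallel[OF b] by (simp_all add: parallel_field_def)
      have "smooth_on (T ?c) (\<lambda>t. cm ?c (xc ?c t) (Rc ?c (xc ?c t) (fic (\<lambda>t. \<Psi> t y) ?c t) (vc ?c t) (vc ?c t)) (fic (E b) ?c t))"
        by (rule metric_curve_smooth[OF c curvature_curve_smooth[OF c fic_smooth[OF s(1) c] vc_smooth[OF c] vc_smooth[OF c]] fic_smooth[OF s(2) c]])
      from smooth_on_continuous[OF this] show ?thesis by (rule continuous_on_eq) (rule eq[OF b, symmetric])
    qed
    then have "continuous_on (T ?c) (\<lambda>t. \<Sum>b\<in>Basis. (Rf t y \<bullet> b) *\<^sub>R b)"
      by (intro continuous_on_sum continuous_on_scaleR continuous_on_const)
    then have "continuous_on (T ?c) (\<lambda>t. Rf t y)" by (simp only: euclidean_representation)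
    then show ?thesis using T_open[OF c] T_at[of t0] by (simp add: continuous_on_eq_continuous_at)
  qed
  show ?thesis
    apply (rule continuous_at_imp_continuous_on)
    apply (rule ballI)
    apply (rule ct)
    done
qed

end

section \<open>Functions with continuous derivative at a point\<close>

text \<open>
  Differentiable near \<open>t\<close> with a derivative that is continuous at \<open>t\<close> only. This weak form is closed under division
  of \<open>C\<^sup>2\<close> functions by a simple zero, where nothing better is available without further derivatives.
\<close>

definition C1_at :: "real \<Rightarrow> (real \<Rightarrow> 'b::real_normed_vector) \<Rightarrow> bool" where
  "C1_at t f \<longleftrightarrow> (\<exists>U f'. open U \<and> t \<in> U \<and> (\<forall>s\<in>U. (f has_vector_derivative f' s) (at s)) \<and> isCont f' t)"

lemma C1_atI: "open U \<Longrightarrow> t \<in> U \<Longrightarrow> (\<And>s. s \<in> U \<Longrightarrow> (f has_vector_derivative f' s) (at s)) \<Longrightarrow> isCont f' t \<Longrightarrow> C1_at t f"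
  unfolding C1_at_def by (intro exI[of _ U] exI[of _ f']) simp

lemma C1_at_deriv:
  assumes "C1_at t f" shows "(f has_vector_derivative vector_derivative f (at t)) (at t)"
proof -
  obtain U f' where "open U" "t \<in> U" "\<forall>s\<in>U. (f has_vector_derivative f' s) (at s)"
    using assms unfolding C1_at_def by (elim exE conjE)
  then have "(f has_vector_derivative f' t) (at t)" by simp
  then show ?thesis using vector_derivative_at by metis
qed

lemma C1_at_isCont: "C1_at t f \<Longrightarrow> isCont f t"
  by (rule has_vector_derivative_continuous[OF C1_at_deriv])

lemma C1_at_deriv_isCont:
  assumes "C1_at t f" shows "isCont (\<lambda>s. vector_derivative f (at s)) t"
proof -
  obtain U f' where U: "open U" "t \<in> U" "\<forall>s\<in>U. (f has_vector_derivative f' s) (at s)" "isCont f' t"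
    using assms unfolding C1_at_def by (elim exE conjE)
  have "vector_derivative f (at s) = f' s" if "s \<in> U" for s
    using U(3) that by (simp add: vector_derivative_at)
  then have "\<forall>\<^sub>F s in nhds t. vector_derivative f (at s) = f' s"
    unfolding eventually_nhds using U(1,2) by (intro exI[of _ U]) simp
  then show ?thesis using U(4) by (simp add: isCont_cong)
qed

lemma C1_at_cong:
  assumes "C1_at t f" "\<forall>\<^sub>F s in nhds t. f s = g s" shows "C1_at t g"
proof -
  obtain U f' where U: "open U" "t \<in> U" "\<forall>s\<in>U. (f has_vector_derivative f' s) (at s)" "isCont f' t"
    using assms(1) unfolding C1_at_def by (elim exE conjE)
  obtain V where V: "open V" "t \<in> V" "\<forall>s\<in>V. f s = g s" using assms(2) unfolding eventually_nhds by (elim exE conjE)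
  show ?thesis
  proof (rule C1_atI[OF _ _ _ U(4)])
    show "open (U \<inter> V)" "t \<in> U \<inter> V" using U V by auto
    fix s assume "s \<in> U \<inter> V"
    then show "(g has_vector_derivative f' s) (at s)"
      using has_vector_derivative_transform_within_open[of f "f' s" s "V" g] U(3) V by auto
  qed
qed

lemma C1_at_const: "C1_at t (\<lambda>_. c)"
  by (rule C1_atI[OF open_UNIV, where f'="\<lambda>_. 0"]) simp_all

lemma C1_at_bilinear:
  assumes m: "bounded_bilinear m" and "C1_at t f" "C1_at t g" shows "C1_at t (\<lambda>s. m (f s) (g s))"
proof -
  obtain U f' where U: "open U" "t \<in> U" "\<forall>s\<in>U. (f has_vector_derivative f' s) (at s)" "isCont f' t"
    using assms(2) unfolding C1_at_def by (elim exE conjE)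
  obtain V g' where V: "open V" "t \<in> V" "\<forall>s\<in>V. (g has_vector_derivative g' s) (at s)" "isCont g' t"
    using assms(3) unfolding C1_at_def by (elim exE conjE)
  show ?thesis
  proof (rule C1_atI[of "U \<inter> V" _ _ "\<lambda>s. m (f s) (g' s) + m (f' s) (g s)"])
    show "open (U \<inter> V)" "t \<in> U \<inter> V" using U V by auto
    show "((\<lambda>s. m (f s) (g s)) has_vector_derivative m (f s) (g' s) + m (f' s) (g s)) (at s)" if "s \<in> U \<inter> V" for s
      by (rule bounded_bilinear.has_vector_derivative[OF m]) (use that U(3) V(3) in auto)
    show "isCont (\<lambda>s. m (f s) (g' s) + m (f' s) (g s)) t"
      by (intro isCont_add bounded_bilinear.isCont[OF m] C1_at_isCont assms U V)
  qed
qed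

lemma C1_at_add: assumes "C1_at t f" "C1_at t g" shows "C1_at t (\<lambda>s. f s + g s)"
proof -
  obtain U f' where U: "open U" "t \<in> U" "\<forall>s\<in>U. (f has_vector_derivative f' s) (at s)" "isCont f' t"
    using assms(1) unfolding C1_at_def by (elim exE conjE)
  obtain V g' where V: "open V" "t \<in> V" "\<forall>s\<in>V. (g has_vector_derivative g' s) (at s)" "isCont g' t"
    using assms(2) unfolding C1_at_def by (elim exE conjE)
  show ?thesis
  proof (rule C1_atI[of "U \<inter> V" _ _ "\<lambda>s. f' s + g' s"])
    show "open (U \<inter> V)" "t \<in> U \<inter> V" using U V by auto
    show "((\<lambda>s. f s + g s) has_vector_derivative f' s + g' s) (at s)" if "s \<in> U \<inter> V" for s
      by (rule has_vector_derivative_add) (use that U(3) V(3) in auto)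
    show "isCont (\<lambda>s. f' s + g' s) t" by (intro isCont_add U V)
  qed
qed

lemmas C1_at_scaleR = C1_at_bilinear[OF bounded_bilinear_scaleR]
lemmas C1_at_inner = C1_at_bilinear[OF bounded_bilinear_inner]
lemmas C1_at_mult = C1_at_bilinear[OF bounded_bilinear_mult]

lemma C1_at_sum: "(\<And>i. i \<in> B \<Longrightarrow> C1_at t (f i)) \<Longrightarrow> C1_at t (\<lambda>s. \<Sum>i\<in>B. f i s)"
  by (induction B rule: infinite_finite_induct) (auto intro: C1_at_const C1_at_add)

lemma C1_at_diff: assumes "C1_at t f" "C1_at t g" shows "C1_at t (\<lambda>s. f s - g s)"
  using C1_at_add[OF assms(1) C1_at_scaleR[OF C1_at_const[of t "-1"] assms(2)]] by simp

lemma C1_at_nonzero: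
  fixes f :: "real \<Rightarrow> real"
  assumes "C1_at t f" "f t \<noteq> 0" shows "\<forall>\<^sub>F s in nhds t. f s \<noteq> 0"
  using continuous_at_avoid[OF C1_at_isCont[OF assms(1)] assms(2)]
  by (auto simp: eventually_nhds_metric dist_commute)

lemma C1_at_inverse:
  fixes f :: "real \<Rightarrow> real"
  assumes "C1_at t f" "f t \<noteq> 0" shows "C1_at t (\<lambda>s. inverse (f s))"
proof -
  obtain U f' where U: "open U" "t \<in> U" "\<forall>s\<in>U. (f has_vector_derivative f' s) (at s)" "isCont f' t"
    using assms(1) unfolding C1_at_def by (elim exE conjE)
  obtain V where V: "open V" "t \<in> V" "\<forall>s\<in>V. f s \<noteq> 0"
    using C1_at_nonzero[OF assms] unfolding eventually_nhds by (elim exE conjE)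
  show ?thesis
  proof (rule C1_atI[of "U \<inter> V" _ _ "\<lambda>s. - (inverse (f s) * f' s * inverse (f s))"])
    show "open (U \<inter> V)" "t \<in> U \<inter> V" using U V by auto
    show "((\<lambda>s. inverse (f s)) has_vector_derivative - (inverse (f s) * f' s * inverse (f s))) (at s)" if s: "s \<in> U \<inter> V" for s
    proof -
      have "(f has_real_derivative f' s) (at s)" using U(3) s by (simp add: has_real_derivative_iff_has_vector_derivative)
      from DERIV_inverse'[OF this] V(3) s show ?thesis by (simp add: has_real_derivative_iff_has_vector_derivative)
    qed
    show "isCont (\<lambda>s. - (inverse (f s) * f' s * inverse (f s))) t"
      by (intro continuous_intros C1_at_isCont assms U)
  qed
qed

lemma germ_ring_C1: "germ_ring (C1_at t) t"
  by (unfold_locales; (rule C1_at_const | erule (1) C1_at_add | erule (1) C1_at_mult | erule (1) C1_at_inverse | erule (1) C1_at_nonzero))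

lemma C1_at_components:
  fixes f :: "real \<Rightarrow> 'b::euclidean_space"
  assumes "\<And>e. e \<in> Basis \<Longrightarrow> C1_at t (\<lambda>s. f s \<bullet> e)" shows "C1_at t f"
proof -
  have "C1_at t (\<lambda>s. \<Sum>e\<in>Basis. (f s \<bullet> e) *\<^sub>R e)"
    by (intro C1_at_sum C1_at_scaleR C1_at_const assms)
  then show ?thesis by (simp only: euclidean_representation)
qed

lemma C1_at_family_apply:
  fixes P :: "real \<Rightarrow> 'a::euclidean_space \<Rightarrow> 'b::real_normed_vector"
  assumes "\<And>s. linear (P s)" "\<And>b. C1_at t (\<lambda>s. P s b)" "C1_at t w"
  shows "C1_at t (\<lambda>s. P s (w s))"
proof -
  have "C1_at t (\<lambda>s. \<Sum>b\<in>Basis. (w s \<bullet> b) *\<^sub>R P s b)"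
    by (intro C1_at_sum C1_at_scaleR C1_at_inner C1_at_const assms)
  moreover have "(\<lambda>s. P s (w s)) = (\<lambda>s. \<Sum>b\<in>Basis. (w s \<bullet> b) *\<^sub>R P s b)"
    by (rule ext) (rule linear_basis_expand[OF assms(1)])
  ultimately show ?thesis by simp
qed

lemma isCont_family_apply:
  fixes P :: "real \<Rightarrow> 'a::euclidean_space \<Rightarrow> 'b::real_normed_vector"
  assumes "\<And>s. linear (P s)" "\<And>b. isCont (\<lambda>s. P s b) t" "isCont w t"
  shows "isCont (\<lambda>s. P s (w s)) t"
proof -
  have "isCont (\<lambda>s. \<Sum>b\<in>Basis. (w s \<bullet> b) *\<^sub>R P s b) t"
    by (intro continuous_intros assms)
  moreover have "(\<lambda>s. P s (w s)) = (\<lambda>s. \<Sum>b\<in>Basis. (w s \<bullet> b) *\<^sub>R P s b)"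
    by (rule ext) (rule linear_basis_expand[OF assms(1)])
  ultimately show ?thesis by simp
qed

text \<open>A zero of a \<open>C\<^sup>2\<close> function can be divided out.\<close>

lemma C1_at_quotient_real:
  fixes K :: "real \<Rightarrow> real"
  assumes 1: "\<And>s. (K has_real_derivative K1 s) (at s)" and 2: "\<And>s. (K1 has_real_derivative K2 s) (at s)"
    and c: "isCont K2 t" and z: "K t = 0"
  shows "C1_at t (\<lambda>s. if s = t then K1 t else K s / (s - t))"
proof (rule C1_atI[OF open_UNIV UNIV_I, where f'="\<lambda>s. if s = t then K2 t / 2 else (K1 s * (s - t) - K s) / (s - t)^2"])
  let ?q = "\<lambda>s. if s = t then K1 t else K s / (s - t)"
  let ?q' = "\<lambda>s. if s = t then K2 t / 2 else (K1 s * (s - t) - K s) / (s - t)^2"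
  have K0: "K \<midarrow>t\<rightarrow> 0" using DERIV_isCont[OF 1[of t]] z by (simp add: isCont_def)
  have K10: "K1 \<midarrow>t\<rightarrow> K1 t" using DERIV_isCont[OF 2[of t]] by (simp add: isCont_def)
  have st: "((\<lambda>s. s - t) \<longlongrightarrow> 0) (at t)" by (rule LIM_eq[THEN iffD2]) auto
  have ne: "\<forall>\<^sub>F s in at t. s \<noteq> t" by (simp add: eventually_at_filter)
  have lim1: "((\<lambda>s. (K s - K1 t * (s - t)) / (s - t)^2) \<longlongrightarrow> K2 t / 2) (at t)"
  proof (rule lhopital[where f'="\<lambda>s. K1 s - K1 t" and g'="\<lambda>s. 2 * (s - t)"])
    show "((\<lambda>s. K s - K1 t * (s - t)) \<longlongrightarrow> 0) (at t)" using tendsto_diff[OF K0 tendsto_mult[OF tendsto_const[of "K1 t"] st]] by simp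
    show "((\<lambda>s. (s - t)^2) \<longlongrightarrow> 0) (at t)" using tendsto_power[OF st, of 2] by simp
    show "\<forall>\<^sub>F s in at t. (s - t)^2 \<noteq> 0" using ne by eventually_elim simp
    show "\<forall>\<^sub>F s in at t. 2 * (s - t) \<noteq> 0" using ne by eventually_elim simp
    show "\<forall>\<^sub>F s in at t. ((\<lambda>s. K s - K1 t * (s - t)) has_real_derivative K1 s - K1 t) (at s)"
      by (rule always_eventually) (auto intro!: derivative_eq_intros 1)
    show "\<forall>\<^sub>F s in at t. ((\<lambda>s. (s - t)^2) has_real_derivative 2 * (s - t)) (at s)"
      by (rule always_eventually) (auto intro!: derivative_eq_intros)
    have "((\<lambda>s. (K1 s - K1 t) / (s - t)) \<longlongrightarrow> K2 t) (at t)" using 2[of t] by (simp add: has_field_derivative_iff)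
    from tendsto_mult[OF tendsto_const[of "1/2"] this]
    show "((\<lambda>s. (K1 s - K1 t) / (2 * (s - t))) \<longlongrightarrow> K2 t / 2) (at t)" by (simp add: field_simps)
  qed
  have lim2: "((\<lambda>s. (K1 s * (s - t) - K s) / (s - t)^2) \<longlongrightarrow> K2 t / 2) (at t)"
  proof (rule lhopital[where f'="\<lambda>s. K2 s * (s - t)" and g'="\<lambda>s. 2 * (s - t)"])
    show "((\<lambda>s. K1 s * (s - t) - K s) \<longlongrightarrow> 0) (at t)" using tendsto_diff[OF tendsto_mult[OF K10 st] K0] by simp
    show "((\<lambda>s. (s - t)^2) \<longlongrightarrow> 0) (at t)" using tendsto_power[OF st, of 2] by simp
    show "\<forall>\<^sub>F s in at t. (s - t)^2 \<noteq> 0" using ne by eventually_elim simp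
    show "\<forall>\<^sub>F s in at t. 2 * (s - t) \<noteq> 0" using ne by eventually_elim simp
    show "\<forall>\<^sub>F s in at t. ((\<lambda>s. K1 s * (s - t) - K s) has_real_derivative K2 s * (s - t)) (at s)"
      by (rule always_eventually) (auto intro!: derivative_eq_intros 1 2)
    show "\<forall>\<^sub>F s in at t. ((\<lambda>s. (s - t)^2) has_real_derivative 2 * (s - t)) (at s)"
      by (rule always_eventually) (auto intro!: derivative_eq_intros)
    have "((\<lambda>s. K2 s / 2) \<longlongrightarrow> K2 t / 2) (at t)" using c by (auto simp: isCont_def intro!: tendsto_intros)
    moreover have "K2 s / 2 = K2 s * (s - t) / (2 * (s - t))" if "s \<noteq> t" for s
      using that by (simp only: times_divide_times_eq[symmetric]) simp
    ultimately show "((\<lambda>s. K2 s * (s - t) / (2 * (s - t))) \<longlongrightarrow> K2 t / 2) (at t)"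
      using ne by (elim Lim_transform_eventually) (erule eventually_mono)
  qed
  show "(?q has_vector_derivative ?q' s) (at s)" for s
  proof (cases "s = t")
    case True
    have "((\<lambda>s. (?q s - ?q t) / (s - t)) \<longlongrightarrow> K2 t / 2) (at t)"
      by (rule Lim_transform_eventually[OF lim1])
        (use ne in \<open>eventually_elim, simp add: field_simps power2_eq_square\<close>)
    then show ?thesis using True by (simp add: has_real_derivative_iff_has_vector_derivative[symmetric] has_field_derivative_iff)
  next
    case False
    have "((\<lambda>s. K s / (s - t)) has_real_derivative (K1 s * (s - t) - K s) / (s - t)^2) (at s)"
      using False by (auto intro!: derivative_eq_intros 1 simp: power2_eq_square)
    then have "((\<lambda>s. K s / (s - t)) has_vector_derivative ?q' s) (at s)"
      using False by (simp add: has_real_derivative_iff_has_vector_derivative)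
    then show ?thesis
      by (rule has_vector_derivative_transform_within_open[of _ _ _ "- {t}"]) (use False in auto)
  qed
  have "(?q' \<longlongrightarrow> K2 t / 2) (at t)"
    by (rule Lim_transform_eventually[OF lim2]) (use ne in \<open>eventually_elim, simp\<close>)
  then show "isCont ?q' t" by (simp add: isCont_def)
qed

lemma C1_at_quotient:
  fixes K :: "real \<Rightarrow> 'b::euclidean_space"
  assumes 1: "\<And>s. (K has_vector_derivative K1 s) (at s)" and 2: "\<And>s. (K1 has_vector_derivative K2 s) (at s)"
    and c: "isCont K2 t" and z: "K t = 0"
  shows "C1_at t (\<lambda>s. if s = t then K1 t else (1 / (s - t)) *\<^sub>R K s)"
proof (rule C1_at_components)
  fix e :: 'b
  have d: "(f has_vector_derivative f') (at s) \<Longrightarrow> ((\<lambda>s. f s \<bullet> e) has_real_derivative f' \<bullet> e) (at s)" for f f' s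
    using bounded_linear.has_vector_derivative[OF bounded_linear_inner_left, of f f' "at s" e]
    by (simp add: has_real_derivative_iff_has_vector_derivative)
  have "C1_at t (\<lambda>s. if s = t then K1 t \<bullet> e else (K s \<bullet> e) / (s - t))"
    by (rule C1_at_quotient_real[OF d[OF 1] d[OF 2]]) (use c z in \<open>auto intro!: continuous_intros\<close>)
  moreover have "(\<lambda>s. (if s = t then K1 t else (1 / (s - t)) *\<^sub>R K s) \<bullet> e) = (\<lambda>s. if s = t then K1 t \<bullet> e else (K s \<bullet> e) / (s - t))"
    by (rule ext) simp
  ultimately show "C1_at t (\<lambda>s. (if s = t then K1 t else (1 / (s - t)) *\<^sub>R K s) \<bullet> e)" by simp
qed


section \<open>Orthogonal projections and traces\<close>

definition oproj :: "'a::euclidean_space set \<Rightarrow> 'a \<Rightarrow> 'a" where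
  "oproj U x = (THE y. y \<in> U \<and> (\<forall>z\<in>U. (x - y) \<bullet> z = 0))"

lemma oproj_eqI:
  assumes "subspace U" "y \<in> U" "\<And>z. z \<in> U \<Longrightarrow> (x - y) \<bullet> z = 0"
  shows "oproj U x = y"
  unfolding oproj_def
proof (rule the_equality)
  show "y \<in> U \<and> (\<forall>z\<in>U. (x - y) \<bullet> z = 0)" using assms by simp
  fix y' assume y': "y' \<in> U \<and> (\<forall>z\<in>U. (x - y') \<bullet> z = 0)"
  have "y' - y \<in> U" using y' assms by (simp add: subspace_diff)
  then have "(x - y) \<bullet> (y' - y) = 0" "(x - y') \<bullet> (y' - y) = 0" using assms(3) y' by auto
  then have "(y' - y) \<bullet> (y' - y) = 0" by (simp add: inner_simps)
  then show "y' = y" by simp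
qed

lemma oproj:
  assumes "subspace U"
  shows "oproj U x \<in> U" "z \<in> U \<Longrightarrow> (x - oproj U x) \<bullet> z = 0"
proof -
  obtain y w where y: "y \<in> span U" and w: "\<And>z. z \<in> span U \<Longrightarrow> orthogonal w z" and x: "x = y + w"
    using orthogonal_subspace_decomp_exists[of U x] by metis
  have U: "span U = U" using assms by (simp add: span_eq_iff)
  have "oproj U x = y"
    by (rule oproj_eqI[OF assms]) (use y w x U in \<open>auto simp: orthogonal_def\<close>)
  then show "oproj U x \<in> U" "z \<in> U \<Longrightarrow> (x - oproj U x) \<bullet> z = 0"
    using y w x U by (auto simp: orthogonal_def)
qed

lemma oproj_linear: assumes U: "subspace U" shows "linear (oproj U)"
proof (rule linearI)
  fix x y show "oproj U (x + y) = oproj U x + oproj U y"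
  proof (rule oproj_eqI[OF U])
    show "oproj U x + oproj U y \<in> U" by (intro subspace_add[OF U] oproj[OF U])
    show "(x + y - (oproj U x + oproj U y)) \<bullet> z = 0" if "z \<in> U" for z
      using oproj(2)[OF U that, of x] oproj(2)[OF U that, of y] by (simp add: inner_simps)
  qed
  fix r show "oproj U (r *\<^sub>R x) = r *\<^sub>R oproj U x"
  proof (rule oproj_eqI[OF U])
    show "r *\<^sub>R oproj U x \<in> U" by (intro subspace_scale[OF U] oproj[OF U])
    show "(r *\<^sub>R x - r *\<^sub>R oproj U x) \<bullet> z = 0" if "z \<in> U" for z
      using oproj(2)[OF U that, of x] by (simp add: inner_simps right_diff_distrib[symmetric])
  qed
qed

lemma oproj_id: "subspace U \<Longrightarrow> x \<in> U \<Longrightarrow> oproj U x = x"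
  by (rule oproj_eqI) auto

lemma oproj_sym: assumes U: "subspace U" shows "oproj U x \<bullet> y = x \<bullet> oproj U y"
  using oproj(2)[OF U oproj(1)[OF U, of y], of x] oproj(2)[OF U oproj(1)[OF U, of x], of y]
  by (simp add: inner_simps inner_commute)

lemma family_independent:
  assumes "finite B" "\<And>c i. (\<Sum>i\<in>B. c i *\<^sub>R q i) = 0 \<Longrightarrow> i \<in> B \<Longrightarrow> c i = 0"
  shows "inj_on q B" "independent (q ` B)"
proof -
  show inj: "inj_on q B"
  proof (rule inj_onI)
    fix i j assume ij: "i \<in> B" "j \<in> B" "q i = q j"
    show "i = j"
    proof (rule ccontr)
      assume "i \<noteq> j"
      let ?c = "\<lambda>k. if k = i then 1 else if k = j then -1 else 0 :: real"
      have "(\<Sum>k\<in>B. ?c k *\<^sub>R q k) = (\<Sum>k\<in>{i,j}. ?c k *\<^sub>R q k)"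
        by (rule sum.mono_neutral_right) (use assms(1) ij in auto)
      also have "\<dots> = 0" using \<open>i \<noteq> j\<close> ij(3) by simp
      finally show False using assms(2)[of ?c i] ij by simp
    qed
  qed
  show "independent (q ` B)"
    unfolding independent_explicit_module
  proof (intro allI impI)
    fix T u v assume T: "finite T" "T \<subseteq> q ` B" "(\<Sum>v\<in>T. u v *\<^sub>R v) = 0" "v \<in> T"
    obtain i where i: "i \<in> B" "v = q i" using T by auto
    let ?c = "\<lambda>k. if q k \<in> T then u (q k) else 0"
    have "(\<Sum>k\<in>B. ?c k *\<^sub>R q k) = (\<Sum>w\<in>q ` B. (if w \<in> T then u w else 0) *\<^sub>R w)"
      by (simp add: sum.reindex[OF inj])
    also have "\<dots> = (\<Sum>w\<in>T. (if w \<in> T then u w else 0) *\<^sub>R w)"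
      by (rule sum.mono_neutral_right) (use assms(1) T in auto)
    also have "\<dots> = (\<Sum>w\<in>T. u w *\<^sub>R w)" by (rule sum.cong) auto
    finally have "(\<Sum>k\<in>B. ?c k *\<^sub>R q k) = 0" using T by simp
    from assms(2)[OF this i(1)] show "u v = 0" using i T by simp
  qed
qed

text \<open>
  The dual vectors span \<open>U\<close> as well, so that orthogonality to \<open>U\<close> can be tested against them.
\<close>

lemma dual_frame_proj:
  fixes U :: "'a::euclidean_space set"
  assumes B: "finite B" and U: "subspace U" "dim U = card B"
    and q: "\<And>i. i \<in> B \<Longrightarrow> q i \<in> U" and d: "\<And>i. i \<in> B \<Longrightarrow> d i \<in> U"
    and dual: "\<And>i j. i \<in> B \<Longrightarrow> j \<in> B \<Longrightarrow> q i \<bullet> d j = (if i = j then 1 else 0)"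
  shows "oproj U x = (\<Sum>b\<in>B. (x \<bullet> d b) *\<^sub>R q b)"
proof (rule oproj_eqI[OF U(1)])
  show "(\<Sum>b\<in>B. (x \<bullet> d b) *\<^sub>R q b) \<in> U" by (intro subspace_sum[OF U(1)] subspace_scale[OF U(1)] q)
  have ind: "c i = 0" if "(\<Sum>i\<in>B. c i *\<^sub>R d i) = 0" "i \<in> B" for c i
  proof -
    have "q i \<bullet> (\<Sum>j\<in>B. c j *\<^sub>R d j) = (\<Sum>j\<in>B. c j * (q i \<bullet> d j))" by (simp add: inner_sum_right)
    also have "\<dots> = (\<Sum>j\<in>B. if j = i then c j else 0)" by (rule sum.cong) (use dual that(2) in auto)
    also have "\<dots> = c i" using B that by simp
    finally show ?thesis using that by simp
  qed
  have fi: "inj_on d B" "independent (d ` B)"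
    by (rule family_independent[OF B], erule ind, assumption)+
  have "dim U \<le> card (d ` B)" using card_image[OF fi(1)] U(2) by simp
  then have "U \<subseteq> span (d ` B)" by (intro card_ge_dim_independent) (use d fi in auto)
  fix z assume "z \<in> U"
  then have "z \<in> span (d ` B)" using \<open>U \<subseteq> span (d ` B)\<close> by auto
  then show "(x - (\<Sum>b\<in>B. (x \<bullet> d b) *\<^sub>R q b)) \<bullet> z = 0"
  proof (induction rule: span_induct)
    case base then show ?case by (simp add: subspace_def inner_simps)
  next
    case (step w)
    then obtain j where j: "j \<in> B" "w = d j" by auto
    have "(\<Sum>b\<in>B. (x \<bullet> d b) *\<^sub>R q b) \<bullet> d j = (\<Sum>b\<in>B. if b = j then x \<bullet> d b else 0)"
      unfolding inner_sum_left by (rule sum.cong) (use dual j in auto)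
    also have "\<dots> = x \<bullet> d j" using B j by simp
    finally show ?case by (simp add: j inner_simps)
  qed
qed

text \<open>
  The trace of a bilinear form is the same in every orthonormal basis; the standard basis is compared with \<open>B\<close>.
\<close>

lemma trace_orthonormal:
  fixes \<beta> :: "'a::euclidean_space \<Rightarrow> 'a \<Rightarrow> real"
  assumes l: "\<And>x. linear (\<beta> x)" "\<And>y. linear (\<lambda>x. \<beta> x y)"
    and B: "finite B" "pairwise orthogonal B" "\<And>x. x \<in> B \<Longrightarrow> norm x = 1" "span B = UNIV"
  shows "(\<Sum>b\<in>Basis. \<beta> b b) = (\<Sum>e\<in>B. \<beta> e e)"
proof -
  have ex: "(\<Sum>e\<in>B. (x \<bullet> e) *\<^sub>R e) = x" for x
    by (rule orthonormal_basis_expand) (use B in auto)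
  have on: "e \<bullet> e' = (if e = e' then 1 else 0)" if "e \<in> B" "e' \<in> B" for e e'
    using B(2) B(3)[OF that(1)] that by (auto simp: pairwise_def orthogonal_def norm_eq_1)
  have "(\<Sum>b\<in>Basis. \<beta> b b) = (\<Sum>b\<in>Basis. \<Sum>e\<in>B. \<Sum>e'\<in>B. (b \<bullet> e) * (b \<bullet> e') * \<beta> e e')"
  proof (rule sum.cong[OF refl])
    fix b :: 'a
    have "\<beta> b b = \<beta> (\<Sum>e\<in>B. (b \<bullet> e) *\<^sub>R e) (\<Sum>e\<in>B. (b \<bullet> e) *\<^sub>R e)" by (simp only: ex)
    also have "\<dots> = (\<Sum>e\<in>B. \<Sum>e'\<in>B. (b \<bullet> e) * (b \<bullet> e') * \<beta> e e')"
      unfolding linear_sum[OF l(2)] linear_sum[OF l(1)] linear_scale[OF l(1)] linear_scale[OF l(2)]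
      by (subst sum.swap) (simp add: sum_distrib_left mult_ac)
    finally show "\<beta> b b = (\<Sum>e\<in>B. \<Sum>e'\<in>B. (b \<bullet> e) * (b \<bullet> e') * \<beta> e e')" .
  qed
  also have "\<dots> = (\<Sum>e\<in>B. \<Sum>e'\<in>B. \<Sum>b\<in>Basis. (b \<bullet> e) * (b \<bullet> e') * \<beta> e e')"
    by (subst sum.swap) (intro sum.cong refl sum.swap)
  also have "\<dots> = (\<Sum>e\<in>B. \<Sum>e'\<in>B. (e \<bullet> e') * \<beta> e e')"
  proof (intro sum.cong refl)
    fix e e'
    have "(\<Sum>b\<in>Basis. (b \<bullet> e) * (b \<bullet> e') * \<beta> e e') = (\<Sum>b\<in>Basis. (e \<bullet> b) * (e' \<bullet> b)) * \<beta> e e'"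
      by (simp add: sum_distrib_right inner_commute)
    also have "(\<Sum>b\<in>Basis. (e \<bullet> b) * (e' \<bullet> b)) = e \<bullet> e'" by (rule euclidean_inner[symmetric])
    finally show "(\<Sum>b\<in>Basis. (b \<bullet> e) * (b \<bullet> e') * \<beta> e e') = (e \<bullet> e') * \<beta> e e'" .
  qed
  also have "\<dots> = (\<Sum>e\<in>B. \<Sum>e'\<in>B. if e' = e then \<beta> e e' else 0)"
    by (intro sum.cong refl) (use on in auto)
  also have "\<dots> = (\<Sum>e\<in>B. \<beta> e e)" using B(1) by simp
  finally show ?thesis .
qed

lemma orthonormal_basis_adapted:
  fixes H :: "'a::euclidean_space set"
  assumes H: "subspace H"
  obtains B C where "finite B" "finite C" "B \<subseteq> H" "span B = H" "card B = dim H" "B \<inter> C = {}"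
    "\<And>c h. c \<in> C \<Longrightarrow> h \<in> H \<Longrightarrow> c \<bullet> h = 0"
    "pairwise orthogonal (B \<union> C)" "\<And>x. x \<in> B \<union> C \<Longrightarrow> norm x = 1" "span (B \<union> C) = UNIV"
proof -
  obtain B where B: "B \<subseteq> H" "pairwise orthogonal B" "\<And>x. x \<in> B \<Longrightarrow> norm x = 1" "independent B" "card B = dim H" "span B = H"
    using orthonormal_basis_subspace[OF H] by metis
  let ?H' = "{x. \<forall>h\<in>H. x \<bullet> h = 0}"
  have H': "subspace ?H'" by (auto simp: subspace_def inner_simps)
  obtain C where C: "C \<subseteq> ?H'" "pairwise orthogonal C" "\<And>x. x \<in> C \<Longrightarrow> norm x = 1" "independent C" "card C = dim ?H'" "span C = ?H'"
    by (rule orthonormal_basis_subspace[OF H']) (rule that)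
  have bc: "c \<bullet> h = 0" if "c \<in> C" "h \<in> H" for c h using C(1) that by auto
  show thesis
  proof (rule that[of B C])
    show "finite B" "finite C" using B(4) C(4) by (simp_all add: finiteI_independent)
    show "B \<inter> C = {}"
    proof (rule ccontr)
      assume "B \<inter> C \<noteq> {}"
      then obtain x where "x \<in> B" "x \<in> C" by auto
      then have "x \<bullet> x = 0" using bc B(1) by blast
      then show False using B(3)[OF \<open>x \<in> B\<close>] by simp
    qed
    show "pairwise orthogonal (B \<union> C)"
    proof -
      have "c \<bullet> b = 0" "b \<bullet> c = 0" if "b \<in> B" "c \<in> C" for b c
        using bc[of c b] that B(1) by (auto simp: inner_commute)
      then show ?thesis using B(2) C(2) by (auto simp: pairwise_def orthogonal_def)
    qed
    show "span (B \<union> C) = UNIV"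
    proof -
      have "x \<in> span (B \<union> C)" for x
      proof -
        have "oproj H x \<in> span (B \<union> C)" using oproj(1)[OF H, of x] B(6) span_mono[of B "B \<union> C"] by auto
        moreover have "x - oproj H x \<in> span (B \<union> C)"
          using oproj(2)[OF H, of _ x] C(6) span_mono[of C "B \<union> C"] by auto
        ultimately show ?thesis using span_add[of "oproj H x" "B \<union> C" "x - oproj H x"] by simp
      qed
      then show ?thesis by auto
    qed
  qed (use B C bc in auto)
qed


section \<open>Monotonicity with exceptional points\<close>

text \<open>
  Riccati operators have poles, so that derivatives are only known near, but not at, certain times. Every time has a
  neighbourhood in which it is the only exceptional one; continuity bridges it, and bisection patches these
  neighbourhoods together.
\<close>

lemma decreasing_except:
  fixes f :: "real \<Rightarrow> real"
  assumes "a \<le> b" and c: "continuous_on {a..b} f"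
    and ev: "\<And>\<tau>. \<tau> \<in> {a..b} \<Longrightarrow> \<forall>\<^sub>F t in at \<tau>. a < t \<and> t < b \<longrightarrow> (\<exists>d. (f has_real_derivative d) (at t) \<and> d \<le> 0)"
  shows "f b \<le> f a"
proof -
  have "a \<le> a \<and> b \<le> b \<longrightarrow> f b \<le> f a"
    using assms(1)
  proof (induction rule: Bolzano[where P="\<lambda>x y. a \<le> x \<and> y \<le> b \<longrightarrow> f y \<le> f x"])
    case (trans x y z) then show ?case by auto
  next
    case (local \<tau>)
    then have "\<tau> \<in> {a..b}" by simp
    from ev[OF this] obtain e where e: "e > 0"
      and E: "\<forall>t. t \<noteq> \<tau> \<and> dist t \<tau> < e \<longrightarrow> a < t \<and> t < b \<longrightarrow> (\<exists>d. (f has_real_derivative d) (at t) \<and> d \<le> 0)"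
      unfolding eventually_at by auto
    have step: "f y \<le> f x" if "x \<le> y" "a \<le> x" "y \<le> b" "\<And>t. x < t \<Longrightarrow> t < y \<Longrightarrow> t \<noteq> \<tau> \<and> dist t \<tau> < e" for x y
    proof (rule DERIV_nonpos_imp_decreasing_open[OF that(1)])
      show "continuous_on {x..y} f" by (rule continuous_on_subset[OF c]) (use that in auto)
      fix t assume t: "x < t" "t < y"
      from that(4)[OF t] E t that(2,3) show "\<exists>d. (f has_real_derivative d) (at t) \<and> d \<le> 0" by auto
    qed
    show ?case
    proof (intro exI[of _ e] conjI allI impI e)
      fix x y assume xy: "x \<le> \<tau> \<and> \<tau> \<le> y \<and> y - x < e" and ab: "a \<le> x \<and> y \<le> b"
      have "f \<tau> \<le> f x" by (rule step) (use xy ab in \<open>auto simp: dist_real_def\<close>)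
      moreover have "f y \<le> f \<tau>" by (rule step) (use xy ab in \<open>auto simp: dist_real_def\<close>)
      ultimately show "f y \<le> f x" by simp
    qed
  qed
  then show ?thesis by simp
qed

lemma constant_except:
  fixes f :: "real \<Rightarrow> 'b::euclidean_space"
  assumes "a \<le> b" and c: "continuous_on {a..b} f"
    and ev: "\<And>\<tau>. \<tau> \<in> {a..b} \<Longrightarrow> \<forall>\<^sub>F t in at \<tau>. a < t \<and> t < b \<longrightarrow> (f has_vector_derivative 0) (at t)"
  shows "f b = f a"
proof (rule euclidean_eqI)
  fix e :: 'b
  have d: "((\<lambda>s. r * (f s \<bullet> e)) has_real_derivative 0) (at t)" if "(f has_vector_derivative 0) (at t)" for t r
    using bounded_linear.has_vector_derivative[OF bounded_linear_inner_left that, of e]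
    by (auto simp: has_real_derivative_iff_has_vector_derivative[symmetric] intro!: derivative_eq_intros)
  have "r * (f b \<bullet> e) \<le> r * (f a \<bullet> e)" for r
  proof (rule decreasing_except[OF assms(1)])
    show "continuous_on {a..b} (\<lambda>s. r * (f s \<bullet> e))" by (intro continuous_intros c)
    show "\<forall>\<^sub>F t in at \<tau>. a < t \<and> t < b \<longrightarrow> (\<exists>d. ((\<lambda>s. r * (f s \<bullet> e)) has_real_derivative d) (at t) \<and> d \<le> 0)" if "\<tau> \<in> {a..b}" for \<tau>
      using ev[OF that] by eventually_elim (use d in auto)
  qed
  from this[of 1] this[of "-1"] show "f b \<bullet> e = f a \<bullet> e" by simp
qed

lemma zero_except:
  fixes f :: "real \<Rightarrow> 'b::euclidean_space"
  assumes "a < b" and c: "continuous_on {a..b} f" and \<tau>: "\<tau> \<in> {a..b}"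
    and ev: "\<forall>\<^sub>F t in at \<tau>. a < t \<and> t < b \<longrightarrow> f t = 0"
  shows "f \<tau> = 0"
proof -
  have nb: "at \<tau> within {a<..<b} \<noteq> bot"
  proof -
    consider "\<tau> = a" | "\<tau> = b" | "\<tau> \<in> interior {a<..<b}" using \<tau> by fastforce
    then have "\<tau> islimpt {a<..<b}"
      by cases (simp_all add: islimpt_greaterThanLessThan1[OF assms(1)] islimpt_greaterThanLessThan2[OF assms(1)] interior_limit_point)
    then show ?thesis using trivial_limit_within[of \<tau> "{a<..<b}"] by simp
  qed
  have "(f \<longlongrightarrow> f \<tau>) (at \<tau> within {a..b})" using c \<tau> by (simp add: continuous_on_def)
  then have 1: "(f \<longlongrightarrow> f \<tau>) (at \<tau> within {a<..<b})" by (rule tendsto_within_subset) auto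
  have "\<forall>\<^sub>F t in at \<tau> within {a<..<b}. f t = 0"
    using ev unfolding eventually_at_filter by eventually_elim auto
  then have 2: "(f \<longlongrightarrow> 0) (at \<tau> within {a<..<b})" by (rule tendsto_eventually)
  show ?thesis by (rule tendsto_unique[OF nb 1 2])
qed

text \<open>
  Multiplied by \<open>exp (- C t)\<close> the function decreases, multiplied by \<open>exp (C t)\<close> it increases; the first serves
  times after \<open>s\<close>, the second times before \<open>s\<close>.
\<close>

lemma differential_inequality_zero:
  fixes F :: "real \<Rightarrow> real"
  assumes c: "continuous_on {a..b} F" and d: "\<And>t. a < t \<Longrightarrow> t < b \<Longrightarrow> \<exists>d. (F has_real_derivative d) (at t) \<and> \<bar>d\<bar> \<le> C * F t"
    and s: "s \<in> {a..b}" "F s = 0" and t: "t \<in> {a..b}"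
  shows "F t \<le> 0"
proof (cases "s \<le> t")
  case True
  have "F t * exp (- C * t) \<le> F s * exp (- C * s)"
  proof (rule DERIV_nonpos_imp_decreasing_open[OF True])
      show "continuous_on {s..t} (\<lambda>t. F t * exp (- C * t))"
        by (intro continuous_intros continuous_on_subset[OF c]) (use s t in auto)
      fix x assume x: "s < x" "x < t"
      obtain d where d: "(F has_real_derivative d) (at x)" "\<bar>d\<bar> \<le> C * F x" using d[of x] x s t by auto
      have "((\<lambda>t. F t * exp (- C * t)) has_real_derivative (d - C * F x) * exp (- C * x)) (at x)"
        by (auto intro!: derivative_eq_intros d(1) simp: algebra_simps)
      moreover have "(d - C * F x) * exp (- C * x) \<le> 0" using d(2) by (intro mult_nonpos_nonneg) auto
      ultimately show "\<exists>y. ((\<lambda>t. F t * exp (- C * t)) has_real_derivative y) (at x) \<and> y \<le> 0" by (intro exI conjI)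
  qed
  then show ?thesis using s(2) by (simp add: mult_le_0_iff)
next
  case False
  have "F t * exp (C * t) \<le> F s * exp (C * s)"
  proof (rule DERIV_nonneg_imp_increasing_open[where f="\<lambda>t. F t * exp (C * t)"])
    show "t \<le> s" using False by simp
    show "continuous_on {t..s} (\<lambda>t. F t * exp (C * t))"
      by (intro continuous_intros continuous_on_subset[OF c]) (use s t in auto)
    fix x assume x: "t < x" "x < s"
    obtain d where d: "(F has_real_derivative d) (at x)" "\<bar>d\<bar> \<le> C * F x" using d[of x] x s t by auto
    have "((\<lambda>t. F t * exp (C * t)) has_real_derivative (d + C * F x) * exp (C * x)) (at x)"
      by (auto intro!: derivative_eq_intros d(1) simp: algebra_simps)
    moreover have "(d + C * F x) * exp (C * x) \<ge> 0" using d(2) by (intro mult_nonneg_nonneg) auto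
    ultimately show "\<exists>y. ((\<lambda>t. F t * exp (C * t)) has_real_derivative y) (at x) \<and> y \<ge> 0" by (intro exI conjI)
  qed
  then show ?thesis using s(2) by (simp add: mult_le_0_iff)
qed

text \<open>
  The difference \<open>\<sigma> - lam\<close> satisfies \<open>(\<sigma> - lam)' \<le> - (\<sigma> + lam) (\<sigma> - lam)\<close>, so that it decreases after
  multiplication with the integrating factor \<open>exp (\<integral> \<sigma> + lam)\<close>. If it starts nonpositive and ends at zero, it
  must vanish throughout.
\<close>

lemma riccati_comparison:
  fixes \<sigma> lam :: "real \<Rightarrow> real"
  assumes ab: "a \<le> b" and c: "continuous_on {a..b} \<sigma>" and lam: "continuous_on {a..b} lam"
    and ev: "\<And>\<tau>. \<tau> \<in> {a..b} \<Longrightarrow> \<forall>\<^sub>F t in at \<tau>. a < t \<and> t < b \<longrightarrow> (\<exists>d. (\<sigma> has_real_derivative d) (at t) \<and> d \<le> - ((\<sigma> t)^2) - \<kappa>)"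
    and lam': "\<And>t. a < t \<Longrightarrow> t < b \<Longrightarrow> (lam has_real_derivative - ((lam t)^2) - \<kappa>) (at t)"
    and le: "\<sigma> a \<le> lam a"
  shows "\<sigma> b \<le> lam b" and "\<sigma> b = lam b \<Longrightarrow> t \<in> {a..b} \<Longrightarrow> \<sigma> t = lam t"
proof -
  define u where "u = (\<lambda>t. \<sigma> t + lam t)"
  have cu: "continuous_on {a..b} u" unfolding u_def by (intro continuous_on_add c lam)
  define U where "U = (\<lambda>t. integral {a..t} u)"
  have dU: "(U has_real_derivative u t) (at t)" if "a < t" "t < b" for t
  proof -
    have "(U has_vector_derivative u t) (at t within {a..b})"
      unfolding U_def by (rule integral_has_vector_derivative[OF cu]) (use that in auto)
    moreover have "at t within {a..b} = at t" by (rule at_within_interior) (use that in \<open>auto simp: interior_atLeastAtMost_real\<close>)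
    ultimately show ?thesis by (simp add: has_real_derivative_iff_has_vector_derivative)
  qed
  have cU: "continuous_on {a..b} U" unfolding U_def
    by (rule indefinite_integral_continuous_1[OF integrable_continuous_real[OF cu]])
  define p where "p = (\<lambda>t. exp (U t) * (\<sigma> t - lam t))"
  have cp: "continuous_on {a..b} p" unfolding p_def by (intro continuous_intros cU c lam)
  have dp: "\<exists>d. (p has_real_derivative d) (at t) \<and> d \<le> 0"
    if "a < t" "t < b" "(\<sigma> has_real_derivative d) (at t)" "d \<le> - ((\<sigma> t)^2) - \<kappa>" for t d
  proof -
    have "(p has_real_derivative exp (U t) * (u t * (\<sigma> t - lam t) + d - (- ((lam t)^2) - \<kappa>))) (at t)"
      unfolding p_def by (auto intro!: derivative_eq_intros dU lam' that simp: algebra_simps)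
    moreover have "u t * (\<sigma> t - lam t) + d - (- ((lam t)^2) - \<kappa>) \<le> 0"
      using that(4) by (simp add: u_def power2_eq_square algebra_simps)
    ultimately show ?thesis by (intro exI conjI) (assumption, simp add: mult_le_0_iff)
  qed
  have mono: "p y \<le> p x" if "a \<le> x" "x \<le> y" "y \<le> b" for x y
  proof (rule decreasing_except[OF that(2)])
    show "continuous_on {x..y} p" by (rule continuous_on_subset[OF cp]) (use that in auto)
    fix \<tau> assume "\<tau> \<in> {x..y}"
    then have "\<tau> \<in> {a..b}" using that by auto
    from ev[OF this] show "\<forall>\<^sub>F t in at \<tau>. x < t \<and> t < y \<longrightarrow> (\<exists>d. (p has_real_derivative d) (at t) \<and> d \<le> 0)"
      by eventually_elim (use that dp in auto)
  qed
  have pa: "p a \<le> 0" using le by (simp add: p_def mult_le_0_iff)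
  have "p b \<le> 0" using mono[of a b] ab pa by simp
  then show "\<sigma> b \<le> lam b" by (simp add: p_def mult_le_0_iff)
  assume eq: "\<sigma> b = lam b" and t: "t \<in> {a..b}"
  have "p b \<le> p t" "p t \<le> p a" using mono t by auto
  moreover have "p b = 0" using eq by (simp add: p_def)
  ultimately have "p t = 0" using pa by linarith
  then show "\<sigma> t = lam t" by (simp add: p_def)
qed

section \<open>Lagrangian families of solutions of the Jacobi equation in Euclidean space\<close>

lemma C1_dual_frame:
  fixes q :: "'i \<Rightarrow> real \<Rightarrow> 'b::euclidean_space"
  assumes B: "finite B" and q: "\<forall>i\<in>B. C1_at \<tau> (q i)"
    and ind: "\<forall>c. (\<Sum>i\<in>B. c i *\<^sub>R q i \<tau>) = 0 \<longrightarrow> (\<forall>i\<in>B. c i = 0)"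
  shows "\<exists>d. (\<forall>i\<in>B. C1_at \<tau> (d i)) \<and>
    (\<forall>\<^sub>F t in nhds \<tau>. \<forall>i\<in>B. \<forall>j\<in>B. q i t \<bullet> d j t = (if i = j then 1 else 0)) \<and>
    (\<forall>i\<in>B. \<forall>t. d i t \<in> span ((\<lambda>j. q j t) ` B))"
proof (rule germ_ring.local_dual_frame[OF germ_ring_C1 B, of \<tau> q])
  show "C1_at \<tau> (\<lambda>t. q i t \<bullet> e)" if "i \<in> B" for i e
    by (rule C1_at_inner[OF bspec[OF q that] C1_at_const])
  show "c i = 0" if "(\<Sum>i\<in>B. c i *\<^sub>R q i \<tau>) = 0" "i \<in> B" for c i using spec[OF ind, of c] that by simp
  fix d
  assume d: "\<And>i e. i \<in> B \<Longrightarrow> e \<in> Basis \<Longrightarrow> C1_at \<tau> (\<lambda>x. d i x \<bullet> e)"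
    "\<forall>\<^sub>F t in nhds \<tau>. \<forall>i\<in>B. \<forall>j\<in>B. q i t \<bullet> d j t = (if i = j then 1 else 0)"
    "\<And>i t. i \<in> B \<Longrightarrow> d i t \<in> span ((\<lambda>j. q j t) ` B)"
  show ?thesis
  proof (intro exI[of _ d] conjI ballI allI)
    show "C1_at \<tau> (d i)" if "i \<in> B" for i by (rule C1_at_components) (rule d(1)[OF that])
    show "d i t \<in> span ((\<lambda>j. q j t) ` B)" if "i \<in> B" for i t by (rule d(3)[OF that])
  qed (rule d(2))
qed

text \<open>
  The Jacobi equation in a parallel frame. A parameter \<open>z\<close> labels the solution \<open>t \<mapsto> \<phi> t z\<close> with derivative
  \<open>\<psi> t z\<close>; \<open>e0\<close> is the constant vector that represents the velocity of the geodesic, \<open>L\<close> is the Lagrangian space of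
  solutions and \<open>V\<close> the subspace that is divided out. Symmetry of \<open>R\<close> on the values of \<open>L\<close> follows from the
  Lagrangian condition by differentiation.
\<close>

locale jacobi_flow =
  fixes \<phi> \<psi> :: "real \<Rightarrow> 'p::euclidean_space \<Rightarrow> 'a::euclidean_space"
    and R :: "real \<Rightarrow> 'a \<Rightarrow> 'a" and e0 :: 'a and L V :: "'p set"
  assumes \<phi>_linear: "linear (\<phi> t)" and \<psi>_linear: "linear (\<psi> t)"
    and \<phi>_deriv: "((\<lambda>t. \<phi> t z) has_vector_derivative \<psi> t z) (at t)"
    and \<psi>_deriv: "((\<lambda>t. \<psi> t z) has_vector_derivative - R t (\<phi> t z)) (at t)"
    and R_linear: "linear (R t)" and R_cont: "continuous_on UNIV (\<lambda>t. R t v)"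
    and e0: "e0 \<bullet> e0 = 1"
    and L: "subspace L" and dim_L: "dim L = DIM('a) - 1"
    and perp: "z \<in> L \<Longrightarrow> \<phi> t z \<bullet> e0 = 0"
    and lagr: "z \<in> L \<Longrightarrow> z' \<in> L \<Longrightarrow> \<phi> t z \<bullet> \<psi> t z' = \<psi> t z \<bullet> \<phi> t z'"
    and nondeg: "z \<in> L \<Longrightarrow> (\<And>t. \<phi> t z = 0) \<Longrightarrow> z = 0"
    and V: "subspace V" and VL: "V \<subseteq> L"
begin

text \<open>
  Uniqueness for the linear equation: \<open>|y|\<^sup>2 + |y'|\<^sup>2\<close> changes at most at an exponential rate. The derivatives are
  taken within an interval, since the lemma is also applied to projections of solutions that are controlled only there.
\<close>

lemma jacobi_zero:
  assumes y: "\<And>t. t \<in> {a..b} \<Longrightarrow> (y has_vector_derivative w t) (at t within {a..b})"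
    and w: "\<And>t. t \<in> {a..b} \<Longrightarrow> (w has_vector_derivative - R t (y t)) (at t within {a..b})"
    and s: "s \<in> {a..b}" "y s = 0" "w s = 0" and t: "t \<in> {a..b}"
  shows "y t = 0"
proof -
  obtain K where K: "0 < K" "\<And>t v. t \<in> {a..b} \<Longrightarrow> norm (R t v) \<le> K * norm v"
    using linear_family_bound[where A=R and S="{a..b}", OF compact_Icc R_linear continuous_on_subset[OF R_cont]] by auto
  define F where "F = (\<lambda>t. y t \<bullet> y t + w t \<bullet> w t)"
  have cy: "continuous_on {a..b} y" "continuous_on {a..b} w"
    by (rule continuous_on_vector_derivative[OF y], simp) (rule continuous_on_vector_derivative[OF w], simp)
  have "F t \<le> 0"
  proof (rule differential_inequality_zero[OF _ _ s(1) _ t, of F "1 + K"])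
    show "continuous_on {a..b} F" unfolding F_def by (intro continuous_intros cy)
    show "F s = 0" using s by (simp add: F_def)
    fix t assume t: "a < t" "t < b"
    then have ti: "t \<in> {a..b}" and at: "at t within {a..b} = at t"
      by (auto intro!: at_within_interior simp: interior_atLeastAtMost_real)
    have "(F has_vector_derivative (y t \<bullet> w t + w t \<bullet> y t) + (w t \<bullet> (- R t (y t)) + (- R t (y t)) \<bullet> w t)) (at t)"
      unfolding F_def
      by (intro has_vector_derivative_add bounded_bilinear.has_vector_derivative[OF bounded_bilinear_inner] y[OF ti, unfolded at] w[OF ti, unfolded at])
    then have d: "(F has_real_derivative 2 * (y t \<bullet> w t) - 2 * (w t \<bullet> R t (y t))) (at t)"
      by (simp add: has_real_derivative_iff_has_vector_derivative inner_commute)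
    let ?n = "norm (y t) * norm (w t)"
    have "\<bar>y t \<bullet> w t\<bar> \<le> ?n" by (rule Cauchy_Schwarz_ineq2)
    moreover have "\<bar>w t \<bullet> R t (y t)\<bar> \<le> K * ?n"
      using order_trans[OF Cauchy_Schwarz_ineq2[of "w t" "R t (y t)"] mult_left_mono[OF K(2)[OF ti, of "y t"] norm_ge_zero]]
      by (simp add: mult_ac)
    ultimately have "\<bar>2 * (y t \<bullet> w t) - 2 * (w t \<bullet> R t (y t))\<bar> \<le> (1 + K) * (2 * ?n)" by (simp add: algebra_simps)
    also have "2 * ?n \<le> F t"
      using sum_squares_bound[of "norm (y t)" "norm (w t)"] by (simp add: F_def dot_square_norm)
    then have "(1 + K) * (2 * ?n) \<le> (1 + K) * F t" using K(1) by (intro mult_left_mono) auto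
    finally show "\<exists>d. (F has_real_derivative d) (at t) \<and> \<bar>d\<bar> \<le> (1 + K) * F t" using d by (intro exI conjI)
  qed
  moreover have "y t \<bullet> y t \<le> F t" by (simp add: F_def)
  ultimately have "y t \<bullet> y t = 0" using inner_ge_zero[of "y t"] by linarith
  then show ?thesis by simp
qed

lemma flow_inj: assumes z: "z \<in> L" "\<phi> t z = 0" "\<psi> t z = 0" shows "z = 0"
proof (rule nondeg[OF z(1)])
  fix u
  show "\<phi> u z = 0"
    by (rule jacobi_zero[where a="min t u" and b="max t u" and w="\<lambda>t. \<psi> t z" and s=t])
      (use z in \<open>auto intro: has_vector_derivative_at_within[OF \<phi>_deriv] has_vector_derivative_at_within[OF \<psi>_deriv]\<close>)
qed

definition N :: "'a set" where "N = {v. v \<bullet> e0 = 0}"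

lemma N_subspace: "subspace N" by (auto simp: N_def subspace_def inner_simps)

lemma dim_N: "dim N = DIM('a) - 1"
proof -
  have "e0 \<noteq> 0" using e0 by auto
  then have "dim (span {e0}) = 1" by simp
  moreover have "N = {y \<in> UNIV. \<forall>x\<in>span {e0}. orthogonal x y}"
    by (auto simp: N_def orthogonal_def span_singleton inner_commute)
  ultimately show ?thesis
    using dim_subspace_orthogonal_to_vectors[OF subspace_span subspace_UNIV, of "{e0}"] by simp
qed

lemma \<phi>_N: "z \<in> L \<Longrightarrow> \<phi> t z \<in> N" by (simp add: N_def perp)

lemma inner_deriv:
  "(f has_vector_derivative f') (at t) \<Longrightarrow> (g has_vector_derivative g') (at t) \<Longrightarrow>
    ((\<lambda>s. f s \<bullet> g s) has_vector_derivative f t \<bullet> g' + f' \<bullet> g t) (at t)"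
  by (rule bounded_bilinear.has_vector_derivative[OF bounded_bilinear_inner])

lemma \<psi>_N: assumes "z \<in> L" shows "\<psi> t z \<in> N"
proof -
  have "((\<lambda>s. \<phi> s z \<bullet> e0) has_vector_derivative \<phi> t z \<bullet> 0 + \<psi> t z \<bullet> e0) (at t)"
    by (rule inner_deriv[OF \<phi>_deriv has_vector_derivative_const])
  then have "((\<lambda>s. 0) has_vector_derivative \<psi> t z \<bullet> e0) (at t)" using perp[OF assms] by simp
  from vector_derivative_unique_at[OF this has_vector_derivative_const] show ?thesis by (simp add: N_def)
qed

lemma R_N: assumes "z \<in> L" shows "R t (\<phi> t z) \<in> N"
proof -
  have "((\<lambda>s. \<psi> s z \<bullet> e0) has_vector_derivative \<psi> t z \<bullet> 0 + (- R t (\<phi> t z)) \<bullet> e0) (at t)"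
    by (rule inner_deriv[OF \<psi>_deriv has_vector_derivative_const])
  then have "((\<lambda>s. 0) has_vector_derivative - (R t (\<phi> t z) \<bullet> e0)) (at t)" using \<psi>_N[OF assms] by (simp add: N_def)
  from vector_derivative_unique_at[OF this has_vector_derivative_const] show ?thesis by (simp add: N_def)
qed

text \<open>
  Differentiate \<open>lagr\<close>.
\<close>

lemma R_sym: assumes "z \<in> L" "z' \<in> L" shows "R t (\<phi> t z) \<bullet> \<phi> t z' = \<phi> t z \<bullet> R t (\<phi> t z')"
proof -
  have "((\<lambda>s. \<phi> s z \<bullet> \<psi> s z') has_vector_derivative \<phi> t z \<bullet> (- R t (\<phi> t z')) + \<psi> t z \<bullet> \<psi> t z') (at t)"
    by (rule inner_deriv[OF \<phi>_deriv \<psi>_deriv])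
  moreover have "((\<lambda>s. \<psi> s z \<bullet> \<phi> s z') has_vector_derivative \<psi> t z \<bullet> \<psi> t z' + (- R t (\<phi> t z)) \<bullet> \<phi> t z') (at t)"
    by (rule inner_deriv[OF \<psi>_deriv \<phi>_deriv])
  ultimately show ?thesis using vector_derivative_unique_at lagr[OF assms] by fastforce
qed


subsection \<open>The distribution of a space of solutions\<close>

definition distr :: "'p set \<Rightarrow> real \<Rightarrow> 'a set" where
  "distr U t = {\<phi> t u + \<psi> t v | u v. u \<in> U \<and> v \<in> U \<and> \<phi> t v = 0}"

lemma distrI: "u \<in> U \<Longrightarrow> v \<in> U \<Longrightarrow> \<phi> t v = 0 \<Longrightarrow> \<phi> t u + \<psi> t v \<in> distr U t"
  by (auto simp: distr_def)

lemma distr_\<phi>: "subspace U \<Longrightarrow> u \<in> U \<Longrightarrow> \<phi> t u \<in> distr U t"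
  using distrI[of u U 0 t] by (simp add: subspace_0 linear_0[OF \<phi>_linear] linear_0[OF \<psi>_linear])

lemma distr_\<psi>: "subspace U \<Longrightarrow> v \<in> U \<Longrightarrow> \<phi> t v = 0 \<Longrightarrow> \<psi> t v \<in> distr U t"
  using distrI[of 0 U v t] by (simp add: subspace_0 linear_0[OF \<phi>_linear])

lemma distr_subspace: assumes U: "subspace U" shows "subspace (distr U t)"
proof (rule subspaceI)
  show "0 \<in> distr U t" using distr_\<phi>[OF U subspace_0[OF U], of t] by (simp add: linear_0[OF \<phi>_linear])
next
  fix x y assume "x \<in> distr U t" "y \<in> distr U t"
  then obtain u v u' v' where x: "x = \<phi> t u + \<psi> t v" "u \<in> U" "v \<in> U" "\<phi> t v = 0"
    and y: "y = \<phi> t u' + \<psi> t v'" "u' \<in> U" "v' \<in> U" "\<phi> t v' = 0" unfolding distr_def by blast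
  have "x + y = \<phi> t (u + u') + \<psi> t (v + v')"
    by (simp add: x y linear_add[OF \<phi>_linear] linear_add[OF \<psi>_linear])
  also have "\<dots> \<in> distr U t" by (rule distrI) (use x y U in \<open>auto simp: subspace_add linear_add[OF \<phi>_linear]\<close>)
  finally show "x + y \<in> distr U t" .
next
  fix r x assume "x \<in> distr U t"
  then obtain u v where x: "x = \<phi> t u + \<psi> t v" "u \<in> U" "v \<in> U" "\<phi> t v = 0" unfolding distr_def by blast
  have "r *\<^sub>R x = \<phi> t (r *\<^sub>R u) + \<psi> t (r *\<^sub>R v)"
    by (simp add: x linear_scale[OF \<phi>_linear] linear_scale[OF \<psi>_linear] scaleR_add_right)
  also have "\<dots> \<in> distr U t" by (rule distrI) (use x U in \<open>auto simp: subspace_scale linear_scale[OF \<phi>_linear]\<close>)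
  finally show "r *\<^sub>R x \<in> distr U t" .
qed

lemma distr_sub_N: assumes "U \<subseteq> L" shows "distr U t \<subseteq> N"
proof
  fix x assume "x \<in> distr U t"
  then obtain u v where "x = \<phi> t u + \<psi> t v" "u \<in> U" "v \<in> U" unfolding distr_def by blast
  moreover from this have "u \<in> L" "v \<in> L" using assms by auto
  ultimately show "x \<in> N" using subspace_add[OF N_subspace \<phi>_N[of u t] \<psi>_N[of v t]] by simp
qed

lemma \<phi>_\<psi>_orth: "u \<in> L \<Longrightarrow> v \<in> L \<Longrightarrow> \<phi> t v = 0 \<Longrightarrow> \<phi> t u \<bullet> \<psi> t v = 0"
  by (simp add: lagr)

text \<open>Near a singular time \<open>\<tau>\<close> the distribution has a frame with continuous derivative: the solutions that vanish
  at \<open>\<tau>\<close> are divided by \<open>t - \<tau>\<close>.\<close>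

definition frame_at :: "'p set \<Rightarrow> real \<Rightarrow> 'p set \<Rightarrow> ('p \<Rightarrow> real \<Rightarrow> 'a) \<Rightarrow> bool" where
  "frame_at U \<tau> B q \<longleftrightarrow> finite B \<and> B \<subseteq> U \<and> card B = dim U \<and> span B = U \<and>
    (\<forall>b\<in>B. C1_at \<tau> (q b)) \<and> (\<forall>b\<in>B. \<forall>t. q b t \<in> distr U t) \<and>
    (\<forall>c. (\<Sum>b\<in>B. c b *\<^sub>R q b \<tau>) = 0 \<longrightarrow> (\<forall>b\<in>B. c b = 0)) \<and>
    (\<forall>b\<in>B. \<forall>t. t \<noteq> \<tau> \<longrightarrow> (\<exists>r. r \<noteq> 0 \<and> q b t = r *\<^sub>R \<phi> t b)) \<and>
    distr U \<tau> \<subseteq> span ((\<lambda>b. q b \<tau>) ` B)"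

text \<open>
  A basis of the solutions vanishing at \<open>\<tau>\<close> is extended to a basis of \<open>U\<close>. At \<open>\<tau>\<close> the derivatives of the former are
  orthogonal to the values of the latter, by the Lagrangian condition, so that no nontrivial combination vanishes.
\<close>

lemma adapted_frame:
  assumes U: "subspace U" "U \<subseteq> L"
  shows "\<exists>B q. frame_at U \<tau> B q"
proof -
  let ?Ker = "{v \<in> U. \<phi> \<tau> v = 0}"
  have Ker: "subspace ?Ker" using U(1) by (auto simp: subspace_def linear_0[OF \<phi>_linear] linear_add[OF \<phi>_linear] linear_scale[OF \<phi>_linear])
  obtain B0 where B0: "B0 \<subseteq> ?Ker" "independent B0" "?Ker \<subseteq> span B0" by (rule maximal_independent_subset)
  have "B0 \<subseteq> U" using B0(1) by auto
  then obtain B where B: "B0 \<subseteq> B" "B \<subseteq> U" "independent B" "U \<subseteq> span B"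
    using maximal_independent_subset_extend[OF _ B0(2)] by metis
  have fin: "finite B" "finite B0" using B(3) B0(2) by (simp_all add: finiteI_independent)
  have spB: "span B = U" using B(2,4) U(1) span_minimal by blast
  have spB0: "span B0 = ?Ker" using B0(1,3) Ker span_minimal by blast
  define q where "q = (\<lambda>b t. if b \<in> B0 then (if t = \<tau> then \<psi> \<tau> b else (1 / (t - \<tau>)) *\<^sub>R \<phi> t b) else \<phi> t b)"
  have C1\<phi>: "C1_at \<tau> (\<lambda>t. \<phi> t b)" for b
    by (rule C1_atI[OF open_UNIV UNIV_I \<phi>_deriv]) (rule has_vector_derivative_continuous[OF \<psi>_deriv])
  have Rc: "isCont (\<lambda>t. - R t (\<phi> t b)) \<tau>" for b
    using isCont_family_apply[where P=R, OF R_linear _ has_vector_derivative_continuous[OF \<phi>_deriv]] R_cont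
    by (intro continuous_minus) (simp add: continuous_on_eq_continuous_at)
  have C1: "C1_at \<tau> (q b)" if "b \<in> B" for b
  proof (cases "b \<in> B0")
    case True
    then have "\<phi> \<tau> b = 0" using B0(1) by auto
    from C1_at_quotient[OF \<phi>_deriv \<psi>_deriv Rc this] show ?thesis using True by (simp add: q_def)
  next
    case False then show ?thesis using C1\<phi> by (simp add: q_def)
  qed
  have inD: "q b t \<in> distr U t" if "b \<in> B" for b t
  proof -
    have b: "b \<in> U" using that B(2) by auto
    have "\<phi> \<tau> b = 0" if "b \<in> B0" using that B0(1) by auto
    then show ?thesis using distr_\<phi>[OF U(1) b, of t] distr_\<psi>[OF U(1) b, of \<tau>] subspace_scale[OF distr_subspace[OF U(1)] distr_\<phi>[OF U(1) b, of t]]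
      by (simp add: q_def)
  qed
  have q\<tau>: "(\<Sum>b\<in>B. c b *\<^sub>R q b \<tau>) = \<psi> \<tau> (\<Sum>b\<in>B0. c b *\<^sub>R b) + \<phi> \<tau> (\<Sum>b\<in>B - B0. c b *\<^sub>R b)" for c
  proof -
    have "(\<Sum>b\<in>B. c b *\<^sub>R q b \<tau>) = (\<Sum>b\<in>B - B0. c b *\<^sub>R q b \<tau>) + (\<Sum>b\<in>B0. c b *\<^sub>R q b \<tau>)"
      by (rule sum.subset_diff[OF B(1) fin(1)])
    also have "(\<Sum>b\<in>B - B0. c b *\<^sub>R q b \<tau>) = (\<Sum>b\<in>B - B0. c b *\<^sub>R \<phi> \<tau> b)" by (rule sum.cong) (auto simp: q_def)
    also have "(\<Sum>b\<in>B0. c b *\<^sub>R q b \<tau>) = (\<Sum>b\<in>B0. c b *\<^sub>R \<psi> \<tau> b)" by (rule sum.cong) (auto simp: q_def)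
    finally show ?thesis
      by (simp add: linear_sum[OF \<phi>_linear] linear_sum[OF \<psi>_linear] linear_scale[OF \<phi>_linear] linear_scale[OF \<psi>_linear])
  qed
  have ind: "c b = 0" if sum: "(\<Sum>b\<in>B. c b *\<^sub>R q b \<tau>) = 0" and b: "b \<in> B" for c b
  proof -
    define v where "v = (\<Sum>b\<in>B0. c b *\<^sub>R b)"
    define u where "u = (\<Sum>b\<in>B - B0. c b *\<^sub>R b)"
    have "v \<in> span B0" unfolding v_def by (intro span_sum span_scale span_base)
    then have v: "v \<in> U" "\<phi> \<tau> v = 0" using spB0 by auto
    have u: "u \<in> U" unfolding u_def using B(2) by (intro subspace_sum[OF U(1)] subspace_scale[OF U(1)]) auto
    have s: "\<psi> \<tau> v + \<phi> \<tau> u = 0" using sum q\<tau> by (simp add: u_def v_def)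
    have "\<phi> \<tau> u \<bullet> \<psi> \<tau> v = 0" using \<phi>_\<psi>_orth[of u v \<tau>] u v U(2) by auto
    then have "\<psi> \<tau> v \<bullet> \<psi> \<tau> v = (\<psi> \<tau> v + \<phi> \<tau> u) \<bullet> \<psi> \<tau> v" by (simp add: inner_simps)
    then have "\<psi> \<tau> v = 0" using s by simp
    then have "v = 0" using flow_inj[of v \<tau>] v U(2) by auto
    have "\<phi> \<tau> u = 0" using s \<open>\<psi> \<tau> v = 0\<close> by simp
    then have "u \<in> span B0" using u spB0 by auto
    then obtain d where d: "u = (\<Sum>b\<in>B0. d b *\<^sub>R b)" unfolding span_finite[OF fin(2)] by auto
    show ?thesis
    proof (cases "b \<in> B0")
      case True
      then show ?thesis using independentD[OF B0(2) fin(2) subset_refl] \<open>v = 0\<close> v_def by metis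
    next
      case False
      let ?c = "\<lambda>b. if b \<in> B0 then d b else - c b"
      have "(\<Sum>b\<in>B. ?c b *\<^sub>R b) = (\<Sum>b\<in>B - B0. ?c b *\<^sub>R b) + (\<Sum>b\<in>B0. ?c b *\<^sub>R b)"
        by (rule sum.subset_diff[OF B(1) fin(1)])
      also have "(\<Sum>b\<in>B - B0. ?c b *\<^sub>R b) = - u" unfolding u_def sum_negf[symmetric] by (rule sum.cong) auto
      also have "(\<Sum>b\<in>B0. ?c b *\<^sub>R b) = u" unfolding d by (rule sum.cong) auto
      finally have "(\<Sum>b\<in>B. ?c b *\<^sub>R b) = 0" by simp
      from independentD[OF B(3) fin(1) subset_refl this b] show ?thesis using False by simp
    qed
  qed
  have cov: "distr U \<tau> \<subseteq> span ((\<lambda>b. q b \<tau>) ` B)"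
  proof
    fix x assume "x \<in> distr U \<tau>"
    then obtain u v where x: "x = \<phi> \<tau> u + \<psi> \<tau> v" "u \<in> U" "v \<in> U" "\<phi> \<tau> v = 0" unfolding distr_def by blast
    have "u \<in> span B" "v \<in> span B0" using x spB spB0 by auto
    then obtain c d where c: "u = (\<Sum>b\<in>B. c b *\<^sub>R b)" and d: "v = (\<Sum>b\<in>B0. d b *\<^sub>R b)"
      unfolding span_finite[OF fin(1)] span_finite[OF fin(2)] by auto
    have "\<phi> \<tau> u = (\<Sum>b\<in>B. c b *\<^sub>R \<phi> \<tau> b)" by (simp add: c linear_sum[OF \<phi>_linear] linear_scale[OF \<phi>_linear])
    also have "\<dots> \<in> span ((\<lambda>b. q b \<tau>) ` B)"
    proof (intro span_sum span_scale)
      fix b assume b: "b \<in> B"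
      show "\<phi> \<tau> b \<in> span ((\<lambda>b. q b \<tau>) ` B)"
      proof (cases "b \<in> B0")
        case True then have "\<phi> \<tau> b = 0" using B0(1) by auto
        then show ?thesis by (simp add: span_zero)
      next
        case False then have "\<phi> \<tau> b = q b \<tau>" by (simp add: q_def)
        then show ?thesis using b by (auto intro: span_base)
      qed
    qed
    finally have 1: "\<phi> \<tau> u \<in> span ((\<lambda>b. q b \<tau>) ` B)" .
    have "\<psi> \<tau> v = (\<Sum>b\<in>B0. d b *\<^sub>R \<psi> \<tau> b)" by (simp add: d linear_sum[OF \<psi>_linear] linear_scale[OF \<psi>_linear])
    also have "\<dots> = (\<Sum>b\<in>B0. d b *\<^sub>R q b \<tau>)" by (rule sum.cong) (auto simp: q_def)
    also have "\<dots> \<in> span ((\<lambda>b. q b \<tau>) ` B)" using B(1) by (intro span_sum span_scale span_base) auto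
    finally show "x \<in> span ((\<lambda>b. q b \<tau>) ` B)" unfolding x(1) by (rule span_add[OF 1])
  qed
  have quo: "\<exists>r. r \<noteq> 0 \<and> q b t = r *\<^sub>R \<phi> t b" if "t \<noteq> \<tau>" for b t
  proof (cases "b \<in> B0")
    case True then show ?thesis using that by (intro exI[of _ "1 / (t - \<tau>)"]) (simp add: q_def)
  next
    case False then show ?thesis by (intro exI[of _ 1]) (simp add: q_def)
  qed
  have card: "card B = dim U" using B basis_card_eq_dim by blast
  show ?thesis unfolding frame_at_def
    by (intro exI[of _ B] exI[of _ q] conjI ballI allI impI fin B card spB C1 inD ind quo cov) assumption
qed

text \<open>
  The dimension of the distribution never drops: at a zero of a solution its derivative replaces the lost
  direction.
\<close>

lemma distr_dim: assumes U: "subspace U" "U \<subseteq> L" shows "dim (distr U t) = dim U"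
proof -
  obtain B q where F: "frame_at U t B q" using adapted_frame[OF U, of t] by (elim exE)
  have B: "finite B" "card B = dim U" "\<forall>b\<in>B. \<forall>s. q b s \<in> distr U s"
    "\<forall>c. (\<Sum>b\<in>B. c b *\<^sub>R q b t) = 0 \<longrightarrow> (\<forall>b\<in>B. c b = 0)" "distr U t \<subseteq> span ((\<lambda>b. q b t) ` B)"
    using F unfolding frame_at_def by - (elim conjE, assumption)+
  have fi: "inj_on (\<lambda>b. q b t) B" "independent ((\<lambda>b. q b t) ` B)"
    using family_independent[OF B(1), of "\<lambda>b. q b t"] B(4) by auto
  have "card ((\<lambda>b. q b t) ` B) = dim (distr U t)"
    by (rule basis_card_eq_dim[OF _ B(5) fi(2)]) (use B(3) in auto)
  then show ?thesis using B(2) card_image[OF fi(1)] by simp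
qed

lemma distr_L: "distr L t = N"
  using subspace_dim_equal[OF distr_subspace[OF L] N_subspace distr_sub_N[OF subset_refl]] distr_dim[OF L subset_refl] dim_L dim_N by simp

lemma oproj_distr_C1: assumes U: "subspace U" "U \<subseteq> L" shows "C1_at \<tau> (\<lambda>t. oproj (distr U t) x)"
proof -
  obtain B q where F: "frame_at U \<tau> B q" using adapted_frame[OF U, of \<tau>] by (elim exE)
  have B: "finite B" "card B = dim U" "\<forall>b\<in>B. C1_at \<tau> (q b)" "\<forall>b\<in>B. \<forall>s. q b s \<in> distr U s"
    "\<forall>c. (\<Sum>b\<in>B. c b *\<^sub>R q b \<tau>) = 0 \<longrightarrow> (\<forall>b\<in>B. c b = 0)"
    using F unfolding frame_at_def by - (elim conjE, assumption)+
  obtain d where d: "\<forall>i\<in>B. C1_at \<tau> (d i)"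
    "\<forall>\<^sub>F t in nhds \<tau>. \<forall>i\<in>B. \<forall>j\<in>B. q i t \<bullet> d j t = (if i = j then 1 else 0)"
    "\<forall>i\<in>B. \<forall>t. d i t \<in> span ((\<lambda>j. q j t) ` B)"
    using C1_dual_frame[OF B(1,3,5)] by (elim exE conjE)
  have "C1_at \<tau> (\<lambda>t. \<Sum>b\<in>B. (x \<bullet> d b t) *\<^sub>R q b t)"
    by (intro C1_at_sum C1_at_scaleR C1_at_inner C1_at_const) (use B(3) d(1) in auto)
  moreover have "\<forall>\<^sub>F t in nhds \<tau>. (\<Sum>b\<in>B. (x \<bullet> d b t) *\<^sub>R q b t) = oproj (distr U t) x"
    using d(2)
  proof (rule eventually_mono)
    fix t assume dual: "\<forall>i\<in>B. \<forall>j\<in>B. q i t \<bullet> d j t = (if i = j then 1 else 0)"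
    have "span ((\<lambda>j. q j t) ` B) \<subseteq> distr U t"
      by (rule span_minimal[OF _ distr_subspace[OF U(1)]]) (use B(4) in auto)
    then show "(\<Sum>b\<in>B. (x \<bullet> d b t) *\<^sub>R q b t) = oproj (distr U t) x"
      by (intro dual_frame_proj[symmetric] distr_subspace U B(1))
        (use dual B d(3) distr_dim[OF U] in auto)
  qed
  ultimately show ?thesis by (rule C1_at_cong)
qed

definition nonsing :: "real \<Rightarrow> bool" where "nonsing t \<longleftrightarrow> (\<forall>z\<in>L. \<phi> t z = 0 \<longrightarrow> z = 0)"

text \<open>
  Close to any time the adapted frame of \<open>L\<close> is independent, and away from that time its members are nonzero
  multiples of the solutions. Hence the times at which some solution of \<open>L\<close> vanishes are isolated.
\<close>

lemma nonsing_punctured: "\<forall>\<^sub>F t in at \<tau>. nonsing t"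
proof -
  obtain B q where F: "frame_at L \<tau> B q" using adapted_frame[OF L subset_refl, of \<tau>] by (elim exE)
  have B: "finite B" "span B = L" "\<forall>b\<in>B. C1_at \<tau> (q b)"
    "\<forall>c. (\<Sum>b\<in>B. c b *\<^sub>R q b \<tau>) = 0 \<longrightarrow> (\<forall>b\<in>B. c b = 0)"
    "\<forall>b\<in>B. \<forall>t. t \<noteq> \<tau> \<longrightarrow> (\<exists>r. r \<noteq> 0 \<and> q b t = r *\<^sub>R \<phi> t b)"
    using F unfolding frame_at_def by - (elim conjE, assumption)+
  obtain d where d: "\<forall>\<^sub>F t in nhds \<tau>. \<forall>i\<in>B. \<forall>j\<in>B. q i t \<bullet> d j t = (if i = j then 1 else 0)"
    using C1_dual_frame[OF B(1,3,4)] by (elim exE conjE)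
  then have "\<forall>\<^sub>F t in at \<tau>. t \<noteq> \<tau> \<and> (\<forall>i\<in>B. \<forall>j\<in>B. q i t \<bullet> d j t = (if i = j then 1 else 0))"
    unfolding eventually_at_filter by (rule eventually_mono) simp
  then show ?thesis
  proof (rule eventually_mono)
    fix t assume t: "t \<noteq> \<tau> \<and> (\<forall>i\<in>B. \<forall>j\<in>B. q i t \<bullet> d j t = (if i = j then 1 else 0))"
    have "z = 0" if z: "z \<in> L" "\<phi> t z = 0" for z
    proof -
      obtain c where c: "z = (\<Sum>b\<in>B. c b *\<^sub>R b)" using z(1) B(2) span_finite[OF B(1)] by auto
      have "c j = 0" if j: "j \<in> B" for j
      proof -
        have "\<forall>b\<in>B. \<exists>r. r \<noteq> 0 \<and> q b t = r *\<^sub>R \<phi> t b" using B(5) t by simp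
        from bchoice[OF this] obtain r where r: "\<forall>b\<in>B. r b \<noteq> 0 \<and> q b t = r b *\<^sub>R \<phi> t b" by (elim exE)
        have "0 = \<phi> t z \<bullet> d j t" using z by simp
        also have "\<dots> = (\<Sum>b\<in>B. c b * (\<phi> t b \<bullet> d j t))"
          by (simp add: c linear_sum[OF \<phi>_linear] linear_scale[OF \<phi>_linear] inner_sum_left)
        also have "\<dots> = (\<Sum>b\<in>B. if b = j then c b / r b else 0)"
        proof (rule sum.cong[OF refl])
          fix b assume b: "b \<in> B"
          then have "r b * (\<phi> t b \<bullet> d j t) = (if b = j then 1 else 0)" using r t j by (metis inner_scaleR_left)
          then have "\<phi> t b \<bullet> d j t = (if b = j then 1 / r b else 0)" using r b by (auto simp: field_simps split: if_splits)
          then show "c b * (\<phi> t b \<bullet> d j t) = (if b = j then c b / r b else 0)" by simp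
        qed
        also have "\<dots> = c j / r j" using j B(1) by simp
        finally show ?thesis using r j by simp
      qed
      then show ?thesis by (simp add: c)
    qed
    then show "nonsing t" by (simp add: nonsing_def)
  qed
qed


subsection \<open>The horizontal distribution\<close>

definition H :: "real \<Rightarrow> 'a set" where "H t = {v \<in> N. \<forall>w\<in>distr V t. v \<bullet> w = 0}"
definition PH :: "real \<Rightarrow> 'a \<Rightarrow> 'a" where "PH t x = x - (x \<bullet> e0) *\<^sub>R e0 - oproj (distr V t) x"
definition full :: "real \<Rightarrow> bool" where "full t \<longleftrightarrow> (\<forall>z\<in>L. \<phi> t z = 0 \<longrightarrow> z \<in> V)"

lemma H_subspace: "subspace (H t)"
  using N_subspace by (auto simp: H_def subspace_def inner_simps)

lemma H_N: "h \<in> H t \<Longrightarrow> h \<in> N" by (simp add: H_def)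

lemma PH_oproj: "oproj (H t) x = PH t x"
proof (rule oproj_eqI[OF H_subspace])
  note D = distr_subspace[OF V, of t]
  have DN: "w \<bullet> e0 = 0" if "w \<in> distr V t" for w using distr_sub_N[OF VL, of t] that by (auto simp: N_def)
  have pn: "oproj (distr V t) x \<bullet> e0 = 0" by (rule DN[OF oproj(1)[OF D]])
  show "PH t x \<in> H t"
  proof -
    have "PH t x \<bullet> w = 0" if "w \<in> distr V t" for w
      using oproj(2)[OF D that, of x] DN[OF that] by (simp add: PH_def inner_simps inner_commute[of e0])
    moreover have "PH t x \<bullet> e0 = 0" using pn e0 by (simp add: PH_def inner_simps)
    ultimately show ?thesis by (simp add: H_def N_def)
  qed
  fix z assume z: "z \<in> H t"
  have "e0 \<bullet> z = 0" using z by (simp add: H_def N_def inner_commute)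
  moreover have "z \<bullet> oproj (distr V t) x = 0" using z oproj(1)[OF D, of x] by (simp add: H_def)
  then have "oproj (distr V t) x \<bullet> z = 0" by (simp add: inner_commute)
  ultimately show "(x - PH t x) \<bullet> z = 0" by (simp add: PH_def inner_simps)
qed

lemma PH_linear: "linear (PH t)"
proof -
  have "PH t = oproj (H t)" by (rule ext) (simp add: PH_oproj)
  then show ?thesis using oproj_linear[OF H_subspace] by simp
qed

lemma PH_H: "PH t x \<in> H t" using oproj(1)[OF H_subspace, of t x] by (simp add: PH_oproj)
lemma PH_id: "x \<in> H t \<Longrightarrow> PH t x = x" using oproj_id[OF H_subspace, of x t] by (simp add: PH_oproj)
lemma PH_sym: "PH t x \<bullet> y = x \<bullet> PH t y" using oproj_sym[OF H_subspace, of t x y] by (simp add: PH_oproj)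
lemma PH_zeroI: "(\<And>h. h \<in> H t \<Longrightarrow> x \<bullet> h = 0) \<Longrightarrow> PH t x = 0"
  using oproj_eqI[OF H_subspace subspace_0[OF H_subspace], of t x] by (simp add: PH_oproj)
lemma PH_orth: "h \<in> H t \<Longrightarrow> PH t x \<bullet> h = x \<bullet> h" by (simp add: PH_sym PH_id)

lemma PH_distr: "w \<in> distr V t \<Longrightarrow> PH t w = 0"
  by (rule PH_zeroI) (simp add: H_def inner_commute)

lemma distr_iff: "x \<in> distr V t \<longleftrightarrow> x \<in> N \<and> PH t x = 0"
proof
  assume "x \<in> distr V t" then show "x \<in> N \<and> PH t x = 0" using PH_distr distr_sub_N[OF VL, of t] by auto
next
  assume "x \<in> N \<and> PH t x = 0"
  then have "x = oproj (distr V t) x" by (auto simp: PH_def N_def)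
  then show "x \<in> distr V t" using oproj(1)[OF distr_subspace[OF V], of t x] by simp
qed

lemma PH_C1: "C1_at \<tau> (\<lambda>t. PH t x)"
  unfolding PH_def by (intro C1_at_diff C1_at_const oproj_distr_C1 V VL)

lemma dim_H: "dim (H t) + dim V = dim L"
proof -
  have "H t = {y \<in> N. \<forall>x\<in>distr V t. orthogonal x y}" by (auto simp: H_def orthogonal_def inner_commute)
  with dim_subspace_orthogonal_to_vectors[OF distr_subspace[OF V] N_subspace distr_sub_N[OF VL], of t]
  show ?thesis using distr_dim[OF V VL] dim_N dim_L by simp
qed

definition DP :: "real \<Rightarrow> 'a \<Rightarrow> 'a" where "DP t x = vector_derivative (\<lambda>s. PH s x) (at t)"

lemma PH_deriv: "((\<lambda>s. PH s x) has_vector_derivative DP t x) (at t)"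
  unfolding DP_def by (rule C1_at_deriv[OF PH_C1])

lemma DP_linear: "linear (DP t)"
proof (rule linearI)
  fix x y
  have "((\<lambda>s. PH s (x + y)) has_vector_derivative DP t x + DP t y) (at t)"
    unfolding linear_add[OF PH_linear] by (rule has_vector_derivative_add[OF PH_deriv PH_deriv])
  from vector_derivative_unique_at[OF PH_deriv this] show "DP t (x + y) = DP t x + DP t y" .
  fix r
  have "((\<lambda>s. PH s (r *\<^sub>R x)) has_vector_derivative r *\<^sub>R DP t x) (at t)"
    unfolding linear_scale[OF PH_linear] by (rule bounded_linear.has_vector_derivative[OF bounded_linear_scaleR_right PH_deriv])
  from vector_derivative_unique_at[OF PH_deriv this] show "DP t (r *\<^sub>R x) = r *\<^sub>R DP t x" .
qed

lemma PH_apply_deriv: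
  assumes "(w has_vector_derivative w') (at t)"
  shows "((\<lambda>s. PH s (w s)) has_vector_derivative (DP t (w t) + PH t w')) (at t)"
proof -
  have "((\<lambda>s. PH s (w s)) has_derivative (\<lambda>u. u *\<^sub>R DP t (w t) + PH t (u *\<^sub>R w'))) (at t)"
    by (rule has_derivative_family_apply[where B=PH and B'="\<lambda>u b. u *\<^sub>R DP t b", OF open_UNIV UNIV_I PH_linear
      PH_deriv[unfolded has_vector_derivative_def] assms[unfolded has_vector_derivative_def]])
      (intro linear_compose_scale_right DP_linear)
  then show ?thesis by (simp add: has_vector_derivative_def linear_scale[OF PH_linear] scaleR_add_right)
qed

text \<open>Differentiate \<open>P\<^sup>2 = P\<close>.\<close>

lemma PH_DP_H: assumes "h \<in> H t" shows "PH t (DP t h) = 0"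
proof -
  have "((\<lambda>s. PH s (PH s h)) has_vector_derivative DP t (PH t h) + PH t (DP t h)) (at t)"
    by (rule PH_apply_deriv[OF PH_deriv])
  then have "((\<lambda>s. PH s h) has_vector_derivative DP t h + PH t (DP t h)) (at t)"
    by (simp add: PH_id[OF PH_H] PH_id[OF assms])
  from vector_derivative_unique_at[OF PH_deriv this] show ?thesis by simp
qed

text \<open>
  Only \<open>V\<close> contributes derivative directions at a time of full index, and these are orthogonal to the horizontal
  space.
\<close>

lemma lift_H: assumes "full t" "h \<in> H t" shows "\<exists>z\<in>L. \<phi> t z = h"
proof -
  have "h \<in> distr L t" using H_N[OF assms(2)] by (simp add: distr_L)
  then obtain u v where uv: "h = \<phi> t u + \<psi> t v" "u \<in> L" "v \<in> L" "\<phi> t v = 0" unfolding distr_def by blast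
  have "v \<in> V" using assms(1) uv by (simp add: full_def)
  then have "h \<bullet> \<psi> t v = 0" using assms(2) distr_\<psi>[OF V _ uv(4)] by (simp add: H_def)
  then have "\<psi> t v \<bullet> \<psi> t v = 0" using \<phi>_\<psi>_orth[OF uv(2-4)] uv(1) by (simp add: inner_simps)
  then show ?thesis using uv by auto
qed

lemma V_of_distr: assumes "full t" "k \<in> L" "\<phi> t k \<in> distr V t" shows "k \<in> V"
proof -
  obtain u v where uv: "\<phi> t k = \<phi> t u + \<psi> t v" "u \<in> V" "v \<in> V" "\<phi> t v = 0" using assms(3) unfolding distr_def by blast
  have ku: "k - u \<in> L" using assms(2) uv(2) VL L by (auto intro: subspace_diff)
  have e: "\<phi> t (k - u) = \<psi> t v" using uv(1) by (simp add: linear_diff[OF \<phi>_linear])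
  have "\<phi> t (k - u) \<bullet> \<psi> t v = 0" by (rule \<phi>_\<psi>_orth[OF ku _ uv(4)]) (use uv(3) VL in auto)
  then have "\<phi> t (k - u) = 0" using e by simp
  then have "k - u \<in> V" using assms(1) ku by (simp add: full_def)
  from subspace_add[OF V this uv(2)] show ?thesis by simp
qed


subsection \<open>The transverse Riccati operator and its trace\<close>

text \<open>
  The transverse Riccati operator, extended by zero from the horizontal space. Vectors of the horizontal space are
  values of solutions even at singular times, if the index is full there; the choice of the solution is immaterial
  after projecting its derivative.
\<close>

definition Sh :: "real \<Rightarrow> 'a \<Rightarrow> 'a" where "Sh t x = PH t (\<psi> t (SOME z. z \<in> L \<and> \<phi> t z = PH t x))"
definition tr :: "real \<Rightarrow> real" where "tr t = (\<Sum>b\<in>Basis. Sh t b \<bullet> b)"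

lemma PH_\<psi>_eq: assumes "full t" "z \<in> L" "z' \<in> L" "\<phi> t z = \<phi> t z'" shows "PH t (\<psi> t z) = PH t (\<psi> t z')"
proof -
  have d: "z - z' \<in> L" "\<phi> t (z - z') = 0" using assms L by (auto simp: subspace_diff linear_diff[OF \<phi>_linear])
  then have "z - z' \<in> V" using assms(1) by (simp add: full_def)
  from PH_distr[OF distr_\<psi>[OF V this d(2)]] show ?thesis by (simp add: linear_diff[OF \<psi>_linear] linear_diff[OF PH_linear])
qed

lemma Sh_eq: assumes "full t" "z \<in> L" "\<phi> t z = PH t x" shows "Sh t x = PH t (\<psi> t z)"
proof -
  have "\<exists>z. z \<in> L \<and> \<phi> t z = PH t x" using assms by auto
  from someI_ex[OF this] show ?thesis unfolding Sh_def by (intro PH_\<psi>_eq assms) (use assms in auto)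
qed

lemma Sh_linear: assumes f: "full t" shows "linear (Sh t)"
proof (rule linearI)
  fix x y
  obtain z w where z: "z \<in> L" "\<phi> t z = PH t x" and w: "w \<in> L" "\<phi> t w = PH t y" using lift_H[OF f PH_H] by metis
  have "Sh t (x + y) = PH t (\<psi> t (z + w))"
    by (rule Sh_eq[OF f]) (use z w L in \<open>auto simp: subspace_add linear_add[OF \<phi>_linear] linear_add[OF PH_linear]\<close>)
  then show "Sh t (x + y) = Sh t x + Sh t y"
    by (simp add: Sh_eq[OF f z] Sh_eq[OF f w] linear_add[OF \<psi>_linear] linear_add[OF PH_linear])
next
  fix r x
  obtain z where z: "z \<in> L" "\<phi> t z = PH t x" using lift_H[OF f PH_H] by metis
  have "Sh t (r *\<^sub>R x) = PH t (\<psi> t (r *\<^sub>R z))"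
    by (rule Sh_eq[OF f]) (use z L in \<open>auto simp: subspace_scale linear_scale[OF \<phi>_linear] linear_scale[OF PH_linear]\<close>)
  then show "Sh t (r *\<^sub>R x) = r *\<^sub>R Sh t x"
    by (simp add: Sh_eq[OF f z] linear_scale[OF \<psi>_linear] linear_scale[OF PH_linear])
qed

lemma Sh_PH: "Sh t (PH t x) = Sh t x" by (simp add: Sh_def PH_id[OF PH_H])

text \<open>
  Modulo \<open>V\<close> every solution has a horizontal representative with the same transverse component
  \<open>s \<mapsto> PH s (\<phi> s z)\<close>, and the transverse Riccati operator is the logarithmic derivative of these components.
\<close>

lemma Sh_transverse:
  assumes f: "full t" and z: "z \<in> L" and Y': "((\<lambda>s. PH s (\<phi> s z)) has_vector_derivative Y') (at t)"
  shows "Sh t (PH t (\<phi> t z)) = PH t Y'"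
proof -
  let ?h = "PH t (\<phi> t z)"
  obtain m where m: "m \<in> L" "\<phi> t m = ?h" using lift_H[OF f PH_H] by metis
  have k: "z - m \<in> L" using z m L by (simp add: subspace_diff)
  have "\<phi> t (z - m) \<in> distr V t"
    unfolding distr_iff
  proof
    show "\<phi> t (z - m) \<in> N" by (rule \<phi>_N[OF k])
    show "PH t (\<phi> t (z - m)) = 0" by (simp add: linear_diff[OF \<phi>_linear] m(2) linear_diff[OF PH_linear] PH_id[OF PH_H])
  qed
  then have kV: "z - m \<in> V" by (rule V_of_distr[OF f k])
  have "PH s (\<phi> s z) = PH s (\<phi> s m)" for s
    using PH_distr[OF distr_\<phi>[OF V kV, of s]] by (simp add: linear_diff[OF \<phi>_linear] linear_diff[OF PH_linear])
  then have "((\<lambda>s. PH s (\<phi> s z)) has_vector_derivative DP t (\<phi> t m) + PH t (\<psi> t m)) (at t)"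
    using PH_apply_deriv[OF \<phi>_deriv, of m t] by simp
  from vector_derivative_unique_at[OF Y' this] have "PH t Y' = PH t (\<psi> t m)"
    by (simp add: m(2) linear_add[OF PH_linear] PH_DP_H[OF PH_H] PH_id[OF PH_H])
  then show ?thesis using Sh_eq[OF f m(1), of ?h] m(2) by (simp add: PH_id[OF PH_H])
qed

text \<open>
  The transverse components of solutions form a \<open>C\<^sup>1\<close> frame of the horizontal spaces near \<open>\<tau>\<close>, also when \<open>\<tau>\<close> is
  singular. Expressed in this frame the transverse Riccati operator is continuous: unlike the full one it has no poles
  where the index is full.
\<close>

lemma tr_continuous:
  assumes I: "\<And>t. t \<in> I \<Longrightarrow> full t" and \<tau>: "\<tau> \<in> I"
  shows "continuous (at \<tau> within I) tr"
proof -
  obtain B where B: "finite B" "B \<subseteq> H \<tau>" "card B = dim (H \<tau>)" "independent B"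
    using basis_exists[of "H \<tau>"] finiteI_independent by metis
  have "\<forall>e\<in>B. \<exists>z\<in>L. \<phi> \<tau> z = e" using lift_H[OF I[OF \<tau>]] B(2) by auto
  then obtain zz where zz: "\<And>e. e \<in> B \<Longrightarrow> zz e \<in> L" "\<And>e. e \<in> B \<Longrightarrow> \<phi> \<tau> (zz e) = e" by metis
  define Y where "Y = (\<lambda>e t. PH t (\<phi> t (zz e)))"
  have C1\<phi>: "C1_at \<tau> (\<lambda>t. \<phi> t b)" for b
    by (rule C1_atI[OF open_UNIV UNIV_I \<phi>_deriv]) (rule has_vector_derivative_continuous[OF \<psi>_deriv])
  have C1Y: "C1_at \<tau> (Y e)" for e
    unfolding Y_def by (rule C1_at_family_apply[OF PH_linear PH_C1 C1\<phi>])
  have dY: "(Y e has_vector_derivative vector_derivative (Y e) (at t)) (at t)" for e t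
  proof -
    have "(Y e has_vector_derivative DP t (\<phi> t (zz e)) + PH t (\<psi> t (zz e))) (at t)"
      unfolding Y_def by (rule PH_apply_deriv[OF \<phi>_deriv])
    then show ?thesis using vector_derivative_at by metis
  qed
  have Y\<tau>: "Y e \<tau> = e" if "e \<in> B" for e using zz(2)[OF that] B(2) that by (auto simp: Y_def intro: PH_id)
  have ind: "\<forall>c. (\<Sum>e\<in>B. c e *\<^sub>R Y e \<tau>) = 0 \<longrightarrow> (\<forall>e\<in>B. c e = 0)"
  proof (intro allI impI ballI)
    fix c e assume "(\<Sum>e\<in>B. c e *\<^sub>R Y e \<tau>) = 0" "e \<in> B"
    then have "(\<Sum>e\<in>B. c e *\<^sub>R e) = 0" using Y\<tau> by simp
    from independentD[OF B(4) B(1) subset_refl this \<open>e \<in> B\<close>] show "c e = 0" .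
  qed
  have C1Y': "\<forall>e\<in>B. C1_at \<tau> (Y e)" using C1Y by simp
  obtain D where D: "\<forall>i\<in>B. C1_at \<tau> (D i)"
    "\<forall>\<^sub>F t in nhds \<tau>. \<forall>i\<in>B. \<forall>j\<in>B. Y i t \<bullet> D j t = (if i = j then 1 else 0)"
    "\<forall>i\<in>B. \<forall>t. D i t \<in> span ((\<lambda>j. Y j t) ` B)"
    using C1_dual_frame[OF B(1) C1Y' ind] by (elim exE conjE)
  define G where "G = (\<lambda>t. \<Sum>b\<in>Basis. (\<Sum>e\<in>B. (b \<bullet> D e t) *\<^sub>R PH t (vector_derivative (Y e) (at t))) \<bullet> b)"
  have cG: "isCont G \<tau>"
  proof -
    have "isCont (\<lambda>t. PH t (vector_derivative (Y e) (at t))) \<tau>" for e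
      by (rule isCont_family_apply[OF PH_linear C1_at_isCont[OF PH_C1] C1_at_deriv_isCont[OF C1Y]])
    then show ?thesis unfolding G_def
      by (intro continuous_sum continuous_inner continuous_scaleR continuous_const) (use D(1) C1_at_isCont in auto)
  qed
  have "\<forall>\<^sub>F t in nhds \<tau>. t \<in> I \<longrightarrow> tr t = G t"
    using D(2)
  proof (rule eventually_mono)
    fix t assume dual: "\<forall>i\<in>B. \<forall>j\<in>B. Y i t \<bullet> D j t = (if i = j then 1 else 0)"
    show "t \<in> I \<longrightarrow> tr t = G t"
    proof
      assume "t \<in> I"
      then have f: "full t" by (rule I)
      have YH: "Y e t \<in> H t" for e by (simp add: Y_def PH_H)
      have "span ((\<lambda>j. Y j t) ` B) \<subseteq> H t" by (rule span_minimal[OF _ H_subspace]) (use YH in auto)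
      moreover have "dim (H t) = card B" using dim_H[of t] dim_H[of \<tau>] B(3) by simp
      ultimately have p: "PH t x = (\<Sum>e\<in>B. (x \<bullet> D e t) *\<^sub>R Y e t)" for x
        unfolding PH_oproj[symmetric] by (intro dual_frame_proj H_subspace B(1) YH) (use dual D(3) in auto)
      have "Sh t x = (\<Sum>e\<in>B. (x \<bullet> D e t) *\<^sub>R PH t (vector_derivative (Y e) (at t)))" for x
      proof -
        have "Sh t x = Sh t (\<Sum>e\<in>B. (x \<bullet> D e t) *\<^sub>R Y e t)" unfolding p[symmetric] Sh_PH ..
        also have "\<dots> = (\<Sum>e\<in>B. (x \<bullet> D e t) *\<^sub>R Sh t (Y e t))"
          by (simp add: linear_sum[OF Sh_linear[OF f]] linear_scale[OF Sh_linear[OF f]])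
        also have "\<dots> = (\<Sum>e\<in>B. (x \<bullet> D e t) *\<^sub>R PH t (vector_derivative (Y e) (at t)))"
        proof (intro sum.cong refl arg_cong2[where f=scaleR])
          fix e assume "e \<in> B"
          then show "Sh t (Y e t) = PH t (vector_derivative (Y e) (at t))"
            using Sh_transverse[OF f zz(1) dY[of e t, unfolded Y_def]] by (simp add: Y_def)
        qed
        finally show ?thesis .
      qed
      then show "tr t = G t" by (simp add: tr_def G_def)
    qed
  qed
  note ev = this
  have eq: "tr \<tau> = G \<tau>" using eventually_nhds_x_imp_x[OF ev] \<tau> by simp
  have ev': "\<forall>\<^sub>F t in at \<tau> within I. G t = tr t"
    unfolding eventually_at_filter using ev by (rule eventually_mono) simp
  have lim: "(G \<longlongrightarrow> G \<tau>) (at \<tau> within I)"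
    using cG continuous_at_imp_continuous_within[of \<tau> G I] by (simp add: continuous_within)
  show ?thesis unfolding continuous_within eq by (rule Lim_transform_eventually[OF lim ev'])
qed

end

context jacobi_flow
begin

subsection \<open>The Riccati operator at regular times\<close>

text \<open>
  The Riccati operator \<open>\<phi> t z \<mapsto> \<psi> t z\<close> at a regular time, extended by zero to the direction of \<open>e0\<close>.
\<close>

definition St :: "real \<Rightarrow> 'a \<Rightarrow> 'a" where "St t x = \<psi> t (SOME z. z \<in> L \<and> \<phi> t z = x - (x \<bullet> e0) *\<^sub>R e0)"

lemma nonsing_surj: assumes "nonsing t" "x \<in> N" shows "\<exists>z\<in>L. \<phi> t z = x"
proof -
  obtain u v where uv: "x = \<phi> t u + \<psi> t v" "u \<in> L" "v \<in> L" "\<phi> t v = 0" using assms(2) unfolding distr_L[of t, symmetric] distr_def by blast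
  then have "v = 0" using assms(1) by (simp add: nonsing_def)
  then show ?thesis using uv by (auto simp: linear_0[OF \<psi>_linear])
qed

lemma N_proj: "x - (x \<bullet> e0) *\<^sub>R e0 \<in> N" by (simp add: N_def inner_simps e0)

lemma St_eq: assumes n: "nonsing t" and z: "z \<in> L" "\<phi> t z = x - (x \<bullet> e0) *\<^sub>R e0" shows "St t x = \<psi> t z"
proof -
  let ?z = "SOME z. z \<in> L \<and> \<phi> t z = x - (x \<bullet> e0) *\<^sub>R e0"
  have "\<exists>z. z \<in> L \<and> \<phi> t z = x - (x \<bullet> e0) *\<^sub>R e0" using z by auto
  from someI_ex[OF this] have s: "?z \<in> L" "\<phi> t ?z = x - (x \<bullet> e0) *\<^sub>R e0" by simp_all
  have "?z - z \<in> L" using s z L by (simp add: subspace_diff)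
  moreover have "\<phi> t (?z - z) = 0" using s z by (simp add: linear_diff[OF \<phi>_linear])
  ultimately have "?z - z = 0" by (rule mp[OF bspec[OF n[unfolded nonsing_def]]])
  then show ?thesis by (simp add: St_def)
qed

lemma St_lift: assumes n: "nonsing t"
  obtains z where "z \<in> L" "\<phi> t z = x - (x \<bullet> e0) *\<^sub>R e0" "St t x = \<psi> t z"
  using nonsing_surj[OF n N_proj[of x]] St_eq[OF n] by metis

lemma St_\<phi>: "nonsing t \<Longrightarrow> z \<in> L \<Longrightarrow> St t (\<phi> t z) = \<psi> t z"
  by (rule St_eq) (simp_all add: perp)

lemma St_linear: assumes n: "nonsing t" shows "linear (St t)"
proof (rule linearI)
  fix x y
  obtain z where z: "z \<in> L" "\<phi> t z = x - (x \<bullet> e0) *\<^sub>R e0" "St t x = \<psi> t z" by (rule St_lift[OF n])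
  obtain w where w: "w \<in> L" "\<phi> t w = y - (y \<bullet> e0) *\<^sub>R e0" "St t y = \<psi> t w" by (rule St_lift[OF n])
  have "St t (x + y) = \<psi> t (z + w)"
    by (rule St_eq[OF n]) (use z w L in \<open>auto simp: subspace_add linear_add[OF \<phi>_linear] inner_simps scaleR_add_left\<close>)
  then show "St t (x + y) = St t x + St t y" by (simp add: z w linear_add[OF \<psi>_linear])
next
  fix r x
  obtain z where z: "z \<in> L" "\<phi> t z = x - (x \<bullet> e0) *\<^sub>R e0" "St t x = \<psi> t z" by (rule St_lift[OF n])
  have "St t (r *\<^sub>R x) = \<psi> t (r *\<^sub>R z)"
    by (rule St_eq[OF n]) (use z L in \<open>auto simp: subspace_scale linear_scale[OF \<phi>_linear] scaleR_diff_right\<close>)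
  then show "St t (r *\<^sub>R x) = r *\<^sub>R St t x" by (simp add: z linear_scale[OF \<psi>_linear])
qed

lemma St_sym: assumes n: "nonsing t" shows "St t x \<bullet> y = x \<bullet> St t y"
proof -
  obtain z where z: "z \<in> L" "\<phi> t z = x - (x \<bullet> e0) *\<^sub>R e0" "St t x = \<psi> t z" by (rule St_lift[OF n])
  obtain w where w: "w \<in> L" "\<phi> t w = y - (y \<bullet> e0) *\<^sub>R e0" "St t y = \<psi> t w" by (rule St_lift[OF n])
  have 0: "\<psi> t z \<bullet> e0 = 0" "\<psi> t w \<bullet> e0 = 0" using \<psi>_N z(1) w(1) by (auto simp: N_def)
  have "St t x \<bullet> y = \<psi> t z \<bullet> \<phi> t w" using 0 by (simp add: z(3) w(2) inner_simps)
  also have "\<dots> = \<phi> t z \<bullet> \<psi> t w" using lagr[OF z(1) w(1)] by simp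
  also have "\<dots> = x \<bullet> St t y" using 0 by (simp add: z(2) w(3) inner_simps inner_commute[of e0])
  finally show ?thesis .
qed

lemma nonsing_nhds: "nonsing t \<Longrightarrow> \<forall>\<^sub>F s in nhds t. nonsing s"
  using nonsing_punctured[of t] by (simp add: eventually_nhds_conv_at)

lemma \<phi>_C1: "C1_at \<tau> (\<lambda>t. \<phi> t b)"
  by (rule C1_atI[OF open_UNIV UNIV_I \<phi>_deriv]) (rule has_vector_derivative_continuous[OF \<psi>_deriv])

lemma R_isCont: "isCont (\<lambda>t. R t v) \<tau>"
  using R_cont by (simp add: continuous_on_eq_continuous_at)

lemma \<psi>_C1: "C1_at \<tau> (\<lambda>t. \<psi> t b)"
  by (rule C1_atI[OF open_UNIV UNIV_I \<psi>_deriv])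
    (rule continuous_minus[OF isCont_family_apply[where P=R, OF R_linear R_isCont has_vector_derivative_continuous[OF \<phi>_deriv]]])

lemma St_C1: assumes n: "nonsing \<tau>" shows "C1_at \<tau> (\<lambda>t. St t x)"
proof -
  obtain B where B0: "B \<subseteq> L" "independent B" "L \<subseteq> span B" "card B = dim L" by (rule basis_exists[of L])
  then have B: "finite B" "B \<subseteq> L" "independent B" "span B = L" "card B = dim L"
    using span_minimal[OF B0(1) L] by (simp_all add: finiteI_independent subset_antisym)
  have ind: "\<forall>c. (\<Sum>b\<in>B. c b *\<^sub>R \<phi> \<tau> b) = 0 \<longrightarrow> (\<forall>b\<in>B. c b = 0)"
  proof (intro allI impI ballI)
    fix c b assume c: "(\<Sum>b\<in>B. c b *\<^sub>R \<phi> \<tau> b) = 0" and b: "b \<in> B"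
    have "(\<Sum>b\<in>B. c b *\<^sub>R b) \<in> L" using B(2) by (intro subspace_sum[OF L] subspace_scale[OF L]) auto
    moreover have "\<phi> \<tau> (\<Sum>b\<in>B. c b *\<^sub>R b) = 0" using c by (simp add: linear_sum[OF \<phi>_linear] linear_scale[OF \<phi>_linear])
    ultimately have "(\<Sum>b\<in>B. c b *\<^sub>R b) = 0" using n by (simp add: nonsing_def)
    from independentD[OF B(3) B(1) subset_refl this b] show "c b = 0" .
  qed
  have C: "\<forall>b\<in>B. C1_at \<tau> (\<lambda>t. \<phi> t b)" using \<phi>_C1 by simp
  obtain d where d: "\<forall>i\<in>B. C1_at \<tau> (d i)"
    "\<forall>\<^sub>F t in nhds \<tau>. \<forall>i\<in>B. \<forall>j\<in>B. \<phi> t i \<bullet> d j t = (if i = j then 1 else 0)"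
    "\<forall>i\<in>B. \<forall>t. d i t \<in> span ((\<lambda>j. \<phi> t j) ` B)"
    using C1_dual_frame[of B \<tau> "\<lambda>b t. \<phi> t b", OF B(1) C ind] by (elim exE conjE)
  have "C1_at \<tau> (\<lambda>t. \<Sum>b\<in>B. (x \<bullet> d b t) *\<^sub>R \<psi> t b)"
    by (intro C1_at_sum C1_at_scaleR C1_at_inner C1_at_const \<psi>_C1) (use d(1) in auto)
  moreover have "\<forall>\<^sub>F t in nhds \<tau>. (\<Sum>b\<in>B. (x \<bullet> d b t) *\<^sub>R \<psi> t b) = St t x"
    using eventually_conj[OF d(2) nonsing_nhds[OF n]]
  proof (rule eventually_mono)
    fix t assume "(\<forall>i\<in>B. \<forall>j\<in>B. \<phi> t i \<bullet> d j t = (if i = j then 1 else 0)) \<and> nonsing t"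
    then have dual: "\<forall>i\<in>B. \<forall>j\<in>B. \<phi> t i \<bullet> d j t = (if i = j then 1 else 0)" and nt: "nonsing t" by auto
    let ?z = "\<Sum>b\<in>B. (x \<bullet> d b t) *\<^sub>R b"
    have sp: "span ((\<lambda>j. \<phi> t j) ` B) \<subseteq> N" by (rule span_minimal[OF _ N_subspace]) (use \<phi>_N B(2) in auto)
    have "oproj N x = (\<Sum>b\<in>B. (x \<bullet> d b t) *\<^sub>R \<phi> t b)"
      by (rule dual_frame_proj[OF B(1) N_subspace]) (use dual d(3) sp \<phi>_N B(2,5) dim_N dim_L in auto)
    moreover have "oproj N x = x - (x \<bullet> e0) *\<^sub>R e0"
      by (rule oproj_eqI[OF N_subspace N_proj]) (simp add: N_def inner_commute)
    ultimately have "\<phi> t ?z = x - (x \<bullet> e0) *\<^sub>R e0" by (simp add: linear_sum[OF \<phi>_linear] linear_scale[OF \<phi>_linear])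
    moreover have "?z \<in> L" using B(2) by (intro subspace_sum[OF L] subspace_scale[OF L]) auto
    ultimately have "St t x = \<psi> t ?z" by (intro St_eq[OF nt])
    then show "(\<Sum>b\<in>B. (x \<bullet> d b t) *\<^sub>R \<psi> t b) = St t x" by (simp add: linear_sum[OF \<psi>_linear] linear_scale[OF \<psi>_linear])
  qed
  ultimately show ?thesis by (rule C1_at_cong)
qed

definition DS :: "real \<Rightarrow> 'a \<Rightarrow> 'a" where "DS t x = vector_derivative (\<lambda>s. St s x) (at t)"

lemma St_deriv: "nonsing t \<Longrightarrow> ((\<lambda>s. St s x) has_vector_derivative DS t x) (at t)"
  unfolding DS_def by (rule C1_at_deriv[OF St_C1])

lemma DS_linear: assumes n: "nonsing t" shows "linear (DS t)"
proof -
  obtain U where U: "open U" "t \<in> U" "\<forall>s\<in>U. nonsing s" using nonsing_nhds[OF n] unfolding eventually_nhds by (elim exE conjE)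
  show ?thesis
  proof (rule linearI)
    fix x y
    have "((\<lambda>s. St s (x + y)) has_vector_derivative DS t x + DS t y) (at t)"
      by (rule has_vector_derivative_transform_within_open[OF has_vector_derivative_add[OF St_deriv[OF n] St_deriv[OF n]] U(1,2)])
        (use U(3) in \<open>simp add: linear_add[OF St_linear]\<close>)
    from vector_derivative_unique_at[OF St_deriv[OF n] this] show "DS t (x + y) = DS t x + DS t y" .
    fix r
    have "((\<lambda>s. St s (r *\<^sub>R x)) has_vector_derivative r *\<^sub>R DS t x) (at t)"
      by (rule has_vector_derivative_transform_within_open[OF bounded_linear.has_vector_derivative[OF bounded_linear_scaleR_right St_deriv[OF n]] U(1,2)])
        (use U(3) in \<open>simp add: linear_scale[OF St_linear]\<close>)
    from vector_derivative_unique_at[OF St_deriv[OF n] this] show "DS t (r *\<^sub>R x) = r *\<^sub>R DS t x" .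
  qed
qed

text \<open>
  Differentiate \<open>St s (\<phi> s z) = \<psi> s z\<close>.
\<close>

lemma riccati_equation:
  assumes n: "nonsing t" and x: "x \<in> N"
  shows "DS t x = - R t x - St t (St t x)"
proof -
  obtain z where z: "z \<in> L" "\<phi> t z = x" using nonsing_surj[OF n x] by auto
  obtain U where U: "open U" "t \<in> U" "\<forall>s\<in>U. nonsing s" using nonsing_nhds[OF n] unfolding eventually_nhds by (elim exE conjE)
  have "((\<lambda>s. St s (\<phi> s z)) has_derivative (\<lambda>u. u *\<^sub>R DS t (\<phi> t z) + St t (u *\<^sub>R \<psi> t z))) (at t)"
  proof (rule has_derivative_family_apply[where B=St and B'="\<lambda>u b. u *\<^sub>R DS t b", OF U(1,2)])
    show "linear (St s)" if "s \<in> U" for s by (rule St_linear) (use U(3) that in auto)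
    show "((\<lambda>s. St s b) has_derivative (\<lambda>u. u *\<^sub>R DS t b)) (at t)" for b
      by (rule St_deriv[OF n, unfolded has_vector_derivative_def])
    show "((\<lambda>s. \<phi> s z) has_derivative (\<lambda>u. u *\<^sub>R \<psi> t z)) (at t)" by (rule \<phi>_deriv[unfolded has_vector_derivative_def])
    show "linear (\<lambda>b. u *\<^sub>R DS t b)" for u by (intro linear_compose_scale_right DS_linear n)
  qed
  then have "((\<lambda>s. St s (\<phi> s z)) has_vector_derivative DS t x + St t (\<psi> t z)) (at t)"
    by (simp add: has_vector_derivative_def linear_scale[OF St_linear[OF n]] scaleR_add_right z(2))
  then have "((\<lambda>s. \<psi> s z) has_vector_derivative DS t x + St t (\<psi> t z)) (at t)"
    by (rule has_vector_derivative_transform_within_open[OF _ U(1,2)]) (use U(3) z(1) in \<open>simp add: St_\<phi>\<close>)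
  from vector_derivative_unique_at[OF this \<psi>_deriv] have "DS t x + St t (\<psi> t z) = - R t x" by (simp add: z(2))
  moreover have "\<psi> t z = St t x" using St_\<phi>[OF n z(1)] z(2) by simp
  ultimately show ?thesis by (simp add: algebra_simps eq_neg_iff_add_eq_0)
qed


subsection \<open>Variation of the horizontal distribution\<close>

text \<open>
  Such a vector is, up to a multiple of \<open>e0\<close>, the value at \<open>t\<close> of a solution in \<open>V\<close>, along which the projection is
  identically zero.
\<close>

lemma DP_perp:
  assumes n: "nonsing t" and x: "\<And>h. h \<in> H t \<Longrightarrow> x \<bullet> h = 0"
  shows "DP t x = - PH t (St t x)"
proof -
  have e0H: "PH s e0 = 0" for s by (rule PH_zeroI) (simp add: H_def N_def inner_commute)
  have De0: "DP t e0 = 0"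
  proof -
    have "((\<lambda>s. PH s e0) has_vector_derivative 0) (at t)" unfolding e0H by (rule has_vector_derivative_const)
    from vector_derivative_unique_at[OF PH_deriv this] show ?thesis .
  qed
  let ?v = "x - (x \<bullet> e0) *\<^sub>R e0"
  have "PH t ?v = 0" using PH_zeroI[OF x] e0H by (simp add: linear_diff[OF PH_linear] linear_scale[OF PH_linear])
  then have "?v \<in> distr V t" using N_proj by (simp add: distr_iff)
  then obtain u w where uw: "?v = \<phi> t u + \<psi> t w" "u \<in> V" "w \<in> V" "\<phi> t w = 0" unfolding distr_def by blast
  then have "w = 0" using n VL by (auto simp: nonsing_def)
  then have v: "?v = \<phi> t u" using uw(1) by (simp add: linear_0[OF \<psi>_linear])
  have z: "PH s (\<phi> s u) = 0" for s by (rule PH_distr[OF distr_\<phi>[OF V uw(2)]])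
  have "((\<lambda>s. PH s (\<phi> s u)) has_vector_derivative 0) (at t)" unfolding z by (rule has_vector_derivative_const)
  from vector_derivative_unique_at[OF PH_apply_deriv[OF \<phi>_deriv] this] have "DP t ?v = - PH t (\<psi> t u)"
    unfolding v by (simp add: eq_neg_iff_add_eq_0)
  moreover have "St t x = \<psi> t u" by (rule St_eq[OF n]) (use uw(2) VL v in auto)
  moreover have "DP t ?v = DP t x" by (simp add: linear_diff[OF DP_linear] linear_scale[OF DP_linear] De0)
  ultimately show ?thesis by simp
qed

lemma DP_sym: "DP t x \<bullet> y = x \<bullet> DP t y"
proof -
  have 1: "((\<lambda>s. PH s x \<bullet> y) has_vector_derivative PH t x \<bullet> 0 + DP t x \<bullet> y) (at t)"
    by (rule inner_deriv[OF PH_deriv has_vector_derivative_const])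
  have "((\<lambda>s. x \<bullet> PH s y) has_vector_derivative x \<bullet> DP t y + 0 \<bullet> PH t y) (at t)"
    by (rule inner_deriv[OF has_vector_derivative_const PH_deriv])
  then have "((\<lambda>s. PH s x \<bullet> y) has_vector_derivative x \<bullet> DP t y + 0 \<bullet> PH t y) (at t)" by (simp only: PH_sym)
  from vector_derivative_unique_at[OF 1 this] show ?thesis by simp
qed

lemma perp_PH: "h \<in> H t \<Longrightarrow> (y - PH t y) \<bullet> h = 0"
  by (simp add: inner_diff_left PH_orth)

text \<open>
  The derivative of the projections is symmetric and off-diagonal, so that it is determined by its other block.
\<close>

lemma DP_H:
  assumes n: "nonsing t" and h: "h \<in> H t"
  shows "DP t h = PH t (St t h) - St t h"
proof -
  have "DP t h \<bullet> y = (PH t (St t h) - St t h) \<bullet> y" for y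
  proof -
    let ?y = "y - PH t y"
    have "DP t h \<bullet> y = DP t h \<bullet> PH t y + DP t h \<bullet> ?y" by (simp add: inner_simps)
    also have "DP t h \<bullet> PH t y = 0" using PH_DP_H[OF h] by (simp add: PH_sym[symmetric])
    also have "DP t h \<bullet> ?y = - (St t h \<bullet> ?y)"
    proof -
      have "DP t ?y = - PH t (St t ?y)" by (rule DP_perp[OF n]) (rule perp_PH)
      then have "DP t h \<bullet> ?y = - (h \<bullet> PH t (St t ?y))" unfolding DP_sym[of t h] by (simp only: inner_minus_right)
      also have "h \<bullet> PH t (St t ?y) = h \<bullet> St t ?y" unfolding PH_sym[symmetric] PH_id[OF h] ..
      also have "h \<bullet> St t ?y = St t h \<bullet> ?y" by (rule St_sym[OF n, symmetric])
      finally show ?thesis .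
    qed
    also have "0 + - (St t h \<bullet> ?y) = (PH t (St t h) - St t h) \<bullet> y" by (simp add: inner_simps PH_sym)
    finally show ?thesis .
  qed
  then have "\<forall>y. DP t h \<bullet> y = (PH t (St t h) - St t h) \<bullet> y" by (rule allI)
  then show ?thesis by (rule iffD1[OF vector_eq_rdot])
qed

lemma tr_adapted:
  assumes f: "full t" and n: "nonsing t"
    and B: "B \<subseteq> H t" "finite B" "finite C" "B \<inter> C = {}" "\<And>c h. c \<in> C \<Longrightarrow> h \<in> H t \<Longrightarrow> c \<bullet> h = 0"
    and on: "pairwise orthogonal (B \<union> C)" "\<And>x. x \<in> B \<union> C \<Longrightarrow> norm x = 1" "span (B \<union> C) = UNIV"
  shows "tr t = (\<Sum>e\<in>B. St t e \<bullet> e)" "(\<Sum>b\<in>Basis. St t b \<bullet> PH t b) = (\<Sum>e\<in>B. St t e \<bullet> e)"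
proof -
  have fin: "finite (B \<union> C)" using B by simp
  have PC: "PH t c = 0" if "c \<in> C" for c by (rule PH_zeroI) (rule B(5)[OF that])
  have "tr t = (\<Sum>e\<in>B \<union> C. Sh t e \<bullet> e)"
    unfolding tr_def
    by (rule trace_orthonormal[OF _ _ fin on])
      (auto intro!: linearI simp: inner_simps linear_add[OF Sh_linear[OF f]] linear_scale[OF Sh_linear[OF f]])
  also have "\<dots> = (\<Sum>e\<in>B. Sh t e \<bullet> e) + (\<Sum>e\<in>C. Sh t e \<bullet> e)" by (rule sum.union_disjoint) (use B in auto)
  also have "(\<Sum>e\<in>C. Sh t e \<bullet> e) = 0"
  proof (rule sum.neutral, rule ballI)
    fix c assume "c \<in> C"
    then have "Sh t c = Sh t 0" using Sh_PH[of t c] PC by simp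
    then show "Sh t c \<bullet> c = 0" by (simp add: linear_0[OF Sh_linear[OF f]])
  qed
  also have "(\<Sum>e\<in>B. Sh t e \<bullet> e) = (\<Sum>e\<in>B. St t e \<bullet> e)"
  proof (rule sum.cong[OF refl])
    fix e assume "e \<in> B"
    then have e: "e \<in> H t" using B(1) by auto
    obtain z where z: "z \<in> L" "\<phi> t z = e" using nonsing_surj[OF n H_N[OF e]] by auto
    have "Sh t e = PH t (St t e)" using Sh_eq[OF f z(1), of e] St_\<phi>[OF n z(1)] z(2) by (simp add: PH_id[OF e])
    then show "Sh t e \<bullet> e = St t e \<bullet> e" by (simp add: PH_orth[OF e])
  qed
  finally show "tr t = (\<Sum>e\<in>B. St t e \<bullet> e)" by simp
  have "(\<Sum>b\<in>Basis. St t b \<bullet> PH t b) = (\<Sum>e\<in>B \<union> C. St t e \<bullet> PH t e)"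
    by (rule trace_orthonormal[OF _ _ fin on])
      (auto intro!: linearI simp: inner_simps linear_add[OF St_linear[OF n]] linear_scale[OF St_linear[OF n]] linear_add[OF PH_linear] linear_scale[OF PH_linear])
  also have "\<dots> = (\<Sum>e\<in>B. St t e \<bullet> PH t e) + (\<Sum>e\<in>C. St t e \<bullet> PH t e)" by (rule sum.union_disjoint) (use B in auto)
  also have "(\<Sum>e\<in>C. St t e \<bullet> PH t e) = 0" by (rule sum.neutral) (simp add: PC)
  also have "(\<Sum>e\<in>B. St t e \<bullet> PH t e) = (\<Sum>e\<in>B. St t e \<bullet> e)"
    by (rule sum.cong[OF refl]) (use B(1) in \<open>auto simp: PH_id\<close>)
  finally show "(\<Sum>b\<in>Basis. St t b \<bullet> PH t b) = (\<Sum>e\<in>B. St t e \<bullet> e)" by simp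
qed

text \<open>
  At a regular time the trace is \<open>\<Sum> St b \<bullet> PH b\<close>. The derivative of \<open>St\<close> is given by the Riccati equation. The
  derivative of the projection contributes minus the squared lengths of the off-diagonal parts of \<open>St\<close>, once for each
  block; this has a sign and is dropped. Together with the off-diagonal part of \<open>St\<^sup>2\<close> it is the O'Neill term of
  Wilking's transverse equation.
\<close>

lemma tr_deriv:
  assumes n: "nonsing \<tau>" and full: "\<forall>\<^sub>F t in nhds \<tau>. full t"
  obtains d B where "(tr has_real_derivative d) (at \<tau>)" "finite B" "B \<subseteq> H \<tau>" "span B = H \<tau>" "card B = dim (H \<tau>)"
    "pairwise orthogonal B" "\<And>x. x \<in> B \<Longrightarrow> norm x = 1" "tr \<tau> = (\<Sum>e\<in>B. St \<tau> e \<bullet> e)"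
    "d \<le> - (\<Sum>e\<in>B. St \<tau> e \<bullet> St \<tau> e + R \<tau> e \<bullet> e)"
proof -
  obtain B C where B: "finite B" "finite C" "B \<subseteq> H \<tau>" "span B = H \<tau>" "card B = dim (H \<tau>)" "B \<inter> C = {}"
    "\<And>c h. c \<in> C \<Longrightarrow> h \<in> H \<tau> \<Longrightarrow> c \<bullet> h = 0"
    "pairwise orthogonal (B \<union> C)" "\<And>x. x \<in> B \<union> C \<Longrightarrow> norm x = 1" "span (B \<union> C) = UNIV"
    by (rule orthonormal_basis_adapted[OF H_subspace[of \<tau>]]) (rule that)
  have f: "full \<tau>" by (rule eventually_nhds_x_imp_x[OF full])
  have fin: "finite (B \<union> C)" using B by simp
  obtain U where U: "open U" "\<tau> \<in> U" "\<forall>s\<in>U. full s \<and> nonsing s"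
    using eventually_conj[OF full nonsing_nhds[OF n]] unfolding eventually_nhds by (elim exE conjE)
  let ?d = "\<Sum>b\<in>Basis. St \<tau> b \<bullet> DP \<tau> b + DS \<tau> b \<bullet> PH \<tau> b"
  have "((\<lambda>t. \<Sum>b\<in>Basis. St t b \<bullet> PH t b) has_vector_derivative ?d) (at \<tau>)"
    by (intro has_vector_derivative_sum inner_deriv[OF St_deriv[OF n] PH_deriv])
  then have "(tr has_vector_derivative ?d) (at \<tau>)"
  proof (rule has_vector_derivative_transform_within_open[OF _ U(1,2)])
    fix t assume "t \<in> U"
    then have ft: "full t" and nt: "nonsing t" using U(3) by auto
    obtain B C where B': "finite B" "finite C" "B \<subseteq> H t" "span B = H t" "card B = dim (H t)" "B \<inter> C = {}"
      "\<And>c h. c \<in> C \<Longrightarrow> h \<in> H t \<Longrightarrow> c \<bullet> h = 0"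
      "pairwise orthogonal (B \<union> C)" "\<And>x. x \<in> B \<union> C \<Longrightarrow> norm x = 1" "span (B \<union> C) = UNIV"
      by (rule orthonormal_basis_adapted[OF H_subspace[of t]]) (rule that)
    note ta = tr_adapted[OF ft nt B'(3,1,2,6,7,8,9,10)]
    show "(\<Sum>b\<in>Basis. St t b \<bullet> PH t b) = tr t" by (rule trans[OF ta(2) ta(1)[symmetric]])
  qed
  then have d: "(tr has_real_derivative ?d) (at \<tau>)" by (simp add: has_real_derivative_iff_has_vector_derivative)
  have s1: "(\<Sum>b\<in>Basis. St \<tau> b \<bullet> DP \<tau> b) = (\<Sum>e\<in>B \<union> C. St \<tau> e \<bullet> DP \<tau> e)"
    by (rule trace_orthonormal[OF _ _ fin B(8,9,10)])
      (auto intro!: linearI simp: inner_simps linear_add[OF St_linear[OF n]] linear_scale[OF St_linear[OF n]] linear_add[OF DP_linear] linear_scale[OF DP_linear])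
  have s2: "(\<Sum>b\<in>Basis. DS \<tau> b \<bullet> PH \<tau> b) = (\<Sum>e\<in>B \<union> C. DS \<tau> e \<bullet> PH \<tau> e)"
    by (rule trace_orthonormal[OF _ _ fin B(8,9,10)])
      (auto intro!: linearI simp: inner_simps linear_add[OF DS_linear[OF n]] linear_scale[OF DS_linear[OF n]] linear_add[OF PH_linear] linear_scale[OF PH_linear])
  have le: "(\<Sum>e\<in>B \<union> C. St \<tau> e \<bullet> DP \<tau> e) \<le> 0"
  proof (rule sum_nonpos)
    fix e assume "e \<in> B \<union> C"
    then consider "e \<in> H \<tau>" | "\<And>h. h \<in> H \<tau> \<Longrightarrow> e \<bullet> h = 0" using B(3,7) by blast
    then show "St \<tau> e \<bullet> DP \<tau> e \<le> 0"
    proof cases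
      case 1
      let ?s = "St \<tau> e"
      have "(?s - PH \<tau> ?s) \<bullet> (?s - PH \<tau> ?s) = ?s \<bullet> ?s - ?s \<bullet> PH \<tau> ?s - (?s - PH \<tau> ?s) \<bullet> PH \<tau> ?s"
        by (simp add: inner_simps inner_commute[of "PH \<tau> ?s" ?s])
      also have "(?s - PH \<tau> ?s) \<bullet> PH \<tau> ?s = 0" by (rule perp_PH[OF PH_H])
      finally have "?s \<bullet> PH \<tau> ?s - ?s \<bullet> ?s \<le> 0" using inner_ge_zero[of "?s - PH \<tau> ?s"] by linarith
      then show ?thesis unfolding DP_H[OF n 1] by (simp add: inner_simps)
    next
      case 2
      have "PH \<tau> (St \<tau> e) \<bullet> PH \<tau> (St \<tau> e) = St \<tau> e \<bullet> PH \<tau> (St \<tau> e)" by (rule PH_orth[OF PH_H])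
      then have "St \<tau> e \<bullet> PH \<tau> (St \<tau> e) \<ge> 0" using inner_ge_zero[of "PH \<tau> (St \<tau> e)"] by linarith
      moreover have "DP \<tau> e = - PH \<tau> (St \<tau> e)" by (rule DP_perp[OF n]) (rule 2)
      ultimately show ?thesis by (simp only: inner_minus_right neg_le_0_iff_le)
    qed
  qed
  have "(\<Sum>e\<in>B \<union> C. DS \<tau> e \<bullet> PH \<tau> e) = (\<Sum>e\<in>B. DS \<tau> e \<bullet> PH \<tau> e) + (\<Sum>e\<in>C. DS \<tau> e \<bullet> PH \<tau> e)"
    by (rule sum.union_disjoint) (use B in auto)
  also have "(\<Sum>e\<in>C. DS \<tau> e \<bullet> PH \<tau> e) = 0"
  proof (rule sum.neutral, rule ballI)
    fix c assume "c \<in> C"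
    then have "PH \<tau> c = 0" using B(7) by (intro PH_zeroI)
    then show "DS \<tau> c \<bullet> PH \<tau> c = 0" by simp
  qed
  also have "(\<Sum>e\<in>B. DS \<tau> e \<bullet> PH \<tau> e) = (\<Sum>e\<in>B. - (St \<tau> e \<bullet> St \<tau> e + R \<tau> e \<bullet> e))"
  proof (rule sum.cong[OF refl])
    fix e assume "e \<in> B"
    then have e: "e \<in> H \<tau>" using B(3) by auto
    have "St \<tau> (St \<tau> e) \<bullet> e = St \<tau> e \<bullet> St \<tau> e" by (rule St_sym[OF n])
    then show "DS \<tau> e \<bullet> PH \<tau> e = - (St \<tau> e \<bullet> St \<tau> e + R \<tau> e \<bullet> e)"
      by (simp add: riccati_equation[OF n H_N[OF e]] PH_id[OF e] inner_simps)
  qed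
  finally have "(\<Sum>e\<in>B \<union> C. DS \<tau> e \<bullet> PH \<tau> e) = - (\<Sum>e\<in>B. St \<tau> e \<bullet> St \<tau> e + R \<tau> e \<bullet> e)" by (simp only: sum_negf add_0_right)
  then have "?d \<le> - (\<Sum>e\<in>B. St \<tau> e \<bullet> St \<tau> e + R \<tau> e \<bullet> e)" using le by (simp add: sum.distrib s1 s2)
  moreover have on: "pairwise orthogonal B" using B(8) by (rule pairwise_subset) simp
  have nB: "\<And>x. x \<in> B \<Longrightarrow> norm x = 1" by (rule B(9)) simp
  have "tr \<tau> = (\<Sum>e\<in>B. St \<tau> e \<bullet> e)" by (rule tr_adapted(1)[OF f n B(3,1,2,6,7,8,9,10)])
  ultimately show thesis by (intro that[OF d B(1,3,4,5) on nB])
qed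

text \<open>
  Cauchy--Schwarz for the trace: \<open>tr\<^sup>2 / k\<close> is at most the sum of the squared lengths of \<open>St e\<close>, and the defect is the
  sum of the squares of \<open>St e - (tr / k) e\<close>. Equality thus makes \<open>St\<close> a multiple of the identity on the
  horizontal space.
\<close>

lemma tr_inequality:
  assumes n: "nonsing \<tau>" and full: "\<forall>\<^sub>F t in nhds \<tau>. full t"
    and k: "k = dim (H \<tau>)" "0 < k"
    and ric: "\<And>B. finite B \<Longrightarrow> B \<subseteq> N \<Longrightarrow> card B = k \<Longrightarrow> pairwise orthogonal B \<Longrightarrow> (\<And>x. x \<in> B \<Longrightarrow> norm x = 1)
       \<Longrightarrow> real k * \<kappa> \<le> (\<Sum>e\<in>B. R \<tau> e \<bullet> e)"
  obtains d where "(tr has_real_derivative d) (at \<tau>)" "d \<le> - ((tr \<tau>)^2 / k) - k * \<kappa>"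
    "d = - ((tr \<tau>)^2 / k) - k * \<kappa> \<Longrightarrow> (\<forall>h\<in>H \<tau>. St \<tau> h = (tr \<tau> / k) *\<^sub>R h)"
proof -
  obtain d B where d: "(tr has_real_derivative d) (at \<tau>)" and B: "finite B" "B \<subseteq> H \<tau>" "span B = H \<tau>" "card B = dim (H \<tau>)"
    "pairwise orthogonal B" "\<And>x. x \<in> B \<Longrightarrow> norm x = 1" and tr: "tr \<tau> = (\<Sum>e\<in>B. St \<tau> e \<bullet> e)"
    and le: "d \<le> - (\<Sum>e\<in>B. St \<tau> e \<bullet> St \<tau> e + R \<tau> e \<bullet> e)"
    by (rule tr_deriv[OF n full]) (rule that)
  define \<sigma> where "\<sigma> = tr \<tau> / k"
  let ?D = "\<Sum>e\<in>B. (St \<tau> e - \<sigma> *\<^sub>R e) \<bullet> (St \<tau> e - \<sigma> *\<^sub>R e)"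
  have "real k * \<kappa> \<le> (\<Sum>e\<in>B. R \<tau> e \<bullet> e)"
    by (rule ric) (use B k H_N in auto)
  moreover have "?D = (\<Sum>e\<in>B. St \<tau> e \<bullet> St \<tau> e) - (tr \<tau>)^2 / k"
  proof -
    have "?D = (\<Sum>e\<in>B. St \<tau> e \<bullet> St \<tau> e - 2 * \<sigma> * (St \<tau> e \<bullet> e) + \<sigma>^2)"
    proof (rule sum.cong[OF refl])
      fix e assume "e \<in> B"
      then have "e \<bullet> e = 1" using B(6) by (simp add: norm_eq_1)
      then show "(St \<tau> e - \<sigma> *\<^sub>R e) \<bullet> (St \<tau> e - \<sigma> *\<^sub>R e) = St \<tau> e \<bullet> St \<tau> e - 2 * \<sigma> * (St \<tau> e \<bullet> e) + \<sigma>^2"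
        by (simp add: inner_simps inner_commute[of e "St \<tau> e"] power2_eq_square algebra_simps)
    qed
    also have "\<dots> = (\<Sum>e\<in>B. St \<tau> e \<bullet> St \<tau> e) - 2 * \<sigma> * tr \<tau> + k * \<sigma>^2"
      using B(4) k(1) by (simp add: sum.distrib sum_subtractf sum_distrib_left tr)
    also have "\<dots> = (\<Sum>e\<in>B. St \<tau> e \<bullet> St \<tau> e) - (tr \<tau>)^2 / k"
      using k(2) by (simp add: \<sigma>_def power2_eq_square field_simps)
    finally show ?thesis .
  qed
  ultimately have main: "d \<le> - ((tr \<tau>)^2 / k) - k * \<kappa> - ?D" using le by (simp add: sum.distrib)
  have D0: "?D \<ge> 0" by (rule sum_nonneg) simp
  have eq: "St \<tau> h = \<sigma> *\<^sub>R h" if "d = - ((tr \<tau>)^2 / k) - k * \<kappa>" "h \<in> H \<tau>" for h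
  proof -
    have "?D = 0" using main D0 that(1) by linarith
    then have e: "St \<tau> e = \<sigma> *\<^sub>R e" if "e \<in> B" for e
      using sum_nonneg_eq_0_iff[OF B(1), of "\<lambda>e. (St \<tau> e - \<sigma> *\<^sub>R e) \<bullet> (St \<tau> e - \<sigma> *\<^sub>R e)"] that by simp
    have "h \<in> span B" using that(2) B(3) by simp
    then show ?thesis by (rule linear_eq_on_span[OF St_linear[OF n] linear_scale_self e, rotated]) 
  qed
  show thesis
  proof (rule that[OF d])
    show "d \<le> - ((tr \<tau>)^2 / k) - k * \<kappa>" using main D0 by linarith
    show "\<forall>h\<in>H \<tau>. St \<tau> h = (tr \<tau> / k) *\<^sub>R h" if "d = - ((tr \<tau>)^2 / k) - k * \<kappa>"
      using eq[OF that] unfolding \<sigma>_def by (rule ballI)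
  qed
qed

end

section \<open>Comparison and rigidity for the transverse Riccati trace\<close>

text \<open>
  The lower bound \<open>ric\<close> is the form that a lower bound on intermediate Ricci curvature takes in the parallel frame:
  only sums over orthonormal \<open>k\<close>-tuples are controlled, and \<open>k\<close> is exactly the dimension of the horizontal spaces.
\<close>

locale transverse_comparison = jacobi_flow +
  fixes k :: nat and \<kappa> a b :: real and lam :: "real \<Rightarrow> real"
  assumes dim_V: "dim L = k + dim V"
    and ric: "finite B \<Longrightarrow> B \<subseteq> N \<Longrightarrow> card B = k \<Longrightarrow> pairwise orthogonal B \<Longrightarrow> (\<And>x. x \<in> B \<Longrightarrow> norm x = 1)
       \<Longrightarrow> real k * \<kappa> \<le> (\<Sum>e\<in>B. R t e \<bullet> e)"
    and ab: "a \<le> b" and full: "t \<in> {a..b} \<Longrightarrow> full t"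
    and lam: "t \<in> {a..b} \<Longrightarrow> (lam has_real_derivative - ((lam t)^2) - \<kappa>) (at t within {a..b})"
    and tr_le: "tr a \<le> real k * lam a"
begin

lemma dim_H_k: "dim (H t) = k" using dim_H[of t] dim_V by linarith

lemma interior_at: "a < t \<Longrightarrow> t < b \<Longrightarrow> at t within {a..b} = at t"
  by (rule at_within_interior) (simp add: interior_atLeastAtMost_real)

lemma H_trivial: assumes "k = 0" "h \<in> H t" shows "h = 0"
  using dim_H_k[of t] assms dim_eq_0[of "H t"] by auto

lemma full_nhds: assumes "a < t" "t < b" shows "\<forall>\<^sub>F s in nhds t. full s"
proof -
  have "\<forall>\<^sub>F s in nhds t. s \<in> {a<..<b}" by (rule eventually_nhds_in_open[OF open_greaterThanLessThan]) (use assms in simp)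
  then show ?thesis by (rule eventually_mono) (rule full, simp)
qed

lemma tr_inequality_at:
  assumes t: "a < t" "t < b" "nonsing t" and k: "0 < k"
  shows "\<exists>d. (tr has_real_derivative d) (at t) \<and> d \<le> - ((tr t)^2 / k) - k * \<kappa> \<and>
    (d = - ((tr t)^2 / k) - k * \<kappa> \<longrightarrow> (\<forall>h\<in>H t. St t h = (tr t / k) *\<^sub>R h))"
proof (rule tr_inequality[OF t(3) full_nhds[OF t(1,2)] dim_H_k[of t, symmetric] k, of \<kappa>])
  show "real k * \<kappa> \<le> (\<Sum>e\<in>B. R t e \<bullet> e)"
    if "finite B" "B \<subseteq> N" "card B = k" "pairwise orthogonal B" "\<And>x. x \<in> B \<Longrightarrow> norm x = 1" for B
    by (rule ric[OF that])
  fix d assume d: "(tr has_real_derivative d) (at t)" "d \<le> - ((tr t)^2 / k) - k * \<kappa>"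
    "d = - ((tr t)^2 / k) - k * \<kappa> \<Longrightarrow> (\<forall>h\<in>H t. St t h = (tr t / k) *\<^sub>R h)"
  show ?thesis by (intro exI[of _ d] conjI impI d)
qed

lemma
  assumes k: "0 < k"
  shows tr_le_lam_pos: "tr b / k \<le> lam b"
    and tr_eq_lam_pos: "tr b / k = lam b \<Longrightarrow> t \<in> {a..b} \<Longrightarrow> tr t / k = lam t"
proof -
  have c: "continuous_on {a..b} (\<lambda>t. tr t / k)"
    unfolding continuous_on_eq_continuous_within
  proof (rule ballI)
    fix t assume t: "t \<in> {a..b}"
    have "continuous (at t within {a..b}) tr" by (rule tr_continuous[OF full t])
    then show "continuous (at t within {a..b}) (\<lambda>t. tr t / k)" using k by (intro continuous_divide continuous_const) auto
  qed
  have cl: "continuous_on {a..b} lam" by (rule DERIV_continuous_on[OF lam])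
  have ev: "\<forall>\<^sub>F t in at \<tau>. a < t \<and> t < b \<longrightarrow>
      (\<exists>d. ((\<lambda>t. tr t / k) has_real_derivative d) (at t) \<and> d \<le> - ((tr t / k)^2) - \<kappa>)" for \<tau>
    using nonsing_punctured
  proof (rule eventually_mono, intro impI)
    fix t assume n: "nonsing t" and "a < t \<and> t < b"
    then have t: "a < t" "t < b" by auto
    obtain d where d: "(tr has_real_derivative d) (at t)" "d \<le> - ((tr t)^2 / k) - k * \<kappa>"
      using tr_inequality_at[OF t n k] by (elim exE conjE)
    have "d / k \<le> (- ((tr t)^2 / k) - k * \<kappa>) / k" by (rule divide_right_mono[OF d(2)]) simp
    also have "\<dots> = - ((tr t / k)^2) - \<kappa>" using k by (simp add: field_simps power2_eq_square)
    finally show "\<exists>d. ((\<lambda>t. tr t / k) has_real_derivative d) (at t) \<and> d \<le> - ((tr t / k)^2) - \<kappa>"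
      by (intro exI[of _ "d / k"] conjI DERIV_cdivide[OF d(1)])
  qed
  have l: "(lam has_real_derivative - ((lam t)^2) - \<kappa>) (at t)" if "a < t" "t < b" for t
    using lam[of t] that by (simp add: interior_at)
  have le: "tr a / k \<le> lam a" using tr_le k by (simp add: field_simps)
  show "tr b / k \<le> lam b" by (rule riccati_comparison(1)[OF ab c cl ev l le])
  show "tr t / k = lam t" if "tr b / k = lam b" "t \<in> {a..b}"
    by (rule riccati_comparison(2)[OF ab c cl ev l le that])
qed

lemma tr_trivial: assumes "k = 0" shows "tr t = 0"
proof -
  have "PH t x = 0" for x by (rule H_trivial[OF assms PH_H])
  then show ?thesis by (simp add: tr_def Sh_def)
qed

theorem tr_le_lam: "tr b \<le> real k * lam b"
proof (cases "k = 0")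
  case True then show ?thesis by (simp add: tr_trivial)
next
  case False then show ?thesis using tr_le_lam_pos by (simp add: field_simps)
qed

end

text \<open>
  The case of equality at the end point. The function \<open>f\<close> is the solution of the scalar Jacobi equation with
  logarithmic derivative \<open>lam\<close>, normalised at the start.
\<close>

locale transverse_rigidity = transverse_comparison +
  fixes f :: "real \<Rightarrow> real"
  assumes eq: "tr b = real k * lam b"
    and f: "t \<in> {a..b} \<Longrightarrow> (f has_real_derivative lam t * f t) (at t within {a..b})"
    and f_nz: "t \<in> {a..b} \<Longrightarrow> f t \<noteq> 0" and f_a: "f a = 1"
begin

text \<open>
  Equality at the end point forces \<open>tr = k lam\<close> on the whole interval, hence equality in the differential
  inequality at every regular time.
\<close>

lemma St_H: assumes t: "a < t" "t < b" and n: "nonsing t" and h: "h \<in> H t" shows "St t h = lam t *\<^sub>R h"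
proof (cases "k = 0")
  case True
  then have "h = 0" using H_trivial h by blast
  then show ?thesis using linear_0[OF St_linear[OF n]] by simp
next
  case False
  then have k: "0 < k" by simp
  have e: "tr s = k * lam s" if "s \<in> {a<..<b}" for s
    using tr_eq_lam_pos[OF k _, of s] eq k that by (simp add: field_simps)
  obtain d where d: "(tr has_real_derivative d) (at t)"
    "d = - ((tr t)^2 / k) - k * \<kappa> \<longrightarrow> (\<forall>h\<in>H t. St t h = (tr t / k) *\<^sub>R h)"
    using tr_inequality_at[OF t n k] by (elim exE conjE)
  have "((\<lambda>s. k * lam s) has_real_derivative k * (- ((lam t)^2) - \<kappa>)) (at t)"
    using DERIV_cmult[OF lam[of t], of "real k"] t by (simp add: interior_at)
  then have "(tr has_real_derivative k * (- ((lam t)^2) - \<kappa>)) (at t)"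
    by (rule has_field_derivative_transform_within_open[OF _ open_greaterThanLessThan[of a b]]) (use t e in auto)
  from DERIV_unique[OF d(1) this] have "d = k * (- ((lam t)^2) - \<kappa>)" .
  also have "\<dots> = - ((tr t)^2 / k) - k * \<kappa>" using e[of t] t k by (simp add: field_simps power2_eq_square)
  finally have "St t h = (tr t / k) *\<^sub>R h" using d(2) h by blast
  then show ?thesis using e[of t] t k by simp
qed

lemma PH_St: assumes t: "a < t" "t < b" and n: "nonsing t" shows "PH t (St t x) = lam t *\<^sub>R PH t x"
proof -
  let ?y = "x - PH t x"
  have "PH t (St t ?y) = 0"
  proof (rule PH_zeroI)
    fix h assume h: "h \<in> H t"
    have "St t ?y \<bullet> h = ?y \<bullet> St t h" by (rule St_sym[OF n])
    also have "\<dots> = lam t * (?y \<bullet> h)" unfolding St_H[OF t n h] by simp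
    also have "?y \<bullet> h = 0" by (rule perp_PH[OF h])
    finally show "St t ?y \<bullet> h = 0" by simp
  qed
  moreover have "St t (PH t x) = lam t *\<^sub>R PH t x" by (rule St_H[OF t n PH_H])
  ultimately show ?thesis
    by (simp add: linear_diff[OF St_linear[OF n]] linear_diff[OF PH_linear] linear_scale[OF PH_linear] PH_id[OF PH_H])
qed

lemma DP_zero: assumes t: "a < t" "t < b" and n: "nonsing t" shows "DP t x = 0"
proof -
  have "DP t (PH t x) = PH t (St t (PH t x)) - St t (PH t x)" by (rule DP_H[OF n PH_H])
  also have "\<dots> = 0" by (simp add: PH_St[OF t n] St_H[OF t n PH_H] PH_id[OF PH_H] linear_scale[OF PH_linear])
  finally have 1: "DP t (PH t x) = 0" .
  have "DP t (x - PH t x) = - PH t (St t (x - PH t x))" by (rule DP_perp[OF n]) (rule perp_PH)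
  also have "\<dots> = 0" by (simp add: PH_St[OF t n] linear_diff[OF PH_linear] PH_id[OF PH_H])
  finally show ?thesis using 1 by (simp add: linear_diff[OF DP_linear])
qed

text \<open>
  The off-diagonal part of the Riccati operator vanishes, so that the projections have zero derivative at regular
  times. In the parallel frame this says that the horizontal distribution is parallel.
\<close>

lemma PH_const: assumes "t \<in> {a..b}" shows "PH t x = PH a x"
proof (rule constant_except)
  show "a \<le> t" using assms by simp
  show "continuous_on {a..t} (\<lambda>s. PH s x)"
    by (rule continuous_at_imp_continuous_on, rule ballI, rule has_vector_derivative_continuous[OF PH_deriv])
  fix \<tau>
  show "\<forall>\<^sub>F s in at \<tau>. a < s \<and> s < t \<longrightarrow> ((\<lambda>s. PH s x) has_vector_derivative 0) (at s)"
    using nonsing_punctured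
  proof (rule eventually_mono, intro impI)
    fix s assume "nonsing s" "a < s \<and> s < t"
    then have "DP s x = 0" using assms by (intro DP_zero) auto
    then show "((\<lambda>s. PH s x) has_vector_derivative 0) (at s)" using PH_deriv[of x s] by simp
  qed
qed

lemma H_const: assumes "t \<in> {a..b}" shows "H t = H a"
proof -
  have "h \<in> H t \<longleftrightarrow> PH t h = h" for h t using PH_H[of t h] PH_id by metis
  then show ?thesis using PH_const[OF assms] by auto
qed

lemma distr_const: assumes "t \<in> {a..b}" shows "distr V t = distr V a"
  using PH_const[OF assms] by (auto simp: distr_iff)

lemma PH_a_deriv: "(w has_vector_derivative w') F \<Longrightarrow> ((\<lambda>s. PH a (w s)) has_vector_derivative PH a w') F"
  by (rule bounded_linear.has_vector_derivative[OF linear_conv_bounded_linear[THEN iffD1, OF PH_linear]])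

lemma PH_a_continuous: "isCont w t \<Longrightarrow> isCont (\<lambda>s. PH a (w s)) t"
  by (rule bounded_linear.isCont[OF linear_conv_bounded_linear[THEN iffD1, OF PH_linear]])

text \<open>
  The quotient of the transverse component by \<open>f\<close> has derivative zero at regular times.
\<close>

lemma PH_flow: assumes z: "z \<in> L" and t: "t \<in> {a..b}" shows "PH a (\<phi> t z) = f t *\<^sub>R PH a (\<phi> a z)"
proof -
  define g where "g = (\<lambda>s. (1 / f s) *\<^sub>R PH a (\<phi> s z))"
  have sub: "{a..t} \<subseteq> {a..b}" using t by auto
  have "g t = g a"
  proof (rule constant_except)
    show "a \<le> t" using t by simp
    have "continuous_on {a..b} f" by (rule DERIV_continuous_on[OF f])
    then have "continuous_on {a..t} f" using sub by (rule continuous_on_subset)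
    moreover have "continuous_on {a..t} (\<lambda>s. PH a (\<phi> s z))"
      by (rule continuous_at_imp_continuous_on, rule ballI, rule has_vector_derivative_continuous[OF PH_a_deriv[OF \<phi>_deriv]])
    moreover have "\<forall>s\<in>{a..t}. f s \<noteq> 0" using f_nz sub by blast
    ultimately show "continuous_on {a..t} g" unfolding g_def
      by (intro continuous_on_scaleR continuous_on_divide continuous_on_const)
    fix \<tau>
    show "\<forall>\<^sub>F s in at \<tau>. a < s \<and> s < t \<longrightarrow> (g has_vector_derivative 0) (at s)"
      using nonsing_punctured
    proof (rule eventually_mono, intro impI)
      fix s assume n: "nonsing s" and "a < s \<and> s < t"
      then have s: "a < s" "s < b" "s \<in> {a..b}" using t by auto
      have "PH s (St s (\<phi> s z)) = lam s *\<^sub>R PH s (\<phi> s z)" by (rule PH_St[OF s(1,2) n])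
      then have p: "PH a (\<psi> s z) = lam s *\<^sub>R PH a (\<phi> s z)" by (simp add: St_\<phi>[OF n z] PH_const[OF s(3)])
      have fs: "(f has_real_derivative lam s * f s) (at s)" using f[OF s(3)] s by (simp add: interior_at)
      have "((\<lambda>s. 1 / f s) has_real_derivative - lam s / f s) (at s)"
        using DERIV_inverse'[OF fs f_nz[OF s(3)]] f_nz[OF s(3)] by (simp add: field_simps inverse_eq_divide)
      then have "(g has_vector_derivative (1 / f s) *\<^sub>R PH a (\<psi> s z) + (- lam s / f s) *\<^sub>R PH a (\<phi> s z)) (at s)"
        unfolding g_def by (intro has_vector_derivative_scaleR PH_a_deriv \<phi>_deriv)
      also have "(1 / f s) *\<^sub>R PH a (\<psi> s z) + (- lam s / f s) *\<^sub>R PH a (\<phi> s z) = 0" by (simp add: p)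
      finally show "(g has_vector_derivative 0) (at s)" .
    qed
  qed
  then have "f t *\<^sub>R g t = f t *\<^sub>R g a" by simp
  then show ?thesis using f_nz[OF t] by (simp add: g_def f_a)
qed

lemma PH_\<phi>_V: assumes "u \<in> V" "t \<in> {a..b}" shows "PH a (\<phi> t u) = 0"
  using PH_distr[OF distr_\<phi>[OF V assms(1)], of t] by (simp add: PH_const[OF assms(2)])

lemma zero_deriv: assumes "(w has_vector_derivative w') (at t)" "a < t" "t < b" "\<And>s. a < s \<Longrightarrow> s < b \<Longrightarrow> w s = 0" shows "w' = 0"
proof -
  have "((\<lambda>s. 0) has_vector_derivative w') (at t)"
    by (rule has_vector_derivative_transform_within_open[OF assms(1) open_greaterThanLessThan[of a b]]) (use assms in auto)
  from vector_derivative_unique_at[OF this has_vector_derivative_const] show ?thesis .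
qed

lemma PH_\<psi>_V: assumes u: "u \<in> V" and t: "a < t" "t < b" shows "PH a (\<psi> t u) = 0"
  by (rule zero_deriv[OF PH_a_deriv[OF \<phi>_deriv] t]) (use u in \<open>simp add: PH_\<phi>_V\<close>)

lemma PH_R_V: assumes u: "u \<in> V" and t: "a < t" "t < b" shows "PH a (R t (\<phi> t u)) = 0"
proof -
  have "PH a (- R t (\<phi> t u)) = 0"
    by (rule zero_deriv[OF PH_a_deriv[OF \<psi>_deriv] t]) (use u in \<open>simp add: PH_\<psi>_V\<close>)
  then show ?thesis by (simp add: linear_neg[OF PH_linear])
qed

lemma PH_\<psi>_V_a: assumes u: "u \<in> V" and "a < b" shows "PH a (\<psi> a u) = 0"
proof (rule zero_except[where f="\<lambda>t. PH a (\<psi> t u)", OF assms(2)])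
  show "continuous_on {a..b} (\<lambda>t. PH a (\<psi> t u))"
    by (rule continuous_at_imp_continuous_on, rule ballI, rule has_vector_derivative_continuous[OF PH_a_deriv[OF \<psi>_deriv]])
  show "a \<in> {a..b}" using ab by simp
  show "\<forall>\<^sub>F t in at a. a < t \<and> t < b \<longrightarrow> PH a (\<psi> t u) = 0" using u by (intro always_eventually allI impI PH_\<psi>_V) auto
qed

lemma R_distr: assumes t: "a < t" "t < b" and n: "nonsing t" and y: "y \<in> distr V t" shows "PH a (R t y) = 0"
proof -
  obtain u w where uw: "y = \<phi> t u + \<psi> t w" "u \<in> V" "w \<in> V" "\<phi> t w = 0" using y unfolding distr_def by blast
  then have "w = 0" using n VL by (auto simp: nonsing_def)
  then have "y = \<phi> t u" using uw(1) by (simp add: linear_0[OF \<psi>_linear])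
  then show ?thesis using PH_R_V[OF uw(2) t] by simp
qed

lemma R_N_sym: assumes n: "nonsing t" and x: "x \<in> N" "y \<in> N" shows "R t x \<in> N" "R t x \<bullet> y = x \<bullet> R t y"
proof -
  obtain z where z: "z \<in> L" "\<phi> t z = x" using nonsing_surj[OF n x(1)] by auto
  obtain w where w: "w \<in> L" "\<phi> t w = y" using nonsing_surj[OF n x(2)] by auto
  show "R t x \<in> N" "R t x \<bullet> y = x \<bullet> R t y" using R_N[OF z(1), of t] R_sym[OF z(1) w(1), of t] z(2) w(2) by simp_all
qed

text \<open>
  The solutions in \<open>V\<close> stay in a constant subspace, hence so do their second derivatives: \<open>R\<close> preserves that
  subspace and, being symmetric, its orthogonal complement.
\<close>

lemma R_commutes: assumes t: "a < t" "t < b" and n: "nonsing t" and x: "x \<in> N" shows "PH a (R t x) = R t (PH a x)"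
proof -
  have tab: "t \<in> {a..b}" using t by simp
  have pN: "PH a x \<in> N" by (rule H_N[OF PH_H])
  have "R t (PH a x) \<in> H t"
    unfolding H_def
  proof (intro CollectI conjI ballI)
    show "R t (PH a x) \<in> N" by (rule R_N_sym(1)[OF n pN pN])
    fix w assume w: "w \<in> distr V t"
    then have wN: "w \<in> N" using distr_sub_N[OF VL] by auto
    have "R t (PH a x) \<bullet> w = PH a x \<bullet> R t w" by (rule R_N_sym(2)[OF n pN wN])
    also have "\<dots> = x \<bullet> PH a (R t w)" by (rule PH_sym)
    also have "PH a (R t w) = 0" by (rule R_distr[OF t n w])
    finally show "R t (PH a x) \<bullet> w = 0" by simp
  qed
  then have 1: "PH a (R t (PH a x)) = R t (PH a x)" by (intro PH_id) (simp add: H_const[OF tab])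
  have "x - PH a x \<in> distr V a"
    unfolding distr_iff using subspace_diff[OF N_subspace x pN] by (simp add: linear_diff[OF PH_linear] PH_id[OF PH_H])
  then have "PH a (R t (x - PH a x)) = 0" by (intro R_distr[OF t n]) (simp add: distr_const[OF tab])
  then show ?thesis using 1 by (simp add: linear_diff[OF R_linear] linear_diff[OF PH_linear])
qed

lemma R_flow_commutes: assumes z: "z \<in> L" and t: "t \<in> {a..b}" and "a < b"
  shows "PH a (R t (\<phi> t z)) = R t (PH a (\<phi> t z))"
proof -
  define w where "w = (\<lambda>t. PH a (R t (\<phi> t z)) - R t (PH a (\<phi> t z)))"
  have "w t = 0"
  proof (rule zero_except[OF assms(3) _ t])
    have "isCont (\<lambda>t. R t (\<phi> t z)) s" for s
      by (rule isCont_family_apply[where P=R, OF R_linear R_isCont has_vector_derivative_continuous[OF \<phi>_deriv]])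
    moreover have "isCont (\<lambda>t. R t (PH a (\<phi> t z))) s" for s
      by (rule isCont_family_apply[where P=R, OF R_linear R_isCont has_vector_derivative_continuous[OF PH_a_deriv[OF \<phi>_deriv]]])
    ultimately have "isCont w s" for s unfolding w_def by (intro continuous_diff PH_a_continuous)
    then show "continuous_on {a..b} w" by (intro continuous_at_imp_continuous_on ballI)
    show "\<forall>\<^sub>F s in at t. a < s \<and> s < b \<longrightarrow> w s = 0"
      using nonsing_punctured
    proof (rule eventually_mono, intro impI)
      fix s assume n: "nonsing s" and s: "a < s \<and> s < b"
      have "PH a (R s (\<phi> s z)) = R s (PH a (\<phi> s z))" by (rule R_commutes[OF _ _ n \<phi>_N[OF z]]) (use s in auto)
      then show "w s = 0" by (simp add: w_def)
    qed
  qed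
  then show ?thesis by (simp add: w_def)
qed

text \<open>
  The complement of \<open>V\<close> in the splitting. Horizontal initial values do not determine a solution when some members of
  \<open>V\<close> vanish at the start; the second condition fixes the remaining freedom in the initial derivative.
\<close>

definition "Z = {z \<in> L. \<phi> a z \<in> H a \<and> (\<forall>v\<in>V. \<phi> a v = 0 \<longrightarrow> \<psi> a z \<bullet> \<psi> a v = 0)}"

lemma Z_subspace: "subspace Z"
  using L H_subspace[of a]
  by (auto simp: Z_def subspace_def linear_0[OF \<phi>_linear] linear_0[OF \<psi>_linear] linear_add[OF \<phi>_linear] linear_add[OF \<psi>_linear]
      linear_scale[OF \<phi>_linear] linear_scale[OF \<psi>_linear] inner_simps)

lemma Z_L: "Z \<subseteq> L" by (auto simp: Z_def)

lemma a_ab: "a \<in> {a..b}" using ab by simp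

lemma H_distr_zero: "x \<in> H t \<Longrightarrow> x \<in> distr V t \<Longrightarrow> x = 0" using PH_id PH_distr by metis

lemma Z_V: assumes "z \<in> Z" "z \<in> V" shows "z = 0"
proof -
  have z: "z \<in> L" "\<phi> a z \<in> H a" "\<forall>v\<in>V. \<phi> a v = 0 \<longrightarrow> \<psi> a z \<bullet> \<psi> a v = 0" using assms(1) by (simp_all add: Z_def)
  have 0: "\<phi> a z = 0" by (rule H_distr_zero[OF z(2) distr_\<phi>[OF V assms(2)]])
  then have "\<psi> a z \<bullet> \<psi> a z = 0" using z(3) assms(2) by blast
  then have "\<psi> a z = 0" by simp
  then show ?thesis by (rule flow_inj[OF z(1) 0])
qed

text \<open>
  Lift the horizontal part of the initial value of \<open>j\<close>, and correct the lift by an element of \<open>V\<close> that vanishes at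
  the start so as to meet the condition on the derivative.
\<close>

lemma Z_complement: assumes j: "j \<in> L" shows "\<exists>v\<in>V. \<exists>z\<in>Z. j = v + z"
proof -
  obtain m where m: "m \<in> L" "\<phi> a m = PH a (\<phi> a j)" using lift_H[OF full[OF a_ab] PH_H] by blast
  have jm: "j - m \<in> L" by (rule subspace_diff[OF L j m(1)])
  have "PH a (\<phi> a (j - m)) = 0" by (simp add: linear_diff[OF \<phi>_linear] linear_diff[OF PH_linear] m(2) PH_id[OF PH_H])
  then have "\<phi> a (j - m) \<in> distr V a" unfolding distr_iff using \<phi>_N[OF jm] by simp
  then have jmV: "j - m \<in> V" by (rule V_of_distr[OF full[OF a_ab] jm])
  let ?K = "{v \<in> V. \<phi> a v = 0}"
  have K: "subspace ?K"
    using V by (auto simp: subspace_def linear_0[OF \<phi>_linear] linear_add[OF \<phi>_linear] linear_scale[OF \<phi>_linear])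
  have U: "subspace (\<psi> a ` ?K)" by (rule linear_subspace_image[OF \<psi>_linear K])
  obtain v0 where v0: "v0 \<in> V" "\<phi> a v0 = 0" "oproj (\<psi> a ` ?K) (\<psi> a m) = \<psi> a v0" using oproj(1)[OF U, of "\<psi> a m"] by auto
  have "m - v0 \<in> Z"
    unfolding Z_def
  proof (intro CollectI conjI ballI impI)
    show "m - v0 \<in> L" using subspace_diff[OF L m(1)] v0(1) VL by blast
    show "\<phi> a (m - v0) \<in> H a" by (simp add: linear_diff[OF \<phi>_linear] v0(2) m(2) PH_H)
    fix v assume "v \<in> V" "\<phi> a v = 0"
    then have "\<psi> a v \<in> \<psi> a ` ?K" by simp
    from oproj(2)[OF U this, of "\<psi> a m"] show "\<psi> a (m - v0) \<bullet> \<psi> a v = 0" by (simp add: linear_diff[OF \<psi>_linear] v0(3))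
  qed
  moreover have "(j - m) + v0 \<in> V" by (rule subspace_add[OF V jmV v0(1)])
  moreover have "j = ((j - m) + v0) + (m - v0)" by simp
  ultimately show ?thesis by blast
qed

lemma \<phi>_Z: "\<phi> a ` Z = H a"
proof
  show "\<phi> a ` Z \<subseteq> H a" by (auto simp: Z_def)
  show "H a \<subseteq> \<phi> a ` Z"
  proof
    fix h assume h: "h \<in> H a"
    obtain m where m: "m \<in> L" "\<phi> a m = h" using lift_H[OF full[OF a_ab] h] by blast
    obtain v z where vz: "v \<in> V" "z \<in> Z" "m = v + z" using Z_complement[OF m(1)] by blast
    have z: "\<phi> a z \<in> H a" using vz(2) by (simp add: Z_def)
    have e: "h - \<phi> a z = \<phi> a v" using m(2) vz(3) by (simp add: linear_add[OF \<phi>_linear] algebra_simps)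
    have "h - \<phi> a z = 0"
      by (rule H_distr_zero[OF subspace_diff[OF H_subspace h z]]) (unfold e, rule distr_\<phi>[OF V vz(1)])
    then show "h \<in> \<phi> a ` Z" using vz(2) by auto
  qed
qed

text \<open>
  The vertical component of the solution solves the Jacobi equation, because \<open>R\<close> commutes with the projection, and it
  has zero initial data; so it vanishes, and \<open>PH_flow\<close> describes what is left.
\<close>

lemma flow_Z: assumes z: "z \<in> Z" and t: "t \<in> {a..b}" shows "\<phi> t z = f t *\<^sub>R \<phi> a z"
proof (cases "a < b")
  case False
  then have "t = a" using t by simp
  then show ?thesis by (simp add: f_a)
next
  case True
  have zL: "z \<in> L" and za: "\<phi> a z \<in> H a" and zv: "\<And>v. v \<in> V \<Longrightarrow> \<phi> a v = 0 \<Longrightarrow> \<psi> a z \<bullet> \<psi> a v = 0" using z by (auto simp: Z_def)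
  have "\<psi> a z \<in> H a"
    unfolding H_def
  proof (intro CollectI conjI ballI)
    show "\<psi> a z \<in> N" by (rule \<psi>_N[OF zL])
    fix x assume "x \<in> distr V a"
    then obtain u v where x: "x = \<phi> a u + \<psi> a v" "u \<in> V" "v \<in> V" "\<phi> a v = 0" unfolding distr_def by blast
    have "\<psi> a z \<bullet> \<phi> a u = \<phi> a z \<bullet> \<psi> a u" by (rule lagr[symmetric]) (use zL x VL in auto)
    also have "\<dots> = PH a (\<phi> a z) \<bullet> \<psi> a u" by (simp only: PH_id[OF za])
    also have "\<dots> = \<phi> a z \<bullet> PH a (\<psi> a u)" by (rule PH_sym)
    also have "PH a (\<psi> a u) = 0" by (rule PH_\<psi>_V_a[OF x(2) True])
    finally show "\<psi> a z \<bullet> x = 0" using zv[OF x(3,4)] by (simp add: x(1) inner_simps)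
  qed
  then have w1: "\<psi> a z - PH a (\<psi> a z) = 0" by (simp add: PH_id)
  have "\<phi> t z - PH a (\<phi> t z) = 0"
  proof (rule jacobi_zero[where w="\<lambda>t. \<psi> t z - PH a (\<psi> t z)", OF _ _ a_ab _ w1 t])
    show "((\<lambda>t. \<phi> t z - PH a (\<phi> t z)) has_vector_derivative \<psi> t z - PH a (\<psi> t z)) (at t within {a..b})" for t
      by (rule has_vector_derivative_at_within[OF has_vector_derivative_diff[OF \<phi>_deriv PH_a_deriv[OF \<phi>_deriv]]])
    show "((\<lambda>t. \<psi> t z - PH a (\<psi> t z)) has_vector_derivative - R t (\<phi> t z - PH a (\<phi> t z))) (at t within {a..b})"
      if t: "t \<in> {a..b}" for t
    proof -
      have "((\<lambda>t. \<psi> t z - PH a (\<psi> t z)) has_vector_derivative - R t (\<phi> t z) - PH a (- R t (\<phi> t z))) (at t within {a..b})"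
        by (rule has_vector_derivative_at_within[OF has_vector_derivative_diff[OF \<psi>_deriv PH_a_deriv[OF \<psi>_deriv]]])
      also have "- R t (\<phi> t z) - PH a (- R t (\<phi> t z)) = - R t (\<phi> t z - PH a (\<phi> t z))"
        using R_flow_commutes[OF zL t True] by (simp add: linear_neg[OF PH_linear] linear_diff[OF R_linear])
      finally show ?thesis .
    qed
    show "\<phi> a z - PH a (\<phi> a z) = 0" using za by (simp add: PH_id)
  qed
  then show ?thesis using PH_flow[OF zL t] by (simp add: PH_id[OF za])
qed

end

context transverse_rigidity
begin

lemma distr_Z: assumes t: "t \<in> {a..b}" shows "distr Z t = H a"
proof
  have 0: "v = 0" if v: "v \<in> Z" "\<phi> t v = 0" for v
  proof (rule Z_V[OF v(1)])
    have "\<phi> a v = 0" using flow_Z[OF v(1) t] v(2) f_nz[OF t] by simp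
    then show "v \<in> V" using full[OF a_ab] v(1) Z_L by (auto simp: full_def)
  qed
  show "distr Z t \<subseteq> H a"
  proof
    fix x assume "x \<in> distr Z t"
    then obtain u v where uv: "x = \<phi> t u + \<psi> t v" "u \<in> Z" "v \<in> Z" "\<phi> t v = 0" unfolding distr_def by blast
    have "x = f t *\<^sub>R \<phi> a u" using uv(1) 0[OF uv(3,4)] flow_Z[OF uv(2) t] by (simp add: linear_0[OF \<psi>_linear])
    moreover have "\<phi> a u \<in> H a" using uv(2) by (simp add: Z_def)
    ultimately show "x \<in> H a" by (simp add: subspace_scale[OF H_subspace])
  qed
  show "H a \<subseteq> distr Z t"
  proof
    fix h assume h: "h \<in> H a"
    have "(1 / f t) *\<^sub>R h \<in> \<phi> a ` Z" unfolding \<phi>_Z by (rule subspace_scale[OF H_subspace h])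
    then obtain z where z: "z \<in> Z" "(1 / f t) *\<^sub>R h = \<phi> a z" by (elim imageE)
    have "\<phi> t z = h" using flow_Z[OF z(1) t] f_nz[OF t] by (simp add: z(2)[symmetric])
    then show "h \<in> distr Z t" using distr_\<phi>[OF Z_subspace z(1), of t] by simp
  qed
qed

end


section \<open>Lagrangian families of Jacobi fields in a parallel frame\<close>

lemma sum_fun: "(\<Sum>i\<in>A. f i) t = (\<Sum>i\<in>A. f i (t::real) :: 'a::euclidean_space)"
  by (induction A rule: infinite_finite_induct) auto

text \<open>
  The abstract development needs a Euclidean parameter space for the Lagrangian space of Jacobi fields. A basis of
  \<open>\<Lambda>\<close> has one element less than the standard basis of the model space, so that the hyperplane orthogonal to one
  standard basis vector serves as parameter space.
\<close>

locale lagrangian_family = parallel_frame M \<gamma> E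
  for M :: "('m::{t2_space, second_countable_topology}, 'a::euclidean_space) metric_atlas" and \<gamma> and E +
  fixes \<Lambda> :: "(real \<Rightarrow> 'a) set"
  assumes Lam: "lagrangian M \<gamma> \<Lambda>"
begin

lemma \<Phi>_parallel_const: assumes "parallel_field M \<gamma> X" shows "\<Phi> t (X t) = \<Phi> s (X s)"
proof -
  have "((\<lambda>s. \<Phi> s (X s)) has_vector_derivative 0) (at t within UNIV)" for t
    using \<Phi>_deriv[OF parallelD[OF assms], of t] by (simp add: linear_0[OF \<Phi>_linear])
  then obtain c where "\<And>t. t \<in> UNIV \<Longrightarrow> \<Phi> t (X t) = c"
    using has_vector_derivative_zero_constant[OF convex_UNIV] by metis
  then show ?thesis by simp
qed

definition e0 :: 'a where "e0 = \<Phi> 0 (vel 0)"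

lemma \<Phi>_vel: "\<Phi> t (vel t) = e0" unfolding e0_def by (rule \<Phi>_parallel_const[OF vel_parallel])

lemma e0_unit: "e0 \<bullet> e0 = 1"
  using \<Phi>_isometry[of 0 "vel 0" "vel 0"] us by (simp add: e0_def unit_speed_geodesic_def)

lemma \<Phi>_zero: "\<Phi> t v = 0 \<Longrightarrow> v = 0" using \<Psi>_\<Phi>[of t v] by (simp add: linear_0[OF \<Psi>_linear])

lemma jacobi: assumes "J \<in> \<Lambda>"
  shows "smooth_field_along M \<gamma> J" "cov (cov J) t = - curvature M (\<gamma> t) (J t) (vel t) (vel t)" "\<Phi> t (J t) \<bullet> e0 = 0"
  using Lam assms \<Phi>_isometry[of t "J t" "vel t"]
  by (auto simp: lagrangian_def normal_jacobi_field_def \<Phi>_vel eq_neg_iff_add_eq_0)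

lemma Lam_subspace: "fields.subspace \<Lambda>" using Lam by (simp add: lagrangian_def)

definition b0 :: 'a where "b0 = (SOME i. i \<in> Basis)"
lemma b0: "b0 \<in> Basis"
proof -
  have "\<exists>i::'a. i \<in> Basis" using nonempty_Basis by blast
  then show ?thesis unfolding b0_def by (rule someI_ex)
qed

abbreviation I0 :: "'a set" where "I0 \<equiv> Basis - {b0}"

lemma Lam_basis: "\<exists>\<beta>. inj_on \<beta> I0 \<and> fields.independent (\<beta> ` I0) \<and> \<beta> ` I0 \<subseteq> \<Lambda> \<and> \<Lambda> \<subseteq> fields.span (\<beta> ` I0)"
proof -
  obtain B where B: "B \<subseteq> \<Lambda>" "fields.independent B" "\<Lambda> \<subseteq> fields.span B" "card B = fields.dim \<Lambda>"
    by (rule fields.basis_exists)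
  have c: "card B = DIM('a) - 1" using B(4) Lam by (simp add: lagrangian_def)
  \<comment> \<open>In dimension one the cardinality does not show that \<open>B\<close> is finite, but there all normal fields vanish.\<close>
  have "finite B"
  proof (cases "DIM('a) = 1")
    case True
    have "e0 \<noteq> 0" using e0_unit by auto
    then have "{x. e0 \<bullet> x = 0} \<subseteq> {0}" using dim_hyperplane[of e0] True by (simp only: dim_eq_0[symmetric]) simp
    then have N0: "x = 0" if "x \<bullet> e0 = 0" for x using that by (auto simp: inner_commute)
    have "J t = 0" if "J \<in> \<Lambda>" for J t by (rule \<Phi>_zero[OF N0[OF jacobi(3)[OF that]]])
    then have "B \<subseteq> {0}" using B(1) by (auto simp: fun_eq_iff)
    then show ?thesis by (rule finite_subset) simp
  next
    case False
    have "DIM('a) > 0" by (rule DIM_positive)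
    with False have "card B > 0" unfolding c by linarith
    then show ?thesis by (rule card_ge_0_finite)
  qed
  moreover have "card I0 = DIM('a) - 1" using b0 by simp
  ultimately obtain \<beta> where "bij_betw \<beta> I0 B" using finite_same_card_bij[of I0 B] c by auto
  then show ?thesis using B by (intro exI[of _ \<beta>]) (simp add: bij_betw_def)
qed

definition \<beta> :: "'a \<Rightarrow> real \<Rightarrow> 'a" where
  "\<beta> = (SOME \<beta>. inj_on \<beta> I0 \<and> fields.independent (\<beta> ` I0) \<and> \<beta> ` I0 \<subseteq> \<Lambda> \<and> \<Lambda> \<subseteq> fields.span (\<beta> ` I0))"

lemma \<beta>: "inj_on \<beta> I0" "fields.independent (\<beta> ` I0)" "\<beta> ` I0 \<subseteq> \<Lambda>" "\<Lambda> \<subseteq> fields.span (\<beta> ` I0)"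
  using someI_ex[OF Lam_basis] unfolding \<beta>_def by blast+

definition Lp :: "'a set" where "Lp = {z. b0 \<bullet> z = 0}"
definition Jz :: "'a \<Rightarrow> real \<Rightarrow> 'a" where "Jz z = (\<Sum>i\<in>I0. (\<lambda>t. (z \<bullet> i) *\<^sub>R \<beta> i t))"

lemma Jz_apply: "Jz z t = (\<Sum>i\<in>I0. (z \<bullet> i) *\<^sub>R \<beta> i t)" by (simp add: Jz_def sum_fun)

lemma Jz_add: "Jz (x + y) = (\<lambda>t. Jz x t + Jz y t)"
  by (rule ext) (simp add: Jz_apply inner_simps scaleR_add_left sum.distrib)

lemma Jz_scale: "Jz (r *\<^sub>R x) = (\<lambda>t. r *\<^sub>R Jz x t)"
  by (rule ext) (simp add: Jz_apply scaleR_sum_right)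

lemma Jz_0: "Jz 0 = 0" by (rule ext) (simp add: Jz_apply)

lemma Jz_Lam: "Jz z \<in> \<Lambda>"
  unfolding Jz_def
proof (rule fields.subspace_sum[OF Lam_subspace])
  fix i assume "i \<in> I0"
  then have "\<beta> i \<in> \<Lambda>" using \<beta>(3) by blast
  from fields.subspace_scale[OF Lam_subspace this] show "(\<lambda>t. (z \<bullet> i) *\<^sub>R \<beta> i t) \<in> \<Lambda>" .
qed

lemma Jz_inj: assumes z: "z \<in> Lp" "Jz z = 0" shows "z = 0"
proof (rule euclidean_eqI)
  fix i :: 'a assume i: "i \<in> Basis"
  show "z \<bullet> i = 0 \<bullet> i"
  proof (cases "i = b0")
    case True then show ?thesis using z(1) by (simp add: Lp_def inner_commute)
  next
    case False
    then have iI: "i \<in> I0" using i by simp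
    let ?u = "\<lambda>J. z \<bullet> inv_into I0 \<beta> J"
    have "(\<Sum>J\<in>\<beta> ` I0. (\<lambda>t. ?u J *\<^sub>R J t)) = (\<Sum>i\<in>I0. (\<lambda>t. ?u (\<beta> i) *\<^sub>R \<beta> i t))"
      by (rule sum.reindex[OF \<beta>(1), unfolded o_def])
    also have "\<dots> = Jz z" unfolding Jz_def by (rule sum.cong[OF refl]) (simp add: inv_into_f_f[OF \<beta>(1)])
    finally have "(\<Sum>J\<in>\<beta> ` I0. (\<lambda>t. ?u J *\<^sub>R J t)) = 0" using z(2) by simp
    from fields.independentD[OF \<beta>(2) _ subset_refl this, of "\<beta> i"] iI show ?thesis
      by (simp add: inv_into_f_f[OF \<beta>(1)])
  qed
qed

lemma Jz_surj: assumes J: "J \<in> \<Lambda>" shows "\<exists>z\<in>Lp. J = Jz z"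
proof -
  have "J \<in> fields.span (\<beta> ` I0)" using J \<beta>(4) by blast
  then have "J \<in> range (\<lambda>u. \<Sum>v\<in>\<beta> ` I0. (\<lambda>t. u v *\<^sub>R v t))" using fields.span_finite[of "\<beta> ` I0"] by simp
  then obtain u where u: "J = (\<Sum>v\<in>\<beta> ` I0. (\<lambda>t. u v *\<^sub>R v t))" by (elim rangeE)
  define z where "z = (\<Sum>i\<in>I0. u (\<beta> i) *\<^sub>R i)"
  have zi: "z \<bullet> j = (if j \<in> I0 then u (\<beta> j) else 0)" if "j \<in> Basis" for j
  proof -
    have "z \<bullet> j = (\<Sum>i\<in>I0. if i = j then u (\<beta> i) else 0)"
      unfolding z_def inner_sum_left by (rule sum.cong) (use that in \<open>auto simp: inner_Basis\<close>)
    then show ?thesis by simp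
  qed
  have "z \<in> Lp" using zi[OF b0] by (simp add: Lp_def inner_commute)
  moreover have "J = (\<Sum>i\<in>I0. (\<lambda>t. u (\<beta> i) *\<^sub>R \<beta> i t))"
    unfolding u by (rule sum.reindex[OF \<beta>(1), unfolded o_def])
  then have "J = Jz z" unfolding Jz_def using zi by (auto intro!: sum.cong)
  ultimately show ?thesis by blast
qed

lemma Lp_subspace: "subspace Lp" by (simp add: Lp_def subspace_hyperplane)

lemma cov_Jz: "has_cov (Jz z) (cov (Jz z) t) t UNIV" by (rule smooth_has_cov[OF jacobi(1)[OF Jz_Lam]])

definition \<phi> :: "real \<Rightarrow> 'a \<Rightarrow> 'a" where "\<phi> t z = \<Phi> t (Jz z t)"
definition \<psi> :: "real \<Rightarrow> 'a \<Rightarrow> 'a" where "\<psi> t z = \<Phi> t (cov (Jz z) t)"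

lemma Jz_\<phi>: "Jz z t = \<Psi> t (\<phi> t z)" by (simp add: \<phi>_def \<Psi>_\<Phi>)

lemma flow: assumes U: "subspace U" "U \<subseteq> Lp" shows "jacobi_flow \<phi> \<psi> Rf e0 Lp U"
proof (rule jacobi_flow.intro)
  show "linear (\<phi> t)" for t
    by (rule linearI) (simp_all add: \<phi>_def Jz_add Jz_scale linear_add[OF \<Phi>_linear] linear_scale[OF \<Phi>_linear])
  show "linear (\<psi> t)" for t
  proof (rule linearI)
    show "\<psi> t (x + y) = \<psi> t x + \<psi> t y" for x y
      unfolding \<psi>_def Jz_add cov_eqI[OF has_cov_add[OF cov_Jz cov_Jz]] by (rule linear_add[OF \<Phi>_linear])
    show "\<psi> t (r *\<^sub>R x) = r *\<^sub>R \<psi> t x" for r x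
      unfolding \<psi>_def Jz_scale cov_eqI[OF has_cov_scale[OF cov_Jz]] by (rule linear_scale[OF \<Phi>_linear])
  qed
  show "((\<lambda>t. \<phi> t z) has_vector_derivative \<psi> t z) (at t)" for z t
    unfolding \<phi>_def \<psi>_def by (rule \<Phi>_deriv[OF cov_Jz])
  show "((\<lambda>t. \<psi> t z) has_vector_derivative - Rf t (\<phi> t z)) (at t)" for z t
  proof -
    have "- Rf t (\<phi> t z) = \<Phi> t (cov (cov (Jz z)) t)"
      unfolding jacobi(2)[OF Jz_Lam] by (simp add: Rf_def Jz_\<phi>[symmetric] linear_neg[OF \<Phi>_linear])
    then show ?thesis
      unfolding \<psi>_def using \<Phi>_deriv[OF smooth_has_cov[OF cov_smooth[OF jacobi(1)[OF Jz_Lam]]]] by simp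
  qed
  show "linear (Rf t)" for t by (rule Rf_linear)
  show "continuous_on UNIV (\<lambda>t. Rf t v)" for v by (rule Rf_continuous)
  show "e0 \<bullet> e0 = 1" by (rule e0_unit)
  show "subspace Lp" by (rule Lp_subspace)
  show "dim Lp = DIM('a) - 1" unfolding Lp_def by (rule dim_hyperplane) (use b0 in auto)
  show "\<phi> t z \<bullet> e0 = 0" for t z unfolding \<phi>_def by (rule jacobi(3)[OF Jz_Lam])
  show "\<phi> t z \<bullet> \<psi> t z' = \<psi> t z \<bullet> \<phi> t z'" for t z z'
    using Lam Jz_Lam[of z] Jz_Lam[of z'] by (simp add: \<phi>_def \<psi>_def \<Phi>_isometry lagrangian_def)
  show "z = 0" if z: "z \<in> Lp" "\<And>t. \<phi> t z = 0" for z
  proof (rule Jz_inj[OF z(1)])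
    show "Jz z = 0" by (rule ext) (simp add: Jz_\<phi> z(2) linear_0[OF \<Psi>_linear])
  qed
  show "subspace U" "U \<subseteq> Lp" by (rule U)+
qed

end

text \<open>
  Expand \<open>g e\<close> in the vectors \<open>h b\<close> and interchange the two sums.
\<close>

lemma trace_expand:
  fixes g :: "'a::euclidean_space \<Rightarrow> 'a" and h :: "'c \<Rightarrow> 'a"
  assumes g: "linear g" and r: "\<And>b. b \<in> B \<Longrightarrow> linear (r b)"
    and rep: "\<And>x. g x = (\<Sum>b\<in>B. r b (g x) *\<^sub>R h b)"
  shows "(\<Sum>e\<in>Basis. g e \<bullet> e) = (\<Sum>b\<in>B. r b (g (h b)))"
proof -
  have "(\<Sum>e\<in>Basis. g e \<bullet> e) = (\<Sum>e\<in>Basis. \<Sum>b\<in>B. r b (g e) * (h b \<bullet> e))"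
  proof (rule sum.cong[OF refl])
    fix e :: 'a
    have "g e \<bullet> e = (\<Sum>b\<in>B. r b (g e) *\<^sub>R h b) \<bullet> e" by (rule arg_cong[where f="\<lambda>x. x \<bullet> e", OF rep])
    then show "g e \<bullet> e = (\<Sum>b\<in>B. r b (g e) * (h b \<bullet> e))" by (simp only: inner_sum_left inner_scaleR_left)
  qed
  also have "\<dots> = (\<Sum>b\<in>B. \<Sum>e\<in>Basis. r b (g e) * (h b \<bullet> e))" by (rule sum.swap)
  also have "\<dots> = (\<Sum>b\<in>B. r b (g (h b)))"
  proof (rule sum.cong[OF refl])
    fix b assume b: "b \<in> B"
    have "(\<Sum>e\<in>Basis. r b (g e) * (h b \<bullet> e)) = r b (g (\<Sum>e\<in>Basis. (h b \<bullet> e) *\<^sub>R e))"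
      by (simp only: linear_sum[OF g] linear_scale[OF g] linear_sum[OF r[OF b]] linear_scale[OF r[OF b]] real_scaleR_def mult.commute)
    then show "(\<Sum>e\<in>Basis. r b (g e) * (h b \<bullet> e)) = r b (g (h b))" by (simp only: euclidean_representation)
  qed
  finally show ?thesis .
qed

locale lagrangian_pair = lagrangian_family M \<gamma> E \<Lambda>
  for M :: "('m::{t2_space, second_countable_topology}, 'a::euclidean_space) metric_atlas" and \<gamma> and E and \<Lambda> +
  fixes \<V> :: "(real \<Rightarrow> 'a) set"
  assumes \<V>: "fields.subspace \<V>" "\<V> \<subseteq> \<Lambda>"
begin

definition Vp :: "'a set" where "Vp = {z \<in> Lp. Jz z \<in> \<V>}"

lemma Vp_subspace: "subspace Vp"
proof (rule subspaceI)
  show "0 \<in> Vp" using fields.subspace_0[OF \<V>(1)] subspace_0[OF Lp_subspace] by (simp add: Vp_def Jz_0)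
  show "x + y \<in> Vp" if "x \<in> Vp" "y \<in> Vp" for x y
    using fields.subspace_add[OF \<V>(1), of "Jz x" "Jz y"] subspace_add[OF Lp_subspace, of x y] that
    by (simp add: Vp_def Jz_add plus_fun_def)
  show "r *\<^sub>R x \<in> Vp" if "x \<in> Vp" for r x
    using fields.subspace_scale[OF \<V>(1), of "Jz x" r] subspace_scale[OF Lp_subspace, of x r] that
    by (simp add: Vp_def Jz_scale)
qed

lemma Vp_Lp: "Vp \<subseteq> Lp" by (auto simp: Vp_def)

lemma \<V>_Jz: "\<V> = Jz ` Vp"
proof
  show "Jz ` Vp \<subseteq> \<V>" by (auto simp: Vp_def)
  show "\<V> \<subseteq> Jz ` Vp"
  proof
    fix J assume J: "J \<in> \<V>"
    then obtain z where "z \<in> Lp" "J = Jz z" using Jz_surj \<V>(2) by blast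
    then show "J \<in> Jz ` Vp" using J by (auto simp: Vp_def)
  qed
qed

sublocale F: jacobi_flow \<phi> \<psi> Rf e0 Lp Vp by (rule flow[OF Vp_subspace Vp_Lp])

lemma distribution_iff: "x \<in> distribution_of M \<gamma> (Jz ` U) t \<longleftrightarrow> \<Phi> t x \<in> F.distr U t"
proof
  assume "x \<in> distribution_of M \<gamma> (Jz ` U) t"
  then obtain u v where "x = Jz u t + cov (Jz v) t" "u \<in> U" "v \<in> U" "Jz v t = 0" unfolding distribution_of_def by blast
  moreover from this have "\<phi> t v = 0" by (simp add: \<phi>_def linear_0[OF \<Phi>_linear])
  ultimately have "\<Phi> t x = \<phi> t u + \<psi> t v" "u \<in> U" "v \<in> U" "\<phi> t v = 0"
    by (simp_all add: \<phi>_def \<psi>_def linear_add[OF \<Phi>_linear])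
  then show "\<Phi> t x \<in> F.distr U t" unfolding F.distr_def by blast
next
  assume "\<Phi> t x \<in> F.distr U t"
  then obtain u v where uv: "\<Phi> t x = \<phi> t u + \<psi> t v" "u \<in> U" "v \<in> U" "\<phi> t v = 0" unfolding F.distr_def by blast
  have "\<Psi> t (\<Phi> t x) = Jz u t + cov (Jz v) t" unfolding uv(1) by (simp add: linear_add[OF \<Psi>_linear] \<phi>_def \<psi>_def \<Psi>_\<Phi>)
  moreover have "Jz v t = 0" using uv(4) by (simp add: Jz_\<phi> linear_0[OF \<Psi>_linear])
  ultimately show "x \<in> distribution_of M \<gamma> (Jz ` U) t" unfolding distribution_of_def \<Psi>_\<Phi> using uv(2,3) by blast
qed

lemma distribution_\<V>_iff: "x \<in> distribution_of M \<gamma> \<V> t \<longleftrightarrow> \<Phi> t x \<in> F.distr Vp t"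
  by (rule distribution_iff[of x Vp t, folded \<V>_Jz])

lemma velocity_perp_iff: "x \<in> velocity_perp M \<gamma> t \<longleftrightarrow> \<Phi> t x \<in> F.N"
  by (simp add: velocity_perp_def F.N_def \<Phi>_isometry[symmetric] \<Phi>_vel)

lemma horizontal_iff: "x \<in> horizontal_space M \<gamma> \<V> t \<longleftrightarrow> \<Phi> t x \<in> F.H t"
proof -
  have "(\<forall>w\<in>distribution_of M \<gamma> \<V> t. rmetric M (\<gamma> t) x w = 0) \<longleftrightarrow> (\<forall>w\<in>F.distr Vp t. \<Phi> t x \<bullet> w = 0)"
  proof
    assume l: "\<forall>w\<in>distribution_of M \<gamma> \<V> t. rmetric M (\<gamma> t) x w = 0"
    show "\<forall>w\<in>F.distr Vp t. \<Phi> t x \<bullet> w = 0"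
    proof
      fix w assume "w \<in> F.distr Vp t"
      then have "\<Psi> t w \<in> distribution_of M \<gamma> \<V> t" unfolding distribution_\<V>_iff \<Phi>_\<Psi> .
      then have "rmetric M (\<gamma> t) x (\<Psi> t w) = 0" using l by blast
      then show "\<Phi> t x \<bullet> w = 0" by (simp add: \<Phi>_isometry[symmetric] \<Phi>_\<Psi>)
    qed
  next
    assume r: "\<forall>w\<in>F.distr Vp t. \<Phi> t x \<bullet> w = 0"
    show "\<forall>w\<in>distribution_of M \<gamma> \<V> t. rmetric M (\<gamma> t) x w = 0"
    proof
      fix w assume "w \<in> distribution_of M \<gamma> \<V> t"
      then have "\<Phi> t w \<in> F.distr Vp t" unfolding distribution_\<V>_iff .
      then show "rmetric M (\<gamma> t) x w = 0" using r by (simp add: \<Phi>_isometry[symmetric])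
    qed
  qed
  then show ?thesis by (simp add: horizontal_space_def F.H_def velocity_perp_iff)
qed

lemma full_index: assumes "full_index_at \<Lambda> \<V> t" shows "F.full t"
  unfolding F.full_def
proof (intro ballI impI)
  fix z assume z: "z \<in> Lp" "\<phi> t z = 0"
  then have "Jz z t = 0" by (simp add: Jz_\<phi> linear_0[OF \<Psi>_linear])
  then have "Jz z \<in> \<V>" using assms Jz_Lam by (simp add: full_index_at_def)
  then show "z \<in> Vp" using z(1) by (simp add: Vp_def)
qed

lemma riccati_proj:
  assumes f: "F.full t" and w: "w \<in> horizontal_space M \<gamma> \<V> t"
  shows "metric_proj M (\<gamma> t) (horizontal_space M \<gamma> \<V> t) (riccati M \<gamma> \<Lambda> t w) = \<Psi> t (F.Sh t (\<Phi> t w))"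
proof -
  have h: "\<Phi> t w \<in> F.H t" using w by (simp add: horizontal_iff)
  obtain z' where z': "z' \<in> Lp" "\<phi> t z' = \<Phi> t w" using F.lift_H[OF f h] by blast
  have "Jz z' \<in> \<Lambda> \<and> Jz z' t = w" using Jz_Lam by (simp add: Jz_\<phi> z'(2) \<Psi>_\<Phi>)
  then have "\<exists>J. J \<in> \<Lambda> \<and> J t = w" by blast
  from someI_ex[OF this] obtain J where J: "J = (SOME J. J \<in> \<Lambda> \<and> J t = w)" "J \<in> \<Lambda>" "J t = w" by blast
  obtain z where z: "z \<in> Lp" "J = Jz z" using Jz_surj[OF J(2)] by blast
  have "\<phi> t z = \<Phi> t w" using J(3) z(2) by (simp add: \<phi>_def)
  then have "F.Sh t (\<Phi> t w) = F.PH t (\<psi> t z)" by (intro F.Sh_eq[OF f z(1)]) (simp add: F.PH_id[OF h])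
  moreover have "\<psi> t z = \<Phi> t (riccati M \<gamma> \<Lambda> t w)" by (simp add: \<psi>_def riccati_def J(1)[symmetric] z(2))
  ultimately have S: "F.Sh t (\<Phi> t w) = F.PH t (\<Phi> t (riccati M \<gamma> \<Lambda> t w))" by simp
  let ?r = "riccati M \<gamma> \<Lambda> t w" and ?p = "\<Psi> t (F.Sh t (\<Phi> t w))" and ?X = "horizontal_space M \<gamma> \<V> t"
  have p: "?p \<in> ?X" unfolding horizontal_iff \<Phi>_\<Psi> S by (rule F.PH_H)
  have o: "rmetric M (\<gamma> t) (?r - ?p) z = 0" if "z \<in> ?X" for z
    using F.perp_PH[of "\<Phi> t z" t "\<Phi> t ?r"] that
    by (simp add: \<Phi>_isometry[symmetric] linear_diff[OF \<Phi>_linear] \<Phi>_\<Psi> S horizontal_iff)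
  show ?thesis
    unfolding metric_proj_def
  proof (rule the_equality)
    show "?p \<in> ?X \<and> (\<forall>z\<in>?X. rmetric M (\<gamma> t) (?r - ?p) z = 0)" using p o by blast
    fix q assume q: "q \<in> ?X \<and> (\<forall>z\<in>?X. rmetric M (\<gamma> t) (?r - q) z = 0)"
    have "q - ?p \<in> ?X" using q p by (simp add: horizontal_iff linear_diff[OF \<Phi>_linear] subspace_diff[OF F.H_subspace])
    then have "rmetric M (\<gamma> t) (?r - ?p) (q - ?p) - rmetric M (\<gamma> t) (?r - q) (q - ?p) = 0" using o q by simp
    then have "rmetric M (\<gamma> t) (q - ?p) (q - ?p) = 0" by (simp add: rm_simps)
    then have "\<Phi> t (q - ?p) = 0" by (simp add: \<Phi>_isometry[symmetric])
    from \<Phi>_zero[OF this] show "q = ?p" by simp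
  qed
qed

text \<open>
  Traces do not depend on the basis, so that the unspecified basis in the definition of the trace can be replaced
  by the standard basis of the frame.
\<close>

lemma riccati_trace_tr:
  assumes f: "F.full t"
  shows "riccati_trace M \<gamma> \<Lambda> t (horizontal_space M \<gamma> \<V> t) = F.tr t"
proof -
  let ?X = "horizontal_space M \<gamma> \<V> t"
  define B where "B = (SOME B. B \<subseteq> ?X \<and> independent B \<and> ?X \<subseteq> span B)"
  have "\<exists>B. B \<subseteq> ?X \<and> independent B \<and> ?X \<subseteq> span B"
    by (rule maximal_independent_subset[of ?X]) (intro exI conjI)
  then have "B \<subseteq> ?X \<and> independent B \<and> ?X \<subseteq> span B" unfolding B_def by (rule someI_ex)
  then have B: "B \<subseteq> ?X" "independent B" "?X \<subseteq> span B" by simp_all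
  have fin: "finite B" by (rule finiteI_independent[OF B(2)])
  define r where "r = (\<lambda>b y. representation B (\<Psi> t (F.PH t y)) b)"
  have sp: "\<Psi> t (F.PH t y) \<in> span B" for y
  proof -
    have "\<Psi> t (F.PH t y) \<in> ?X" unfolding horizontal_iff \<Phi>_\<Psi> by (rule F.PH_H)
    then show ?thesis using B(3) by blast
  qed
  have r: "linear (r b)" for b
    by (rule linearI)
      (simp_all add: r_def linear_add[OF F.PH_linear] linear_scale[OF F.PH_linear] linear_add[OF \<Psi>_linear] linear_scale[OF \<Psi>_linear]
        representation_add[OF B(2) sp sp] representation_scale[OF B(2) sp])
  have ShH: "F.PH t (F.Sh t x) = F.Sh t x" for x unfolding F.Sh_def by (rule F.PH_id[OF F.PH_H])
  have rep: "F.Sh t x = (\<Sum>b\<in>B. r b (F.Sh t x) *\<^sub>R \<Phi> t b)" for x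
  proof -
    have "(\<Sum>b\<in>B. representation B (\<Psi> t (F.PH t (F.Sh t x))) b *\<^sub>R b) = \<Psi> t (F.PH t (F.Sh t x))"
      by (rule sum_representation_eq[OF B(2) sp fin subset_refl])
    then have "\<Phi> t (\<Sum>b\<in>B. r b (F.Sh t x) *\<^sub>R b) = \<Phi> t (\<Psi> t (F.Sh t x))" by (simp add: r_def ShH)
    then show ?thesis by (simp add: \<Phi>_\<Psi> linear_sum[OF \<Phi>_linear] linear_scale[OF \<Phi>_linear])
  qed
  have "F.tr t = (\<Sum>b\<in>B. r b (F.Sh t (\<Phi> t b)))"
    unfolding F.tr_def by (rule trace_expand[OF F.Sh_linear[OF f] r rep])
  also have "\<dots> = (\<Sum>b\<in>B. representation B (metric_proj M (\<gamma> t) ?X (riccati M \<gamma> \<Lambda> t b)) b)"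
  proof (rule sum.cong[OF refl])
    fix b assume "b \<in> B"
    then have b: "b \<in> ?X" using B(1) by blast
    show "r b (F.Sh t (\<Phi> t b)) = representation B (metric_proj M (\<gamma> t) ?X (riccati M \<gamma> \<Lambda> t b)) b"
      unfolding riccati_proj[OF f b] r_def ShH ..
  qed
  finally show ?thesis by (simp add: riccati_trace_def trace_on_def Let_def B_def[symmetric])
qed

text \<open>
  Both skew symmetries of the curvature tensor are used.
\<close>

lemma sec_curvature_Rf:
  assumes y: "y \<in> F.N" "y \<bullet> y = 1"
  shows "sec_curvature M (\<gamma> t) (vel t) (\<Psi> t y) = Rf t y \<bullet> y"
proof -
  let ?v = "\<Psi> t y" and ?u = "vel t" and ?R = "curvature M (\<gamma> t)"
  have "rmetric M (\<gamma> t) ?u ?v = 0" using y(1) by (simp add: \<Phi>_isometry[symmetric] \<Phi>_\<Psi> \<Phi>_vel F.N_def inner_commute)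
  moreover have "rmetric M (\<gamma> t) ?u ?u = 1" "rmetric M (\<gamma> t) ?v ?v = 1"
    using y(2) by (simp_all add: \<Phi>_isometry[symmetric] \<Phi>_\<Psi> \<Phi>_vel e0_unit)
  ultimately have "sec_curvature M (\<gamma> t) ?u ?v = rmetric M (\<gamma> t) (?R ?u ?v ?v) ?u" by (simp add: sec_curvature_def)
  also have "?R ?u ?v ?v = - ?R ?v ?u ?v" by (rule curvature_antisym)
  also have "rmetric M (\<gamma> t) (- ?R ?v ?u ?v) ?u = - rmetric M (\<gamma> t) (?R ?v ?u ?v) ?u" by (simp add: rm_simps)
  also have "\<dots> = rmetric M (\<gamma> t) ?v (?R ?v ?u ?u)" by (simp add: curvature_skew[of "\<gamma> t" ?v ?u ?v ?u])
  also have "\<dots> = Rf t y \<bullet> y" by (simp add: \<Phi>_isometry[symmetric] \<Phi>_\<Psi> Rf_def inner_commute)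
  finally show ?thesis .
qed

lemma Ric_orthonormal:
  assumes ric: "Ric_along_ge M k \<gamma> c"
    and B: "finite B" "B \<subseteq> F.N" "card B = k" "pairwise orthogonal B" "\<And>x. x \<in> B \<Longrightarrow> norm x = 1"
  shows "c \<le> (\<Sum>e\<in>B. Rf t e \<bullet> e)"
proof -
  obtain h where h: "bij_betw h {1..k} B" using ex_bij_betw_nat_finite_1[OF B(1)] B(3) by auto
  have hB: "h i \<in> B" if "i \<in> {1..k}" for i using h that by (auto simp: bij_betw_def)
  have hu: "h i \<bullet> h i = 1" if "i \<in> {1..k}" for i using B(5)[OF hB[OF that]] by (simp add: norm_eq_1)
  have h0: "h i \<bullet> h j = 0" if "i \<in> {1..k}" "j \<in> {1..k}" "i \<noteq> j" for i j
  proof -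
    have "h i \<noteq> h j" using h that unfolding bij_betw_def by (auto dest: inj_onD)
    then show ?thesis using B(4) hB that by (auto simp: pairwise_def orthogonal_def)
  qed
  have hN: "h i \<bullet> e0 = 0" if "i \<in> {1..k}" for i using hB[OF that] B(2) by (auto simp: F.N_def)
  define En where "En = (\<lambda>i::nat. if i = 0 then vel t else \<Psi> t (h i))"
  have "rmetric M (\<gamma> t) (En i) (En j) = (if i = j then 1 else 0)" if "i \<in> {0..k}" "j \<in> {0..k}" for i j
  proof -
    have "\<Phi> t (En i) = (if i = 0 then e0 else h i)" for i by (simp add: En_def \<Phi>_vel \<Phi>_\<Psi>)
    then show ?thesis using that hu[of i] h0[of i j] hN[of i] hN[of j]
      by (cases "i = 0"; cases "j = 0") (auto simp: \<Phi>_isometry[symmetric] e0_unit inner_commute[of e0 "h j"] inner_commute[of e0 "h i"])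
  qed
  then have "orthonormal_at M (\<gamma> t) {0..k} En" by (simp add: orthonormal_at_def)
  moreover have "En 0 = vel t" by (simp add: En_def)
  ultimately have "c \<le> (\<Sum>i = 1..k. sec_curvature M (\<gamma> t) (vel t) (En i))" using ric by (simp add: Ric_along_ge_def)
  also have "\<dots> = (\<Sum>i = 1..k. Rf t (h i) \<bullet> h i)"
  proof (rule sum.cong[OF refl])
    fix i assume i: "i \<in> {1..k}"
    have "sec_curvature M (\<gamma> t) (vel t) (\<Psi> t (h i)) = Rf t (h i) \<bullet> h i"
      by (rule sec_curvature_Rf[OF _ hu[OF i]]) (use hB[OF i] B(2) in auto)
    then show "sec_curvature M (\<gamma> t) (vel t) (En i) = Rf t (h i) \<bullet> h i" using i by (simp add: En_def)
  qed
  also have "\<dots> = (\<Sum>e\<in>B. Rf t e \<bullet> e)" by (rule sum.reindex_bij_betw[OF h])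
  finally show ?thesis .
qed

lemma parallel_distributionI:
  assumes "\<And>t x. t \<in> I \<Longrightarrow> x \<in> D t \<longleftrightarrow> \<Phi> t x \<in> D0"
  shows "parallel_distribution M \<gamma> I D"
  unfolding parallel_distribution_def
proof (intro ballI)
  fix s v assume s: "s \<in> I" and v: "v \<in> D s"
  show "\<exists>X. parallel_field M \<gamma> X \<and> X s = v \<and> (\<forall>t\<in>I. X t \<in> D t)"
  proof (intro exI[of _ "\<lambda>t. \<Psi> t (\<Phi> s v)"] conjI ballI)
    show "parallel_field M \<gamma> (\<lambda>t. \<Psi> t (\<Phi> s v))" by (rule \<Psi>_parallel)
    show "\<Psi> s (\<Phi> s v) = v" by (rule \<Psi>_\<Phi>)
    fix t assume t: "t \<in> I"
    show "\<Psi> t (\<Phi> s v) \<in> D t" using assms[OF s, of v] v by (simp add: assms[OF t] \<Phi>_\<Psi>)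
  qed
qed

text \<open>
  The space \<open>W\<close> is horizontal by construction and by the Lagrangian condition. Conversely, a horizontal vector
  orthogonal to \<open>W\<close> is the value of a solution, by full index; this solution belongs to \<open>\<V>\<close>, so that the vector is
  vertical as well as horizontal, hence zero.
\<close>

lemma horizontal_eq:
  assumes W: "subspace W" "W \<subseteq> velocity_perp M \<gamma> s" "riccati_defined_on \<Lambda> s W"
    and V: "\<V> = {J \<in> \<Lambda>. \<forall>w\<in>W. rmetric M (\<gamma> s) (J s) w = 0}" and f: "F.full s"
  shows "horizontal_space M \<gamma> \<V> s = W"
proof -
  let ?W = "\<Phi> s ` W"
  have sW: "subspace ?W" by (rule linear_subspace_image[OF \<Phi>_linear W(1)])
  have Vp_iff: "z \<in> Vp \<longleftrightarrow> z \<in> Lp \<and> (\<forall>y\<in>?W. \<phi> s z \<bullet> y = 0)" for z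
  proof -
    have "Jz z \<in> \<V> \<longleftrightarrow> (\<forall>w\<in>W. rmetric M (\<gamma> s) (Jz z s) w = 0)" using Jz_Lam[of z] by (subst V) simp
    then show ?thesis by (simp add: Vp_def \<phi>_def \<Phi>_isometry)
  qed
  have WH: "y \<in> F.H s" if "y \<in> ?W" for y
    unfolding F.H_def
  proof (intro CollectI conjI ballI)
    from that obtain w where w: "w \<in> W" "y = \<Phi> s w" by blast
    show "y \<in> F.N" using W(2) w velocity_perp_iff[of w s] by auto
    obtain J where J: "J \<in> \<Lambda>" "J s = w" using W(3) w(1) by (auto simp: riccati_defined_on_def)
    obtain z where z: "z \<in> Lp" "J = Jz z" using Jz_surj[OF J(1)] by blast
    have y: "y = \<phi> s z" using w J z by (simp add: \<phi>_def)
    fix x assume "x \<in> F.distr Vp s"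
    then obtain u v where uv: "x = \<phi> s u + \<psi> s v" "u \<in> Vp" "v \<in> Vp" "\<phi> s v = 0" unfolding F.distr_def by blast
    have "\<phi> s u \<bullet> y = 0" using uv(2) that unfolding Vp_iff by blast
    moreover have "y \<bullet> \<psi> s v = 0" unfolding y by (rule F.\<phi>_\<psi>_orth[OF z(1) _ uv(4)]) (use uv(3) Vp_Lp in auto)
    ultimately show "y \<bullet> x = 0" by (simp add: uv(1) inner_simps inner_commute[of y "\<phi> s u"])
  qed
  have HW: "h \<in> ?W" if h: "h \<in> F.H s" for h
  proof -
    let ?p = "oproj ?W h"
    have p: "?p \<in> ?W" by (rule oproj(1)[OF sW])
    have d: "h - ?p \<in> F.H s" by (rule subspace_diff[OF F.H_subspace h WH[OF p]])
    obtain m where m: "m \<in> Lp" "\<phi> s m = h - ?p" using F.lift_H[OF f d] by blast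
    have "m \<in> Vp" unfolding Vp_iff m(2) using m(1) oproj(2)[OF sW, of _ h] by blast
    then have "h - ?p \<in> F.distr Vp s" using F.distr_\<phi>[OF Vp_subspace, of m s] by (simp add: m(2))
    then have "(h - ?p) \<bullet> (h - ?p) = 0" using d by (simp add: F.H_def)
    then have "h = ?p" by simp
    then show ?thesis using p by simp
  qed
  show ?thesis
  proof (intro set_eqI iffI)
    fix x assume "x \<in> horizontal_space M \<gamma> \<V> s"
    then obtain w where w: "w \<in> W" "\<Phi> s x = \<Phi> s w" using HW unfolding horizontal_iff by blast
    have "\<Psi> s (\<Phi> s x) = \<Psi> s (\<Phi> s w)" by (rule arg_cong[OF w(2)])
    then have "x = w" unfolding \<Psi>_\<Phi> .
    then show "x \<in> W" using w(1) by (simp only:)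
  next
    fix x assume "x \<in> W"
    then show "x \<in> horizontal_space M \<gamma> \<V> s" unfolding horizontal_iff using WH by blast
  qed
qed

lemma dim_horizontal: "dim (horizontal_space M \<gamma> \<V> t) = dim (F.H t)"
proof -
  have "F.H t = \<Phi> t ` horizontal_space M \<gamma> \<V> t"
  proof (intro set_eqI iffI)
    fix h assume "h \<in> F.H t"
    then show "h \<in> \<Phi> t ` horizontal_space M \<gamma> \<V> t"
      by (intro image_eqI[of _ _ "\<Psi> t h"]) (simp_all add: horizontal_iff \<Phi>_\<Psi>)
  qed (auto simp: horizontal_iff)
  moreover have "inj (\<Phi> t)" by (rule inj_on_inverseI[of _ "\<Psi> t"]) (rule \<Psi>_\<Phi>)
  then have "dim (\<Phi> t ` horizontal_space M \<gamma> \<V> t) = dim (horizontal_space M \<gamma> \<V> t)"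
    by (intro dim_image_eq[OF \<Phi>_linear]) (auto intro: inj_on_subset)
  ultimately show ?thesis by simp
qed

end

section \<open>Scalar equations\<close>

lemma jacobi_equation_solution:
  fixes \<kappa> l s :: real
  assumes "\<kappa> \<in> {-1, 0, 1}"
  shows "\<exists>f f'. f s = 1 \<and> f' s = l \<and> (\<forall>t. (f has_real_derivative f' t) (at t)) \<and> (\<forall>t. (f' has_real_derivative - (\<kappa> * f t)) (at t))"
proof -
  consider "\<kappa> = 1" | "\<kappa> = 0" | "\<kappa> = -1" using assms by blast
  then show ?thesis
  proof cases
    case 1
    show ?thesis
      by (rule exI[of _ "\<lambda>t. cos (t - s) + l * sin (t - s)"], rule exI[of _ "\<lambda>t. - sin (t - s) + l * cos (t - s)"])
        (auto intro!: derivative_eq_intros simp: 1)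
  next
    case 2
    show ?thesis
      by (rule exI[of _ "\<lambda>t. 1 + l * (t - s)"], rule exI[of _ "\<lambda>t. l"]) (auto intro!: derivative_eq_intros simp: 2)
  next
    case 3
    show ?thesis
      by (rule exI[of _ "\<lambda>t. cosh (t - s) + l * sinh (t - s)"], rule exI[of _ "\<lambda>t. sinh (t - s) + l * cosh (t - s)"])
        (auto intro!: derivative_eq_intros simp: 3)
  qed
qed

lemma linear_equation_zero:
  fixes y c :: "real \<Rightarrow> real"
  assumes c: "continuous_on {a..b} c" and y: "continuous_on {a..b} y"
    and d: "\<And>t. a < t \<Longrightarrow> t < b \<Longrightarrow> (y has_real_derivative c t * y t) (at t)"
    and s: "s \<in> {a..b}" "y s = 0" and t: "t \<in> {a..b}"
  shows "y t = 0"
proof -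
  have "compact (c ` {a..b})" by (rule compact_continuous_image[OF c compact_Icc])
  then have "bounded (c ` {a..b})" by (rule compact_imp_bounded)
  then obtain C where C: "\<forall>x\<in>c ` {a..b}. norm x \<le> C" unfolding bounded_iff by (elim exE)
  define F where "F = (\<lambda>t. (y t)^2)"
  have "F t \<le> 0"
  proof (rule differential_inequality_zero[OF _ _ s(1) _ t, of F "2 * C"])
    show "continuous_on {a..b} F" unfolding F_def by (intro continuous_on_power y)
    show "F s = 0" using s(2) by (simp add: F_def)
    fix t assume t: "a < t" "t < b"
    have "(F has_real_derivative 2 * (c t * F t)) (at t)"
      unfolding F_def using DERIV_power[OF d[OF t], of 2] by (simp add: power2_eq_square algebra_simps)
    moreover have "\<bar>c t\<bar> \<le> C" using C t by simp
    then have "\<bar>c t\<bar> * F t \<le> C * F t" by (rule mult_right_mono) (simp add: F_def)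
    then have "\<bar>2 * (c t * F t)\<bar> \<le> 2 * C * F t" by (simp add: abs_mult F_def)
    ultimately show "\<exists>d. (F has_real_derivative d) (at t) \<and> \<bar>d\<bar> \<le> 2 * C * F t" by (intro exI conjI)
  qed
  then show ?thesis by (simp add: F_def)
qed

text \<open>
  The defects \<open>f' - lam f\<close> and \<open>f\<close> both solve homogeneous linear first-order equations; the first is zero initially,
  the second is not.
\<close>

lemma riccati_solution_log_derivative:
  fixes f f' lam :: "real \<Rightarrow> real"
  assumes f: "\<And>t. (f has_real_derivative f' t) (at t)" and f': "\<And>t. (f' has_real_derivative - (\<kappa> * f t)) (at t)"
    and lam: "\<And>t. t \<in> {a..b} \<Longrightarrow> (lam has_real_derivative - ((lam t)^2) - \<kappa>) (at t within {a..b})"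
    and ini: "f a = 1" "f' a = lam a" and t: "t \<in> {a..b}"
  shows "f' t = lam t * f t" and "f t \<noteq> 0"
proof -
  have a: "a \<in> {a..b}" using t by auto
  have cl: "continuous_on {a..b} lam" by (rule DERIV_continuous_on[OF lam])
  have cf: "continuous_on {a..b} f" "continuous_on {a..b} f'"
    by (rule DERIV_continuous_on, rule has_field_derivative_at_within[OF f])
      (rule DERIV_continuous_on, rule has_field_derivative_at_within[OF f'])
  define g where "g = (\<lambda>t. f' t - lam t * f t)"
  have g: "g t = 0" if t: "t \<in> {a..b}" for t
  proof (rule linear_equation_zero[of a b "\<lambda>t. - lam t" g a])
    show "continuous_on {a..b} (\<lambda>t. - lam t)" by (intro continuous_on_minus cl)
    show "continuous_on {a..b} g" unfolding g_def by (intro continuous_on_diff continuous_on_mult cl cf)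
    show "(g has_real_derivative - lam t * g t) (at t)" if t: "a < t" "t < b" for t
    proof -
      have "at t within {a..b} = at t" by (rule at_within_interior) (use t in \<open>simp add: interior_atLeastAtMost_real\<close>)
      then have "(lam has_real_derivative - ((lam t)^2) - \<kappa>) (at t)" using lam[of t] t by simp
      from DERIV_diff[OF f' DERIV_mult[OF this f]] show ?thesis
        unfolding g_def by (rule DERIV_cong) (simp add: power2_eq_square algebra_simps)
    qed
    show "g a = 0" by (simp add: g_def ini)
  qed (rule a t)+
  then show "f' t = lam t * f t" using t by (simp add: g_def)
  show "f t \<noteq> 0"
  proof
    assume "f t = 0"
    have "f a = 0"
    proof (rule linear_equation_zero[OF cl cf(1) _ t \<open>f t = 0\<close> a])
      show "(f has_real_derivative lam t * f t) (at t)" if "a < t" "t < b" for t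
        using f[of t] g[of t] that by (simp add: g_def)
    qed
    then show False using ini by simp
  qed
qed


section \<open>The transverse Jacobi comparison\<close>

theorem lemma2p23:
  fixes M :: "('m::{t2_space, second_countable_topology}, 'a::euclidean_space) metric_atlas"
    and \<gamma> :: "real \<Rightarrow> 'm"
    and k :: nat
    and \<kappa> t\<^sub>0 :: real
    and t\<^sub>m\<^sub>a\<^sub>x :: ereal
    and \<Lambda> \<V> :: "(real \<Rightarrow> 'a) set"
    and W :: "'a set"
    and lam :: "real \<Rightarrow> real"
    and H :: "real \<Rightarrow> 'a set"
    and I :: "real set"
  assumes "\<kappa> \<in> {-1, 0, 1}"
    and "riemannian_manifold M" and "complete_manifold M"
    and "unit_speed_geodesic M \<gamma>"
    and "Ric_along_ge M k \<gamma> (real k * \<kappa>)"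
    and "lagrangian M \<gamma> \<Lambda>"
    and "ereal t\<^sub>0 < t\<^sub>m\<^sub>a\<^sub>x" and I_def: "I = {t. t\<^sub>0 \<le> t \<and> ereal t < t\<^sub>m\<^sub>a\<^sub>x}"
    and "\<And>t. t \<in> I \<Longrightarrow> \<exists>d. (lam has_real_derivative d) (at t within I) \<and> d + (lam t)\<^sup>2 + \<kappa> = 0"
    and "subspace W" and "dim W = k" and "W \<subseteq> velocity_perp M \<gamma> t\<^sub>0"
    and "riccati_defined_on \<Lambda> t\<^sub>0 W"
    and "riccati_trace M \<gamma> \<Lambda> t\<^sub>0 W \<le> real k * lam t\<^sub>0"
    and V_def: "\<V> = {J \<in> \<Lambda>. \<forall>w\<in>W. rmetric M (\<gamma> t\<^sub>0) (J t\<^sub>0) w = 0}"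
    and H_def: "H = horizontal_space M \<gamma> \<V>"
    and "\<And>t. t \<in> I \<Longrightarrow> full_index_at \<Lambda> \<V> t"
  shows "(\<forall>t\<in>I. riccati_trace M \<gamma> \<Lambda> t (H t) \<le> real k * lam t) \<and>
    (\<forall>t\<^sub>1\<in>I. riccati_trace M \<gamma> \<Lambda> t\<^sub>1 (H t\<^sub>1) = real k * lam t\<^sub>1 \<longrightarrow>
       (\<exists>\<H>. splits_orthogonally M \<gamma> \<Lambda> \<V> \<H> {t\<^sub>0..t\<^sub>1} \<and>
          (\<forall>J\<in>\<H>. J \<noteq> 0 \<longrightarrow>
             (\<exists>E f f'.
                parallel_field M \<gamma> E \<and> (\<forall>t. rmetric M (\<gamma> t) (E t) (E t) = 1) \<and> E t\<^sub>0 \<in> H t\<^sub>0 \<and>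
                (\<forall>t. (f has_real_derivative f' t) (at t)) \<and>
                (\<forall>t. \<exists>f''. (f' has_real_derivative f'') (at t) \<and> f'' + \<kappa> * f t = 0) \<and>
                (\<forall>t\<in>I. f t \<noteq> 0 \<and> f' t / f t = lam t) \<and>
                f t\<^sub>0 = sqrt (rmetric M (\<gamma> t\<^sub>0) (J t\<^sub>0) (J t\<^sub>0)) \<and>
                (\<forall>t\<in>{t\<^sub>0..t\<^sub>1}. J t = f t *\<^sub>R E t)))))"
proof -
  note full = assms(17)
  interpret geodesic_curve M \<gamma> by unfold_locales (rule assms(2), rule assms(4))
  obtain E :: "'a \<Rightarrow> real \<Rightarrow> 'a" where E: "\<forall>i\<in>Basis. parallel_field M \<gamma> (E i) \<and> (\<forall>j\<in>Basis. \<forall>t. rmetric M (\<gamma> t) (E i t) (E j t) = (if i = j then 1 else 0))"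
    by (rule exE[OF parallel_frame_exists]) (rule that)
  have "fields.subspace \<Lambda>" using assms(6) by (simp add: lagrangian_def)
  have V_sub: "fields.subspace \<V>"
  proof (rule fields.subspaceI)
    show "0 \<in> \<V>" using fields.subspace_0[OF \<open>fields.subspace \<Lambda>\<close>] by (simp add: V_def rm_simps)
    show "x + y \<in> \<V>" if "x \<in> \<V>" "y \<in> \<V>" for x y
      using fields.subspace_add[OF \<open>fields.subspace \<Lambda>\<close>, of x y] that by (simp add: V_def rm_simps)
    show "(\<lambda>t. c *\<^sub>R x t) \<in> \<V>" if "x \<in> \<V>" for c x
      using fields.subspace_scale[OF \<open>fields.subspace \<Lambda>\<close>, of x c] that by (simp add: V_def rm_simps)
  qed
  have V_Lam: "\<V> \<subseteq> \<Lambda>" by (auto simp: V_def)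
  interpret P: lagrangian_pair M \<gamma> E \<Lambda> \<V>
    by unfold_locales (use E assms(6) V_sub V_Lam in auto)
  have t0I: "t\<^sub>0 \<in> I" using assms(7) by (simp add: I_def)
  have sub: "{t\<^sub>0..t\<^sub>1} \<subseteq> I" if "t\<^sub>1 \<in> I" for t\<^sub>1
  proof
    fix s assume "s \<in> {t\<^sub>0..t\<^sub>1}"
    then have s: "t\<^sub>0 \<le> s" "ereal s \<le> ereal t\<^sub>1" by auto
    have "ereal t\<^sub>1 < t\<^sub>m\<^sub>a\<^sub>x" using that by (simp add: I_def)
    from le_less_trans[OF s(2) this] show "s \<in> I" using s(1) by (simp add: I_def)
  qed
  have fullF: "P.F.full t" if "t \<in> I" for t by (rule P.full_index[OF full[OF that]])
  have HW: "H t\<^sub>0 = W" unfolding H_def by (rule P.horizontal_eq[OF assms(10,12,13) V_def fullF[OF t0I]])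
  have tr: "riccati_trace M \<gamma> \<Lambda> t (H t) = P.F.tr t" if "t \<in> I" for t
    unfolding H_def by (rule P.riccati_trace_tr[OF fullF[OF that]])
  have dimV: "dim P.Lp = k + dim P.Vp"
    using P.F.dim_H[of "t\<^sub>0"] P.dim_horizontal[of "t\<^sub>0"] HW assms(11) by (simp add: H_def)
  have lamI: "(lam has_real_derivative - ((lam t)^2) - \<kappa>) (at t within I)" if t: "t \<in> I" for t
  proof -
    obtain d where d: "(lam has_real_derivative d) (at t within I)" "d + (lam t)\<^sup>2 + \<kappa> = 0" using assms(9)[OF t] by (elim exE conjE)
    have "d = - ((lam t)^2) - \<kappa>" using d(2) by linarith
    then show ?thesis using d(1) by simp
  qed
  have lam1: "(lam has_real_derivative - ((lam t)^2) - \<kappa>) (at t within {t\<^sub>0..t\<^sub>1})" if "t\<^sub>1 \<in> I" "t \<in> {t\<^sub>0..t\<^sub>1}" for t t\<^sub>1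
    by (rule DERIV_subset[OF lamI[OF subsetD[OF sub[OF that(1)] that(2)]] sub[OF that(1)]])
  have comparison: "transverse_comparison P.\<phi> P.\<psi> P.Rf P.e0 P.Lp P.Vp k \<kappa> t\<^sub>0 t\<^sub>1 lam" if t1: "t\<^sub>1 \<in> I" for t\<^sub>1
  proof (intro transverse_comparison.intro transverse_comparison_axioms.intro P.F.jacobi_flow_axioms)
    show "dim P.Lp = k + dim P.Vp" by (rule dimV)
    show "real k * \<kappa> \<le> (\<Sum>e\<in>B. P.Rf t e \<bullet> e)"
      if "finite B" "B \<subseteq> P.F.N" "card B = k" "pairwise orthogonal B" "\<And>x. x \<in> B \<Longrightarrow> norm x = 1" for B t
      by (rule P.Ric_orthonormal[OF assms(5) that])
    show "t\<^sub>0 \<le> t\<^sub>1" using t1 by (simp add: I_def)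
    show "P.F.full t" if "t \<in> {t\<^sub>0..t\<^sub>1}" for t by (rule fullF) (use sub[OF t1] that in blast)
    show "(lam has_real_derivative - ((lam t)^2) - \<kappa>) (at t within {t\<^sub>0..t\<^sub>1})" if "t \<in> {t\<^sub>0..t\<^sub>1}" for t by (rule lam1[OF t1 that])
    show "P.F.tr t\<^sub>0 \<le> real k * lam t\<^sub>0" using assms(14) tr[OF t0I] by (simp add: HW)
  qed
  show ?thesis
  proof (intro conjI ballI impI)
    show "riccati_trace M \<gamma> \<Lambda> t (H t) \<le> real k * lam t" if "t \<in> I" for t
      unfolding tr[OF that] by (rule transverse_comparison.tr_le_lam[OF comparison[OF that]])
    fix t\<^sub>1 assume t1: "t\<^sub>1 \<in> I" and eq: "riccati_trace M \<gamma> \<Lambda> t\<^sub>1 (H t\<^sub>1) = real k * lam t\<^sub>1"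
    obtain f f' where f: "f t\<^sub>0 = 1" "f' t\<^sub>0 = lam t\<^sub>0" "\<And>t. (f has_real_derivative f' t) (at t)"
      "\<And>t. (f' has_real_derivative - (\<kappa> * f t)) (at t)"
      using jacobi_equation_solution[OF assms(1), of "t\<^sub>0" "lam t\<^sub>0"] by blast
    have fI: "f' t = lam t * f t" "f t \<noteq> 0" if t: "t \<in> I" for t
      by (rule riccati_solution_log_derivative[OF f(3,4) lam1[OF t] f(1,2)]; use t in \<open>simp add: I_def\<close>)+
    interpret K: transverse_rigidity P.\<phi> P.\<psi> P.Rf P.e0 P.Lp P.Vp k \<kappa> "t\<^sub>0" "t\<^sub>1" lam f
    proof (intro transverse_rigidity.intro comparison[OF t1] transverse_rigidity_axioms.intro)
      show "P.F.tr t\<^sub>1 = real k * lam t\<^sub>1" using eq by (simp add: tr[OF t1])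
      show "(f has_real_derivative lam t * f t) (at t within {t\<^sub>0..t\<^sub>1})" if "t \<in> {t\<^sub>0..t\<^sub>1}" for t
        using has_field_derivative_at_within[OF f(3)[of t]] fI(1)[of t] that sub[OF t1] by auto
      show "f t \<noteq> 0" if "t \<in> {t\<^sub>0..t\<^sub>1}" for t by (rule fI(2)) (use that sub[OF t1] in blast)
      show "f t\<^sub>0 = 1" by (rule f(1))
    qed
    define \<H> where "\<H> = P.Jz ` K.Z"
    have hor: "x \<in> H t \<longleftrightarrow> P.\<Phi> t x \<in> P.F.H t\<^sub>0" if "t \<in> {t\<^sub>0..t\<^sub>1}" for t x
      unfolding H_def P.horizontal_iff K.H_const[OF that] ..
    have dZ: "x \<in> distribution_of M \<gamma> \<H> t \<longleftrightarrow> P.\<Phi> t x \<in> P.F.H t\<^sub>0" if "t \<in> {t\<^sub>0..t\<^sub>1}" for t x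
      unfolding \<H>_def P.distribution_iff K.distr_Z[OF that] ..
    have dV: "x \<in> distribution_of M \<gamma> \<V> t \<longleftrightarrow> P.\<Phi> t x \<in> P.F.distr P.Vp t\<^sub>0" if "t \<in> {t\<^sub>0..t\<^sub>1}" for t x
      unfolding P.distribution_\<V>_iff K.distr_const[OF that] ..
    have dZH: "distribution_of M \<gamma> \<H> t = horizontal_space M \<gamma> \<V> t" if "t \<in> {t\<^sub>0..t\<^sub>1}" for t
      using dZ[OF that] hor[OF that] unfolding H_def by blast
    have H_inj: "z = 0" if "z \<in> K.Z" "P.Jz z \<in> \<V>" for z
      by (rule K.Z_V[OF that(1)]) (use that K.Z_L in \<open>auto simp: P.Vp_def\<close>)
    have "splits_orthogonally M \<gamma> \<Lambda> \<V> \<H> {t\<^sub>0..t\<^sub>1}"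
      unfolding splits_orthogonally_def
    proof (intro conjI ballI)
      show "fields.subspace \<H>"
      proof (rule fields.subspaceI)
        show "0 \<in> \<H>" unfolding \<H>_def using P.Jz_0[symmetric] subspace_0[OF K.Z_subspace] by (rule image_eqI)
        fix x y assume x: "x \<in> \<H>"
        then obtain u where u: "x = P.Jz u" "u \<in> K.Z" unfolding \<H>_def by (elim imageE)
        show "(\<lambda>t. c *\<^sub>R x t) \<in> \<H>" for c
          unfolding \<H>_def u(1) P.Jz_scale[symmetric] by (rule imageI) (rule subspace_scale[OF K.Z_subspace u(2)])
        assume y: "y \<in> \<H>"
        then obtain v where v: "y = P.Jz v" "v \<in> K.Z" unfolding \<H>_def by (elim imageE)
        have "x + y = P.Jz (u + v)" unfolding u v P.Jz_add by (rule ext) simp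
        then show "x + y \<in> \<H>" unfolding \<H>_def using subspace_add[OF K.Z_subspace u(2) v(2)] by (rule image_eqI)
      qed
      show "\<H> \<subseteq> \<Lambda>" unfolding \<H>_def using P.Jz_Lam by blast
      show "\<V> \<inter> \<H> = {0}"
      proof
        show "\<V> \<inter> \<H> \<subseteq> {0}" unfolding \<H>_def using H_inj P.Jz_0 by auto
        have "0 \<in> \<H>" unfolding \<H>_def using P.Jz_0[symmetric] subspace_0[OF K.Z_subspace] by (rule image_eqI)
        then show "{0} \<subseteq> \<V> \<inter> \<H>" using fields.subspace_0[OF V_sub] by simp
      qed
      show "{J + K | J K. J \<in> \<V> \<and> K \<in> \<H>} = \<Lambda>"
      proof
        show "{J + K | J K. J \<in> \<V> \<and> K \<in> \<H>} \<subseteq> \<Lambda>"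
          unfolding \<H>_def using fields.subspace_add[OF \<open>fields.subspace \<Lambda>\<close>] V_Lam P.Jz_Lam by blast
        show "\<Lambda> \<subseteq> {J + K | J K. J \<in> \<V> \<and> K \<in> \<H>}"
        proof
          fix J assume "J \<in> \<Lambda>"
          then obtain j where j: "j \<in> P.Lp" "J = P.Jz j" using P.Jz_surj by blast
          obtain v z where vz: "v \<in> P.Vp" "z \<in> K.Z" "j = v + z" using K.Z_complement[OF j(1)] by blast
          have "J = P.Jz v + P.Jz z" unfolding j(2) vz(3) P.Jz_add by (rule ext) simp
          moreover have "P.Jz v \<in> \<V>" using vz(1) by (simp add: P.Vp_def)
          moreover have "P.Jz z \<in> \<H>" unfolding \<H>_def using vz(2) by (rule imageI)
          ultimately show "J \<in> {J + K | J K. J \<in> \<V> \<and> K \<in> \<H>}" by blast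
        qed
      qed
      show "distribution_of M \<gamma> \<H> t = horizontal_space M \<gamma> \<V> t" if "t \<in> {t\<^sub>0..t\<^sub>1}" for t by (rule dZH[OF that])
      show "rmetric M (\<gamma> t) v h = 0" if "t \<in> {t\<^sub>0..t\<^sub>1}" "v \<in> distribution_of M \<gamma> \<V> t" "h \<in> distribution_of M \<gamma> \<H> t" for t v h
      proof -
        have "rmetric M (\<gamma> t) h v = 0" using that(2,3) unfolding dZH[OF that(1)] horizontal_space_def by blast
        then show ?thesis using rm(2)[of "\<gamma> t" v h] by simp
      qed
      show "parallel_distribution M \<gamma> {t\<^sub>0..t\<^sub>1} (distribution_of M \<gamma> \<V>)" by (rule P.parallel_distributionI[OF dV])
      show "parallel_distribution M \<gamma> {t\<^sub>0..t\<^sub>1} (distribution_of M \<gamma> \<H>)" by (rule P.parallel_distributionI[OF dZ])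
    qed
    moreover have "\<exists>E f f'.
        parallel_field M \<gamma> E \<and> (\<forall>t. rmetric M (\<gamma> t) (E t) (E t) = 1) \<and> E t\<^sub>0 \<in> H t\<^sub>0 \<and>
        (\<forall>t. (f has_real_derivative f' t) (at t)) \<and>
        (\<forall>t. \<exists>f''. (f' has_real_derivative f'') (at t) \<and> f'' + \<kappa> * f t = 0) \<and>
        (\<forall>t\<in>I. f t \<noteq> 0 \<and> f' t / f t = lam t) \<and>
        f t\<^sub>0 = sqrt (rmetric M (\<gamma> t\<^sub>0) (J t\<^sub>0) (J t\<^sub>0)) \<and>
        (\<forall>t\<in>{t\<^sub>0..t\<^sub>1}. J t = f t *\<^sub>R E t)" if J: "J \<in> \<H>" "J \<noteq> 0" for J
    proof -
      obtain z where z: "J = P.Jz z" "z \<in> K.Z" using J(1) unfolding \<H>_def by (elim imageE)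
      define h where "h = P.\<phi> t\<^sub>0 z"
      define r where "r = norm h"
      have hH: "h \<in> P.F.H t\<^sub>0" using z(2) unfolding h_def by (simp add: K.Z_def)
      have "h \<noteq> 0"
      proof
        assume "h = 0"
        then have "J t\<^sub>0 = 0" unfolding z(1) P.Jz_\<phi> by (simp add: h_def linear_0[OF P.\<Psi>_linear])
        then have "J \<in> \<V>" using full[OF t0I] P.Jz_Lam[of z] z(1) by (simp add: full_index_at_def)
        then have "z = 0" using H_inj[OF z(2)] z(1) by simp
        then show False using J(2) z(1) P.Jz_0 by simp
      qed
      then have r: "r > 0" by (simp add: r_def)
      have hr: "h \<bullet> h = r * r" by (simp add: r_def dot_square_norm power2_eq_square)
      show ?thesis
      proof (rule exI[of _ "\<lambda>t. P.\<Psi> t ((1 / r) *\<^sub>R h)"], rule exI[of _ "\<lambda>t. r * f t"], rule exI[of _ "\<lambda>t. r * f' t"],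
          intro conjI allI ballI)
        show "parallel_field M \<gamma> (\<lambda>t. P.\<Psi> t ((1 / r) *\<^sub>R h))" by (rule P.\<Psi>_parallel)
        show "rmetric M (\<gamma> t) (P.\<Psi> t ((1 / r) *\<^sub>R h)) (P.\<Psi> t ((1 / r) *\<^sub>R h)) = 1" for t
          using r by (simp add: P.\<Psi>_isometry hr)
        show "P.\<Psi> t\<^sub>0 ((1 / r) *\<^sub>R h) \<in> H t\<^sub>0"
          unfolding H_def P.horizontal_iff P.\<Phi>_\<Psi> by (rule subspace_scale[OF P.F.H_subspace hH])
        show "((\<lambda>t. r * f t) has_real_derivative r * f' t) (at t)" for t by (rule DERIV_cmult[OF f(3)])
        show "\<exists>f''. ((\<lambda>t. r * f' t) has_real_derivative f'') (at t) \<and> f'' + \<kappa> * (r * f t) = 0" for t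
          by (rule exI[of _ "r * (- (\<kappa> * f t))"], rule conjI[OF DERIV_cmult[OF f(4)]]) simp
        show "r * f t \<noteq> 0" "r * f' t / (r * f t) = lam t" if "t \<in> I" for t using fI[OF that] r by simp_all
        have "rmetric M (\<gamma> t\<^sub>0) (J t\<^sub>0) (J t\<^sub>0) = h \<bullet> h" unfolding z(1) P.Jz_\<phi> P.\<Psi>_isometry h_def ..
        then show "r * f t\<^sub>0 = sqrt (rmetric M (\<gamma> t\<^sub>0) (J t\<^sub>0) (J t\<^sub>0))" using r by (simp add: hr f(1))
        show "J t = (r * f t) *\<^sub>R P.\<Psi> t ((1 / r) *\<^sub>R h)" if "t \<in> {t\<^sub>0..t\<^sub>1}" for t
          unfolding z(1) P.Jz_\<phi> K.flow_Z[OF z(2) that] h_def[symmetric] using r by (simp add: linear_scale[OF P.\<Psi>_linear])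
      qed
    qed
    ultimately show "\<exists>\<H>. splits_orthogonally M \<gamma> \<Lambda> \<V> \<H> {t\<^sub>0..t\<^sub>1} \<and>
          (\<forall>J\<in>\<H>. J \<noteq> 0 \<longrightarrow>
             (\<exists>E f f'.
                parallel_field M \<gamma> E \<and> (\<forall>t. rmetric M (\<gamma> t) (E t) (E t) = 1) \<and> E t\<^sub>0 \<in> H t\<^sub>0 \<and>
                (\<forall>t. (f has_real_derivative f' t) (at t)) \<and>
                (\<forall>t. \<exists>f''. (f' has_real_derivative f'') (at t) \<and> f'' + \<kappa> * f t = 0) \<and>
                (\<forall>t\<in>I. f t \<noteq> 0 \<and> f' t / f t = lam t) \<and>
                f t\<^sub>0 = sqrt (rmetric M (\<gamma> t\<^sub>0) (J t\<^sub>0) (J t\<^sub>0)) \<and>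
                (\<forall>t\<in>{t\<^sub>0..t\<^sub>1}. J t = f t *\<^sub>R E t)))"
      by (intro exI[of _ \<H>] conjI ballI impI)
  qed
qed

end
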